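(* There exists a constant $D_0>0$ depending only on $R,L,d,\Phi,b$ such that the following holds. Let $T>0$ and let $f^0$ be a periodic, non-negative function in $L^1\cap H^1(\mathcal{D}_L)$, not identically zero; set $M_{f^0,1}=\|f^0\|_{L^1(\mathcal{D}_L)}$, $M_{f^0,2}=\|f^0\|_{L^2(\mathcal{D}_L)}$. For each $N$ let $f_N^0\in\mathbb{P}_N$ be real-valued, and assume: (a) $\int_{\mathcal{D}_L}f_N^0\,\mathrm{d}v=\int_{\mathcal{D}_L}f^0\,\mathrm{d}v$ for all $N$; (b) $\|f_N^0\|_{L^2(\mathcal{D}_L)}\le\|f^0\|_{L^2(\mathcal{D}_L)}$ and $\|f_N^0\|_{H^1(\mathcal{D}_L)}\le\|f^0\|_{H^1(\mathcal{D}_L)}$ for all $N$; (c) there is $N_1$ such that $\|f_N^0\|_{L^1(\mathcal{D}_L)}\le 2\|f^0\|_{L^1(\mathcal{D}_L)}$ for all $N>N_1$; (d) for every $\varepsilon>0$ there is $N_2$ such that $\|(f_N^0)^-\|_{L^2(\mathcal{D}_L)}<\varepsilon$ for all $N>N_2$. Then there exists an integer $N_0$ (depending on $T$, $f^0$, the sequence $(f_N^0)$, and $R,L,d,\Phi,b$) such that for every $N>N_0$ the system $\partial_t f_N=\mathcal{P}_NQ^R(f_N,f_N)$, $f_N(0)=f_N^0$, admits a unique solution $f_N(t,\cdot)\in L^1\cap H^1(\mathcal{D}_L)$ on $[0,T]$, and it satisfies for all $t\in[0,T]$: $$\|f_N(t)\|_{L^1(\mathcal{D}_L)}\le 2M_{f^0,1},\qquad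 \|f_N(t)\|_{L^2(\mathcal{D}_L)}\le e^{2D_0M_{f^0,1}T}M_{f^0,2}.$$
   Context: Fix $d\ge 2$ and truncation parameters $L\ge R>0$. Let $\mathcal{D}_L=[-L,L]^d$; all functions of $v$ are $2L$-periodic in each coordinate, and norms are taken over one period, with $\|f\|_{H^1(\mathcal{D}_L)}^2=\sum_{|\nu|\le 1}\|\partial_v^\nu f\|_{L^2(\mathcal{D}_L)}^2$. For real $f$, $f^-=\max\{-f,0\}$. The collision kernel is $B=\Phi(|q|)\,b(\sigma\cdot\hat q)$ where $\Phi:[0,\infty)\to[0,\infty)$ satisfies $\sup_{|v|\le R}\Phi(|v|)<\infty$, and $b\ge 0$ satisfies $b(s)=0$ for $s<0$ and $\int_{\mathbb{S}^{d-1}}b(\sigma\cdot e)\,\mathrm{d}\sigma<\infty$. For periodic $g,f$, the truncated collision operator is $$Q^R(g,f)(v)=\int_{\mathbb{R}^d}\int_{\mathbb{S}^{d-1}}\mathbf{1}_{|q|\le R}\Phi(|q|)b(\sigma\cdot\hat q)\big[g(v_*')f(v')-g(v-q)f(v)\big]\,\mathrm{d}\sigma\,\mathrm{d}q,$$ with $\hat q=q/|q|$, $v'=v-\frac{q-|q|\sigma}{2}$, $v_*'=v-\frac{q+|q|\sigma}{2}$. $\mathbb{P}_N=\mathrm{span}\{e^{\mathrm{i}\frac{\pi}{L}k\cdot v}: k\in\mathbb{Z}^d,\ -N/2\le k_j\le N/2\}$ and $\mathcal{P}_N$ is the $L^2(\mathcal{D}_L)$-orthogonal projection onto $\mathbb{P}_N$.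 *)

theory Defs
  imports "HOL-Analysis.Analysis"
begin

text \<open>Period cell D_L = [-L,L]^d, vectors v :: real^'n (d = CARD('n)).
Functions of v are complex-valued (real-valued ones have zero imaginary part).\<close>

definition cell :: "real \<Rightarrow> (real^'n) set" where
  "cell L = {v. \<forall>j. - L \<le> v $ j \<and> v $ j \<le> L}"

definition periodic_fn :: "real \<Rightarrow> (real^'n \<Rightarrow> complex) \<Rightarrow> bool" where
  "periodic_fn L f \<longleftrightarrow> (\<forall>v j. f (v + (2 * L) *\<^sub>R axis j 1) = f v)"

definition in_L1 :: "real \<Rightarrow> (real^'n \<Rightarrow> complex) \<Rightarrow> bool" where
  "in_L1 L f \<longleftrightarrow> set_integrable lborel (cell L) f"

definition in_L2 :: "real \<Rightarrow> (real^'n \<Rightarrow> complex) \<Rightarrow> bool" where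
  "in_L2 L f \<longleftrightarrow> f \<in> borel_measurable lborel \<and>
      set_integrable lborel (cell L) (\<lambda>v. (cmod (f v))\<^sup>2)"

definition L1norm :: "real \<Rightarrow> (real^'n \<Rightarrow> complex) \<Rightarrow> real" where
  "L1norm L f = (LINT v:cell L|lborel. cmod (f v))"

definition L2norm :: "real \<Rightarrow> (real^'n \<Rightarrow> complex) \<Rightarrow> real" where
  "L2norm L f = sqrt (LINT v:cell L|lborel. (cmod (f v))\<^sup>2)"

definition neg_part :: "(real^'n \<Rightarrow> complex) \<Rightarrow> real^'n \<Rightarrow> complex" where
  "neg_part f = (\<lambda>v. complex_of_real (max (- Re (f v)) 0))"

definition has_partial :: "(real^'n \<Rightarrow> real) \<Rightarrow> 'n \<Rightarrow> (real^'n \<Rightarrow> real) \<Rightarrow> bool" where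
  "has_partial \<phi> j \<psi> \<longleftrightarrow>
     (\<forall>v. ((\<lambda>t. \<phi> (v + t *\<^sub>R axis j 1)) has_real_derivative \<psi> v) (at 0))"

definition test_fn :: "(real^'n \<Rightarrow> real) \<Rightarrow> bool" where
  "test_fn \<phi> \<longleftrightarrow> continuous_on UNIV \<phi> \<and> bounded {v. \<phi> v \<noteq> 0} \<and>
     (\<forall>i. \<exists>\<psi>. continuous_on UNIV \<psi> \<and> has_partial \<phi> i \<psi>)"

definition weak_partial :: "(real^'n \<Rightarrow> complex) \<Rightarrow> 'n \<Rightarrow> (real^'n \<Rightarrow> complex) \<Rightarrow> bool" where
  "weak_partial f j g \<longleftrightarrow>
     (\<forall>K. compact K \<longrightarrow> set_integrable lborel K f \<and> set_integrable lborel K g) \<and>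
     (\<forall>\<phi> \<psi>. test_fn \<phi> \<and> has_partial \<phi> j \<psi> \<longrightarrow>
        (LINT v|lborel. complex_of_real (\<psi> v) * f v) =
          - (LINT v|lborel. complex_of_real (\<phi> v) * g v))"

definition in_H1 :: "real \<Rightarrow> (real^'n \<Rightarrow> complex) \<Rightarrow> bool" where
  "in_H1 L f \<longleftrightarrow> in_L2 L f \<and> (\<forall>j. \<exists>g. weak_partial f j g \<and> in_L2 L g)"

definition H1norm :: "real \<Rightarrow> (real^'n \<Rightarrow> complex) \<Rightarrow> real" where
  "H1norm L f = sqrt ((L2norm L f)\<^sup>2 +
      (\<Sum>j\<in>UNIV. (L2norm L (SOME g. weak_partial f j g))\<^sup>2))"

definition fmode :: "real \<Rightarrow> ('n \<Rightarrow> int) \<Rightarrow> real^'n \<Rightarrow> complex" where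
  "fmode L k v = cis (pi / L * (\<Sum>j\<in>UNIV. real_of_int (k j) * v $ j))"

definition freqs :: "nat \<Rightarrow> ('n::finite \<Rightarrow> int) set" where
  "freqs N = {k. \<forall>j. - (real N / 2) \<le> real_of_int (k j) \<and> real_of_int (k j) \<le> real N / 2}"

definition PN_space :: "real \<Rightarrow> nat \<Rightarrow> (real^'n \<Rightarrow> complex) set" where
  "PN_space L N = {f. \<exists>c. f = (\<lambda>v. \<Sum>k\<in>freqs N. c k * fmode L k v)}"

text \<open>The L^2(D_L)-orthogonal projection onto P_N (the modes are orthogonal with
  squared norm (2L)^d).\<close>
definition fcoef :: "real \<Rightarrow> (real^'n \<Rightarrow> complex) \<Rightarrow> ('n \<Rightarrow> int) \<Rightarrow> complex" where
  "fcoef L h k = (LINT w:cell L|lborel. h w * cnj (fmode L k w)) / (2 * L) ^ CARD('n)"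

definition PN :: "real \<Rightarrow> nat \<Rightarrow> (real^'n \<Rightarrow> complex) \<Rightarrow> real^'n \<Rightarrow> complex" where
  "PN L N h = (\<lambda>v. \<Sum>k\<in>freqs N. fcoef L h k * fmode L k v)"

text \<open>Surface measure on the unit sphere S^{d-1} (cone construction:
  sigma(A) = d * Lebesgue measure of {r x : 0 < r <= 1, x in A}).\<close>
definition sphere_measure :: "'a::euclidean_space measure" where
  "sphere_measure = distr (density (restrict_space lborel (ball 0 1)) (\<lambda>_. ennreal (real DIM('a))))
                          borel (\<lambda>x. x /\<^sub>R norm x)"

definition QR :: "real \<Rightarrow> (real \<Rightarrow> real) \<Rightarrow> (real \<Rightarrow> real) \<Rightarrow>
    (real^'n \<Rightarrow> complex) \<Rightarrow> (real^'n \<Rightarrow> complex) \<Rightarrow> real^'n \<Rightarrow> complex" where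
  "QR R \<Phi> b g f v =
     (LINT q|lborel. LINT \<sigma>|sphere_measure.
        complex_of_real (indicator {q. norm q \<le> R} q * \<Phi> (norm q) * b (\<sigma> \<bullet> (q /\<^sub>R norm q))) *
        (g (v - (1/2) *\<^sub>R (q + norm q *\<^sub>R \<sigma>)) * f (v - (1/2) *\<^sub>R (q - norm q *\<^sub>R \<sigma>))
         - g (v - q) * f v))"

definition galerkin_sol :: "real \<Rightarrow> real \<Rightarrow> (real \<Rightarrow> real) \<Rightarrow> (real \<Rightarrow> real) \<Rightarrow> nat \<Rightarrow> real \<Rightarrow>
    (real^'n \<Rightarrow> complex) \<Rightarrow> (real \<Rightarrow> real^'n \<Rightarrow> complex) \<Rightarrow> bool" where
  "galerkin_sol R L \<Phi> b N T f0 F \<longleftrightarrow>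
     F 0 = f0 \<and>
     (\<forall>t\<in>{0..T}. periodic_fn L (F t) \<and> in_L1 L (F t) \<and> in_H1 L (F t)) \<and>
     (\<forall>t\<in>{0..T}. \<forall>v. ((\<lambda>s. F s v) has_vector_derivative PN L N (QR R \<Phi> b (F t) (F t)) v)
                          (at t within {0..T}))"

end

(*
  Pairing the gain term with a test function and moving the shift v -> v - (q + |q| sigma)/2 onto it
  gives | <Q(g,f), psi> | <= 2 C |g|_1 |f|_2 |psi|_2; the kernel vanishes for obtuse deflection angles,
  so the vectors (q + |q| sigma)/2 are spread out over the cell with bounded density.
  Multiplying the Galerkin field by a cut-off that sees the sup norm and the L^1 norm makes it globally
  Lipschitz on bounded continuous functions, so the ODE has a solution on [0,T], and its L^2 norm grows
  at most like exp (8 C M1 t) whatever the sign of the solution.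
  The same estimate for the differences f(v + y) - f(v) propagates the H^1 regularity of the data in the
  discrete form |f(. + y) - f|_2 <= C' |y|; with |y| = L/N this bounds the projection error
  (1 - P_N) Q(f,f) by C''/N.  Hence the negative part satisfies a Gronwall inequality with small data
  and small forcing, mass conservation gives |f|_1 = mass + 2 |f^-|_1 <= 2 M1, and the cut-off is inactive.
  Since an arbitrary solution is tied to the ODE only pointwise in v, uniqueness first recovers its
  Fourier coefficients from its values at the nodes of a discrete Fourier transform.
  The weak gradient in the H^1 norm of a trigonometric polynomial is the classical one almost everywhere.
*)
theory Submission
  imports Defs
begin

section \<open>Integration of periodic functions over a cell\<close>

text \<open>The a priori bounds are circular: the L^2 bound needs the L^1 bound, the smallness of
  the negative part needs the L^2 bound, and the L^1 bound needs the negative part to be small. The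
  cut-off breaks the circle: it vanishes where the L^1 norm exceeds 2 m, with m = 2 M1, so the
  truncated flow obeys the L^2 estimate unconditionally, and the other bounds follow from that one.
  The bounded density of (q + |q| \<sigma>) / 2 cannot be read off for a fixed q, since these points
  lie on a sphere and b is only integrable; it appears after averaging over the direction of q,
  through rotation invariance. Differences replace derivatives because Q commutes with translations,
  so the bilinear L^2 estimate applies to them directly. The projection costs nothing when the test
  function is a trigonometric polynomial; the negative part is none, and this is where the
  projection error, and with it the regularity of the data, enters.\<close>

definition cell_measure :: "real \<Rightarrow> (real^'n) measure" where
  "cell_measure L = restrict_space lborel (cell L)"

text \<open>The polymorphic twin of \<open>periodic_fn\<close>: shift invariance is needed for real,
  complex and extended nonnegative values alike.\<close>

definition periodic :: "real \<Rightarrow> (real^'n \<Rightarrow> 'a) \<Rightarrow> bool" where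
  "periodic L f \<longleftrightarrow> (\<forall>v j. f (v + (2 * L) *\<^sub>R axis j 1) = f v)"

definition cont_periodic :: "real \<Rightarrow> (real^'n \<Rightarrow> 'a::topological_space) \<Rightarrow> bool" where
  "cont_periodic L f \<longleftrightarrow> continuous_on UNIV f \<and> periodic L f"

definition lattice_vec :: "real \<Rightarrow> ('n \<Rightarrow> int) \<Rightarrow> real^'n" where
  "lattice_vec L z = (\<chi> j. 2 * L * real_of_int (z j))"

lemma cell_eq_cbox: "cell L = cbox (\<chi> j. - L) (\<chi> j. L)"
  by (auto simp: cell_def mem_box_cart)

lemma cell_borel [measurable]: "cell L \<in> sets borel"
  by (simp add: cell_eq_cbox)

lemma compact_cell: "compact (cell L)"
  by (simp add: cell_eq_cbox)

lemma space_cell_measure: "space (cell_measure L) = cell L"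
  by (simp add: cell_measure_def space_restrict_space)

lemma measurable_cell_measureI:
  "f \<in> measurable borel M \<Longrightarrow> f \<in> measurable (cell_measure L) M"
  unfolding cell_measure_def by (rule measurable_restrict_space1) simp

lemma finite_cell_measure: "finite_measure (cell_measure L :: (real^'n) measure)"
proof (rule finite_measureI)
  have "emeasure (cell_measure L) (cell L :: (real^'n) set) = emeasure lborel (cell L :: (real^'n) set)"
    unfolding cell_measure_def by (rule emeasure_restrict_space) auto
  also have "\<dots> < \<infinity>"
    by (rule emeasure_compact_finite[OF compact_cell])
  finally show "emeasure (cell_measure L) (space (cell_measure L) :: (real^'n) set) \<noteq> \<infinity>"
    by (simp add: space_cell_measure less_top)
qed

lemma measure_cell_measure:
  assumes "0 \<le> L"
  shows "measure (cell_measure L) (space (cell_measure L) :: (real^'n) set) = (2 * L) ^ CARD('n)"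
proof -
  have "measure (cell_measure L) (cell L :: (real^'n) set) = measure lborel (cell L :: (real^'n) set)"
    unfolding cell_measure_def by (rule measure_restrict_space) auto
  also have "\<dots> = (\<Prod>i\<in>(UNIV::'n set). 2 * L)"
    unfolding cell_eq_cbox
    using content_cbox_cart[of "\<chi> j. - L" "\<chi> j::'n. L"] assms
    by (simp add: interval_ne_empty_cart)
  finally show ?thesis by (simp add: space_cell_measure)
qed

lemma set_integral_cell:
  fixes f :: "real^'n \<Rightarrow> 'b::{banach, second_countable_topology}"
  shows "(LINT v:cell L|lborel. f v) = (\<integral>v. f v \<partial>cell_measure L)"
  unfolding cell_measure_def set_lebesgue_integral_def
  by (subst integral_restrict_space) auto

lemma set_integrable_cell:
  fixes f :: "real^'n \<Rightarrow> 'b::{banach, second_countable_topology}"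
  shows "set_integrable lborel (cell L) f \<longleftrightarrow> integrable (cell_measure L) f"
  unfolding cell_measure_def set_integrable_def
  by (subst integrable_restrict_space) auto

text \<open>A bridge to two facts stated for the gauge integral: differentiation under the integral
  sign, and the vanishing of a continuous nonnegative function whose integral is zero.\<close>

lemma integral_cell_eq_HK:
  fixes f :: "real^'n \<Rightarrow> 'b::euclidean_space"
  assumes "continuous_on UNIV f"
  shows "(\<integral>v. f v \<partial>cell_measure L) = integral (cell L) f"
proof -
  have "set_integrable lborel (cell L) f"
    unfolding set_integrable_def
    by (intro borel_integrable_compact compact_cell continuous_on_subset[OF assms]) simp
  then show ?thesis
    by (metis set_borel_integral_eq_integral(2) set_integral_cell)
qed

subsection \<open>Shift invariance\<close>

lemma periodic_multiple:
  assumes "periodic L f"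
  shows "f (v + (2 * L * of_int m) *\<^sub>R axis j 1) = f v"
proof -
  have nat: "f (v + (2 * L * of_nat n) *\<^sub>R axis j 1) = f v" for n v
  proof (induction n)
    case (Suc n)
    have "v + (2 * L * of_nat (Suc n)) *\<^sub>R axis j 1
        = (v + (2 * L * of_nat n) *\<^sub>R axis j 1) + (2 * L) *\<^sub>R axis j 1"
      by (simp add: algebra_simps)
    with Suc assms show ?case
      unfolding periodic_def by metis
  qed simp
  show ?thesis
  proof (cases "m \<ge> 0")
    case True
    then show ?thesis using nat[of v "nat m"] by simp
  next
    case False
    then show ?thesis
      using nat[of "v + (2 * L * of_int m) *\<^sub>R axis j 1" "nat (- m)"] by (simp add: algebra_simps)
  qed
qed

lemma periodic_lattice:
  assumes "periodic L f"
  shows "f (v + lattice_vec L z) = f v"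
proof -
  have "f (v + (\<Sum>j\<in>S. (2 * L * of_int (z j)) *\<^sub>R axis j 1)) = f v" if "finite S" for S
    using that
  proof (induction S)
    case (insert j S)
    have "v + (\<Sum>j\<in>insert j S. (2 * L * of_int (z j)) *\<^sub>R axis j 1)
       = (v + (\<Sum>j\<in>S. (2 * L * of_int (z j)) *\<^sub>R axis j 1)) + (2 * L * of_int (z j)) *\<^sub>R axis j 1"
      using insert by (simp add: algebra_simps)
    then show ?case
      by (simp only: periodic_multiple[OF assms] insert.IH)
  qed simp
  moreover have "(\<Sum>j\<in>UNIV. (2 * L * of_int (z j)) *\<^sub>R axis j 1) = lattice_vec L z"
    by (auto simp: vec_eq_iff lattice_vec_def axis_def sum_component if_distrib cong: if_cong)
  ultimately show ?thesis by (metis finite)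
qed

text \<open>Unlike the closed cell, the half-open one meets every lattice orbit in exactly one
  point; the two differ by a null set.\<close>

definition half_open_cell :: "real \<Rightarrow> (real^'n) set" where
  "half_open_cell L = {v. \<forall>j. - L \<le> v $ j \<and> v $ j < L}"

lemma half_open_cell_borel [measurable]: "half_open_cell L \<in> sets borel"
proof -
  have "{v \<in> space borel. \<forall>j. - L \<le> v $ j \<and> v $ j < L} \<in> sets (borel :: (real^'a) measure)"
    by measurable
  then show ?thesis by (simp add: half_open_cell_def)
qed

lemma AE_half_open_cell:
  assumes "0 < L"
  shows "AE v in lborel. v \<in> cell L \<longleftrightarrow> v \<in> half_open_cell L"
proof -
  let ?B = "box (\<chi> j. - L) (\<chi> j. L) :: (real^'a) set"
  have "emeasure lborel (cell L - ?B) = emeasure lborel (cell L :: (real^'a) set) - emeasure lborel ?B"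
    by (rule emeasure_Diff)
       (auto simp: cell_eq_cbox emeasure_lborel_box_eq prod_nonneg mem_box_cart less_imp_le)
  also have "\<dots> = 0"
    unfolding cell_eq_cbox emeasure_lborel_box_eq emeasure_lborel_cbox_eq
    using assms by (auto simp: Basis_vec_def inner_axis)
  finally have "cell L - ?B \<in> null_sets lborel"
    by (auto simp: null_sets_def)
  from AE_not_in[OF this] show ?thesis
    by eventually_elim (auto simp: cell_def half_open_cell_def mem_box_cart less_imp_le)
qed

lemma ex1_lattice:
  fixes w :: "real^'n"
  assumes "0 < L"
  shows "\<exists>!z. w + lattice_vec L z \<in> half_open_cell L"
proof -
  have *: "- L \<le> w $ j + 2 * L * of_int m \<and> w $ j + 2 * L * of_int m < L \<longleftrightarrow>
      m = - \<lfloor>(w $ j + L) / (2 * L)\<rfloor>" for m :: int and j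
  proof -
    have "m = - \<lfloor>(w $ j + L) / (2 * L)\<rfloor> \<longleftrightarrow> \<lfloor>(w $ j + L) / (2 * L)\<rfloor> = - m" by auto
    also have "\<dots> \<longleftrightarrow> of_int (- m) \<le> (w $ j + L) / (2 * L) \<and> (w $ j + L) / (2 * L) < of_int (- m) + 1"
      by (rule floor_eq_iff)
    also have "\<dots> \<longleftrightarrow> - L \<le> w $ j + 2 * L * of_int m \<and> w $ j + 2 * L * of_int m < L"
      using assms by (auto simp: field_simps)
    finally show ?thesis by simp
  qed
  define z where "z j = - \<lfloor>(w $ j + L) / (2 * L)\<rfloor>" for j
  show ?thesis
    by (rule ex1I[of _ z])
       (simp_all add: half_open_cell_def lattice_vec_def * z_def[symmetric] fun_eq_iff)
qed

text \<open>A partition of unity by lattice translates, written as an integral over the counting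
  measure so that it can be exchanged with the integral over the space.\<close>

lemma nn_integral_lattice:
  fixes w :: "real^'n"
  assumes "0 < L"
  shows "(\<integral>\<^sup>+z. indicator (half_open_cell L) (w + lattice_vec L z) \<partial>count_space UNIV) = (1::ennreal)"
proof -
  obtain z0 where z0: "\<And>z. w + lattice_vec L z \<in> half_open_cell L \<longleftrightarrow> z = z0"
    using ex1_lattice[OF assms, of w] by blast
  have "(\<integral>\<^sup>+z. indicator (half_open_cell L) (w + lattice_vec L z) \<partial>count_space UNIV)
      = (\<integral>\<^sup>+z. indicator {z0} z \<partial>count_space (UNIV :: ('n \<Rightarrow> int) set))"
    by (intro nn_integral_cong) (auto simp: z0 split: split_indicator)
  then show ?thesis by simp
qed

lemma nn_integral_translate:
  fixes f :: "'a::euclidean_space \<Rightarrow> ennreal"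
  assumes [measurable]: "f \<in> borel_measurable borel"
  shows "(\<integral>\<^sup>+v. f (v + y) \<partial>lborel) = (\<integral>\<^sup>+v. f v \<partial>lborel)"
proof -
  have "(\<integral>\<^sup>+v. f v \<partial>lborel) = (\<integral>\<^sup>+v. f v \<partial>distr lborel borel ((+) y))"
    by (subst lborel_distr_plus) simp
  also have "\<dots> = (\<integral>\<^sup>+v. f (v + y) \<partial>lborel)"
    by (subst nn_integral_distr) (auto simp: add.commute)
  finally show ?thesis by simp
qed

text \<open>Unfolding and folding: inserting the partition of unity cuts the shifted cell into
  lattice pieces, periodicity moves each piece back into the cell, and the partition of unity for
  the shifted point is then summed out.\<close>

lemma nn_integral_half_open_shift:
  fixes f :: "real^'n \<Rightarrow> ennreal"
  assumes "0 < L" "periodic L f" and f[measurable]: "f \<in> borel_measurable borel"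
  shows "(\<integral>\<^sup>+v. f (v + y) * indicator (half_open_cell L) v \<partial>lborel)
       = (\<integral>\<^sup>+v. f v * indicator (half_open_cell L) v \<partial>lborel)"
proof -
  let ?H = "half_open_cell L :: (real^'n) set" and ?C = "count_space (UNIV :: ('n \<Rightarrow> int) set)"
  have "(\<integral>\<^sup>+v. f (v + y) * indicator ?H v \<partial>lborel) = (\<integral>\<^sup>+v. f v * indicator ?H (v - y) \<partial>lborel)"
    using nn_integral_translate[of "\<lambda>v. f v * indicator ?H (v - y)" y] by simp
  also have "\<dots> = (\<integral>\<^sup>+v. \<integral>\<^sup>+z. f v * indicator ?H (v - y) * indicator ?H (v + lattice_vec L z) \<partial>?C \<partial>lborel)"
    by (intro nn_integral_cong) (simp add: nn_integral_cmult nn_integral_lattice[OF assms(1)])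
  also have "\<dots> = (\<integral>\<^sup>+z. \<integral>\<^sup>+v. f v * indicator ?H (v - y) * indicator ?H (v + lattice_vec L z) \<partial>lborel \<partial>?C)"
    by (rule nn_integral_count_space_nn_integral) auto
  also have "\<dots> = (\<integral>\<^sup>+z. \<integral>\<^sup>+v. f v * indicator ?H (v - y + - lattice_vec L z) * indicator ?H v \<partial>lborel \<partial>?C)"
  proof (rule nn_integral_cong)
    fix z :: "'n \<Rightarrow> int"
    have "f (v + - lattice_vec L z) = f v" for v
      using periodic_lattice[OF assms(2), of "v + - lattice_vec L z" z] by simp
    then show "(\<integral>\<^sup>+v. f v * indicator ?H (v - y) * indicator ?H (v + lattice_vec L z) \<partial>lborel)
        = (\<integral>\<^sup>+v. f v * indicator ?H (v - y + - lattice_vec L z) * indicator ?H v \<partial>lborel)"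
      using nn_integral_translate[of "\<lambda>v. f v * indicator ?H (v - y) * indicator ?H (v + lattice_vec L z)"
          "- lattice_vec L z"] by (simp add: algebra_simps)
  qed
  also have "\<dots> = (\<integral>\<^sup>+v. \<integral>\<^sup>+z. f v * indicator ?H (v - y + - lattice_vec L z) * indicator ?H v \<partial>?C \<partial>lborel)"
    by (rule nn_integral_count_space_nn_integral[symmetric]) auto
  also have "\<dots> = (\<integral>\<^sup>+v. f v * indicator ?H v * (\<integral>\<^sup>+z. indicator ?H (v - y + lattice_vec L z) \<partial>?C) \<partial>lborel)"
  proof (rule nn_integral_cong)
    fix v :: "real^'n"
    have neg: "- lattice_vec L z = lattice_vec L (- z)" for z :: "'n \<Rightarrow> int"
      by (simp add: lattice_vec_def vec_eq_iff)
    have bij: "bij_betw uminus (UNIV :: ('n \<Rightarrow> int) set) UNIV"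
      by (rule bij_betwI[where g = uminus]) auto
    have "(\<integral>\<^sup>+z. f v * indicator ?H (v - y + - lattice_vec L z) * indicator ?H v \<partial>?C)
        = (\<integral>\<^sup>+z. (f v * indicator ?H v) * indicator ?H (v - y + lattice_vec L (- z)) \<partial>?C)"
      unfolding neg by (simp add: mult_ac)
    also have "\<dots> = (\<integral>\<^sup>+z. (f v * indicator ?H v) * indicator ?H (v - y + lattice_vec L z) \<partial>?C)"
      by (rule nn_integral_bij_count_space[OF bij])
    finally show "(\<integral>\<^sup>+z. f v * indicator ?H (v - y + - lattice_vec L z) * indicator ?H v \<partial>?C)
        = f v * indicator ?H v * (\<integral>\<^sup>+z. indicator ?H (v - y + lattice_vec L z) \<partial>?C)"
      by (simp add: nn_integral_cmult)
  qed
  also have "\<dots> = (\<integral>\<^sup>+v. f v * indicator ?H v \<partial>lborel)"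
    by (simp add: nn_integral_lattice[OF assms(1)])
  finally show ?thesis .
qed

lemma nn_integral_cell_eq_half_open:
  assumes "0 < L" "f \<in> borel_measurable borel"
  shows "(\<integral>\<^sup>+v. f v \<partial>cell_measure L) = (\<integral>\<^sup>+v. f v * indicator (half_open_cell L) v \<partial>lborel)"
proof -
  have "(\<integral>\<^sup>+v. f v \<partial>cell_measure L) = (\<integral>\<^sup>+v. f v * indicator (cell L) v \<partial>lborel)"
    unfolding cell_measure_def by (subst nn_integral_restrict_space) auto
  also have "\<dots> = (\<integral>\<^sup>+v. f v * indicator (half_open_cell L) v \<partial>lborel)"
    by (rule nn_integral_cong_AE)
       (use AE_half_open_cell[OF assms(1)] in eventually_elim, auto split: split_indicator)
  finally show ?thesis .
qed

lemma nn_integral_cell_shift: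
  fixes f :: "real^'n \<Rightarrow> ennreal"
  assumes "0 < L" "periodic L f" and f[measurable]: "f \<in> borel_measurable borel"
  shows "(\<integral>\<^sup>+v. f (v + y) \<partial>cell_measure L) = (\<integral>\<^sup>+v. f v \<partial>cell_measure L)"
  using nn_integral_half_open_shift[OF assms]
  by (subst (1 2) nn_integral_cell_eq_half_open) (auto simp: assms)

text \<open>The function and its shift have the same image measure on the cell. This carries the
  nonnegative case over to Banach-valued functions at once, and non-integrable ones get the same
  default value on both sides.\<close>

lemma integral_cell_shift:
  fixes f :: "real^'n \<Rightarrow> 'b::{banach, second_countable_topology}"
  assumes L: "0 < L" and per: "periodic L f" and f[measurable]: "f \<in> borel_measurable borel"
  shows "(\<integral>v. f (v + y) \<partial>cell_measure L) = (\<integral>v. f v \<partial>cell_measure L)"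
proof -
  have fm [measurable]: "f \<in> borel_measurable (cell_measure L)"
      "(\<lambda>v. f (v + y)) \<in> borel_measurable (cell_measure L)"
    by (rule measurable_cell_measureI, measurable)+
  have "distr (cell_measure L) borel (\<lambda>v. f (v + y)) = distr (cell_measure L) borel f"
  proof (rule measure_eqI)
    fix A :: "'b set" assume "A \<in> sets (distr (cell_measure L) borel (\<lambda>v. f (v + y)))"
    then have [measurable]: "A \<in> sets borel" by simp
    have "(\<integral>\<^sup>+v. indicator A (f (v + y)) \<partial>cell_measure L) = (\<integral>\<^sup>+v. indicator A (f v) \<partial>cell_measure L)"
      by (rule nn_integral_cell_shift[of L "\<lambda>v. indicator A (f v)"]) (use L per in \<open>auto simp: periodic_def\<close>)
    moreover have "emeasure (distr (cell_measure L) borel h) A = (\<integral>\<^sup>+v. indicator A (h v) \<partial>cell_measure L)"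
      if [measurable]: "h \<in> borel_measurable (cell_measure L)" for h :: "real^'n \<Rightarrow> 'b"
    proof -
      have "emeasure (distr (cell_measure L) borel h) A
          = (\<integral>\<^sup>+x. indicator A x \<partial>distr (cell_measure L) borel h)" by simp
      also have "\<dots> = (\<integral>\<^sup>+v. indicator A (h v) \<partial>cell_measure L)"
        by (rule nn_integral_distr) auto
      finally show ?thesis .
    qed
    ultimately show "emeasure (distr (cell_measure L) borel (\<lambda>v. f (v + y))) A
        = emeasure (distr (cell_measure L) borel f) A" using fm by metis
  qed simp
  then have "(\<integral>x. x \<partial>distr (cell_measure L) borel (\<lambda>v. f (v + y))) = (\<integral>x. x \<partial>distr (cell_measure L) borel f)"
    by simp
  then show ?thesis
    using fm by (simp add: integral_distr)
qed

subsection \<open>Continuous periodic functions\<close>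

lemma cont_periodic_bounded:
  fixes f :: "real^'n \<Rightarrow> 'b::real_normed_vector"
  assumes "0 < L" "cont_periodic L f"
  obtains B where "0 \<le> B" "\<And>v. norm (f v) \<le> B"
proof -
  have "compact (f ` cell L)"
    using assms by (auto intro!: compact_continuous_image compact_cell
        intro: continuous_on_subset simp: cont_periodic_def)
  then obtain B where B: "\<And>v. v \<in> cell L \<Longrightarrow> norm (f v) \<le> B"
    by (meson bounded_iff compact_imp_bounded image_eqI)
  have "norm (f v) \<le> max B 0" for v
  proof -
    obtain z where "v + lattice_vec L z \<in> half_open_cell L"
      using ex1_lattice[OF assms(1), of v] by blast
    then have "v + lattice_vec L z \<in> cell L"
      by (auto simp: half_open_cell_def cell_def less_imp_le)
    from B[OF this] show ?thesis
      using assms(2) periodic_lattice[of L f v z] by (auto simp: cont_periodic_def)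
  qed
  then show ?thesis using that[of "max B 0"] by simp
qed

lemma cont_periodic_shift: "cont_periodic L f \<Longrightarrow> cont_periodic L (\<lambda>v. f (v + y))"
proof -
  assume f: "cont_periodic L f"
  have "continuous_on UNIV (\<lambda>v. f (v + y))"
    using f unfolding cont_periodic_def
    by (auto intro!: continuous_intros intro: continuous_on_compose2)
  moreover have "f (v + (2 * L) *\<^sub>R axis j 1 + y) = f (v + y)" for v j
  proof -
    have "v + (2 * L) *\<^sub>R axis j 1 + y = (v + y) + (2 * L) *\<^sub>R axis j 1" by simp
    with f show ?thesis unfolding cont_periodic_def periodic_def by metis
  qed
  ultimately show ?thesis by (simp add: cont_periodic_def periodic_def)
qed

lemma cont_periodic_shift': "cont_periodic L f \<Longrightarrow> cont_periodic L (\<lambda>v. f (v - y))"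
  using cont_periodic_shift[of L f "- y"] by simp

lemma cont_periodic_compose:
  "cont_periodic L f \<Longrightarrow> continuous_on UNIV h \<Longrightarrow> cont_periodic L (\<lambda>v. h (f v))"
  unfolding cont_periodic_def periodic_def by (auto intro: continuous_on_compose2)

lemma cont_periodic_const: "cont_periodic L (\<lambda>v. c)"
  by (simp add: cont_periodic_def periodic_def)

lemma cont_periodic_binary:
  assumes "cont_periodic L f" "cont_periodic L g"
    and "continuous_on UNIV (\<lambda>p. h (fst p) (snd p))"
  shows "cont_periodic L (\<lambda>v. h (f v) (g v))"
proof -
  have "continuous_on UNIV (\<lambda>v. (f v, g v))"
    using assms by (auto simp: cont_periodic_def intro!: continuous_intros)
  from continuous_on_compose2[OF assms(3) this] assms(1,2) show ?thesis
    by (auto simp: cont_periodic_def periodic_def)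
qed

lemma cont_periodic_mult:
  fixes f g :: "real^'n \<Rightarrow> 'b::real_normed_algebra"
  shows "cont_periodic L f \<Longrightarrow> cont_periodic L g \<Longrightarrow> cont_periodic L (\<lambda>v. f v * g v)"
  by (rule cont_periodic_binary) (auto intro!: continuous_intros)

lemma cont_periodic_add:
  fixes f g :: "real^'n \<Rightarrow> 'b::real_normed_vector"
  shows "cont_periodic L f \<Longrightarrow> cont_periodic L g \<Longrightarrow> cont_periodic L (\<lambda>v. f v + g v)"
  by (rule cont_periodic_binary) (auto intro!: continuous_intros)

lemma cont_periodic_diff:
  fixes f g :: "real^'n \<Rightarrow> 'b::real_normed_vector"
  shows "cont_periodic L f \<Longrightarrow> cont_periodic L g \<Longrightarrow> cont_periodic L (\<lambda>v. f v - g v)"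
  by (rule cont_periodic_binary) (auto intro!: continuous_intros)

lemma cont_periodic_power2:
  fixes f :: "real^'n \<Rightarrow> real"
  shows "cont_periodic L f \<Longrightarrow> cont_periodic L (\<lambda>v. (f v)\<^sup>2)"
  by (erule cont_periodic_compose) (auto intro!: continuous_intros)

lemma cont_periodic_abs:
  fixes f :: "real^'n \<Rightarrow> real"
  shows "cont_periodic L f \<Longrightarrow> cont_periodic L (\<lambda>v. \<bar>f v\<bar>)"
  by (erule cont_periodic_compose) (auto intro!: continuous_intros)

lemma cont_periodic_measurable:
  fixes f :: "real^'n \<Rightarrow> 'b::topological_space"
  shows "cont_periodic L f \<Longrightarrow> f \<in> borel_measurable borel"
  by (simp add: cont_periodic_def borel_measurable_continuous_onI)

lemma integrable_cell_bounded:
  fixes f :: "real^'n \<Rightarrow> 'b::{banach, second_countable_topology}"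
  assumes "f \<in> borel_measurable borel" "\<And>v. norm (f v) \<le> B"
  shows "integrable (cell_measure L) f"
  by (rule finite_measure.integrable_const_bound[OF finite_cell_measure, of f B])
     (use assms in \<open>auto intro: measurable_cell_measureI\<close>)

lemma integrable_cell_cont:
  fixes f :: "real^'n \<Rightarrow> 'b::{banach, second_countable_topology}"
  assumes "0 < L" "cont_periodic L f"
  shows "integrable (cell_measure L) f"
  using cont_periodic_bounded[OF assms] integrable_cell_bounded cont_periodic_measurable[OF assms(2)]
  by metis

lemma integral_cell_shift_cont:
  fixes f :: "real^'n \<Rightarrow> 'b::{banach, second_countable_topology}"
  assumes "0 < L" "cont_periodic L f"
  shows "(\<integral>v. f (v + y) \<partial>cell_measure L) = (\<integral>v. f v \<partial>cell_measure L)"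
  by (rule integral_cell_shift)
     (use assms cont_periodic_measurable[OF assms(2)] in \<open>auto simp: cont_periodic_def\<close>)

lemma integral_power2_eq_0_cell:
  fixes f :: "real^'n \<Rightarrow> real"
  assumes L: "0 < L" and f: "cont_periodic L f"
    and 0: "(\<integral>v. (f v)\<^sup>2 \<partial>cell_measure L) = 0"
  shows "f v = 0"
proof -
  have cont: "continuous_on UNIV (\<lambda>v. (f v)\<^sup>2)" 
    using f by (auto simp: cont_periodic_def intro!: continuous_intros)
  have "integral (cell L) (\<lambda>v. (f v)\<^sup>2) = 0"
    using 0 integral_cell_eq_HK[OF cont] by simp
  then have "((\<lambda>v. (f v)\<^sup>2) has_integral 0) (cbox (\<chi> j. - L) (\<chi> j. L))"
    using integrable_integral[OF integrable_continuous[OF continuous_on_subset[OF cont]], of "\<chi> j. - L" "\<chi> j. L"]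
    by (simp add: cell_eq_cbox)
  from has_integral_0_cbox_imp_0[OF continuous_on_subset[OF cont subset_UNIV] _ this]
  have *: "f v = 0" if "v \<in> cell L" for v
    using that L by (auto simp: cell_eq_cbox box_ne_empty Basis_vec_def inner_axis)
  obtain z where "v + lattice_vec L z \<in> half_open_cell L"
    using ex1_lattice[OF L, of v] by blast
  then have "v + lattice_vec L z \<in> cell L"
    by (auto simp: half_open_cell_def cell_def less_imp_le)
  from *[OF this] show ?thesis
    using f periodic_lattice[of L f v z] by (auto simp: cont_periodic_def)
qed

subsection \<open>The Cauchy--Schwarz inequality\<close>

lemma integral_Cauchy_Schwarz:
  fixes f g :: "'a \<Rightarrow> real"
  assumes f: "integrable M (\<lambda>x. (f x)\<^sup>2)" and g: "integrable M (\<lambda>x. (g x)\<^sup>2)"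
    and fg: "integrable M (\<lambda>x. f x * g x)"
  shows "(\<integral>x. f x * g x \<partial>M)\<^sup>2 \<le> (\<integral>x. (f x)\<^sup>2 \<partial>M) * (\<integral>x. (g x)\<^sup>2 \<partial>M)"
proof -
  define a b c where "a = (\<integral>x. (f x)\<^sup>2 \<partial>M)" and "b = (\<integral>x. f x * g x \<partial>M)" and "c = (\<integral>x. (g x)\<^sup>2 \<partial>M)"
  \<comment> \<open>A quadratic polynomial in t without negative values; its minimum at
    \<open>- b / c\<close> gives the claim when \<open>c\<close> is positive.\<close>
  have ge: "0 \<le> a + 2 * t * b + t\<^sup>2 * c" for t
  proof -
    have "0 \<le> (\<integral>x. (f x + t * g x)\<^sup>2 \<partial>M)" by simp
    also have "\<dots> = (\<integral>x. (f x)\<^sup>2 + 2 * t * (f x * g x) + t\<^sup>2 * (g x)\<^sup>2 \<partial>M)"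
      by (simp add: power2_sum power_mult_distrib algebra_simps)
    also have "\<dots> = a + 2 * t * b + t\<^sup>2 * c"
      using f g fg by (simp add: a_def b_def c_def)
    finally show ?thesis .
  qed
  have "0 \<le> c" by (simp add: c_def)
  have "b\<^sup>2 \<le> a * c"
  proof (cases "c = 0")
    case True
    have "b = 0"
    proof (rule ccontr)
      assume "b \<noteq> 0"
      \<comment> \<open>A nonnegative affine function of t has slope zero: at this t its value would
        be -1.\<close>
      then have "2 * (- (a + 1) / (2 * b)) * b = - (a + 1)" by (simp add: field_simps)
      with ge[of "- (a + 1) / (2 * b)"] True show False by simp
    qed
    then show ?thesis using True by simp
  next
    case False
    then have "0 < c" using \<open>0 \<le> c\<close> by simp
    then show ?thesis
      using ge[of "- b / c"] by (simp add: field_simps power2_eq_square)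
  qed
  then show ?thesis by (simp add: a_def b_def c_def)
qed

section \<open>Trigonometric polynomials\<close>

lemma norm_fmode [simp]: "cmod (fmode L k v) = 1"
  by (simp add: fmode_def)

lemma fmode_mult: "fmode L k v * fmode L l v = fmode L (\<lambda>j. k j + l j) v"
  by (simp add: fmode_def cis_mult sum.distrib distrib_left distrib_right)

lemma cnj_fmode: "cnj (fmode L k v) = fmode L (\<lambda>j. - k j) v"
  by (simp add: fmode_def cis_cnj sum_negf)

lemma fmode_shift: "fmode L k (v + y) = fmode L k v * fmode L k y"
  by (simp add: fmode_def cis_mult sum.distrib distrib_left distrib_right)

lemma fmode_0 [simp]: "fmode L (\<lambda>j. 0) v = 1"
  by (simp add: fmode_def)

lemma fmode_axis: "fmode L k (s *\<^sub>R axis j 1) = cis (pi * of_int (k j) * s / L)"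
proof -
  have "(\<Sum>i\<in>UNIV. real_of_int (k i) * (s *\<^sub>R axis j 1 :: real^'a) $ i)
      = (\<Sum>i\<in>UNIV. if i = j then real_of_int (k j) * s else 0)"
    by (rule sum.cong) (auto simp: axis_def)
  then show ?thesis by (simp add: fmode_def mult.assoc)
qed

lemma cont_periodic_fmode:
  assumes "0 < L"
  shows "cont_periodic L (fmode L k)"
proof -
  have "fmode L k (v + (2 * L) *\<^sub>R axis j 1) = fmode L k v" for v j
    using assms cis_multiple_2pi[of "of_int (k j)"]
    by (simp add: fmode_shift fmode_axis mult_ac)
  moreover have "continuous_on UNIV (fmode L k)"
    unfolding fmode_def cis_conv_exp by (intro continuous_intros)
  ultimately show ?thesis by (simp add: cont_periodic_def periodic_def)
qed

lemma integral_fmode: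
  fixes k :: "'n::finite \<Rightarrow> int"
  assumes L: "0 < L"
  shows "(\<integral>v. fmode L k v \<partial>cell_measure L) = (if k = (\<lambda>j. 0) then (2 * L) ^ CARD('n) else 0)"
proof (cases "k = (\<lambda>j. 0)")
  case True
  have "measure (cell_measure L) (cell L :: (real^'n) set) = (2 * L) ^ CARD('n)"
    using measure_cell_measure[of L, where 'n = 'n] L by (simp add: space_cell_measure)
  with True show ?thesis
    by (simp add: space_cell_measure scaleR_conv_of_real)
next
  case False
  then obtain i where i: "k i \<noteq> 0" by auto
  \<comment> \<open>Half a wavelength in a direction in which the frequency is nonzero: the shift
    turns the mode into its negative but preserves the integral.\<close>
  define y where "y = (L / of_int (k i)) *\<^sub>R axis i (1::real)"
  have "fmode L k y = -1"
    using i L by (simp add: y_def fmode_axis)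
  then have "(\<integral>v. fmode L k v \<partial>cell_measure L) = (\<integral>v. - fmode L k v \<partial>cell_measure L)"
    using integral_cell_shift_cont[OF L cont_periodic_fmode[OF L, of k], of y]
    by (simp add: fmode_shift)
  with False show ?thesis by simp
qed

lemma integral_fmode_orthogonal:
  fixes k :: "'n::finite \<Rightarrow> int"
  assumes L: "0 < L"
  shows "(\<integral>v. fmode L k v * cnj (fmode L l v) \<partial>cell_measure L)
    = (if k = l then (2 * L) ^ CARD('n) else 0)"
proof -
  have "(\<lambda>j. k j - l j) = (\<lambda>j. 0) \<longleftrightarrow> k = l" by (auto simp: fun_eq_iff)
  then show ?thesis
    using integral_fmode[OF L, of "\<lambda>j. k j - l j"] by (simp add: cnj_fmode fmode_mult)
qed

lemma fcoef_eq: "fcoef L h k = (\<integral>w. h w * cnj (fmode L k w) \<partial>cell_measure L) / (2 * L) ^ CARD('n)"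
  for k :: "'n::finite \<Rightarrow> int"
  by (simp add: fcoef_def set_integral_cell)

text \<open>With explicit coefficients, shifts, derivatives and projections become multipliers. The
  index set is free because \<open>freqs N\<close>, \<open>freqs (2 * N)\<close> and their
  difference all occur.\<close>

definition trig_sum :: "real \<Rightarrow> ('n::finite \<Rightarrow> int) set \<Rightarrow> (('n \<Rightarrow> int) \<Rightarrow> complex) \<Rightarrow> real^'n \<Rightarrow> complex" where
  "trig_sum L K c v = (\<Sum>k\<in>K. c k * fmode L k v)"

lemma PN_space_trig_sum: "f \<in> PN_space L N \<longleftrightarrow> (\<exists>c. f = trig_sum L (freqs N) c)"
  by (auto simp: PN_space_def trig_sum_def fun_eq_iff)

lemma PN_trig_sum: "PN L N h = trig_sum L (freqs N) (fcoef L h)"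
  by (simp add: PN_def trig_sum_def fun_eq_iff)

lemma finite_freqs [simp]: "finite (freqs N)"
proof (rule finite_subset)
  have "k j \<in> {- int N .. int N}" if "k \<in> freqs N" for k :: "'a \<Rightarrow> int" and j
  proof -
    have "- (real N / 2) \<le> real_of_int (k j)" "real_of_int (k j) \<le> real N / 2"
      using that by (auto simp: freqs_def)
    then have "- int N \<le> k j" "k j \<le> int N" by linarith+
    then show ?thesis by simp
  qed
  then show "freqs N \<subseteq> PiE (UNIV :: 'a set) (\<lambda>_. {- int N .. int N})"
    by (auto simp: PiE_def Pi_def)
qed (simp add: finite_PiE)

lemma cont_periodic_sum:
  fixes f :: "'i \<Rightarrow> real^'n \<Rightarrow> 'b::real_normed_vector"
  assumes "\<And>i. i \<in> I \<Longrightarrow> cont_periodic L (f i)"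
  shows "cont_periodic L (\<lambda>v. \<Sum>i\<in>I. f i v)"
  using assms unfolding cont_periodic_def periodic_def by (auto intro!: continuous_intros)

lemma cont_periodic_trig_sum: "0 < L \<Longrightarrow> cont_periodic L (trig_sum L K c)"
  unfolding trig_sum_def[abs_def]
  by (intro cont_periodic_sum cont_periodic_mult cont_periodic_const cont_periodic_fmode)

lemma cont_periodic_PN_space: "0 < L \<Longrightarrow> f \<in> PN_space L N \<Longrightarrow> cont_periodic L f"
  by (auto simp: PN_space_trig_sum cont_periodic_trig_sum)

lemma PN_in_PN_space: "PN L N h \<in> PN_space L N"
  by (auto simp: PN_space_trig_sum PN_trig_sum)

lemma cont_periodic_cnj:
  fixes f :: "real^'n \<Rightarrow> complex"
  shows "cont_periodic L f \<Longrightarrow> cont_periodic L (\<lambda>v. cnj (f v))"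
  by (erule cont_periodic_compose) (intro continuous_intros)

lemma integral_trig_sum_mult:
  assumes L: "0 < L" and h: "cont_periodic L h"
  shows "(\<integral>v. trig_sum L K c v * h v \<partial>cell_measure L)
       = (\<Sum>k\<in>K. c k * (\<integral>v. fmode L k v * h v \<partial>cell_measure L))"
proof -
  have "integrable (cell_measure L) (\<lambda>v. c k * (fmode L k v * h v))" for k
    by (intro integrable_cell_cont[OF L] cont_periodic_mult cont_periodic_const
        cont_periodic_fmode[OF L] h)
  then show ?thesis
    by (simp add: trig_sum_def sum_distrib_right mult.assoc integrable_cell_cont[OF L])
qed

lemma fcoef_trig_sum:
  assumes L: "0 < L" and K: "finite K"
  shows "fcoef L (trig_sum L K c) l = (if l \<in> K then c l else 0)"
  unfolding fcoef_eq
  using K L by (simp add: integral_trig_sum_mult cont_periodic_cnj cont_periodic_fmode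
      integral_fmode_orthogonal if_distrib cong: if_cong)

lemma PN_idem:
  assumes "0 < L" "p \<in> PN_space L N"
  shows "PN L N p = p"
proof -
  obtain c where "p = trig_sum L (freqs N) c" using assms by (auto simp: PN_space_trig_sum)
  then have "PN L N p v = p v" for v
    unfolding PN_def using assms(1)
    by (simp add: fcoef_trig_sum cong: sum.cong) (simp add: trig_sum_def)
  then show ?thesis by blast
qed

lemma integral_fmode_cnj:
  fixes k :: "'n::finite \<Rightarrow> int"
  assumes "0 < L"
  shows "(\<integral>v. fmode L k v * cnj (h v) \<partial>cell_measure L) = cnj (fcoef L h k) * (2 * L) ^ CARD('n)"
proof -
  have "(\<integral>v. fmode L k v * cnj (h v) \<partial>cell_measure L) = cnj (\<integral>v. h v * cnj (fmode L k v) \<partial>cell_measure L)"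
    by (subst Bochner_Integration.integral_cnj[symmetric]) (simp add: mult.commute)
  also have "\<dots> = cnj (fcoef L h k) * (2 * L) ^ CARD('n)"
    using assms by (simp add: fcoef_eq)
  finally show ?thesis .
qed

lemma integral_trig_sum_cnj:
  fixes h :: "real^'n \<Rightarrow> complex"
  assumes L: "0 < L" and h: "cont_periodic L h"
  shows "(\<integral>v. trig_sum L K c v * cnj (h v) \<partial>cell_measure L)
       = (\<Sum>k\<in>K. c k * cnj (fcoef L h k)) * (2 * L) ^ CARD('n)"
  by (simp add: integral_trig_sum_mult[OF L] cont_periodic_cnj[OF h] integral_fmode_cnj[OF L]
      sum_distrib_right mult.assoc)

lemma Parseval_trig_sum:
  fixes K :: "('n::finite \<Rightarrow> int) set"
  assumes L: "0 < L" and K: "finite K"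
  shows "(\<integral>v. (cmod (trig_sum L K c v))\<^sup>2 \<partial>cell_measure L) = (\<Sum>k\<in>K. (cmod (c k))\<^sup>2) * (2 * L) ^ CARD('n)"
proof -
  have "complex_of_real (\<integral>v. (cmod (trig_sum L K c v))\<^sup>2 \<partial>cell_measure L)
      = (\<integral>v. trig_sum L K c v * cnj (trig_sum L K c v) \<partial>cell_measure L)"
    by (simp add: complex_norm_square[symmetric] flip: integral_complex_of_real)
  also have "\<dots> = (\<Sum>k\<in>K. c k * cnj (c k)) * (2 * L) ^ CARD('n)"
    using K by (simp add: integral_trig_sum_cnj[OF L] cont_periodic_trig_sum[OF L] fcoef_trig_sum[OF L])
  also have "\<dots> = complex_of_real ((\<Sum>k\<in>K. (cmod (c k))\<^sup>2) * (2 * L) ^ CARD('n))"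
    by (simp flip: complex_norm_square)
  finally show ?thesis by (simp only: of_real_eq_iff)
qed

text \<open>Self-adjointness of the projection: against a test function in \<open>PN_space\<close>
  it disappears, which is how weak estimates for the collision operator pass to the Galerkin
  field.\<close>

lemma integral_PN_cnj:
  fixes h :: "real^'n \<Rightarrow> complex"
  assumes L: "0 < L" and h: "cont_periodic L h" and p: "p \<in> PN_space L N"
  shows "(\<integral>v. p v * cnj (PN L N h v) \<partial>cell_measure L) = (\<integral>v. p v * cnj (h v) \<partial>cell_measure L)"
proof -
  obtain c where c: "p = trig_sum L (freqs N) c" using p by (auto simp: PN_space_trig_sum)
  show ?thesis
    unfolding c using h by (simp add: integral_trig_sum_cnj[OF L] PN_trig_sum cont_periodic_trig_sum[OF L] fcoef_trig_sum[OF L])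
qed

lemma norm_fcoef_le:
  fixes h :: "real^'n \<Rightarrow> complex"
  assumes L: "0 < L" and B: "\<And>v. cmod (h v) \<le> B"
  shows "cmod (fcoef L h k) \<le> B"
proof (cases "integrable (cell_measure L) (\<lambda>w. h w * cnj (fmode L k w))")
  case True
  have "cmod (\<integral>w. h w * cnj (fmode L k w) \<partial>cell_measure L) \<le> (\<integral>w. cmod (h w) \<partial>cell_measure L)"
    using integral_norm_bound[of "cell_measure L" "\<lambda>w. h w * cnj (fmode L k w)"] by (simp add: norm_mult)
  also have "\<dots> \<le> (\<integral>w. B \<partial>(cell_measure L :: (real^'n) measure))"
    using B finite_measure.integrable_const[OF finite_cell_measure]
    by (intro integral_mono') (auto intro: order_trans[OF norm_ge_zero])
  also have "\<dots> = B * (2 * L) ^ CARD('n)"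
    using measure_cell_measure[of L, where 'n = 'n] L by simp
  finally show ?thesis
    using L by (simp add: fcoef_eq norm_divide norm_power norm_mult pos_divide_le_eq)
next
  \<comment> \<open>Without integrability the coefficient is 0 by convention, and \<open>B\<close>
    is nonnegative as a bound of norms.\<close>
  case False
  then show ?thesis
    using order_trans[OF norm_ge_zero B[of 0]] by (simp add: fcoef_eq not_integrable_integral_eq)
qed

text \<open>Norms on a finite-dimensional space are equivalent. The constant grows with N, which is
  harmless because it only fixes the sup norm level of the cut-off.\<close>

lemma sup_le_L2_PN_space:
  fixes p :: "real^'n \<Rightarrow> complex"
  assumes L: "0 < L" and p: "p \<in> PN_space L N"
  shows "cmod (p v) \<le> real (card (freqs N :: ('n \<Rightarrow> int) set)) *
     sqrt ((\<integral>v. (cmod (p v))\<^sup>2 \<partial>cell_measure L) / (2 * L) ^ CARD('n))"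
proof -
  obtain c where c: "p = trig_sum L (freqs N) c" using p by (auto simp: PN_space_trig_sum)
  define S where "S = (\<Sum>k\<in>(freqs N :: ('n \<Rightarrow> int) set). (cmod (c k))\<^sup>2)"
  have S: "(\<integral>v. (cmod (p v))\<^sup>2 \<partial>cell_measure L) / (2 * L) ^ CARD('n) = S"
    using L unfolding c by (simp add: Parseval_trig_sum S_def)
  have "cmod (c k) \<le> sqrt S" if "k \<in> freqs N" for k
    using that unfolding S_def by (intro real_le_rsqrt member_le_sum) auto
  then have "cmod (p v) \<le> (\<Sum>k\<in>(freqs N :: ('n \<Rightarrow> int) set). sqrt S)"
    unfolding c trig_sum_def by (intro sum_norm_le) (simp add: norm_mult)
  then show ?thesis by (simp only: S) simp
qed

text \<open>The frequency set is symmetric under negation, and real data have conjugate coefficients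
  at opposite frequencies.\<close>

lemma PN_real:
  fixes h :: "real^'n \<Rightarrow> complex"
  assumes L: "0 < L" and h: "\<And>v. Im (h v) = 0"
  shows "Im (PN L N h v) = 0"
proof -
  have hc: "cnj (h v) = h v" for v by (rule complex_eqI) (simp_all add: h)
  have cf: "cnj (fcoef L h k) = fcoef L h (\<lambda>j. - k j)" for k
    unfolding fcoef_eq complex_cnj_divide by (subst Bochner_Integration.integral_cnj[symmetric]) (simp add: hc cnj_fmode)
  have bij: "bij_betw (\<lambda>k j. - k j) (freqs N) (freqs N :: ('n \<Rightarrow> int) set)"
  proof (rule bij_betwI[where g = "\<lambda>k j. - k j"])
    have "(\<lambda>j. - k j) \<in> freqs N" if "k \<in> freqs N" for k :: "'n \<Rightarrow> int"
      unfolding freqs_def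
    proof (intro CollectI allI)
      fix j
      have "- (real N / 2) \<le> real_of_int (k j) \<and> real_of_int (k j) \<le> real N / 2"
        using that by (simp add: freqs_def)
      then show "- (real N / 2) \<le> real_of_int (- k j) \<and> real_of_int (- k j) \<le> real N / 2"
        by auto
    qed
    note * = this
    show "(\<lambda>k j. - k j) \<in> freqs N \<rightarrow> (freqs N :: ('n \<Rightarrow> int) set)" by (intro Pi_I *)
    show "(\<lambda>k j. - k j) \<in> freqs N \<rightarrow> (freqs N :: ('n \<Rightarrow> int) set)" by (intro Pi_I *)
  qed (simp_all add: fun_eq_iff)
  have "cnj (PN L N h v) = (\<Sum>k\<in>freqs N. fcoef L h (\<lambda>j. - k j) * fmode L (\<lambda>j. - k j) v)"
    by (simp add: PN_def cf cnj_fmode)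
  also have "\<dots> = PN L N h v"
    unfolding PN_def using sum.reindex_bij_betw[OF bij, of "\<lambda>k. fcoef L h k * fmode L k v"] .
  finally have "Im (cnj (PN L N h v)) = Im (PN L N h v)" by (rule arg_cong)
  then show ?thesis by simp
qed

lemma trig_sum_shift_diff:
  "trig_sum L K c (v + y) - trig_sum L K c v = trig_sum L K (\<lambda>k. c k * (fmode L k y - 1)) v"
  by (simp add: trig_sum_def fmode_shift sum_subtractf algebra_simps)

lemma cmod_cis_diff_one: "(cmod (cis x - 1))\<^sup>2 = 2 - 2 * cos x"
proof -
  have "(cmod (cis x - 1))\<^sup>2 = (cos x - 1)\<^sup>2 + (sin x)\<^sup>2" by (simp add: cmod_power2)
  then show ?thesis using sin_cos_squared_add[of x] by (simp add: power2_diff)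
qed

text \<open>With the shift \<open>L/N\<close> a mode with \<open>N/2 < |k j| \<le> N\<close> turns by an angle in \<open>[\<pi>/2, \<pi>]\<close>.\<close>
lemma PN_error_le_shift:
  fixes h :: "real^'n \<Rightarrow> complex" and E :: real
  assumes L: "0 < L" and N: "0 < N" and h: "h \<in> PN_space L (2 * N)"
    and E: "\<And>j. (\<integral>v. (cmod (h (v + (L / N) *\<^sub>R axis j 1) - h v))\<^sup>2 \<partial>cell_measure L) \<le> E"
  shows "(\<integral>v. (cmod (h v - PN L N h v))\<^sup>2 \<partial>cell_measure L) \<le> real CARD('n) * E / 2"
proof -
  let ?F = "freqs (2 * N) :: ('n \<Rightarrow> int) set" and ?G = "freqs N :: ('n \<Rightarrow> int) set"
  let ?V = "(2 * L) ^ CARD('n)"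
  have V: "0 < ?V" using L by simp
  obtain c where c: "h = trig_sum L ?F c" using h by (auto simp: PN_space_trig_sum)
  have sub: "?G \<subseteq> ?F"
  proof
    fix k :: "'n \<Rightarrow> int" assume "k \<in> ?G"
    then have "- (real N / 2) \<le> real_of_int (k j) \<and> real_of_int (k j) \<le> real N / 2" for j
      by (simp add: freqs_def)
    note k = this
    have "- (real (2 * N) / 2) \<le> real_of_int (k j) \<and> real_of_int (k j) \<le> real (2 * N) / 2" for j
      using k[of j] by simp
    then show "k \<in> ?F" by (simp add: freqs_def)
  qed
  have "h v - PN L N h v = trig_sum L (?F - ?G) c v" for v
  proof -
    have "PN L N h v = (\<Sum>k\<in>?G. c k * fmode L k v)"
      unfolding PN_def c using sub by (intro sum.cong) (auto simp: fcoef_trig_sum[OF L])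
    then show ?thesis
      unfolding c trig_sum_def using sub by (simp add: sum_diff)
  qed
  then have "(\<integral>v. (cmod (h v - PN L N h v))\<^sup>2 \<partial>cell_measure L) = (\<Sum>k\<in>?F - ?G. (cmod (c k))\<^sup>2) * ?V"
    by (simp add: Parseval_trig_sum[OF L])
  also have "\<dots> \<le> (\<Sum>j\<in>UNIV. \<Sum>k\<in>?F. (cmod (c k * (fmode L k ((L / N) *\<^sub>R axis j 1) - 1)))\<^sup>2 / 2) * ?V"
  proof (intro mult_right_mono)
    have "(\<Sum>k\<in>?F - ?G. (cmod (c k))\<^sup>2)
        \<le> (\<Sum>k\<in>?F - ?G. \<Sum>j\<in>UNIV. (cmod (c k * (fmode L k ((L / N) *\<^sub>R axis j 1) - 1)))\<^sup>2 / 2)"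
    proof (rule sum_mono)
      fix k assume k: "k \<in> ?F - ?G"
      then obtain j where "\<not> (- (real N / 2) \<le> real_of_int (k j) \<and> real_of_int (k j) \<le> real N / 2)"
        by (auto simp: freqs_def)
      then have j1: "real N / 2 \<le> \<bar>real_of_int (k j)\<bar>" by auto
      have j2: "\<bar>real_of_int (k j)\<bar> \<le> real N"
      proof -
        have "- (real (2 * N) / 2) \<le> real_of_int (k j) \<and> real_of_int (k j) \<le> real (2 * N) / 2"
          using k by (simp add: freqs_def)
        then show ?thesis by auto
      qed
      define x where "x = pi * \<bar>real_of_int (k j)\<bar> / N"
      have x: "pi / 2 \<le> x" "x \<le> pi"
        using j1 j2 N by (auto simp: x_def field_simps)
      then have "cos x \<le> cos (pi / 2)" by (intro cos_monotone_0_pi_le) auto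
      then have cx: "cos x \<le> 0" by simp
      have "cos (pi * real_of_int (k j) / N) = cos x"
        by (cases "k j \<ge> 0") (auto simp: x_def)
      \<comment> \<open>The square of the turn is 2 - 2 cos x, so a nonpositive cosine makes it at
        least 2; this is the origin of the factor 1/2 in the bound.\<close>
      then have "2 \<le> (cmod (fmode L k ((L / N) *\<^sub>R axis j 1) - 1))\<^sup>2"
        using cx L by (simp add: fmode_axis cmod_cis_diff_one)
      then have "(cmod (c k))\<^sup>2 * 1 \<le> (cmod (c k))\<^sup>2 * ((cmod (fmode L k ((L / N) *\<^sub>R axis j 1) - 1))\<^sup>2 / 2)"
        by (intro mult_left_mono) auto
      then have "(cmod (c k))\<^sup>2 \<le> (cmod (c k * (fmode L k ((L / N) *\<^sub>R axis j 1) - 1)))\<^sup>2 / 2"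
        by (simp add: norm_mult power_mult_distrib)
      also have "\<dots> \<le> (\<Sum>j\<in>UNIV. (cmod (c k * (fmode L k ((L / N) *\<^sub>R axis j 1) - 1)))\<^sup>2 / 2)"
        by (rule member_le_sum) auto
      finally show "(cmod (c k))\<^sup>2 \<le> (\<Sum>j\<in>UNIV. (cmod (c k * (fmode L k ((L / N) *\<^sub>R axis j 1) - 1)))\<^sup>2 / 2)" .
    qed
    \<comment> \<open>Enlarged to all modes, the sum becomes the Parseval sum of the shifted
      difference.\<close>
    also have "\<dots> \<le> (\<Sum>k\<in>?F. \<Sum>j\<in>UNIV. (cmod (c k * (fmode L k ((L / N) *\<^sub>R axis j 1) - 1)))\<^sup>2 / 2)"
      by (rule sum_mono2) (auto intro!: sum_nonneg)
    also have "\<dots> = (\<Sum>j\<in>UNIV. \<Sum>k\<in>?F. (cmod (c k * (fmode L k ((L / N) *\<^sub>R axis j 1) - 1)))\<^sup>2 / 2)"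
      by (rule sum.swap)
    finally show "(\<Sum>k\<in>?F - ?G. (cmod (c k))\<^sup>2) \<le> \<dots>" .
  qed (use V in simp)
  also have "\<dots> = (\<Sum>j\<in>UNIV. (\<integral>v. (cmod (h (v + (L / N) *\<^sub>R axis j 1) - h v))\<^sup>2 \<partial>cell_measure L) / 2)"
    unfolding c trig_sum_shift_diff
    by (simp add: Parseval_trig_sum[OF L] sum_distrib_right sum_divide_distrib)
  also have "\<dots> \<le> (\<Sum>j\<in>(UNIV::'n set). E / 2)"
    by (intro sum_mono divide_right_mono E) auto
  finally show ?thesis by simp
qed

definition trig_partial :: "real \<Rightarrow> 'n \<Rightarrow> (('n::finite \<Rightarrow> int) \<Rightarrow> complex) \<Rightarrow> ('n \<Rightarrow> int) \<Rightarrow> complex" where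
  "trig_partial L j c k = \<i> * of_real (pi * of_int (k j) / L) * c k"

text \<open>Modewise this is |cis x - 1| \<le> |x| for the phase increment x; Parseval sums it
  up.\<close>

lemma shift_le_partial:
  fixes c :: "('n::finite \<Rightarrow> int) \<Rightarrow> complex"
  assumes L: "0 < L" and K: "finite K"
  shows "(\<integral>v. (cmod (trig_sum L K c (v + s *\<^sub>R axis j 1) - trig_sum L K c v))\<^sup>2 \<partial>cell_measure L)
    \<le> s\<^sup>2 * (\<integral>v. (cmod (trig_sum L K (trig_partial L j c) v))\<^sup>2 \<partial>cell_measure L)"
proof -
  have "(cmod (cis x - 1))\<^sup>2 \<le> x\<^sup>2" for x
  proof -
    have "cos x = 1 - 2 * (sin (x / 2))\<^sup>2" using cos_double_sin[of "x / 2"] by simp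
    moreover have "(sin (x / 2))\<^sup>2 \<le> (x / 2)\<^sup>2"
      using abs_sin_x_le_abs_x[of "x / 2"] by (metis abs_le_square_iff)
    ultimately show ?thesis by (simp add: cmod_cis_diff_one power_divide)
  qed
  note * = this
  have "(cmod (c k * (fmode L k (s *\<^sub>R axis j 1) - 1)))\<^sup>2 \<le> s\<^sup>2 * (cmod (trig_partial L j c k))\<^sup>2" for k
  proof -
    have "(cmod (c k * (fmode L k (s *\<^sub>R axis j 1) - 1)))\<^sup>2
        \<le> (cmod (c k))\<^sup>2 * (pi * of_int (k j) * s / L)\<^sup>2"
      by (simp only: norm_mult power_mult_distrib fmode_axis) (intro mult_left_mono *, simp)
    also have "\<dots> = s\<^sup>2 * (cmod (trig_partial L j c k))\<^sup>2"
      using L by (simp add: trig_partial_def norm_mult norm_divide power_mult_distrib power_divide)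
    finally show ?thesis .
  qed
  then show ?thesis
    unfolding trig_sum_shift_diff Parseval_trig_sum[OF L K] mult.assoc[symmetric] sum_distrib_left
    using L by (intro mult_right_mono sum_mono) auto
qed

subsection \<open>Recovering coefficients from finitely many values\<close>

lemma cis_sum: "cis (\<Sum>i\<in>A. f i) = (\<Prod>i\<in>A. cis (f i))"
  by (induction A rule: infinite_finite_induct) (auto simp: cis_mult[symmetric])

text \<open>Orthogonality of the characters of the cyclic group of order \<open>M\<close>; the bound
  on \<open>d\<close> excludes its nonzero multiples.\<close>

lemma sum_cis_roots:
  assumes "\<bar>d\<bar> < int M"
  shows "(\<Sum>m<M. cis (2 * pi * of_int d * of_nat m / of_nat M)) = (if d = 0 then of_nat M else 0)"
proof (cases "d = 0")
  case False
  define z where "z = cis (2 * pi * of_int d / of_nat M)"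
  have M: "0 < M" using assms by auto
  have "z \<noteq> 1"
  proof
    assume "z = 1"
    then have "cos (2 * pi * of_int d / of_nat M) = 1" by (simp add: z_def complex_eq_iff)
    then obtain n :: int where n: "2 * pi * of_int d / of_nat M = n * 2 * pi"
      by (auto simp: cos_one_2pi_int)
    then have "real_of_int d = of_int n * of_nat M"
      using M by (simp add: field_simps)
    then have "real_of_int d = real_of_int (n * int M)" by simp
    then have "d = n * int M" by linarith
    with assms False show False
      by (metis abs_mult abs_of_nat dvd_imp_le_int dvd_triv_right linorder_not_le)
  qed
  moreover have "z ^ M = 1"
  proof -
    have "z ^ M = cis (2 * pi * of_int d)"
      unfolding z_def Complex.DeMoivre using M by simp
    then show ?thesis using cis_multiple_2pi[of "of_int d"] by simp
  qed
  moreover have "(\<Sum>m<M. cis (2 * pi * of_int d * of_nat m / of_nat M)) = (\<Sum>m<M. z ^ m)"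
    unfolding z_def Complex.DeMoivre by (simp add: mult_ac)
  ultimately show ?thesis
    using False by (simp add: geometric_sum)
qed simp

text \<open>A discrete Fourier transform with \<open>Suc N\<close> nodes per axis. Two frequencies
  in \<open>freqs N\<close> differ by at most N in each coordinate, so distinct ones stay distinct
  modulo \<open>Suc N\<close>.\<close>

lemma interpolation_weights:
  assumes L: "0 < L"
  obtains S :: "('n::finite \<Rightarrow> nat) set" and P :: "('n \<Rightarrow> nat) \<Rightarrow> real^'n" and W
  where "finite S" "\<And>k l. k \<in> freqs N \<Longrightarrow> l \<in> freqs N \<Longrightarrow>
      (\<Sum>s\<in>S. W k s * fmode L l (P s)) = (if k = l then 1 else (0::complex))"
proof -
  define M where "M = Suc N"
  define S where "S = PiE (UNIV :: 'n set) (\<lambda>_. {..<M})"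
  define P where "P s = (\<chi> j. 2 * L * real (s j) / real M)" for s :: "'n \<Rightarrow> nat"
  define W where "W k s = cnj (fmode L k (P s)) / of_nat M ^ CARD('n)" for k :: "'n \<Rightarrow> int" and s
  have "(\<Sum>s\<in>S. W k s * fmode L l (P s)) = (if k = l then 1 else 0)"
    if k: "k \<in> freqs N" and l: "l \<in> freqs N" for k l
  proof -
    have d: "\<bar>l j - k j\<bar> < int M" for j
    proof -
      have "- (real N / 2) \<le> real_of_int (k j)" "real_of_int (k j) \<le> real N / 2"
        "- (real N / 2) \<le> real_of_int (l j)" "real_of_int (l j) \<le> real N / 2"
        using k l by (auto simp: freqs_def)
      then have "\<bar>real_of_int (l j) - real_of_int (k j)\<bar> \<le> real N" by linarith
      then have "\<bar>l j - k j\<bar> \<le> int N" by linarith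
      then show ?thesis by (simp add: M_def)
    qed
    have "(\<Sum>s\<in>S. W k s * fmode L l (P s))
        = (\<Sum>s\<in>S. \<Prod>j\<in>UNIV. cis (2 * pi * of_int (l j - k j) * of_nat (s j) / of_nat M)) / of_nat M ^ CARD('n)"
      unfolding sum_divide_distrib
    proof (rule sum.cong)
      fix s
      have "cnj (fmode L k (P s)) * fmode L l (P s) = fmode L (\<lambda>j. l j - k j) (P s)"
        by (simp add: cnj_fmode fmode_mult)
      also have "\<dots> = cis (\<Sum>j\<in>UNIV. 2 * pi * of_int (l j - k j) * of_nat (s j) / of_nat M)"
        unfolding fmode_def sum_distrib_left P_def
        by (rule arg_cong[where f = cis], rule sum.cong) (use L in auto)
      finally show "W k s * fmode L l (P s)
          = (\<Prod>j\<in>UNIV. cis (2 * pi * of_int (l j - k j) * of_nat (s j) / of_nat M)) / of_nat M ^ CARD('n)"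
        by (simp only: W_def times_divide_eq_left cis_sum)
    qed simp
    also have "\<dots> = (\<Prod>j\<in>UNIV. \<Sum>m<M. cis (2 * pi * of_int (l j - k j) * of_nat m / of_nat M)) / of_nat M ^ CARD('n)"
      unfolding S_def by (subst prod_sum_PiE) auto
    also have "\<dots> = (\<Prod>j\<in>UNIV. if l j - k j = 0 then of_nat M else 0) / of_nat M ^ CARD('n)"
      by (simp only: sum_cis_roots[OF d])
    also have "\<dots> = (if k = l then 1 else 0)"
    proof (cases "k = l")
      case False
      then obtain j where "k j \<noteq> l j" by auto
      then have "l j - k j \<noteq> 0" by simp
      then have "(\<Prod>j\<in>UNIV. if l j - k j = 0 then of_nat M else (0::complex)) = 0"
        by (intro prod_zero) auto
      with False show ?thesis by simp
    next
      case True
      have "complex_of_nat M \<noteq> 0" unfolding M_def by (rule of_nat_neq_0)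
      with True show ?thesis by simp
    qed
    finally show ?thesis .
  qed
  moreover have "finite S" unfolding S_def by (rule finite_PiE) auto
  ultimately show ?thesis using that by blast
qed

section \<open>Polar coordinates\<close>

lemma orthogonal_transformation_borel:
  "orthogonal_transformation T \<Longrightarrow> T \<in> borel_measurable borel"
  for T :: "'a::euclidean_space \<Rightarrow> 'a"
  by (intro borel_measurable_continuous_onI linear_continuous_on)
     (simp add: linear_conv_bounded_linear[symmetric] orthogonal_transformation_linear)

text \<open>Both measures are translation invariant, so integrating \<open>indicator A (T x + y)\<close> over
  \<open>y\<close> in the unit ball in either order shows that they agree up to the factor given by the ball,
  which is \<open>1\<close>. The library version needs a well-ordered index type.\<close>
lemma nn_integral_orthogonal:
  fixes T :: "'a::euclidean_space \<Rightarrow> 'a"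
  assumes T: "orthogonal_transformation T" and f[measurable]: "f \<in> borel_measurable borel"
  shows "(\<integral>\<^sup>+x. f (T x) \<partial>lborel) = (\<integral>\<^sup>+x. f x \<partial>lborel)"
proof -
  note [measurable] = orthogonal_transformation_borel[OF T]
  have lin: "T (x + y) = T x + T y" for x y
    using T by (simp add: orthogonal_transformation_linear linear_add)
  define B where "B = (ball 0 1 :: 'a set)"
  have B[measurable]: "B \<in> sets borel" by (simp add: B_def)
  have "distr lborel borel T = lborel"
  proof (rule measure_eqI)
    fix A assume "A \<in> sets (distr lborel borel T)"
    then have A[measurable]: "A \<in> sets borel" by simp
    have "emeasure (distr lborel borel T) A = (\<integral>\<^sup>+x. indicator A (T x) \<partial>lborel)"
    proof -
      have "emeasure (distr lborel borel T) A = (\<integral>\<^sup>+x. indicator A x \<partial>distr lborel borel T)" by simp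
      also have "\<dots> = (\<integral>\<^sup>+x. indicator A (T x) \<partial>lborel)" by (rule nn_integral_distr) auto
      finally show ?thesis .
    qed
    then have "emeasure (distr lborel borel T) A * emeasure lborel B
       = (\<integral>\<^sup>+y. (\<integral>\<^sup>+x. indicator A (T x) \<partial>lborel) * indicator B y \<partial>lborel)"
      by (simp add: nn_integral_cmult_indicator)
    also have "\<dots> = (\<integral>\<^sup>+y. \<integral>\<^sup>+x. indicator A (T x + y) * indicator B y \<partial>lborel \<partial>lborel)"
    proof (rule nn_integral_cong)
      fix y
      obtain z where z: "T z = y"
        using orthogonal_transformation_surj[OF T] by (metis surjD)
      have "(\<integral>\<^sup>+x. indicator A (T x) \<partial>lborel) = (\<integral>\<^sup>+x. indicator A (T (x + z)) \<partial>lborel)"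
        by (subst nn_integral_translate[of "\<lambda>x. indicator A (T x)"]) auto
      then show "(\<integral>\<^sup>+x. indicator A (T x) \<partial>lborel) * indicator B y
          = (\<integral>\<^sup>+x. indicator A (T x + y) * indicator B y \<partial>lborel)"
        by (simp add: lin z nn_integral_multc)
    qed
    also have "\<dots> = (\<integral>\<^sup>+x. \<integral>\<^sup>+y. indicator A (T x + y) * indicator B y \<partial>lborel \<partial>lborel)"
      by (rule lborel_pair.Fubini') measurable
    also have "\<dots> = (\<integral>\<^sup>+x. \<integral>\<^sup>+y. indicator A y * indicator B (y - T x) \<partial>lborel \<partial>lborel)"
    proof (rule nn_integral_cong)
      fix x
      show "(\<integral>\<^sup>+y. indicator A (T x + y) * indicator B y \<partial>lborel)
          = (\<integral>\<^sup>+y. indicator A y * indicator B (y - T x) \<partial>lborel)"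
        using nn_integral_translate[of "\<lambda>y. indicator A y * indicator B (y - T x)" "T x"]
        by (simp add: add.commute)
    qed
    also have "\<dots> = (\<integral>\<^sup>+y. \<integral>\<^sup>+x. indicator A y * indicator B (y - T x) \<partial>lborel \<partial>lborel)"
      by (rule lborel_pair.Fubini') measurable
    also have "\<dots> = (\<integral>\<^sup>+y. indicator A y * emeasure lborel B \<partial>lborel)"
    proof (rule nn_integral_cong)
      fix y
      obtain z where z: "T z = y"
        using orthogonal_transformation_surj[OF T] by (metis surjD)
      have "norm (y - T x) = norm (x + - z)" for x
      proof -
        have "y - T x = T (z - x)"
          using z T by (simp add: orthogonal_transformation_linear linear_diff)
        then show ?thesis
          using orthogonal_transformation_norm[OF T, of "z - x"] by (simp add: norm_minus_commute)
      qed
      then have "(\<integral>\<^sup>+x. indicator B (y - T x) \<partial>lborel) = (\<integral>\<^sup>+x. indicator B (x + - z) \<partial>lborel)"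
        by (intro nn_integral_cong) (simp add: B_def indicator_def)
      also have "\<dots> = emeasure lborel B"
        using nn_integral_translate[of "indicator B" "- z"] by simp
      finally show "(\<integral>\<^sup>+x. indicator A y * indicator B (y - T x) \<partial>lborel)
          = indicator A y * emeasure lborel B"
        by (simp add: nn_integral_cmult)
    qed
    also have "\<dots> = emeasure lborel A * emeasure lborel B"
      by (simp add: nn_integral_multc)
    finally have "emeasure lborel B * emeasure (distr lborel borel T) A
        = emeasure lborel B * emeasure lborel A" by (simp add: mult.commute)
    moreover have "emeasure lborel B \<noteq> 0" "emeasure lborel B \<noteq> \<infinity>"
      using content_ball_pos[of 1 "0::'a"] emeasure_bounded_finite[of B]
      by (auto simp: measure_def B_def)
    ultimately show "emeasure (distr lborel borel T) A = emeasure lborel A"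
      by (simp add: ennreal_mult_cancel_left)
  qed simp
  then have "(\<integral>\<^sup>+x. f x \<partial>lborel) = (\<integral>\<^sup>+x. f x \<partial>distr lborel borel T)" by simp
  also have "\<dots> = (\<integral>\<^sup>+x. f (T x) \<partial>lborel)" by (rule nn_integral_distr) auto
  finally show ?thesis by simp
qed

lemma nn_integral_dilate:
  fixes f :: "'a::euclidean_space \<Rightarrow> ennreal"
  assumes c: "0 < c" and f[measurable]: "f \<in> borel_measurable borel"
  shows "(\<integral>\<^sup>+x. f x \<partial>lborel) = ennreal (c ^ DIM('a)) * (\<integral>\<^sup>+x. f (c *\<^sub>R x) \<partial>lborel)"
proof -
  have "(\<integral>\<^sup>+x. f x \<partial>lborel)
      = (\<integral>\<^sup>+x. f x \<partial>density (distr lborel borel (\<lambda>x. 0 + c *\<^sub>R x)) (\<lambda>_. \<bar>c\<bar> ^ DIM('a)))"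
    using c by (subst lborel_affine[of c 0]) auto
  also have "\<dots> = ennreal (c ^ DIM('a)) * (\<integral>\<^sup>+x. f (c *\<^sub>R x) \<partial>lborel)"
    using c by (simp add: nn_integral_density nn_integral_distr nn_integral_cmult)
  finally show ?thesis .
qed

section \<open>The surface measure: finiteness, support, rotation invariance\<close>

abbreviation direction :: "'a::euclidean_space \<Rightarrow> 'a" where
  "direction x \<equiv> x /\<^sub>R norm x"

lemma sets_sphere_measure [measurable_cong, simp]: "sets sphere_measure = sets borel"
  by (simp add: sphere_measure_def)

lemma space_sphere_measure [simp]: "space sphere_measure = UNIV"
  by (simp add: sphere_measure_def)

lemma indicator_ball_measurable [measurable]:
  "(indicator (ball a r) :: 'a::euclidean_space \<Rightarrow> ennreal) \<in> borel_measurable borel"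
  by (intro borel_measurable_indicator borel_open open_ball)

lemma nn_integral_sphere:
  fixes f :: "'a::euclidean_space \<Rightarrow> ennreal"
  assumes f[measurable]: "f \<in> borel_measurable borel"
  shows "(\<integral>\<^sup>+\<sigma>. f \<sigma> \<partial>sphere_measure)
       = of_nat DIM('a) * (\<integral>\<^sup>+x. f (direction x) * indicator (ball 0 1) x \<partial>lborel)"
proof -
  have m: "(\<lambda>x. direction x) \<in> measurable (restrict_space lborel (ball 0 1)) (borel :: 'a measure)"
    by (intro measurable_restrict_space1) measurable
  have "(\<integral>\<^sup>+\<sigma>. f \<sigma> \<partial>sphere_measure)
      = (\<integral>\<^sup>+x. f (direction x) \<partial>density (restrict_space lborel (ball 0 1)) (\<lambda>_. ennreal (real DIM('a))))"
    unfolding sphere_measure_def by (rule nn_integral_distr) (use m in auto)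
  also have "\<dots> = (\<integral>\<^sup>+x. of_nat DIM('a) * f (direction x) \<partial>restrict_space lborel (ball 0 1))"
    using m by (subst nn_integral_density) (auto intro: measurable_compose[OF m f] simp: ennreal_of_nat_eq_real_of_nat)
  also have "\<dots> = (\<integral>\<^sup>+x. of_nat DIM('a) * f (direction x) * indicator (ball 0 1) x \<partial>lborel)"
    by (subst nn_integral_restrict_space) auto
  also have "\<dots> = of_nat DIM('a) * (\<integral>\<^sup>+x. f (direction x) * indicator (ball 0 1) x \<partial>lborel)"
    unfolding mult.assoc by (rule nn_integral_cmult) measurable
  finally show ?thesis .
qed

lemma emeasure_sphere:
  fixes A :: "'a::euclidean_space set"
  assumes A[measurable]: "A \<in> sets borel"
  shows "emeasure sphere_measure A
       = of_nat DIM('a) * (\<integral>\<^sup>+x. indicator A (direction x) * indicator (ball 0 1) x \<partial>lborel)"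
  using nn_integral_sphere[of "indicator A"] by simp

lemma emeasure_sphere_UNIV:
  "emeasure sphere_measure (UNIV :: 'a::euclidean_space set) = of_nat DIM('a) * emeasure lborel (ball 0 1 :: 'a set)"
  by (subst emeasure_sphere) auto

lemma finite_sphere_measure: "finite_measure (sphere_measure :: 'a::euclidean_space measure)"
  by (rule finite_measureI)
     (use emeasure_bounded_finite[of "ball 0 1 :: 'a set"] in
      \<open>auto simp: emeasure_sphere_UNIV ennreal_mult_eq_top_iff\<close>)

lemma sphere_measure_UNIV_pos: "emeasure sphere_measure (UNIV :: 'a::euclidean_space set) \<noteq> 0"
  using content_ball_pos[of 1 "0::'a"] by (auto simp: emeasure_sphere_UNIV measure_def)

text \<open>\<open>sphere_measure\<close> is a measure on the whole space. The origin is the only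
  point of the ball whose \<open>direction\<close> is not a unit vector, and it is a null
  set.\<close>

lemma AE_sphere_norm: "AE \<sigma> in sphere_measure. norm (\<sigma> :: 'a::euclidean_space) = 1"
proof (rule AE_I'[where N = "{\<sigma>. norm \<sigma> \<noteq> 1}"])
  have [measurable]: "{\<sigma> :: 'a. norm \<sigma> \<noteq> 1} \<in> sets borel" by measurable
  have "(\<integral>\<^sup>+x. indicator {\<sigma> :: 'a. norm \<sigma> \<noteq> 1} (direction x) * indicator (ball 0 1) x \<partial>lborel)
      = (\<integral>\<^sup>+(x::'a). 0 \<partial>lborel)"
  proof (rule nn_integral_cong_AE)
    have "AE x in lborel. x \<noteq> (0::'a)"
      by (rule AE_I'[where N = "{0}"]) auto
    then show "AE x in lborel. indicator {\<sigma> :: 'a. norm \<sigma> \<noteq> 1} (direction x) * indicator (ball 0 1) x = (0::ennreal)"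
      by eventually_elim simp
  qed
  then show "{\<sigma> :: 'a. norm \<sigma> \<noteq> 1} \<in> null_sets sphere_measure"
    by (simp add: null_sets_def emeasure_sphere)
qed auto

lemma nn_integral_sphere_orthogonal:
  fixes T :: "'a::euclidean_space \<Rightarrow> 'a"
  assumes T: "orthogonal_transformation T" and f[measurable]: "f \<in> borel_measurable borel"
  shows "(\<integral>\<^sup>+\<sigma>. f (T \<sigma>) \<partial>sphere_measure) = (\<integral>\<^sup>+\<sigma>. f \<sigma> \<partial>sphere_measure)"
proof -
  note [measurable] = orthogonal_transformation_borel[OF T]
  have "T (direction x) = direction (T x)" for x
    using T by (simp add: orthogonal_transformation_linear linear_scale orthogonal_transformation_norm)
  moreover have "T x \<in> ball 0 1 \<longleftrightarrow> x \<in> ball 0 1" for x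
    using T by (simp add: orthogonal_transformation_norm)
  moreover have m: "(\<lambda>x. f (direction x) * indicator (ball 0 1) x) \<in> borel_measurable borel"
    by measurable
  ultimately show ?thesis
    using nn_integral_orthogonal[OF T, of "\<lambda>x. f (direction x) * indicator (ball 0 1) x"] m
    by (simp add: nn_integral_sphere indicator_def del: mem_ball)
qed

text \<open>This is r^(d-1) dr, obtained as the law of the norm divided by the area of the sphere.
  In this form polar coordinates are an identity of product measures, and no Jacobian has to be
  computed.\<close>

definition radial_measure :: "'a::euclidean_space itself \<Rightarrow> real measure" where
  "radial_measure _ = density (distr lborel borel (norm :: 'a::euclidean_space \<Rightarrow> real))
     (\<lambda>_. inverse (emeasure sphere_measure (UNIV :: 'a set)))"

lemma sets_radial_measure [measurable_cong, simp]: "sets (radial_measure TYPE('a::euclidean_space)) = sets borel"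
  by (simp add: radial_measure_def)

lemma nn_integral_radial:
  assumes f[measurable]: "f \<in> borel_measurable borel"
  shows "(\<integral>\<^sup>+r. f r \<partial>radial_measure TYPE('a::euclidean_space))
    = inverse (emeasure sphere_measure (UNIV :: 'a set)) * (\<integral>\<^sup>+(x::'a). f (norm x) \<partial>lborel)"
  by (simp add: radial_measure_def nn_integral_density nn_integral_distr nn_integral_cmult)

lemma emeasure_radial:
  assumes A[measurable]: "A \<in> sets borel"
  shows "emeasure (radial_measure TYPE('a::euclidean_space)) A
    = inverse (emeasure sphere_measure (UNIV :: 'a set)) * (\<integral>\<^sup>+(x::'a). indicator A (norm x) \<partial>lborel)"
  using nn_integral_radial[of "indicator A", where 'a = 'a] by simp

lemma sigma_finite_radial: "sigma_finite_measure (radial_measure TYPE('a::euclidean_space))"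
proof
  let ?A = "range (\<lambda>n::nat. {..real n})"
  have "emeasure (radial_measure TYPE('a)) {..real n} \<noteq> \<infinity>" for n
  proof -
    have "(\<integral>\<^sup>+(x::'a). indicator {..real n} (norm x) \<partial>lborel) = (\<integral>\<^sup>+(x::'a). indicator (cball 0 (real n)) x \<partial>lborel)"
      by (intro nn_integral_cong) (simp add: indicator_def)
    then show ?thesis
      using emeasure_bounded_finite[of "cball 0 (real n) :: 'a set"] sphere_measure_UNIV_pos[where 'a = 'a]
      by (auto simp: emeasure_radial ennreal_mult_eq_top_iff)
  qed
  then show "\<exists>A. countable A \<and> A \<subseteq> sets (radial_measure TYPE('a)) \<and> \<Union> A = space (radial_measure TYPE('a)) \<and>
      (\<forall>a\<in>A. emeasure (radial_measure TYPE('a)) a \<noteq> \<infinity>)"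
    by (intro exI[of _ ?A]) (auto simp: radial_measure_def intro: real_arch_simple)
qed

text \<open>The volume of a truncated cone scales like the power d of its height, and at height 1 it
  defines \<open>sphere_measure\<close>.\<close>

lemma nn_integral_cone:
  fixes B :: "'a::euclidean_space set"
  assumes a: "0 < a" and B[measurable]: "B \<in> sets borel"
  shows "of_nat DIM('a) * (\<integral>\<^sup>+x. indicator {..<a} (norm x) * indicator B (direction x) \<partial>lborel)
    = ennreal (a ^ DIM('a)) * emeasure sphere_measure B"
proof -
  have "(\<integral>\<^sup>+x. indicator {..<a} (norm x) * indicator B (direction x) \<partial>lborel)
      = ennreal (a ^ DIM('a)) * (\<integral>\<^sup>+x. indicator {..<a} (norm (a *\<^sub>R x)) * indicator B (direction (a *\<^sub>R x)) \<partial>(lborel :: 'a measure))"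
    by (rule nn_integral_dilate) (use a in auto)
  also have "(\<integral>\<^sup>+x. indicator {..<a} (norm (a *\<^sub>R x)) * indicator B (direction (a *\<^sub>R x)) \<partial>(lborel :: 'a measure))
     = (\<integral>\<^sup>+x. indicator B (direction x) * indicator (ball 0 1) x \<partial>lborel)"
  proof (rule nn_integral_cong)
    fix x :: 'a
    have "direction (a *\<^sub>R x) = direction x" using a by simp
    then show "indicator {..<a} (norm (a *\<^sub>R x)) * indicator B (direction (a *\<^sub>R x))
        = (indicator B (direction x) * indicator (ball 0 1) x :: ennreal)"
      using a by (simp only:) (simp add: indicator_def)
  qed
  finally show ?thesis
    by (simp add: emeasure_sphere mult_ac)
qed

text \<open>For fixed \<open>B\<close> both sides are measures in \<open>A\<close>. The intervals
  \<open>{..<a}\<close> generate, and there the cone formula applies to \<open>B\<close> as well as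
  to the whole sphere.\<close>

lemma emeasure_radial_times_sphere:
  fixes B :: "'a::euclidean_space set"
  assumes A[measurable]: "A \<in> sets borel" and B[measurable]: "B \<in> sets borel"
  shows "emeasure (radial_measure TYPE('a)) A * emeasure sphere_measure B
    = (\<integral>\<^sup>+x. indicator A (norm x) * indicator B (direction x) \<partial>lborel)"
proof -
  define s where "s = emeasure sphere_measure (UNIV :: 'a set)"
  have s: "s \<noteq> 0" "s \<noteq> \<infinity>"
    using sphere_measure_UNIV_pos[where 'a = 'a] finite_measure.emeasure_finite[OF finite_sphere_measure, of UNIV]
    by (auto simp: s_def)
  have d: "(of_nat DIM('a) :: ennreal) \<noteq> 0" "(of_nat DIM('a) :: ennreal) \<noteq> \<infinity>"
    by auto
  define M1 where "M1 = distr (density lborel (\<lambda>x. indicator B (direction x))) borel (norm :: 'a \<Rightarrow> real)"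
  define M2 where "M2 = density (radial_measure TYPE('a)) (\<lambda>_. emeasure sphere_measure B)"
  have M1: "emeasure M1 X = (\<integral>\<^sup>+x. indicator X (norm x) * indicator B (direction x) \<partial>lborel)"
    if [measurable]: "X \<in> sets borel" for X
  proof -
    have "emeasure M1 X = (\<integral>\<^sup>+r. indicator X r \<partial>M1)" by (simp add: M1_def)
    also have "\<dots> = (\<integral>\<^sup>+x. indicator X (norm x) \<partial>density lborel (\<lambda>x. indicator B (direction x)))"
      unfolding M1_def by (rule nn_integral_distr) auto
    also have "\<dots> = (\<integral>\<^sup>+x. indicator X (norm x) * indicator B (direction x) \<partial>lborel)"
      by (subst nn_integral_density) (auto simp: mult.commute)
    finally show ?thesis .
  qed
  have M2: "emeasure M2 X = emeasure sphere_measure B * emeasure (radial_measure TYPE('a)) X"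
    if "X \<in> sets borel" for X
    using that by (simp add: M2_def emeasure_density nn_integral_cmult)
  have lt: "emeasure M1 {..<a} = emeasure M2 {..<a}" for a
  proof (cases "0 < a")
    case True
    have "of_nat DIM('a) * emeasure M1 {..<a} = ennreal (a ^ DIM('a)) * emeasure sphere_measure B"
      using nn_integral_cone[OF True B] by (simp add: M1)
    moreover have "of_nat DIM('a) * emeasure (radial_measure TYPE('a)) {..<a} = ennreal (a ^ DIM('a))"
    proof -
      have "of_nat DIM('a) * (\<integral>\<^sup>+(x::'a). indicator {..<a} (norm x) \<partial>lborel) = ennreal (a ^ DIM('a)) * s"
        using nn_integral_cone[OF True, of "UNIV :: 'a set"] by (simp add: s_def)
      then have "of_nat DIM('a) * emeasure (radial_measure TYPE('a)) {..<a} = inverse s * (ennreal (a ^ DIM('a)) * s)"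
        by (simp add: emeasure_radial s_def[symmetric] mult.left_commute)
      also have "\<dots> = ennreal (a ^ DIM('a)) * (s * inverse s)" by (simp add: mult_ac)
      finally show ?thesis using s by (simp add: ennreal_divide_self less_top flip: divide_ennreal_def)
    qed
    ultimately have "of_nat DIM('a) * emeasure M1 {..<a} = of_nat DIM('a) * emeasure M2 {..<a}"
      by (simp add: M2) (metis mult.assoc mult.commute)
    then show ?thesis using d by (simp add: ennreal_mult_cancel_left)
  next
    case False
    then have "indicator {..<a} (norm x) = (0::ennreal)" for x :: 'a
      by (auto simp: indicator_def) (meson norm_ge_zero order_le_less_trans)
    then show ?thesis by (simp add: M1 M2 emeasure_radial)
  qed
  have "M1 = M2"
  proof (rule measure_eqI_generator_eq[where E = "range lessThan" and \<Omega> = UNIV and A = "\<lambda>i. {..<real i}"])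
    show "Int_stable (range (lessThan :: real \<Rightarrow> _))"
    proof -
      have "{..<x} \<inter> {..<y} = {..<min x y}" for x y :: real by auto
      then show ?thesis by (auto simp: Int_stable_def)
    qed
    show "sets M1 = sigma_sets UNIV (range lessThan)" "sets M2 = sigma_sets UNIV (range lessThan)"
      by (simp_all add: M1_def M2_def borel_Iio)
    show "(\<Union>i. {..<real i}) = UNIV" using reals_Archimedean2 by auto
    show "emeasure M1 {..<real i} \<noteq> \<infinity>" for i
    proof -
      have "emeasure M1 {..<real i} \<le> (\<integral>\<^sup>+x. indicator (ball 0 (real i)) x \<partial>(lborel :: 'a measure))"
        by (subst M1, simp, intro nn_integral_mono) (simp add: indicator_def)
      also have "\<dots> < \<infinity>" using emeasure_bounded_finite[of "ball 0 (real i) :: 'a set"] by simp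
      finally show ?thesis by simp
    qed
  qed (use lt in auto)
  then show ?thesis using M1[OF A] M2[OF A] by (simp add: mult.commute)
qed

lemma nn_integral_polar:
  fixes f :: "real \<times> 'a::euclidean_space \<Rightarrow> ennreal"
  assumes f: "f \<in> borel_measurable (borel \<Otimes>\<^sub>M borel)"
  shows "(\<integral>\<^sup>+x. f (norm x, direction x) \<partial>lborel)
    = (\<integral>\<^sup>+r. \<integral>\<^sup>+\<sigma>. f (r, \<sigma>) \<partial>sphere_measure \<partial>radial_measure TYPE('a))"
proof -
  interpret S: finite_measure "sphere_measure :: 'a measure" by (rule finite_sphere_measure)
  have m: "(\<lambda>x. (norm x, direction x)) \<in> measurable lborel (borel \<Otimes>\<^sub>M (borel :: 'a measure))"
    by measurable
  have eq: "radial_measure TYPE('a) \<Otimes>\<^sub>M sphere_measure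
      = distr lborel (borel \<Otimes>\<^sub>M (borel :: 'a measure)) (\<lambda>x. (norm x, direction x))"
  proof (rule pair_measure_eqI)
    show "sigma_finite_measure (radial_measure TYPE('a))" by (rule sigma_finite_radial)
    show "sigma_finite_measure (sphere_measure :: 'a measure)" ..
    show "sets (radial_measure TYPE('a) \<Otimes>\<^sub>M sphere_measure)
        = sets (distr lborel (borel \<Otimes>\<^sub>M (borel :: 'a measure)) (\<lambda>x. (norm x, direction x)))"
      by (simp cong: sets_pair_measure_cong)
    fix A and B :: "'a set" assume "A \<in> sets (radial_measure TYPE('a))" "B \<in> sets sphere_measure"
    then have [measurable]: "A \<in> sets borel" "B \<in> sets borel" by auto
    have "emeasure (distr lborel (borel \<Otimes>\<^sub>M (borel :: 'a measure)) (\<lambda>x. (norm x, direction x))) (A \<times> B)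
       = (\<integral>\<^sup>+z. indicator (A \<times> B) z \<partial>distr lborel (borel \<Otimes>\<^sub>M (borel :: 'a measure)) (\<lambda>x. (norm x, direction x)))"
      by simp
    also have "\<dots> = (\<integral>\<^sup>+x. indicator (A \<times> B) (norm x, direction x) \<partial>lborel)"
      by (rule nn_integral_distr[OF m]) auto
    also have "\<dots> = (\<integral>\<^sup>+x. indicator A (norm x) * indicator B (direction x) \<partial>lborel)"
      by (simp add: indicator_times)
    finally show "emeasure (radial_measure TYPE('a)) A * emeasure sphere_measure B
      = emeasure (distr lborel (borel \<Otimes>\<^sub>M (borel :: 'a measure)) (\<lambda>x. (norm x, direction x))) (A \<times> B)"
      by (simp add: emeasure_radial_times_sphere)
  qed
  have fm: "f \<in> borel_measurable (radial_measure TYPE('a) \<Otimes>\<^sub>M sphere_measure)"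
    using f by (simp add: eq)
  have "(\<integral>\<^sup>+x. f (norm x, direction x) \<partial>lborel)
     = (\<integral>\<^sup>+z. f z \<partial>distr lborel (borel \<Otimes>\<^sub>M (borel :: 'a measure)) (\<lambda>x. (norm x, direction x)))"
    by (rule nn_integral_distr[OF m, symmetric]) (use f in simp)
  also have "\<dots> = (\<integral>\<^sup>+z. f z \<partial>(radial_measure TYPE('a) \<Otimes>\<^sub>M sphere_measure))"
    by (simp add: eq)
  also have "\<dots> = (\<integral>\<^sup>+r. \<integral>\<^sup>+\<sigma>. f (r, \<sigma>) \<partial>sphere_measure \<partial>radial_measure TYPE('a))"
    by (rule S.nn_integral_fst[OF fm, symmetric])
  finally show ?thesis .
qed

section \<open>The collision kernel as a measure\<close>

text \<open>The cone over the cap, cut off at radius 1, is open and contains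
  \<open>(1 / 2) *\<^sub>R e\<close>; a ball inside it gives positivity without computing the area
  of the cap.\<close>

lemma sphere_cap_pos:
  fixes e :: "'a::euclidean_space"
  assumes e: "norm e = 1" and eps: "0 < \<epsilon>"
  shows "emeasure sphere_measure {\<sigma>. 1 - \<epsilon> < e \<bullet> \<sigma>} \<noteq> 0"
proof -
  define U where "U = {x. (1 - \<epsilon>) * norm x < e \<bullet> x} \<inter> ball 0 1"
  have "open U"
    unfolding U_def by (intro open_Int open_Collect_less continuous_intros open_ball)
  moreover have "(1 / 2) *\<^sub>R e \<in> U"
    using e eps by (simp add: U_def dot_square_norm)
  ultimately obtain r where r: "0 < r" "ball ((1 / 2) *\<^sub>R e) r \<subseteq> U"
    by (meson open_contains_ball)
  have [measurable]: "{\<sigma>. 1 - \<epsilon> < e \<bullet> \<sigma>} \<in> sets borel" by measurable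
  have "emeasure lborel (ball ((1 / 2) *\<^sub>R e) r) = (\<integral>\<^sup>+x. indicator (ball ((1 / 2) *\<^sub>R e) r) x \<partial>lborel)"
    by simp
  also have "\<dots> \<le> (\<integral>\<^sup>+x. indicator {\<sigma>. 1 - \<epsilon> < e \<bullet> \<sigma>} (direction x) * indicator (ball 0 1) x \<partial>lborel)"
  proof (rule nn_integral_mono)
    fix x
    have "1 - \<epsilon> < e \<bullet> direction x" "x \<in> ball 0 1" if "x \<in> U"
    proof -
      have "x \<noteq> 0" using that by (auto simp: U_def)
      then show "1 - \<epsilon> < e \<bullet> direction x"
        using that by (simp add: U_def field_simps)
      show "x \<in> ball 0 1" using that by (simp add: U_def)
    qed
    then show "indicator (ball ((1 / 2) *\<^sub>R e) r) x
        \<le> (indicator {\<sigma>. 1 - \<epsilon> < e \<bullet> \<sigma>} (direction x) * indicator (ball 0 1) x :: ennreal)"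
      using r by (auto split: split_indicator simp del: mem_ball)
  qed
  finally show ?thesis
    using content_ball_pos[OF r(1), of "(1 / 2) *\<^sub>R e"]
    by (auto simp: emeasure_sphere measure_def)
qed

lemma ex_orthogonal_unit:
  fixes x e :: "real^'n"
  assumes "norm e = 1"
  obtains T where "orthogonal_transformation T" "x = norm x *\<^sub>R T e"
proof (cases "x = 0")
  case True
  then show ?thesis using that[of id] by (auto simp: orthogonal_transformation_id[unfolded id_def] id_def)
next
  case False
  have "norm e = norm (direction x)" using assms False by simp
  then obtain T where "orthogonal_transformation T" "T e = direction x"
    by (rule orthogonal_transformation_exists)
  then show ?thesis using that[of T] False by simp
qed

text \<open>A thin cap \<open>k x \<sigma>\<close> around the direction of \<open>x\<close> lets \<open>H x\<close> be
  replaced by \<open>H (|x| \<sigma>)\<close>; by invariance the weight of the cap does not depend on its centre.\<close>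
lemma rotation_invariant_average:
  fixes \<mu> :: "(real^'n) measure" and H :: "real^'n \<Rightarrow> real"
  assumes fin: "finite_measure \<mu>" and sets[measurable_cong]: "sets \<mu> = sets borel"
    and inv: "\<And>T f. orthogonal_transformation T \<Longrightarrow> f \<in> borel_measurable borel \<Longrightarrow>
        (\<integral>\<^sup>+x. f (T x) \<partial>\<mu>) = (\<integral>\<^sup>+x. f x \<partial>\<mu>)"
    and supp: "AE x in \<mu>. 0 < norm x \<and> norm x \<le> 1"
    and cont: "continuous_on UNIV H" and pos: "\<And>x. 0 \<le> H x"
  shows "emeasure sphere_measure (UNIV :: (real^'n) set) * (\<integral>\<^sup>+x. H x \<partial>\<mu>)
    \<le> (\<integral>\<^sup>+x. \<integral>\<^sup>+\<sigma>. H (norm x *\<^sub>R \<sigma>) \<partial>sphere_measure \<partial>\<mu>)"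
proof (rule ennreal_le_epsilon)
  fix \<eta>' :: real assume \<eta>': "0 < \<eta>'"
  interpret mu: finite_measure \<mu> by (rule fin)
  interpret S: finite_measure "sphere_measure :: (real^'n) measure" by (rule finite_sphere_measure)
  interpret PS: pair_sigma_finite \<mu> "sphere_measure :: (real^'n) measure" ..
  have [measurable]: "H \<in> borel_measurable borel"
    using cont by (rule borel_measurable_continuous_onI)
  define s where "s = emeasure sphere_measure (UNIV :: (real^'n) set)"
  define m where "m = emeasure \<mu> UNIV"
  have sp: "space \<mu> = UNIV" using sets_eq_imp_space_eq[OF sets] by simp
  have s: "s \<noteq> \<infinity>" using S.emeasure_finite[of UNIV] by (simp add: s_def)
  have m: "m \<noteq> \<infinity>" using mu.emeasure_finite[of UNIV] by (simp add: m_def)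
  \<comment> \<open>Small enough that \<open>s * m * \<eta>\<close> is at most
    \<open>\<eta>'\<close>; the added 1 keeps the denominator positive.\<close>
  define \<eta> where "\<eta> = \<eta>' / (enn2real (s * m) + 1)"
  have \<eta>: "0 < \<eta>" using \<eta>' by (simp add: \<eta>_def add_nonneg_pos)
  have "uniformly_continuous_on (cball 0 1) H"
    by (intro compact_uniformly_continuous continuous_on_subset[OF cont]) auto
  then obtain \<delta> where \<delta>: "0 < \<delta>"
    "\<And>x y. norm x \<le> 1 \<Longrightarrow> norm y \<le> 1 \<Longrightarrow> dist y x < \<delta> \<Longrightarrow> dist (H y) (H x) < \<eta>"
    using \<eta> by (auto simp: uniformly_continuous_on_def dist_norm)
  \<comment> \<open>A unit vector with inner product above 1 - \<epsilon> with the centre of the cap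
    is closer to it than the square root of 2 \<epsilon>, that is \<delta>.\<close>
  define \<epsilon> where "\<epsilon> = \<delta>\<^sup>2 / 2"
  have eps: "0 < \<epsilon>" using \<delta> by (simp add: \<epsilon>_def)
  define e :: "real^'n" where "e = axis undefined 1"
  have e: "norm e = 1" by (simp add: e_def)
  define p where "p = emeasure sphere_measure {\<sigma>. 1 - \<epsilon> < e \<bullet> \<sigma>}"
  have p: "p \<noteq> 0" "p \<noteq> \<infinity>"
    using sphere_cap_pos[OF e eps] S.emeasure_finite by (auto simp: p_def)
  define k :: "real^'n \<Rightarrow> real^'n \<Rightarrow> ennreal" where
    "k x \<sigma> = indicator {z. (1 - \<epsilon>) * norm (fst z) < fst z \<bullet> snd z} (x, \<sigma>)" for x \<sigma>
  have km[measurable]: "case_prod k \<in> borel_measurable (borel \<Otimes>\<^sub>M borel)"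
  proof -
    have "{z :: (real^'n) \<times> (real^'n) \<in> space (borel \<Otimes>\<^sub>M borel). (1 - \<epsilon>) * norm (fst z) < fst z \<bullet> snd z}
        \<in> sets (borel \<Otimes>\<^sub>M borel)"
      by measurable
    then show ?thesis by (simp add: k_def[abs_def] case_prod_beta' space_pair_measure)
  qed
  have kp: "(\<integral>\<^sup>+\<sigma>. k x \<sigma> \<partial>sphere_measure) = p" if "x \<noteq> 0" for x
  proof -
    obtain T where T: "orthogonal_transformation T" "x = norm x *\<^sub>R T e"
      using ex_orthogonal_unit[OF e] by metis
    have "(\<integral>\<^sup>+\<sigma>. k x \<sigma> \<partial>sphere_measure) = (\<integral>\<^sup>+\<sigma>. k x (T \<sigma>) \<partial>sphere_measure)"
      by (rule nn_integral_sphere_orthogonal[OF T(1), symmetric]) measurable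
    also have "\<dots> = (\<integral>\<^sup>+\<sigma>. indicator {\<sigma>. 1 - \<epsilon> < e \<bullet> \<sigma>} \<sigma> \<partial>sphere_measure)"
    proof (rule nn_integral_cong)
      fix \<sigma> :: "real^'n"
      have "x \<bullet> T \<sigma> = norm x * (e \<bullet> \<sigma>)"
        using T by (metis inner_scaleR_left orthogonal_transformation_def)
      then show "k x (T \<sigma>) = indicator {\<sigma>. 1 - \<epsilon> < e \<bullet> \<sigma>} \<sigma>"
        using that by (simp add: k_def indicator_def)
    qed
    finally show ?thesis by (simp add: p_def)
  qed
  \<comment> \<open>By rotation invariance of \<open>\<mu>\<close> the integral is the same for
    every unit vector \<sigma>, so it equals its mean over the sphere; after Fubini the mean
    involves only the weight \<open>p\<close> of a cap.\<close>
  have cap: "s * (\<integral>\<^sup>+x. k x \<sigma> * G (norm x) \<partial>\<mu>) = p * (\<integral>\<^sup>+x. G (norm x) \<partial>\<mu>)"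
    if \<sigma>: "norm \<sigma> = 1" and [measurable]: "G \<in> borel_measurable borel" for \<sigma> and G :: "real \<Rightarrow> ennreal"
  proof -
    define I where "I \<tau> = (\<integral>\<^sup>+x. k x \<tau> * G (norm x) \<partial>\<mu>)" for \<tau>
    have "I \<tau> = I \<sigma>" if "norm \<tau> = 1" for \<tau>
    proof -
      obtain T where T: "orthogonal_transformation T" "\<tau> = T \<sigma>"
        using ex_orthogonal_unit[OF \<sigma>, of \<tau>] \<open>norm \<tau> = 1\<close> by (metis scaleR_one)
      have [measurable]: "T \<in> borel_measurable borel" using T(1) by (intro orthogonal_transformation_borel)
      have "I \<tau> = (\<integral>\<^sup>+x. k (T x) \<tau> * G (norm (T x)) \<partial>\<mu>)"
        unfolding I_def by (rule inv[OF T(1), symmetric]) measurable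
      also have "\<dots> = I \<sigma>"
      proof -
        have "T x \<bullet> T \<sigma> = x \<bullet> \<sigma>" "norm (T x) = norm x" for x
          using T(1) by (auto simp: orthogonal_transformation_def orthogonal_transformation_norm)
        then show ?thesis by (simp add: I_def T(2) k_def indicator_def)
      qed
      finally show ?thesis .
    qed
    then have "(\<integral>\<^sup>+\<tau>. I \<tau> \<partial>sphere_measure) = (\<integral>\<^sup>+\<tau>. I \<sigma> \<partial>(sphere_measure :: (real^'n) measure))"
      by (intro nn_integral_cong_AE) (use AE_sphere_norm in eventually_elim, auto)
    then have "s * I \<sigma> = (\<integral>\<^sup>+\<tau>. I \<tau> \<partial>sphere_measure)" by (simp add: s_def mult.commute)
    also have "\<dots> = (\<integral>\<^sup>+x. \<integral>\<^sup>+\<tau>. k x \<tau> * G (norm x) \<partial>sphere_measure \<partial>\<mu>)"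
      unfolding I_def by (rule PS.Fubini') measurable
    also have "\<dots> = (\<integral>\<^sup>+x. p * G (norm x) \<partial>\<mu>)"
    proof (rule nn_integral_cong_AE)
      show "AE x in \<mu>. (\<integral>\<^sup>+\<tau>. k x \<tau> * G (norm x) \<partial>sphere_measure) = p * G (norm x)"
        using supp by eventually_elim (subst nn_integral_multc, measurable, simp add: kp)
    qed
    also have "\<dots> = p * (\<integral>\<^sup>+x. G (norm x) \<partial>\<mu>)"
      by (rule nn_integral_cmult) measurable
    finally show ?thesis by (simp add: I_def)
  qed
  have "p * (\<integral>\<^sup>+x. H x \<partial>\<mu>) = (\<integral>\<^sup>+x. p * ennreal (H x) \<partial>\<mu>)"
    by (rule nn_integral_cmult[symmetric]) measurable
  also have "\<dots> \<le> (\<integral>\<^sup>+x. (\<integral>\<^sup>+\<sigma>. k x \<sigma> * ennreal (H (norm x *\<^sub>R \<sigma>)) \<partial>sphere_measure) + p * ennreal \<eta> \<partial>\<mu>)"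
  proof (rule nn_integral_mono_AE)
    show "AE x in \<mu>. p * ennreal (H x)
      \<le> (\<integral>\<^sup>+\<sigma>. k x \<sigma> * ennreal (H (norm x *\<^sub>R \<sigma>)) \<partial>sphere_measure) + p * ennreal \<eta>"
      using supp
    proof eventually_elim
      fix x :: "real^'n" assume x: "0 < norm x \<and> norm x \<le> 1"
      have "p * ennreal (H x) = (\<integral>\<^sup>+\<sigma>. k x \<sigma> * ennreal (H x) \<partial>sphere_measure)"
        using x by (subst nn_integral_multc) (measurable, simp add: kp)
      also have "\<dots> \<le> (\<integral>\<^sup>+\<sigma>. k x \<sigma> * ennreal (H (norm x *\<^sub>R \<sigma>)) + k x \<sigma> * ennreal \<eta> \<partial>sphere_measure)"
      proof (rule nn_integral_mono_AE)
        show "AE \<sigma> in sphere_measure. k x \<sigma> * ennreal (H x)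
            \<le> k x \<sigma> * ennreal (H (norm x *\<^sub>R \<sigma>)) + k x \<sigma> * ennreal \<eta>"
          using AE_sphere_norm
        proof eventually_elim
          fix \<sigma> :: "real^'n" assume \<sigma>: "norm \<sigma> = 1"
          have "H x \<le> H (norm x *\<^sub>R \<sigma>) + \<eta>" if k: "(1 - \<epsilon>) * norm x < x \<bullet> \<sigma>"
          proof -
            have "(norm (x - norm x *\<^sub>R \<sigma>))\<^sup>2 = 2 * (norm x)\<^sup>2 - 2 * norm x * (x \<bullet> \<sigma>)"
              using \<sigma> by (simp add: power2_norm_eq_inner inner_diff inner_commute[of \<sigma> x])
                 (simp add: dot_square_norm power2_eq_square right_diff_distrib)
            also have "\<dots> < 2 * (norm x)\<^sup>2 - 2 * norm x * ((1 - \<epsilon>) * norm x)"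
              using k x by simp
            also have "\<dots> = 2 * \<epsilon> * (norm x)\<^sup>2" by (simp add: power2_eq_square algebra_simps)
            also have "\<dots> \<le> 2 * \<epsilon> * 1"
              using x eps by (intro mult_left_mono power_le_one) auto
            finally have "(norm (x - norm x *\<^sub>R \<sigma>))\<^sup>2 < \<delta>\<^sup>2" by (simp add: \<epsilon>_def)
            then have "dist x (norm x *\<^sub>R \<sigma>) < \<delta>"
              using \<delta>(1) power_less_imp_less_base[of "norm (x - norm x *\<^sub>R \<sigma>)" 2 \<delta>] by (simp add: dist_norm)
            with x \<sigma> \<delta>(2)[of "norm x *\<^sub>R \<sigma>" x] show ?thesis
              by (simp add: dist_real_def)
          qed
          then show "k x \<sigma> * ennreal (H x) \<le> k x \<sigma> * ennreal (H (norm x *\<^sub>R \<sigma>)) + k x \<sigma> * ennreal \<eta>"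
            using pos \<eta> by (simp add: k_def indicator_def flip: ennreal_plus)
        qed
      qed
      also have "\<dots> = (\<integral>\<^sup>+\<sigma>. k x \<sigma> * ennreal (H (norm x *\<^sub>R \<sigma>)) \<partial>sphere_measure) + p * ennreal \<eta>"
        using x by (subst nn_integral_add, measurable, subst nn_integral_multc, measurable, simp add: kp)
      finally show "p * ennreal (H x)
        \<le> (\<integral>\<^sup>+\<sigma>. k x \<sigma> * ennreal (H (norm x *\<^sub>R \<sigma>)) \<partial>sphere_measure) + p * ennreal \<eta>" .
    qed
  qed
  also have "\<dots> = (\<integral>\<^sup>+x. \<integral>\<^sup>+\<sigma>. k x \<sigma> * ennreal (H (norm x *\<^sub>R \<sigma>)) \<partial>sphere_measure \<partial>\<mu>) + p * ennreal \<eta> * m"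
    by (subst nn_integral_add) (measurable, simp add: m_def sp)
  also have "(\<integral>\<^sup>+x. \<integral>\<^sup>+\<sigma>. k x \<sigma> * ennreal (H (norm x *\<^sub>R \<sigma>)) \<partial>sphere_measure \<partial>\<mu>)
      = (\<integral>\<^sup>+\<sigma>. \<integral>\<^sup>+x. k x \<sigma> * ennreal (H (norm x *\<^sub>R \<sigma>)) \<partial>\<mu> \<partial>sphere_measure)"
    by (rule PS.Fubini'[symmetric]) measurable
  finally have "s * (p * (\<integral>\<^sup>+x. H x \<partial>\<mu>))
      \<le> s * ((\<integral>\<^sup>+\<sigma>. \<integral>\<^sup>+x. k x \<sigma> * ennreal (H (norm x *\<^sub>R \<sigma>)) \<partial>\<mu> \<partial>sphere_measure) + p * ennreal \<eta> * m)"
    by (rule mult_left_mono) simp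
  also have "\<dots> = (\<integral>\<^sup>+\<sigma>. s * (\<integral>\<^sup>+x. k x \<sigma> * ennreal (H (norm x *\<^sub>R \<sigma>)) \<partial>\<mu>) \<partial>sphere_measure) + s * (p * ennreal \<eta> * m)"
    by (subst nn_integral_cmult) (measurable, simp add: distrib_left)
  \<comment> \<open>With \<sigma> fixed, the integrand is the cap times a function of the norm of x
    alone, so \<open>cap\<close> applies.\<close>
  also have "(\<integral>\<^sup>+\<sigma>. s * (\<integral>\<^sup>+x. k x \<sigma> * ennreal (H (norm x *\<^sub>R \<sigma>)) \<partial>\<mu>) \<partial>sphere_measure)
      = (\<integral>\<^sup>+\<sigma>. p * (\<integral>\<^sup>+x. ennreal (H (norm x *\<^sub>R \<sigma>)) \<partial>\<mu>) \<partial>sphere_measure)"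
  proof (rule nn_integral_cong_AE)
    show "AE \<sigma> in sphere_measure. s * (\<integral>\<^sup>+x. k x \<sigma> * ennreal (H (norm x *\<^sub>R \<sigma>)) \<partial>\<mu>)
        = p * (\<integral>\<^sup>+x. ennreal (H (norm x *\<^sub>R \<sigma>)) \<partial>\<mu>)"
      using AE_sphere_norm
    proof eventually_elim
      fix \<sigma> :: "real^'n" assume "norm \<sigma> = 1"
      from cap[OF this, of "\<lambda>r. ennreal (H (r *\<^sub>R \<sigma>))"]
      show "s * (\<integral>\<^sup>+x. k x \<sigma> * ennreal (H (norm x *\<^sub>R \<sigma>)) \<partial>\<mu>)
        = p * (\<integral>\<^sup>+x. ennreal (H (norm x *\<^sub>R \<sigma>)) \<partial>\<mu>)" by simp
    qed
  qed
  also have "\<dots> = p * (\<integral>\<^sup>+\<sigma>. \<integral>\<^sup>+x. ennreal (H (norm x *\<^sub>R \<sigma>)) \<partial>\<mu> \<partial>sphere_measure)"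
    by (rule nn_integral_cmult) measurable
  also have "(\<integral>\<^sup>+\<sigma>. \<integral>\<^sup>+x. ennreal (H (norm x *\<^sub>R \<sigma>)) \<partial>\<mu> \<partial>sphere_measure)
      = (\<integral>\<^sup>+x. \<integral>\<^sup>+\<sigma>. ennreal (H (norm x *\<^sub>R \<sigma>)) \<partial>sphere_measure \<partial>\<mu>)"
    by (rule PS.Fubini') measurable
  finally have "p * (s * (\<integral>\<^sup>+x. H x \<partial>\<mu>))
      \<le> p * ((\<integral>\<^sup>+x. \<integral>\<^sup>+\<sigma>. ennreal (H (norm x *\<^sub>R \<sigma>)) \<partial>sphere_measure \<partial>\<mu>) + s * m * ennreal \<eta>)"
    by (simp add: distrib_left mult_ac)
  then have "s * (\<integral>\<^sup>+x. H x \<partial>\<mu>)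
      \<le> (\<integral>\<^sup>+x. \<integral>\<^sup>+\<sigma>. ennreal (H (norm x *\<^sub>R \<sigma>)) \<partial>sphere_measure \<partial>\<mu>) + s * m * ennreal \<eta>"
    using p by (simp add: ennreal_mult_le_mult_iff)
  also have "s * m * ennreal \<eta> \<le> ennreal \<eta>'"
  proof -
    have "s * m \<noteq> \<infinity>" using s m by (simp add: ennreal_mult_eq_top_iff)
    then have "s * m = ennreal (enn2real (s * m))" by (simp add: less_top)
    then have "s * m * ennreal \<eta> = ennreal (enn2real (s * m) * \<eta>)"
      using \<eta> by (metis ennreal_mult' enn2real_nonneg)
    also have "enn2real (s * m) * \<eta> \<le> \<eta>'"
    proof -
      define a where "a = enn2real (s * m)"
      have "0 \<le> a" by (simp add: a_def)
      then have "a / (a + 1) \<le> 1" by simp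
      then have "\<eta>' * (a / (a + 1)) \<le> \<eta>' * 1" using \<eta>' by (intro mult_left_mono) auto
      then show ?thesis by (simp add: \<eta>_def a_def mult.commute)
    qed
    finally show ?thesis by (simp add: ennreal_leI)
  qed
  finally show "emeasure sphere_measure (UNIV :: (real^'n) set) * (\<integral>\<^sup>+x. H x \<partial>\<mu>)
    \<le> (\<integral>\<^sup>+x. \<integral>\<^sup>+\<sigma>. H (norm x *\<^sub>R \<sigma>) \<partial>sphere_measure \<partial>\<mu>) + ennreal \<eta>'"
    by (simp add: s_def add_left_mono)
qed

section \<open>Integrals of periodic functions over the truncation ball\<close>

lemma nn_integral_cell_reflect:
  fixes g :: "real^'n \<Rightarrow> ennreal"
  assumes L: "0 < L" and per: "periodic L g" and g[measurable]: "g \<in> borel_measurable borel"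
  shows "(\<integral>\<^sup>+q. g (v - q) * indicator (cell L) q \<partial>lborel) = (\<integral>\<^sup>+q. g q \<partial>cell_measure L)"
proof -
  have T: "orthogonal_transformation (uminus :: real^'n \<Rightarrow> real^'n)"
    by (simp add: orthogonal_transformation_neg[of id, unfolded id_def] orthogonal_transformation_id[unfolded id_def])
  have c: "- q \<in> cell L \<longleftrightarrow> q \<in> cell L" for q :: "real^'n"
    unfolding cell_def mem_Collect_eq by (rule iff_allI) auto
  have "(\<integral>\<^sup>+q. g (v - q) * indicator (cell L) q \<partial>lborel) = (\<integral>\<^sup>+q. g (v - - q) * indicator (cell L) (- q) \<partial>lborel)"
    by (rule nn_integral_orthogonal[OF T, symmetric]) measurable
  also have "\<dots> = (\<integral>\<^sup>+q. g (q + v) * indicator (cell L) q \<partial>lborel)"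
    by (simp add: c indicator_def add.commute)
  also have "\<dots> = (\<integral>\<^sup>+q. g (q + v) \<partial>cell_measure L)"
    unfolding cell_measure_def by (subst nn_integral_restrict_space) auto
  also have "\<dots> = (\<integral>\<^sup>+q. g q \<partial>cell_measure L)"
    by (rule nn_integral_cell_shift[OF L per]) measurable
  finally show ?thesis .
qed

text \<open>The truncation ball fits into one period, so the integral of a periodic function over it
  is bounded by a single cell integral, with no overlap to be counted.\<close>

lemma cball_subset_cell: "R \<le> L \<Longrightarrow> cball 0 R \<subseteq> cell L"
proof
  fix x :: "real^'a" assume "R \<le> L" "x \<in> cball 0 R"
  then have "- L \<le> x $ j \<and> x $ j \<le> L" for j
    using component_le_norm_cart[of x j] unfolding mem_cball_0 by linarith
  then show "x \<in> cell L" by (simp add: cell_def)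
qed

lemma indicator_cball_measurable [measurable]:
  "(indicator (cball a r) :: 'a::euclidean_space \<Rightarrow> ennreal) \<in> borel_measurable borel"
  by (intro borel_measurable_indicator borel_closed closed_cball)

lemma nn_integral_ball_le_cell:
  fixes g :: "real^'n \<Rightarrow> ennreal"
  assumes "0 < L" "R \<le> L" "periodic L g" and [measurable]: "g \<in> borel_measurable borel"
  shows "(\<integral>\<^sup>+q. g (v - q) * indicator (cball 0 R) q \<partial>lborel) \<le> (\<integral>\<^sup>+q. g q \<partial>cell_measure L)"
proof -
  have "(\<integral>\<^sup>+q. g (v - q) * indicator (cball 0 R) q \<partial>lborel) \<le> (\<integral>\<^sup>+q. g (v - q) * indicator (cell L) q \<partial>lborel)"
    using cball_subset_cell[OF assms(2)] by (intro nn_integral_mono) (auto split: split_indicator)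
  then show ?thesis using nn_integral_cell_reflect[OF assms(1,3)] by simp
qed

lemma nn_integral_ball_le_cell':
  fixes g :: "real^'n \<Rightarrow> ennreal"
  assumes "0 < L" "R \<le> L" "periodic L g" and [measurable]: "g \<in> borel_measurable borel"
  shows "(\<integral>\<^sup>+q. g (v + q) * indicator (cball 0 R) q \<partial>lborel) \<le> (\<integral>\<^sup>+q. g q \<partial>cell_measure L)"
proof -
  have "(\<integral>\<^sup>+q. g (v + q) * indicator (cball 0 R) q \<partial>lborel) \<le> (\<integral>\<^sup>+q. g (q + v) \<partial>cell_measure L)"
    unfolding cell_measure_def using cball_subset_cell[OF assms(2)]
    by (subst nn_integral_restrict_space) (auto intro!: nn_integral_mono split: split_indicator simp: add.commute)
  then show ?thesis using nn_integral_cell_shift[OF assms(1,3), of v] by simp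
qed

text \<open>\<open>dim\<close> fixes the velocity space: the other parameters do not mention its
  dimension.\<close>

locale cutoff_kernel =
  fixes R L :: real and \<Phi> b :: "real \<Rightarrow> real" and dim :: "'n::finite itself"
  assumes RL: "0 < R" "R \<le> L"
    and Phi_meas [measurable]: "\<Phi> \<in> borel_measurable borel"
    and Phi_nonneg: "\<forall>r\<ge>0. 0 \<le> \<Phi> r"
    and Phi_bdd: "bdd_above (\<Phi> ` {0..R})"
    and b_meas [measurable]: "b \<in> borel_measurable borel"
    and b_nonneg: "\<forall>s. 0 \<le> b s"
    and b_neg: "\<forall>s<0. b s = 0"
    and b_int: "\<forall>e::real^'n. norm e = 1 \<longrightarrow>
                   (\<integral>\<^sup>+ \<sigma>. ennreal (b (\<sigma> \<bullet> e)) \<partial>sphere_measure) < \<infinity>"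
begin

lemma L_pos: "0 < L" using RL by simp

abbreviation "S \<equiv> sphere_measure :: (real^'n) measure"

sublocale S: finite_measure S by (rule finite_sphere_measure)
sublocale SS: pair_sigma_finite S S ..
sublocale LS: pair_sigma_finite "lborel :: (real^'n) measure" S ..

definition "\<Phi>_sup = max 0 (Sup (\<Phi> ` {0..R}))"

lemma Phi_sup: "0 \<le> \<Phi>_sup" "0 \<le> r \<Longrightarrow> r \<le> R \<Longrightarrow> \<Phi> r \<le> \<Phi>_sup"
  unfolding \<Phi>_sup_def using Phi_bdd by (auto intro!: max.coboundedI2 cSup_upper)

definition kr :: "real \<Rightarrow> ennreal" where "kr r = ennreal (indicator {..R} r * \<Phi> r)"

lemma kr_measurable [measurable]: "kr \<in> borel_measurable borel"
  unfolding kr_def[abs_def] by measurable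

lemma kr_le: "kr (norm (q :: real^'n)) \<le> ennreal \<Phi>_sup * indicator (cball 0 R) q"
  using Phi_sup by (auto simp: kr_def indicator_def intro!: ennreal_leI)

definition "e0 = (axis undefined 1 :: real^'n)"

lemma norm_e0: "norm e0 = 1" by (simp add: e0_def)

definition "b_mass = (\<integral>\<^sup>+\<sigma>. ennreal (b (\<sigma> \<bullet> e0)) \<partial>S)"

lemma b_mass_finite: "b_mass < \<infinity>" using b_int norm_e0 by (simp add: b_mass_def)

text \<open>A rotation taking \<open>e0\<close> to \<open>e\<close> is moved onto \<sigma>, where
  the sphere measure does not see it.\<close>

lemma b_mass: "norm e = 1 \<Longrightarrow> (\<integral>\<^sup>+\<sigma>. ennreal (b (\<sigma> \<bullet> e)) \<partial>S) = b_mass"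
proof -
  assume e: "norm e = 1"
  obtain T where T: "orthogonal_transformation T" "e = T e0"
    using ex_orthogonal_unit[OF norm_e0, of e] e by (metis scaleR_one)
  have "(\<integral>\<^sup>+\<sigma>. ennreal (b (\<sigma> \<bullet> e)) \<partial>S) = (\<integral>\<^sup>+\<sigma>. ennreal (b (T \<sigma> \<bullet> e)) \<partial>S)"
    by (rule nn_integral_sphere_orthogonal[OF T(1), symmetric]) measurable
  also have "\<dots> = b_mass"
    using T(1) by (simp add: T(2) b_mass_def orthogonal_transformation_def)
  finally show ?thesis .
qed

definition kernel_fun :: "(real^'n) \<times> (real^'n) \<Rightarrow> real" where
  "kernel_fun z = indicator {..R} (norm (fst z)) * \<Phi> (norm (fst z)) * b (snd z \<bullet> direction (fst z))"

lemma kernel_fun_measurable [measurable]: "kernel_fun \<in> borel_measurable (borel \<Otimes>\<^sub>M borel)"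
  unfolding kernel_fun_def[abs_def] by measurable

lemma kernel_fun_nonneg: "0 \<le> kernel_fun z"
  using Phi_nonneg b_nonneg by (simp add: kernel_fun_def)

lemma kernel_fun_eq: "ennreal (kernel_fun (q, \<sigma>)) = kr (norm q) * ennreal (b (\<sigma> \<bullet> direction q))"
  using Phi_nonneg b_nonneg by (simp add: kernel_fun_def kr_def ennreal_mult)

text \<open>Distribution of \<open>(q, |q| \<sigma>)\<close>, the relative velocities before and after a collision,
  under the cross section.\<close>
definition coll :: "((real^'n) \<times> (real^'n)) measure" where
  "coll = distr (density (lborel \<Otimes>\<^sub>M S) (\<lambda>z. ennreal (kernel_fun z))) (borel \<Otimes>\<^sub>M borel)
     (\<lambda>z. (fst z, norm (fst z) *\<^sub>R snd z))"

lemma sets_coll [measurable_cong, simp]: "sets coll = sets (borel \<Otimes>\<^sub>M borel)"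
  by (simp add: coll_def)

lemma space_coll [simp]: "space coll = UNIV"
  by (simp add: coll_def space_pair_measure)

lemma nn_integral_coll:
  assumes H[measurable]: "H \<in> borel_measurable (borel \<Otimes>\<^sub>M borel)"
  shows "(\<integral>\<^sup>+z. H z \<partial>coll)
    = (\<integral>\<^sup>+q. \<integral>\<^sup>+\<sigma>. kr (norm q) * ennreal (b (\<sigma> \<bullet> direction q)) * H (q, norm q *\<^sub>R \<sigma>) \<partial>S \<partial>lborel)"
proof -
  have "(\<integral>\<^sup>+z. H z \<partial>coll)
      = (\<integral>\<^sup>+z. H (fst z, norm (fst z) *\<^sub>R snd z) \<partial>density (lborel \<Otimes>\<^sub>M S) (\<lambda>z. ennreal (kernel_fun z)))"
    unfolding coll_def by (rule nn_integral_distr) measurable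
  also have "\<dots> = (\<integral>\<^sup>+z. ennreal (kernel_fun z) * H (fst z, norm (fst z) *\<^sub>R snd z) \<partial>(lborel \<Otimes>\<^sub>M S))"
    by (rule nn_integral_density) measurable
  also have "\<dots> = (\<integral>\<^sup>+q. \<integral>\<^sup>+\<sigma>. ennreal (kernel_fun (q, \<sigma>)) * H (q, norm q *\<^sub>R \<sigma>) \<partial>S \<partial>lborel)"
    by (subst S.nn_integral_fst[symmetric]) simp_all
  finally show ?thesis by (simp add: kernel_fun_eq)
qed

lemma nn_integral_coll_polar:
  assumes H[measurable]: "H \<in> borel_measurable (borel \<Otimes>\<^sub>M borel)"
  shows "(\<integral>\<^sup>+z. H z \<partial>coll)
    = (\<integral>\<^sup>+r. \<integral>\<^sup>+\<omega>. \<integral>\<^sup>+\<sigma>. kr r * ennreal (b (\<sigma> \<bullet> \<omega>)) * H (r *\<^sub>R \<omega>, r *\<^sub>R \<sigma>) \<partial>S \<partial>S \<partial>radial_measure TYPE(real^'n))"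
proof -
  define f where "f z = (\<integral>\<^sup>+\<sigma>. kr (fst z) * ennreal (b (\<sigma> \<bullet> snd z)) * H (fst z *\<^sub>R snd z, fst z *\<^sub>R \<sigma>) \<partial>S)"
    for z :: "real \<times> (real^'n)"
  have fm: "f \<in> borel_measurable (borel \<Otimes>\<^sub>M borel)"
    unfolding f_def[abs_def] by measurable
  have "norm q *\<^sub>R direction q = q" for q :: "real^'n" by (cases "q = 0") auto
  then show ?thesis
    using nn_integral_polar[OF fm] unfolding nn_integral_coll[OF H] f_def by simp
qed

text \<open>Micro-reversibility. In polar coordinates both relative velocities have the same length
  r and the weight \<open>b (\<sigma> \<bullet> \<omega>)\<close> is symmetric in the two
  directions, so Fubini exchanges them.\<close>

lemma nn_integral_coll_swap:
  assumes H[measurable]: "H \<in> borel_measurable (borel \<Otimes>\<^sub>M borel)"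
  shows "(\<integral>\<^sup>+z. H (snd z, fst z) \<partial>coll) = (\<integral>\<^sup>+z. H z \<partial>coll)"
proof -
  have "(\<integral>\<^sup>+z. H (snd z, fst z) \<partial>coll)
    = (\<integral>\<^sup>+r. \<integral>\<^sup>+\<omega>. \<integral>\<^sup>+\<sigma>. kr r * ennreal (b (\<sigma> \<bullet> \<omega>)) * H (r *\<^sub>R \<sigma>, r *\<^sub>R \<omega>) \<partial>S \<partial>S \<partial>radial_measure TYPE(real^'n))"
    by (subst nn_integral_coll_polar) simp_all
  also have "\<dots> = (\<integral>\<^sup>+r. \<integral>\<^sup>+\<sigma>. \<integral>\<^sup>+\<omega>. kr r * ennreal (b (\<sigma> \<bullet> \<omega>)) * H (r *\<^sub>R \<sigma>, r *\<^sub>R \<omega>) \<partial>S \<partial>S \<partial>radial_measure TYPE(real^'n))"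
    by (rule nn_integral_cong, rule SS.Fubini') measurable
  also have "\<dots> = (\<integral>\<^sup>+z. H z \<partial>coll)"
    by (simp add: nn_integral_coll_polar inner_commute)
  finally show ?thesis .
qed

lemma distr_coll_swap: "distr coll coll (\<lambda>z. (snd z, fst z)) = coll"
proof (rule measure_eqI)
  fix A assume "A \<in> sets (distr coll coll (\<lambda>z. (snd z, fst z)))"
  then have A[measurable]: "A \<in> sets (borel \<Otimes>\<^sub>M borel)" by simp
  have "emeasure (distr coll coll (\<lambda>z. (snd z, fst z))) A
      = (\<integral>\<^sup>+z. indicator A z \<partial>distr coll coll (\<lambda>z. (snd z, fst z)))" by simp
  also have "\<dots> = (\<integral>\<^sup>+z. indicator A (snd z, fst z) \<partial>coll)"
    by (rule nn_integral_distr) measurable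
  also have "\<dots> = (\<integral>\<^sup>+z. indicator A z \<partial>coll)"
    by (rule nn_integral_coll_swap) measurable
  finally show "emeasure (distr coll coll (\<lambda>z. (snd z, fst z))) A = emeasure coll A" by simp
qed simp

lemma nn_integral_coll_fst_le:
  assumes h[measurable]: "h \<in> borel_measurable borel"
  shows "(\<integral>\<^sup>+z. h (fst z) \<partial>coll) \<le> ennreal \<Phi>_sup * b_mass * (\<integral>\<^sup>+q. h q * indicator (cball 0 R) q \<partial>lborel)"
proof -
  have "(\<integral>\<^sup>+z. h (fst z) \<partial>coll) = (\<integral>\<^sup>+q. \<integral>\<^sup>+\<sigma>. kr (norm q) * h q * ennreal (b (\<sigma> \<bullet> direction q)) \<partial>S \<partial>lborel)"
    by (subst nn_integral_coll) (measurable, simp add: mult_ac)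
  also have "\<dots> = (\<integral>\<^sup>+q. kr (norm q) * h q * (\<integral>\<^sup>+\<sigma>. ennreal (b (\<sigma> \<bullet> direction q)) \<partial>S) \<partial>lborel)"
    by (rule nn_integral_cong, rule nn_integral_cmult) measurable
  also have "\<dots> \<le> (\<integral>\<^sup>+q. ennreal \<Phi>_sup * b_mass * (h q * indicator (cball 0 R) q) \<partial>lborel)"
  proof (rule nn_integral_mono_AE)
    \<comment> \<open>The origin is excluded because \<open>direction 0\<close> is not a unit
      vector, so \<open>b_mass\<close> does not apply there.\<close>
    have "AE q in lborel. q \<noteq> (0 :: real^'n)"
      by (rule AE_I'[where N = "{0}"]) auto
    then show "AE q in lborel. kr (norm q) * h q * (\<integral>\<^sup>+\<sigma>. ennreal (b (\<sigma> \<bullet> direction q)) \<partial>S)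
        \<le> ennreal \<Phi>_sup * b_mass * (h q * indicator (cball 0 R) q)"
    proof eventually_elim
      fix q :: "real^'n" assume "q \<noteq> 0"
      then have "(\<integral>\<^sup>+\<sigma>. ennreal (b (\<sigma> \<bullet> direction q)) \<partial>S) = b_mass" by (intro b_mass) simp
      moreover have "kr (norm q) * (h q * b_mass) \<le> (ennreal \<Phi>_sup * indicator (cball 0 R) q) * (h q * b_mass)"
        by (rule mult_right_mono[OF kr_le]) simp
      ultimately show "kr (norm q) * h q * (\<integral>\<^sup>+\<sigma>. ennreal (b (\<sigma> \<bullet> direction q)) \<partial>S)
        \<le> ennreal \<Phi>_sup * b_mass * (h q * indicator (cball 0 R) q)"
        by (simp add: mult_ac)
    qed
  qed
  also have "\<dots> = ennreal \<Phi>_sup * b_mass * (\<integral>\<^sup>+q. h q * indicator (cball 0 R) q \<partial>lborel)"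
    by (rule nn_integral_cmult) measurable
  finally show ?thesis .
qed

lemma finite_coll: "finite_measure coll"
proof (rule finite_measureI)
  have "emeasure coll (space coll) = (\<integral>\<^sup>+z. 1 \<partial>coll)" by simp
  also have "\<dots> \<le> ennreal \<Phi>_sup * b_mass * (\<integral>\<^sup>+q. 1 * indicator (cball 0 R) (q :: real^'n) \<partial>lborel)"
    by (rule nn_integral_coll_fst_le) simp
  also have "\<dots> < \<infinity>"
    using b_mass_finite emeasure_bounded_finite[of "cball 0 R :: (real^'n) set"]
    by (simp add: ennreal_mult_less_top)
  finally show "emeasure coll (space coll) \<noteq> \<infinity>" by simp
qed

text \<open>The law of the midpoint between the directions before and after a collision, weighted by
  the cross section; scaled by |q| the midpoint is (q + |q| \<sigma>) / 2.\<close>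

definition mid_measure :: "(real^'n) measure" where
  "mid_measure = distr (density (S \<Otimes>\<^sub>M S) (\<lambda>z. ennreal (b (snd z \<bullet> fst z)))) borel
     (\<lambda>z. (1 / 2) *\<^sub>R (fst z + snd z))"

lemma sets_mid [measurable_cong, simp]: "sets mid_measure = sets borel"
  by (simp add: mid_measure_def)

lemma nn_integral_mid:
  assumes [measurable]: "h \<in> borel_measurable borel"
  shows "(\<integral>\<^sup>+x. h x \<partial>mid_measure) = (\<integral>\<^sup>+\<omega>. \<integral>\<^sup>+\<sigma>. ennreal (b (\<sigma> \<bullet> \<omega>)) * h ((1 / 2) *\<^sub>R (\<omega> + \<sigma>)) \<partial>S \<partial>S)"
proof -
  have "(\<integral>\<^sup>+x. h x \<partial>mid_measure)
      = (\<integral>\<^sup>+z. h ((1 / 2) *\<^sub>R (fst z + snd z)) \<partial>density (S \<Otimes>\<^sub>M S) (\<lambda>z. ennreal (b (snd z \<bullet> fst z))))"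
    unfolding mid_measure_def by (rule nn_integral_distr) measurable
  also have "\<dots> = (\<integral>\<^sup>+z. ennreal (b (snd z \<bullet> fst z)) * h ((1 / 2) *\<^sub>R (fst z + snd z)) \<partial>(S \<Otimes>\<^sub>M S))"
    by (rule nn_integral_density) measurable
  also have "\<dots> = (\<integral>\<^sup>+\<omega>. \<integral>\<^sup>+\<sigma>. ennreal (b (\<sigma> \<bullet> \<omega>)) * h ((1 / 2) *\<^sub>R (\<omega> + \<sigma>)) \<partial>S \<partial>S)"
    by (subst S.nn_integral_fst[symmetric]) simp_all
  finally show ?thesis .
qed

lemma mid_UNIV: "emeasure mid_measure UNIV = b_mass * emeasure S UNIV"
proof -
  have "emeasure mid_measure UNIV = (\<integral>\<^sup>+x. 1 \<partial>mid_measure)" by (simp add: mid_measure_def)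
  also have "\<dots> = (\<integral>\<^sup>+\<omega>. \<integral>\<^sup>+\<sigma>. ennreal (b (\<sigma> \<bullet> \<omega>)) \<partial>S \<partial>S)"
    by (subst nn_integral_mid) auto
  also have "\<dots> = (\<integral>\<^sup>+\<omega>. b_mass \<partial>S)"
    by (rule nn_integral_cong_AE) (use AE_sphere_norm in eventually_elim, simp add: b_mass)
  finally show ?thesis by simp
qed

lemma finite_mid: "finite_measure mid_measure"
proof (rule finite_measureI)
  show "emeasure mid_measure (space mid_measure) \<noteq> \<infinity>"
    using mid_UNIV b_mass_finite S.emeasure_finite[of UNIV]
    by (simp add: mid_measure_def ennreal_mult_eq_top_iff less_top)
qed

text \<open>Both directions can be rotated at once, since \<open>b\<close> sees only their inner
  product.\<close>

lemma mid_invariant: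
  assumes T: "orthogonal_transformation T" and f[measurable]: "f \<in> borel_measurable borel"
  shows "(\<integral>\<^sup>+x. f (T x) \<partial>mid_measure) = (\<integral>\<^sup>+x. f x \<partial>mid_measure)"
proof -
  note [measurable] = orthogonal_transformation_borel[OF T]
  have lin: "T (c *\<^sub>R (x + y)) = c *\<^sub>R (T x + T y)" for c x y
    using T by (simp add: orthogonal_transformation_linear linear_add linear_scale)
  have inn: "T x \<bullet> T y = x \<bullet> y" for x y
    using T by (simp add: orthogonal_transformation_def)
  have "(\<integral>\<^sup>+x. f (T x) \<partial>mid_measure)
      = (\<integral>\<^sup>+\<omega>. \<integral>\<^sup>+\<sigma>. ennreal (b (T \<sigma> \<bullet> T \<omega>)) * f ((1 / 2) *\<^sub>R (T \<omega> + T \<sigma>)) \<partial>S \<partial>S)"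
    by (subst nn_integral_mid) (measurable, simp only: lin inn)
  also have "\<dots> = (\<integral>\<^sup>+\<omega>. \<integral>\<^sup>+\<sigma>. ennreal (b (\<sigma> \<bullet> T \<omega>)) * f ((1 / 2) *\<^sub>R (T \<omega> + \<sigma>)) \<partial>S \<partial>S)"
  proof (rule nn_integral_cong)
    fix \<omega> :: "real^'n"
    show "(\<integral>\<^sup>+\<sigma>. ennreal (b (T \<sigma> \<bullet> T \<omega>)) * f ((1 / 2) *\<^sub>R (T \<omega> + T \<sigma>)) \<partial>S)
      = (\<integral>\<^sup>+\<sigma>. ennreal (b (\<sigma> \<bullet> T \<omega>)) * f ((1 / 2) *\<^sub>R (T \<omega> + \<sigma>)) \<partial>S)"
      by (rule nn_integral_sphere_orthogonal[OF T, of "\<lambda>\<sigma>. ennreal (b (\<sigma> \<bullet> T \<omega>)) * f ((1 / 2) *\<^sub>R (T \<omega> + \<sigma>))"])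
         measurable
  qed
  also have "\<dots> = (\<integral>\<^sup>+\<omega>. \<integral>\<^sup>+\<sigma>. ennreal (b (\<sigma> \<bullet> \<omega>)) * f ((1 / 2) *\<^sub>R (\<omega> + \<sigma>)) \<partial>S \<partial>S)"
    by (rule nn_integral_sphere_orthogonal[OF T, of "\<lambda>\<omega>. \<integral>\<^sup>+\<sigma>. ennreal (b (\<sigma> \<bullet> \<omega>)) * f ((1 / 2) *\<^sub>R (\<omega> + \<sigma>)) \<partial>S"])
       measurable
  also have "\<dots> = (\<integral>\<^sup>+x. f x \<partial>mid_measure)" by (simp add: nn_integral_mid)
  finally show ?thesis .
qed

text \<open>As \<open>b\<close> vanishes for obtuse angles, \<open>\<omega> + \<sigma>\<close> stays away from \<open>0\<close>, so dilations by
  \<open>(\<omega> + \<sigma>) / 2\<close> distort volume by at most a constant factor.\<close>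
lemma AE_mid: "AE x in mid_measure. 1 / 2 \<le> (norm x)\<^sup>2 \<and> 0 < norm x \<and> norm x \<le> 1"
proof -
  define N where "N = {x :: real^'n. \<not> (1 / 2 \<le> (norm x)\<^sup>2 \<and> norm x \<le> 1)}"
  have [measurable]: "N \<in> sets borel"
  proof -
    have "{x :: real^'n \<in> space borel. \<not> (1 / 2 \<le> (norm x)\<^sup>2 \<and> norm x \<le> 1)} \<in> sets borel" by measurable
    then show ?thesis by (simp add: N_def)
  qed
  have "emeasure mid_measure N = (\<integral>\<^sup>+x. indicator N x \<partial>mid_measure)" by simp
  also have "\<dots> = (\<integral>\<^sup>+\<omega>. \<integral>\<^sup>+\<sigma>. ennreal (b (\<sigma> \<bullet> \<omega>)) * indicator N ((1 / 2) *\<^sub>R (\<omega> + \<sigma>)) \<partial>S \<partial>S)"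
    by (rule nn_integral_mid) measurable
  also have "\<dots> = (\<integral>\<^sup>+\<omega>. \<integral>\<^sup>+\<sigma>. 0 \<partial>S \<partial>S)"
  proof (rule nn_integral_cong_AE)
    show "AE \<omega> in S. (\<integral>\<^sup>+\<sigma>. ennreal (b (\<sigma> \<bullet> \<omega>)) * indicator N ((1 / 2) *\<^sub>R (\<omega> + \<sigma>)) \<partial>S) = (\<integral>\<^sup>+\<sigma>. 0 \<partial>S)"
      using AE_sphere_norm
    proof eventually_elim
      fix \<omega> :: "real^'n" assume \<omega>: "norm \<omega> = 1"
      show "(\<integral>\<^sup>+\<sigma>. ennreal (b (\<sigma> \<bullet> \<omega>)) * indicator N ((1 / 2) *\<^sub>R (\<omega> + \<sigma>)) \<partial>S) = (\<integral>\<^sup>+\<sigma>. 0 \<partial>S)"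
      proof (rule nn_integral_cong_AE)
        show "AE \<sigma> in S. ennreal (b (\<sigma> \<bullet> \<omega>)) * indicator N ((1 / 2) *\<^sub>R (\<omega> + \<sigma>)) = 0"
          using AE_sphere_norm
        proof eventually_elim
          fix \<sigma> :: "real^'n" assume \<sigma>: "norm \<sigma> = 1"
          show "ennreal (b (\<sigma> \<bullet> \<omega>)) * indicator N ((1 / 2) *\<^sub>R (\<omega> + \<sigma>)) = 0"
          proof (cases "\<sigma> \<bullet> \<omega> < 0")
            case True
            then show ?thesis using b_neg by simp
          next
            case False
            have "(norm (\<omega> + \<sigma>))\<^sup>2 = 2 + 2 * (\<sigma> \<bullet> \<omega>)"
              using \<omega> \<sigma> by (simp add: power2_norm_eq_inner inner_add inner_commute)
                 (simp add: dot_square_norm inner_commute)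
            then have "1 / 2 \<le> (norm ((1 / 2) *\<^sub>R (\<omega> + \<sigma>)))\<^sup>2"
              using False by (simp add: power_divide)
            moreover have "norm ((1 / 2) *\<^sub>R (\<omega> + \<sigma>)) \<le> 1"
              using norm_triangle_ineq[of \<omega> \<sigma>] \<omega> \<sigma> by simp
            ultimately show ?thesis by (simp add: N_def)
          qed
        qed
      qed
    qed
  qed
  finally have "N \<in> null_sets mid_measure" by (auto simp: null_sets_def)
  then have "AE x in mid_measure. x \<notin> N" by (rule AE_not_in)
  then show ?thesis by eventually_elim (auto simp: N_def)
qed

text \<open>The power of 2 bounds the Jacobian of the inverse dilation by the norm of x, which is at
  least 1/2 for almost every midpoint x.\<close>

definition "J_const = ennreal \<Phi>_sup * ennreal (2 ^ CARD('n)) * b_mass"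

text \<open>For fixed q the points (q + |q| \<sigma>) / 2 lie on a sphere; only their average over q
  has a bounded density. Rotation invariance lets the direction of the midpoint be replaced by an
  independent uniform one. Together with the radius r this direction reassembles into a Lebesgue
  variable, and what is left is a dilation by the norm of the midpoint.\<close>

lemma nn_integral_coll_mid_le:
  fixes h :: "real^'n \<Rightarrow> real"
  assumes h: "cont_periodic L h" and pos: "\<And>x. 0 \<le> h x"
  shows "(\<integral>\<^sup>+z. h (v + (1 / 2) *\<^sub>R (fst z + snd z)) \<partial>coll) \<le> J_const * (\<integral>\<^sup>+x. h x \<partial>cell_measure L)"
proof -
  interpret M: finite_measure mid_measure by (rule finite_mid)
  interpret sigma_finite_measure "radial_measure TYPE(real^'n)" by (rule sigma_finite_radial)
  interpret MR: pair_sigma_finite "radial_measure TYPE(real^'n)" mid_measure ..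
  have [measurable]: "h \<in> borel_measurable borel" using h by (rule cont_periodic_measurable)
  have hc: "continuous_on UNIV h" using h by (simp add: cont_periodic_def)
  define s where "s = emeasure S UNIV"
  have s: "s \<noteq> 0" "s \<noteq> \<infinity>"
    using sphere_measure_UNIV_pos[where 'a = "real^'n"] S.emeasure_finite[of UNIV] by (auto simp: s_def)
  define c where "c = (\<integral>\<^sup>+x. h x \<partial>cell_measure L)"
  have "(\<integral>\<^sup>+z. h (v + (1 / 2) *\<^sub>R (fst z + snd z)) \<partial>coll)
      = (\<integral>\<^sup>+r. kr r * (\<integral>\<^sup>+x. h (v + r *\<^sub>R x) \<partial>mid_measure) \<partial>radial_measure TYPE(real^'n))"
  proof -
    have "(\<integral>\<^sup>+z. h (v + (1 / 2) *\<^sub>R (fst z + snd z)) \<partial>coll)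
      = (\<integral>\<^sup>+r. \<integral>\<^sup>+\<omega>. \<integral>\<^sup>+\<sigma>. kr r * ennreal (b (\<sigma> \<bullet> \<omega>)) * h (v + (1 / 2) *\<^sub>R (r *\<^sub>R \<omega> + r *\<^sub>R \<sigma>)) \<partial>S \<partial>S \<partial>radial_measure TYPE(real^'n))"
      by (subst nn_integral_coll_polar) simp_all
    also have "\<dots> = (\<integral>\<^sup>+r. kr r * (\<integral>\<^sup>+x. h (v + r *\<^sub>R x) \<partial>mid_measure) \<partial>radial_measure TYPE(real^'n))"
    proof (rule nn_integral_cong)
      fix r :: real
      have "(\<integral>\<^sup>+\<omega>. \<integral>\<^sup>+\<sigma>. kr r * ennreal (b (\<sigma> \<bullet> \<omega>)) * h (v + (1 / 2) *\<^sub>R (r *\<^sub>R \<omega> + r *\<^sub>R \<sigma>)) \<partial>S \<partial>S)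
          = (\<integral>\<^sup>+\<omega>. kr r * (\<integral>\<^sup>+\<sigma>. ennreal (b (\<sigma> \<bullet> \<omega>)) * h (v + r *\<^sub>R ((1 / 2) *\<^sub>R (\<omega> + \<sigma>))) \<partial>S) \<partial>S)"
        by (rule nn_integral_cong, subst nn_integral_cmult[symmetric])
           (measurable, simp add: mult.assoc scaleR_right_distrib mult.commute)
      also have "\<dots> = kr r * (\<integral>\<^sup>+\<omega>. \<integral>\<^sup>+\<sigma>. ennreal (b (\<sigma> \<bullet> \<omega>)) * h (v + r *\<^sub>R ((1 / 2) *\<^sub>R (\<omega> + \<sigma>))) \<partial>S \<partial>S)"
        by (rule nn_integral_cmult) measurable
      also have "\<dots> = kr r * (\<integral>\<^sup>+x. h (v + r *\<^sub>R x) \<partial>mid_measure)"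
        by (subst nn_integral_mid) simp_all
      finally show "(\<integral>\<^sup>+\<omega>. \<integral>\<^sup>+\<sigma>. kr r * ennreal (b (\<sigma> \<bullet> \<omega>)) * h (v + (1 / 2) *\<^sub>R (r *\<^sub>R \<omega> + r *\<^sub>R \<sigma>)) \<partial>S \<partial>S)
          = kr r * (\<integral>\<^sup>+x. h (v + r *\<^sub>R x) \<partial>mid_measure)" .
    qed
    finally show ?thesis .
  qed
  \<comment> \<open>The area \<open>s\<close> of the sphere turns the uniform average over
    directions into a plain sphere integral; it is cancelled at the end.\<close>
  then have "s * (\<integral>\<^sup>+z. h (v + (1 / 2) *\<^sub>R (fst z + snd z)) \<partial>coll)
      = (\<integral>\<^sup>+r. kr r * (s * (\<integral>\<^sup>+x. h (v + r *\<^sub>R x) \<partial>mid_measure)) \<partial>radial_measure TYPE(real^'n))"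
    by (simp add: mult.left_commute flip: nn_integral_cmult)
  also have "\<dots> \<le> (\<integral>\<^sup>+r. kr r * (\<integral>\<^sup>+x. \<integral>\<^sup>+\<sigma>. h (v + r *\<^sub>R (norm x *\<^sub>R \<sigma>)) \<partial>S \<partial>mid_measure) \<partial>radial_measure TYPE(real^'n))"
  proof (intro nn_integral_mono mult_left_mono)
    fix r :: real
    have ae: "AE x in mid_measure. 0 < norm x \<and> norm x \<le> 1"
      using AE_mid by eventually_elim simp
    have "continuous_on UNIV (\<lambda>x. h (v + r *\<^sub>R x))"
      by (intro continuous_on_compose2[OF hc] continuous_intros) auto
    from rotation_invariant_average[OF finite_mid sets_mid mid_invariant ae this pos]
    show "s * (\<integral>\<^sup>+x. h (v + r *\<^sub>R x) \<partial>mid_measure)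
      \<le> (\<integral>\<^sup>+x. \<integral>\<^sup>+\<sigma>. h (v + r *\<^sub>R (norm x *\<^sub>R \<sigma>)) \<partial>S \<partial>mid_measure)"
      unfolding s_def .
  qed simp
  also have "\<dots> = (\<integral>\<^sup>+r. \<integral>\<^sup>+x. kr r * (\<integral>\<^sup>+\<sigma>. h (v + r *\<^sub>R (norm x *\<^sub>R \<sigma>)) \<partial>S) \<partial>mid_measure \<partial>radial_measure TYPE(real^'n))"
    by (rule nn_integral_cong, rule nn_integral_cmult[symmetric]) measurable
  also have "\<dots> = (\<integral>\<^sup>+x. \<integral>\<^sup>+r. kr r * (\<integral>\<^sup>+\<sigma>. h (v + r *\<^sub>R (norm x *\<^sub>R \<sigma>)) \<partial>S) \<partial>radial_measure TYPE(real^'n) \<partial>mid_measure)"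
    by (rule MR.Fubini'[symmetric]) measurable
  also have "\<dots> = (\<integral>\<^sup>+x. \<integral>\<^sup>+r. \<integral>\<^sup>+\<sigma>. kr r * h (v + r *\<^sub>R (norm x *\<^sub>R \<sigma>)) \<partial>S \<partial>radial_measure TYPE(real^'n) \<partial>mid_measure)"
    by (intro nn_integral_cong, rule nn_integral_cmult[symmetric]) measurable
  also have "\<dots> = (\<integral>\<^sup>+x. \<integral>\<^sup>+q. kr (norm q) * h (v + norm x *\<^sub>R q) \<partial>lborel \<partial>mid_measure)"
  proof (rule nn_integral_cong)
    fix x :: "real^'n"
    define f where "f z = kr (fst z) * ennreal (h (v + fst z *\<^sub>R (norm x *\<^sub>R snd z)))" for z :: "real \<times> (real^'n)"
    have fm: "f \<in> borel_measurable (borel \<Otimes>\<^sub>M borel)" unfolding f_def[abs_def] by measurable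
    have dir: "norm q *\<^sub>R (norm x *\<^sub>R direction q) = norm x *\<^sub>R q" for q :: "real^'n"
      by (cases "q = 0") auto
    have e1: "f (norm q, direction q) = kr (norm q) * ennreal (h (v + norm x *\<^sub>R q))" for q
      unfolding f_def fst_conv snd_conv dir ..
    have e2: "f (r, \<sigma>) = kr r * ennreal (h (v + r *\<^sub>R (norm x *\<^sub>R \<sigma>)))" for r \<sigma>
      unfolding f_def fst_conv snd_conv ..
    have "(\<integral>\<^sup>+q. kr (norm q) * h (v + norm x *\<^sub>R q) \<partial>lborel)
        = (\<integral>\<^sup>+r. \<integral>\<^sup>+\<sigma>. kr r * h (v + r *\<^sub>R (norm x *\<^sub>R \<sigma>)) \<partial>S \<partial>radial_measure TYPE(real^'n))"
      using nn_integral_polar[OF fm, unfolded e1, unfolded e2] .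
    then show "(\<integral>\<^sup>+r. \<integral>\<^sup>+\<sigma>. kr r * h (v + r *\<^sub>R (norm x *\<^sub>R \<sigma>)) \<partial>S \<partial>radial_measure TYPE(real^'n))
        = (\<integral>\<^sup>+q. kr (norm q) * h (v + norm x *\<^sub>R q) \<partial>lborel)" by (rule sym)
  qed
  also have "\<dots> \<le> (\<integral>\<^sup>+x. ennreal \<Phi>_sup * ennreal (2 ^ CARD('n)) * c \<partial>mid_measure)"
  proof (rule nn_integral_mono_AE)
    show "AE x in mid_measure. (\<integral>\<^sup>+q. kr (norm q) * h (v + norm x *\<^sub>R q) \<partial>lborel)
        \<le> ennreal \<Phi>_sup * ennreal (2 ^ CARD('n)) * c"
      using AE_mid
    proof eventually_elim
      fix x :: "real^'n" assume x: "1 / 2 \<le> (norm x)\<^sup>2 \<and> 0 < norm x \<and> norm x \<le> 1"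
      define a where "a = norm x"
      have a: "0 < a" "a \<le> 1" using x by (auto simp: a_def)
      have "1 / 2 \<le> a"
      proof -
        have "a\<^sup>2 \<le> a" using a by (simp add: power2_eq_square mult_left_le)
        then show ?thesis using x by (simp add: a_def)
      qed
      then have ia: "(1 / a) ^ CARD('n) \<le> 2 ^ CARD('n)"
        using a by (intro power_mono) (auto simp: field_simps)
      have "(\<integral>\<^sup>+q. kr (norm q) * h (v + a *\<^sub>R q) \<partial>lborel)
          \<le> (\<integral>\<^sup>+q. ennreal \<Phi>_sup * (ennreal (h (v + a *\<^sub>R q)) * indicator (cball 0 R) q) \<partial>lborel)"
      proof (rule nn_integral_mono)
        fix q
        show "kr (norm q) * ennreal (h (v + a *\<^sub>R q))
            \<le> ennreal \<Phi>_sup * (ennreal (h (v + a *\<^sub>R q)) * indicator (cball 0 R) q)"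
          using mult_right_mono[OF kr_le[of q], of "ennreal (h (v + a *\<^sub>R q))"] by (simp add: mult_ac)
      qed
      also have "\<dots> = ennreal \<Phi>_sup * (\<integral>\<^sup>+q. ennreal (h (v + a *\<^sub>R q)) * indicator (cball 0 R) q \<partial>lborel)"
        by (rule nn_integral_cmult) measurable
      also have "(\<integral>\<^sup>+q. ennreal (h (v + a *\<^sub>R q)) * indicator (cball 0 R) q \<partial>lborel)
          = ennreal ((1 / a) ^ CARD('n)) * (\<integral>\<^sup>+q. ennreal (h (v + q)) * indicator (cball 0 R) ((1 / a) *\<^sub>R q) \<partial>lborel)"
      proof -
        have "(\<lambda>q. ennreal (h (v + a *\<^sub>R q)) * indicator (cball 0 R) (q :: real^'n)) \<in> borel_measurable borel"
          by measurable
        from nn_integral_dilate[OF _ this, of "1 / a"] a show ?thesis by simp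
      qed
      also have "\<dots> \<le> ennreal (2 ^ CARD('n)) * c"
      proof (rule mult_mono)
        \<comment> \<open>As \<open>a\<close> is at most 1, the dilated ball stays inside the
          truncation ball and hence inside one cell.\<close>
        have "indicator (cball 0 R) ((1 / a) *\<^sub>R q) \<le> (indicator (cball 0 R) q :: ennreal)" for q :: "real^'n"
        proof -
          have "norm q \<le> norm q / a" using a by (simp add: field_simps mult_left_le_one_le)
          then show ?thesis using a by (auto simp: indicator_def)
        qed
        then have "(\<integral>\<^sup>+q. ennreal (h (v + q)) * indicator (cball 0 R) ((1 / a) *\<^sub>R q) \<partial>lborel)
            \<le> (\<integral>\<^sup>+q. ennreal (h (v + q)) * indicator (cball 0 R) q \<partial>lborel)"
          by (intro nn_integral_mono mult_left_mono) auto
        also have "\<dots> \<le> c"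
          unfolding c_def
          by (rule nn_integral_ball_le_cell') (use L_pos RL h in \<open>auto simp: cont_periodic_def periodic_def\<close>)
        finally show "(\<integral>\<^sup>+q. ennreal (h (v + q)) * indicator (cball 0 R) ((1 / a) *\<^sub>R q) \<partial>lborel) \<le> c" .
      qed (use ia in \<open>auto intro!: ennreal_leI\<close>)
      finally show "(\<integral>\<^sup>+q. kr (norm q) * h (v + norm x *\<^sub>R q) \<partial>lborel)
        \<le> ennreal \<Phi>_sup * ennreal (2 ^ CARD('n)) * c"
        by (simp add: a_def mult.assoc mult_left_mono)
    qed
  qed
  also have "\<dots> = s * (J_const * c)"
    using mid_UNIV sets_eq_imp_space_eq[OF sets_mid] by (simp add: J_const_def s_def mult_ac)
  finally have "s * (\<integral>\<^sup>+z. h (v + (1 / 2) *\<^sub>R (fst z + snd z)) \<partial>coll) \<le> s * (J_const * c)" .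
  then show ?thesis
    using s by (simp add: c_def ennreal_mult_le_mult_iff)
qed

end

section \<open>Estimates for the collision operator\<close>

text \<open>Real-valued counterparts of \<open>L1norm\<close> and \<open>L2norm\<close>: the
  truncated flow is real, and sign arguments and energy estimates take place there.\<close>

definition cell_norm1 :: "real \<Rightarrow> (real^'n \<Rightarrow> real) \<Rightarrow> real" where
  "cell_norm1 L f = (\<integral>v. \<bar>f v\<bar> \<partial>cell_measure L)"

definition cell_norm2 :: "real \<Rightarrow> (real^'n \<Rightarrow> real) \<Rightarrow> real" where
  "cell_norm2 L f = sqrt (\<integral>v. (f v)\<^sup>2 \<partial>cell_measure L)"

lemma cell_norm1_nonneg: "0 \<le> cell_norm1 L f" by (simp add: cell_norm1_def)

lemma cell_norm2_nonneg: "0 \<le> cell_norm2 L f" by (simp add: cell_norm2_def)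

lemma cell_norm2_power2: "(cell_norm2 L f)\<^sup>2 = (\<integral>v. (f v)\<^sup>2 \<partial>cell_measure L)"
  by (simp add: cell_norm2_def)

lemma cell_Cauchy_Schwarz:
  assumes "0 < L" "cont_periodic L f" "cont_periodic L g"
  shows "\<bar>\<integral>v. f v * g v \<partial>cell_measure L\<bar> \<le> cell_norm2 L f * cell_norm2 L g"
proof (rule power2_le_imp_le)
  show "\<bar>\<integral>v. f v * g v \<partial>cell_measure L\<bar>\<^sup>2 \<le> (cell_norm2 L f * cell_norm2 L g)\<^sup>2"
    unfolding power2_abs power_mult_distrib cell_norm2_power2
    by (rule integral_Cauchy_Schwarz; rule integrable_cell_cont[OF assms(1)])
       (auto intro!: cont_periodic_power2 cont_periodic_mult assms)
qed (simp add: cell_norm2_nonneg)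

lemma cell_norm1_le_norm2:
  fixes f :: "real^'n \<Rightarrow> real"
  assumes L: "0 < L" and f: "cont_periodic L f"
  shows "cell_norm1 L f \<le> sqrt ((2 * L) ^ CARD('n)) * cell_norm2 L f"
proof -
  have "(\<integral>v. 1 \<partial>(cell_measure L :: (real^'n) measure)) = (2 * L) ^ CARD('n)"
    using measure_cell_measure[of L, where 'n = 'n] L by simp
  then show ?thesis
    using cell_Cauchy_Schwarz[OF L cont_periodic_const[of L 1] cont_periodic_abs[OF f]] cell_norm1_nonneg[of L f]
    by (simp add: cell_norm2_def cell_norm1_def)
qed

lemma cell_norm2_shift:
  "0 < L \<Longrightarrow> cont_periodic L f \<Longrightarrow> cell_norm2 L (\<lambda>v. f (v + y)) = cell_norm2 L f"
  unfolding cell_norm2_def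
  by (rule arg_cong[where f = sqrt], rule integral_cell_shift_cont[of L "\<lambda>v. (f v)\<^sup>2"]) (auto intro: cont_periodic_power2)

lemma cell_norm1_mono:
  assumes "0 < L" "cont_periodic L f" "cont_periodic L g" "\<And>v. \<bar>f v\<bar> \<le> \<bar>g v\<bar>"
  shows "cell_norm1 L f \<le> cell_norm1 L g"
  unfolding cell_norm1_def
  using assms by (intro integral_mono integrable_cell_cont cont_periodic_abs) auto

lemma cell_norm2_mono:
  assumes "0 < L" "cont_periodic L f" "cont_periodic L g" "\<And>v. \<bar>f v\<bar> \<le> \<bar>g v\<bar>"
  shows "cell_norm2 L f \<le> cell_norm2 L g"
  unfolding cell_norm2_def
  using assms by (intro real_sqrt_le_mono integral_mono integrable_cell_cont cont_periodic_power2)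
    (auto simp: abs_le_square_iff)

text \<open>What the analysis needs from the collision law: symmetry under exchange of the relative
  velocities q and q' before and after, and the two bounds saying that v - q and v + (q + q') / 2
  are spread over the cell with bounded density.\<close>

locale collision =
  fixes L C :: real and k :: "((real^'n::finite) \<times> (real^'n)) measure"
  assumes L_pos: "0 < L" and C_nonneg: "0 \<le> C" and k_finite: "finite_measure k"
    and k_sets [measurable_cong]: "sets k = sets (borel \<Otimes>\<^sub>M borel)"
    and k_swap: "distr k k (\<lambda>z. (snd z, fst z)) = k"
    and k_fst: "cont_periodic L h \<Longrightarrow> (\<And>x. 0 \<le> h x) \<Longrightarrow>
        (\<integral>z. h (v - fst z) \<partial>k) \<le> C * (\<integral>x. h x \<partial>cell_measure L)"
    and k_mid: "cont_periodic L h \<Longrightarrow> (\<And>x. 0 \<le> h x) \<Longrightarrow>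
        (\<integral>z. h (v + (1 / 2) *\<^sub>R (fst z + snd z)) \<partial>k) \<le> C * (\<integral>x. h x \<partial>cell_measure L)"
begin

sublocale K: finite_measure k by (rule k_finite)
sublocale CM: finite_measure "cell_measure L :: (real^'n) measure" by (rule finite_cell_measure)
sublocale CK: pair_sigma_finite "cell_measure L :: (real^'n) measure" k ..

abbreviation "cp \<equiv> cont_periodic L"

text \<open>Over a general normed field: the complex case serves products of Fourier modes, the real
  case the energy estimates.\<close>

definition gain :: "(real^'n \<Rightarrow> 'b::{real_normed_field, banach, second_countable_topology}) \<Rightarrow> (real^'n \<Rightarrow> 'b) \<Rightarrow> real^'n \<Rightarrow> 'b" where
  "gain g f v = (\<integral>z. g (v - (1 / 2) *\<^sub>R (fst z + snd z)) * f (v - (1 / 2) *\<^sub>R (fst z - snd z)) \<partial>k)"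

definition loss :: "(real^'n \<Rightarrow> 'b::{real_normed_field, banach, second_countable_topology}) \<Rightarrow> (real^'n \<Rightarrow> 'b) \<Rightarrow> real^'n \<Rightarrow> 'b" where
  "loss g f v = (\<integral>z. g (v - fst z) * f v \<partial>k)"

definition Q :: "(real^'n \<Rightarrow> 'b::{real_normed_field, banach, second_countable_topology}) \<Rightarrow> (real^'n \<Rightarrow> 'b) \<Rightarrow> real^'n \<Rightarrow> 'b" where
  "Q g f v = (\<integral>z. g (v - (1 / 2) *\<^sub>R (fst z + snd z)) * f (v - (1 / 2) *\<^sub>R (fst z - snd z)) - g (v - fst z) * f v \<partial>k)"

lemma k_measurable: "F \<in> borel_measurable (borel \<Otimes>\<^sub>M borel) \<Longrightarrow> F \<in> borel_measurable k"
  using k_sets measurable_cong_sets by blast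

lemma integrable_k_bounded:
  fixes F :: "(real^'n) \<times> (real^'n) \<Rightarrow> 'b::{banach, second_countable_topology}"
  assumes "continuous_on UNIV F" "\<And>z. norm (F z) \<le> B"
  shows "integrable k F"
  by (rule K.integrable_const_bound[of F B])
     (use assms in \<open>auto intro!: k_measurable borel_measurable_continuous_onI simp: borel_prod\<close>)

lemma k_measure: "measure k (space k) = measure k UNIV"
  using sets_eq_imp_space_eq[OF k_sets] by (simp add: space_pair_measure)

lemma integral_k_swap:
  fixes F :: "(real^'n) \<times> (real^'n) \<Rightarrow> 'b::{banach, second_countable_topology}"
  assumes F: "F \<in> borel_measurable (borel \<Otimes>\<^sub>M borel)"
  shows "(\<integral>z. F (snd z, fst z) \<partial>k) = (\<integral>z. F z \<partial>k)"
proof -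
  have m: "(\<lambda>z. (snd z, fst z)) \<in> measurable k k" by measurable
  have "(\<integral>z. F z \<partial>k) = (\<integral>z. F z \<partial>distr k k (\<lambda>z. (snd z, fst z)))" by (simp add: k_swap)
  also have "\<dots> = (\<integral>z. F (snd z, fst z) \<partial>k)"
    by (rule integral_distr[OF m k_measurable[OF F]])
  finally show ?thesis by simp
qed

lemma continuous_gain_integrand:
  fixes g f :: "real^'n \<Rightarrow> 'b::real_normed_field"
  assumes "continuous_on UNIV g" "continuous_on UNIV f"
  shows "continuous_on UNIV (\<lambda>z. g (v - (1 / 2) *\<^sub>R (fst z + snd z)) * f (v - (1 / 2) *\<^sub>R (fst z - snd z)))"
  by (intro continuous_intros continuous_on_compose2[OF assms(1)] continuous_on_compose2[OF assms(2)]) auto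

lemma continuous_loss_integrand:
  fixes g f :: "real^'n \<Rightarrow> 'b::real_normed_field"
  assumes "continuous_on UNIV g"
  shows "continuous_on UNIV (\<lambda>z :: (real^'n) \<times> (real^'n). g (v - fst z) * f v)"
  by (intro continuous_intros continuous_on_compose2[OF assms(1)]) auto

lemma
  fixes g f :: "real^'n \<Rightarrow> 'b::{real_normed_field, banach, second_countable_topology}"
  assumes g: "continuous_on UNIV g" "\<And>x. norm (g x) \<le> B" and f: "continuous_on UNIV f" "\<And>x. norm (f x) \<le> B'"
  shows integrable_gain: "integrable k (\<lambda>z. g (v - (1 / 2) *\<^sub>R (fst z + snd z)) * f (v - (1 / 2) *\<^sub>R (fst z - snd z)))"
    and integrable_loss: "integrable k (\<lambda>z. g (v - fst z) * f v)"
    and Q_gain_loss: "Q g f v = gain g f v - loss g f v"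
    and norm_Q_le: "norm (Q g f v) \<le> 2 * measure k UNIV * B * B'"
proof -
  have B: "0 \<le> B" using g(2)[of 0] norm_ge_zero order_trans by blast
  have bd: "norm (g x * f y) \<le> B * B'" for x y
    unfolding norm_mult by (intro mult_mono g f B) auto
  show ig: "integrable k (\<lambda>z. g (v - (1 / 2) *\<^sub>R (fst z + snd z)) * f (v - (1 / 2) *\<^sub>R (fst z - snd z)))"
    by (rule integrable_k_bounded[OF continuous_gain_integrand[OF g(1) f(1)] bd])
  show il: "integrable k (\<lambda>z. g (v - fst z) * f v)"
    by (rule integrable_k_bounded[OF continuous_loss_integrand[OF g(1)] bd])
  show "Q g f v = gain g f v - loss g f v"
    unfolding Q_def gain_def loss_def by (rule Bochner_Integration.integral_diff[OF ig il])
  have "norm (Q g f v) \<le> (\<integral>z. norm (g (v - (1 / 2) *\<^sub>R (fst z + snd z)) * f (v - (1 / 2) *\<^sub>R (fst z - snd z)) - g (v - fst z) * f v) \<partial>k)"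
    unfolding Q_def by (rule integral_norm_bound)
  also have "\<dots> \<le> (\<integral>z. 2 * B * B' \<partial>k)"
  proof (rule integral_mono)
    fix z
    show "norm (g (v - (1 / 2) *\<^sub>R (fst z + snd z)) * f (v - (1 / 2) *\<^sub>R (fst z - snd z)) - g (v - fst z) * f v) \<le> 2 * B * B'"
      by (rule order_trans[OF norm_triangle_ineq4], rule order_trans[OF add_mono[OF bd bd]]) simp
  qed (use ig il in auto)
  also have "\<dots> = 2 * measure k UNIV * B * B'" by (simp add: k_measure)
  finally show "norm (Q g f v) \<le> 2 * measure k UNIV * B * B'" .
qed

lemma
  fixes g f h :: "real^'n \<Rightarrow> 'b::{real_normed_field, banach, second_countable_topology}"
  assumes g: "continuous_on UNIV g" "\<And>x. norm (g x) \<le> B" and f: "continuous_on UNIV f" "\<And>x. norm (f x) \<le> B'"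
    and h: "continuous_on UNIV h" "\<And>x. norm (h x) \<le> B''"
  shows Q_add_left: "Q (\<lambda>x. g x + h x) f v = Q g f v + Q h f v"
    and Q_add_right: "Q f (\<lambda>x. g x + h x) v = Q f g v + Q f h v"
proof -
  let ?a = "\<lambda>z. v - (1 / 2) *\<^sub>R (fst z + snd z)" and ?b = "\<lambda>z. v - (1 / 2) *\<^sub>R (fst z - snd z)"
  have "Q (\<lambda>x. g x + h x) f v = (\<integral>z. (g (?a z) * f (?b z) - g (v - fst z) * f v)
      + (h (?a z) * f (?b z) - h (v - fst z) * f v) \<partial>k)"
    unfolding Q_def distrib_right by (simp only: add_diff_add)
  also have "\<dots> = Q g f v + Q h f v"
    unfolding Q_def
    by (intro Bochner_Integration.integral_add Bochner_Integration.integrable_diff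
        integrable_gain[OF g f] integrable_loss[OF g f] integrable_gain[OF h f] integrable_loss[OF h f])
  finally show "Q (\<lambda>x. g x + h x) f v = Q g f v + Q h f v" .
  have "Q f (\<lambda>x. g x + h x) v = (\<integral>z. (f (?a z) * g (?b z) - f (v - fst z) * g v)
      + (f (?a z) * h (?b z) - f (v - fst z) * h v) \<partial>k)"
    unfolding Q_def distrib_left by (simp only: add_diff_add)
  also have "\<dots> = Q f g v + Q f h v"
    unfolding Q_def
    by (intro Bochner_Integration.integral_add Bochner_Integration.integrable_diff
        integrable_gain[OF f g] integrable_loss[OF f g] integrable_gain[OF f h] integrable_loss[OF f h])
  finally show "Q f (\<lambda>x. g x + h x) v = Q f g v + Q f h v" .
qed

lemma Q_cmult_left: "Q (\<lambda>x. c * g x) f v = c * Q g f v"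
  unfolding Q_def by (subst integral_mult_right_zero[symmetric]) (simp add: algebra_simps)

lemma Q_cmult_right: "Q g (\<lambda>x. c * f x) v = c * Q g f v"
  unfolding Q_def by (subst integral_mult_right_zero[symmetric]) (simp add: algebra_simps)

lemma Q_of_real: "Q (\<lambda>x. complex_of_real (g x)) (\<lambda>x. complex_of_real (f x)) v = complex_of_real (Q g f v)"
  unfolding Q_def by (simp flip: integral_complex_of_real)

lemma Q_shift: "Q (\<lambda>x. g (x + y)) (\<lambda>x. f (x + y)) v = Q g f (v + y)"
  unfolding Q_def by (simp add: algebra_simps)

lemma continuous_integral_k:
  fixes F :: "real^'n \<Rightarrow> (real^'n) \<times> (real^'n) \<Rightarrow> 'b::{banach, second_countable_topology}"
  assumes "\<And>v. continuous_on UNIV (F v)" "\<And>z. continuous_on UNIV (\<lambda>v. F v z)" "\<And>v z. norm (F v z) \<le> B"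
  shows "continuous_on UNIV (\<lambda>v. \<integral>z. F v z \<partial>k)"
proof -
  have "isCont (\<lambda>v. \<integral>z. F v z \<partial>k) v" for v
    unfolding continuous_at_sequentially o_def
  proof (intro allI impI)
    fix x :: "nat \<Rightarrow> real^'n" assume x: "x \<longlonglongrightarrow> v"
    show "(\<lambda>n. \<integral>z. F (x n) z \<partial>k) \<longlonglongrightarrow> (\<integral>z. F v z \<partial>k)"
    proof (rule integral_dominated_convergence[where w = "\<lambda>_. B"])
      show "F v \<in> borel_measurable k" "F (x n) \<in> borel_measurable k" for n
        using assms(1) by (auto intro!: k_measurable borel_measurable_continuous_onI simp: borel_prod)
      show "AE z in k. (\<lambda>n. F (x n) z) \<longlonglongrightarrow> F v z"
      proof (rule AE_I2)
        fix z
        have "isCont (\<lambda>v. F v z) v" using assms(2) by (simp add: continuous_on_eq_continuous_at)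
        from isCont_tendsto_compose[OF this x] show "(\<lambda>n. F (x n) z) \<longlonglongrightarrow> F v z" .
      qed
    qed (use assms(3) in auto)
  qed
  then show ?thesis by (simp add: continuous_on_eq_continuous_at)
qed

lemma continuous_Q:
  fixes g f :: "real^'n \<Rightarrow> 'b::{real_normed_field, banach, second_countable_topology}"
  assumes g: "continuous_on UNIV g" "\<And>x. norm (g x) \<le> B" and f: "continuous_on UNIV f" "\<And>x. norm (f x) \<le> B'"
  shows "continuous_on UNIV (Q g f)"
proof -
  have B: "0 \<le> B" using g(2)[of 0] norm_ge_zero order_trans by blast
  have bd: "norm (g x * f y) \<le> B * B'" for x y
    unfolding norm_mult by (intro mult_mono g f B) auto
  show ?thesis
    unfolding Q_def[abs_def]
  proof (rule continuous_integral_k[where B = "B * B' + B * B'"])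
    show "continuous_on UNIV (\<lambda>z. g (v - (1 / 2) *\<^sub>R (fst z + snd z)) * f (v - (1 / 2) *\<^sub>R (fst z - snd z)) - g (v - fst z) * f v)" for v
      by (intro continuous_on_diff continuous_gain_integrand continuous_loss_integrand g f)
    show "continuous_on UNIV (\<lambda>v. g (v - (1 / 2) *\<^sub>R (fst z + snd z)) * f (v - (1 / 2) *\<^sub>R (fst z - snd z)) - g (v - fst z) * f v)" for z
      by (intro continuous_intros continuous_on_compose2[OF g(1)] continuous_on_compose2[OF f(1)] f(1)) auto
    show "norm (g (v - (1 / 2) *\<^sub>R (fst z + snd z)) * f (v - (1 / 2) *\<^sub>R (fst z - snd z)) - g (v - fst z) * f v) \<le> B * B' + B * B'" for v z
      by (rule norm_triangle_le_diff) (intro add_mono bd)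
  qed
qed

lemma cont_periodic_Q:
  fixes g f :: "real^'n \<Rightarrow> 'b::{real_normed_field, banach, second_countable_topology}"
  assumes g: "cp g" and f: "cp f"
  shows "cp (Q g f)"
proof -
  obtain B where B: "\<And>x. norm (g x) \<le> B" using cont_periodic_bounded[OF L_pos g] by metis
  obtain B' where B': "\<And>x. norm (f x) \<le> B'" using cont_periodic_bounded[OF L_pos f] by metis
  have "periodic L (Q g f)"
    unfolding periodic_def
  proof (intro allI)
    fix v :: "real^'n" and j :: 'n
    have "(\<lambda>x. g (x + (2 * L) *\<^sub>R axis j 1)) = g" "(\<lambda>x. f (x + (2 * L) *\<^sub>R axis j 1)) = f"
      using g f by (auto simp: cont_periodic_def periodic_def)
    then show "Q g f (v + (2 * L) *\<^sub>R axis j 1) = Q g f v"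
      using Q_shift[of g "(2 * L) *\<^sub>R axis j 1" f v] by simp
  qed
  then show ?thesis
    using continuous_Q[OF _ B _ B'] g f by (simp add: cont_periodic_def)
qed

subsection \<open>Weak form\<close>

lemma cell_k_measurable:
  fixes F :: "real^'n \<Rightarrow> (real^'n) \<times> (real^'n) \<Rightarrow> 'b::topological_space"
  assumes F: "continuous_on UNIV (\<lambda>w. F (fst w) (snd w))"
  shows "(\<lambda>w. F (fst w) (snd w)) \<in> borel_measurable (cell_measure L \<Otimes>\<^sub>M k)"
proof -
  have 1: "(\<lambda>w. F (fst w) (snd w)) \<in> borel_measurable (borel \<Otimes>\<^sub>M (borel \<Otimes>\<^sub>M borel))"
    using borel_measurable_continuous_onI[OF F] by (simp add: borel_prod)
  have 2: "(\<lambda>v. v) \<in> measurable (cell_measure L) (borel :: (real^'n) measure)"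
    by (rule measurable_cell_measureI) simp
  have 3: "(\<lambda>w. w) \<in> measurable (cell_measure L \<Otimes>\<^sub>M k)
      ((borel :: (real^'n) measure) \<Otimes>\<^sub>M ((borel :: (real^'n) measure) \<Otimes>\<^sub>M (borel :: (real^'n) measure)))"
  proof (rule measurable_pair)
    show "fst \<circ> (\<lambda>w. w) \<in> measurable (cell_measure L \<Otimes>\<^sub>M k) (borel :: (real^'n) measure)"
      using measurable_compose[OF measurable_fst[of "cell_measure L" k] 2] by (simp add: o_def)
    show "snd \<circ> (\<lambda>w. w) \<in> measurable (cell_measure L \<Otimes>\<^sub>M k) ((borel :: (real^'n) measure) \<Otimes>\<^sub>M (borel :: (real^'n) measure))"
      using measurable_snd[of "cell_measure L" k] measurable_cong_sets[OF refl k_sets] by (auto simp: o_def)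
  qed
  show ?thesis using measurable_compose[OF 3 1] by simp
qed

lemma integrable_cell_k:
  fixes F :: "real^'n \<Rightarrow> (real^'n) \<times> (real^'n) \<Rightarrow> 'b::{banach, second_countable_topology}"
  assumes F: "continuous_on UNIV (\<lambda>w. F (fst w) (snd w))" and B: "\<And>v z. norm (F v z) \<le> B"
  shows "integrable (cell_measure L \<Otimes>\<^sub>M k) (\<lambda>w. F (fst w) (snd w))"
proof -
  interpret P: finite_measure "cell_measure L \<Otimes>\<^sub>M k"
    by (rule finite_measure_pair_measure[OF k_finite finite_cell_measure])
  show ?thesis
    by (rule P.integrable_const_bound[of _ B]) (use B cell_k_measurable[OF F] in auto)
qed

lemma Fubini_cell_k:
  fixes F :: "real^'n \<Rightarrow> (real^'n) \<times> (real^'n) \<Rightarrow> 'b::{banach, second_countable_topology}"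
  assumes F: "continuous_on UNIV (\<lambda>w. F (fst w) (snd w))" and B: "\<And>v z. norm (F v z) \<le> B"
  shows "(\<integral>v. \<integral>z. F v z \<partial>k \<partial>cell_measure L) = (\<integral>z. \<integral>v. F v z \<partial>cell_measure L \<partial>k)"
    and "(\<integral>v. \<integral>z. F v z \<partial>k \<partial>cell_measure L) = (\<integral>w. F (fst w) (snd w) \<partial>(cell_measure L \<Otimes>\<^sub>M k))"
  using CK.Fubini_integral[of F] CK.integral_fst[of F] integrable_cell_k[OF F B]
  by (simp_all add: case_prod_beta')

end

context collision
begin

lemma cp_bound:
  fixes f :: "real^'n \<Rightarrow> real"
  assumes "cp f" obtains B where "0 \<le> B" "\<And>x. \<bar>f x\<bar> \<le> B"
  using cont_periodic_bounded[OF L_pos assms] by (metis real_norm_def)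

lemma cp_cont: "cp f \<Longrightarrow> continuous_on UNIV f" by (simp add: cont_periodic_def)

lemma cp_Q_gain_loss:
  fixes f g :: "real^'n \<Rightarrow> real"
  assumes "cp g" "cp f"
  shows "Q g f v = gain g f v - loss g f v"
  using cp_bound[OF assms(1)] cp_bound[OF assms(2)] Q_gain_loss[OF cp_cont[OF assms(1)] _ cp_cont[OF assms(2)]]
  by (metis real_norm_def)

lemma abs_mult3_le:
  fixes a b c :: real
  assumes "\<bar>a\<bar> \<le> A" "\<bar>b\<bar> \<le> B" "\<bar>c\<bar> \<le> D"
  shows "\<bar>a * b * c\<bar> \<le> A * B * D"
proof -
  have "0 \<le> A" "0 \<le> B" "0 \<le> D" using assms by linarith+
  then show ?thesis unfolding abs_mult using assms by (intro mult_mono mult_nonneg_nonneg) auto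
qed

text \<open>Shifting \<open>v\<close> by half the momentum transfer and exchanging the relative velocities
  before and after the collision moves the post-collisional arguments to the test function.\<close>
lemma gain_weak:
  fixes g f \<psi> :: "real^'n \<Rightarrow> real"
  assumes g: "cp g" and f: "cp f" and p: "cp \<psi>"
  shows "(\<integral>v. gain g f v * \<psi> v \<partial>cell_measure L)
    = (\<integral>v. \<integral>z. g (v - fst z) * f v * \<psi> (v - (1 / 2) *\<^sub>R (fst z - snd z)) \<partial>k \<partial>cell_measure L)"
proof -
  obtain A where A: "0 \<le> A" "\<And>x. \<bar>g x\<bar> \<le> A" using cp_bound[OF g] by metis
  obtain B where B: "0 \<le> B" "\<And>x. \<bar>f x\<bar> \<le> B" using cp_bound[OF f] by metis
  obtain D where D: "0 \<le> D" "\<And>x. \<bar>\<psi> x\<bar> \<le> D" using cp_bound[OF p] by metis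
  let ?F = "\<lambda>v z. g (v - (1 / 2) *\<^sub>R (fst z + snd z)) * f (v - (1 / 2) *\<^sub>R (fst z - snd z)) * \<psi> v"
  let ?G = "\<lambda>v z. g (v - fst z) * f v * \<psi> (v - (1 / 2) *\<^sub>R (fst z - snd z))"
  have cF: "continuous_on UNIV (\<lambda>w. ?F (fst w) (snd w))"
    by (intro continuous_intros continuous_on_compose2[OF cp_cont[OF g]]
        continuous_on_compose2[OF cp_cont[OF f]] continuous_on_compose2[OF cp_cont[OF p]]) auto
  have cG: "continuous_on UNIV (\<lambda>w. ?G (fst w) (snd w))"
    by (intro continuous_intros continuous_on_compose2[OF cp_cont[OF g]]
        continuous_on_compose2[OF cp_cont[OF f]] continuous_on_compose2[OF cp_cont[OF p]]) auto
  have bF: "norm (?F v z) \<le> A * B * D" and bG: "norm (?G v z) \<le> A * B * D" for v z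
    using abs_mult3_le[OF A(2) B(2) D(2)] by (auto simp del: abs_mult)
  have "(\<integral>v. gain g f v * \<psi> v \<partial>cell_measure L) = (\<integral>v. \<integral>z. ?F v z \<partial>k \<partial>cell_measure L)"
    unfolding gain_def by simp
  also have "\<dots> = (\<integral>z. \<integral>v. ?F v z \<partial>cell_measure L \<partial>k)"
    by (rule Fubini_cell_k(1)[OF cF bF])
  also have "\<dots> = (\<integral>z. \<integral>v. ?G v (snd z, fst z) \<partial>cell_measure L \<partial>k)"
  proof (rule Bochner_Integration.integral_cong)
    fix z :: "(real^'n) \<times> (real^'n)"
    let ?y = "(1 / 2) *\<^sub>R (fst z - snd z)"
    have "cp (\<lambda>v. ?F v z)"
      by (intro cont_periodic_mult cont_periodic_shift' g f p)
    from integral_cell_shift_cont[OF L_pos this, of ?y]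
    have "(\<integral>v. ?F v z \<partial>cell_measure L) = (\<integral>v. ?F (v + ?y) z \<partial>cell_measure L)" by simp
    also have "\<dots> = (\<integral>v. ?G v (snd z, fst z) \<partial>cell_measure L)"
    proof (rule Bochner_Integration.integral_cong)
      fix v :: "real^'n"
      have "fst z = (1 / 2) *\<^sub>R fst z + (1 / 2) *\<^sub>R fst z" "snd z = (1 / 2) *\<^sub>R snd z + (1 / 2) *\<^sub>R snd z"
        by (simp_all flip: scaleR_left_distrib)
      then have e: "v + ?y - (1 / 2) *\<^sub>R (fst z + snd z) = v - snd z" "v + ?y - ?y = v"
         "v + ?y = v - (1 / 2) *\<^sub>R (snd z - fst z)"
        by (simp_all add: scaleR_right_distrib scaleR_right_diff_distrib)
      show "?F (v + ?y) z = ?G v (snd z, fst z)"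
      proof -
        have "?F (v + ?y) z = g (v - snd z) * f v * \<psi> (v + ?y)" by (simp only: e(1,2))
        then show ?thesis by (simp only: e(3) fst_conv snd_conv)
      qed
    qed simp
    finally show "(\<integral>v. ?F v z \<partial>cell_measure L) = (\<integral>v. ?G v (snd z, fst z) \<partial>cell_measure L)" .
  qed simp
  also have "\<dots> = (\<integral>z. \<integral>v. ?G v z \<partial>cell_measure L \<partial>k)"
  proof (rule integral_k_swap)
    have "integrable k (\<lambda>z. \<integral>v. ?G v z \<partial>cell_measure L)"
      by (rule CK.integrable_snd) (use integrable_cell_k[OF cG bG] in \<open>simp add: case_prod_beta'\<close>)
    then have "(\<lambda>z. \<integral>v. ?G v z \<partial>cell_measure L) \<in> borel_measurable k"
      by (rule borel_measurable_integrable)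
    then show "(\<lambda>z. \<integral>v. ?G v z \<partial>cell_measure L) \<in> borel_measurable (borel \<Otimes>\<^sub>M borel)"
      using measurable_cong_sets[OF k_sets refl] by blast
  qed
  also have "\<dots> = (\<integral>v. \<integral>z. ?G v z \<partial>k \<partial>cell_measure L)"
    by (rule Fubini_cell_k(1)[OF cG bG, symmetric])
  finally show ?thesis .
qed

lemma k_fst_abs:
  assumes g: "cp g" shows "(\<integral>z. \<bar>g (v - fst z)\<bar> \<partial>k) \<le> C * cell_norm1 L g"
  using k_fst[OF cont_periodic_abs[OF g]] by (simp add: cell_norm1_def)

text \<open>Cauchy-Schwarz on the product of the cell and the collision law, with |g(v - q)| split
  evenly between f and \<psi>. In the factor with f the integral over q is bounded by
  \<open>k_fst\<close>. In the other the shift v -> v + q brings g to the point v and \<psi> to v +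
  (q + q') / 2, so \<open>k_mid\<close> applies.\<close>

lemma gain_estimate:
  fixes g f \<psi> :: "real^'n \<Rightarrow> real"
  assumes g: "cp g" and f: "cp f" and p: "cp \<psi>"
  shows "\<bar>\<integral>v. gain g f v * \<psi> v \<partial>cell_measure L\<bar> \<le> C * cell_norm1 L g * cell_norm2 L f * cell_norm2 L \<psi>"
proof -
  obtain A where A: "0 \<le> A" "\<And>x. \<bar>g x\<bar> \<le> A" using cp_bound[OF g] by metis
  obtain B where B: "0 \<le> B" "\<And>x. \<bar>f x\<bar> \<le> B" using cp_bound[OF f] by metis
  obtain D where D: "0 \<le> D" "\<And>x. \<bar>\<psi> x\<bar> \<le> D" using cp_bound[OF p] by metis
  note cg = continuous_on_compose2[OF cp_cont[OF g]] and cf = continuous_on_compose2[OF cp_cont[OF f]]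
    and cpsi = continuous_on_compose2[OF cp_cont[OF p]]
  define s where "s v z = sqrt \<bar>g (v - fst z)\<bar>" for v and z :: "(real^'n) \<times> (real^'n)"
  define X where "X v z = s v z * f v" for v z
  define Y where "Y v z = s v z * sgn (g (v - fst z)) * \<psi> (v - (1 / 2) *\<^sub>R (fst z - snd z))" for v z
  define Y' where "Y' v z = s v z * \<psi> (v - (1 / 2) *\<^sub>R (fst z - snd z))" for v z
  let ?P = "cell_measure L \<Otimes>\<^sub>M k"
  let ?G = "\<lambda>v z. g (v - fst z) * f v * \<psi> (v - (1 / 2) *\<^sub>R (fst z - snd z))"
  \<comment> \<open>The factors 1 bring both squares into the shape of a product of three bounded
    factors, so that \<open>abs_mult3_le\<close> covers every bound needed for Fubini.\<close>
  let ?X2 = "\<lambda>v z. \<bar>g (v - fst z)\<bar> * (f v)\<^sup>2 * 1"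
  let ?Y2 = "\<lambda>v z. \<bar>g (v - fst z)\<bar> * 1 * (\<psi> (v - (1 / 2) *\<^sub>R (fst z - snd z)))\<^sup>2"
  have XY: "X v z * Y v z = ?G v z" for v z
  proof -
    have "s v z * s v z = \<bar>g (v - fst z)\<bar>" by (simp add: s_def)
    then have "s v z * s v z * sgn (g (v - fst z)) = g (v - fst z)"
      by (simp add: abs_mult_sgn)
    then show ?thesis by (simp add: X_def Y_def)
  qed
  have X2: "(X v z)\<^sup>2 = ?X2 v z" for v z
    by (simp add: X_def s_def power_mult_distrib)
  have Y2: "(Y v z)\<^sup>2 = ?Y2 v z" for v z
    by (cases "g (v - fst z) = 0") (simp_all add: Y_def s_def power_mult_distrib sgn_if)
  have cG: "continuous_on UNIV (\<lambda>w. ?G (fst w) (snd w))"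
    by (intro continuous_intros cg cf cpsi) auto
  have cX2: "continuous_on UNIV (\<lambda>w. ?X2 (fst w) (snd w))"
    by (intro continuous_intros cg cf cpsi) auto
  have cY2: "continuous_on UNIV (\<lambda>w. ?Y2 (fst w) (snd w))"
    by (intro continuous_intros cg cf cpsi) auto
  have sq: "\<bar>x\<^sup>2\<bar> \<le> M\<^sup>2" if "\<bar>x\<bar> \<le> M" for x M :: real
    using power_mono[OF that, of 2] by simp
  have bG: "norm (?G v z) \<le> A * B * D" for v z
    using abs_mult3_le[OF A(2) B(2) D(2)] by (simp del: abs_mult)
  have bX2: "norm (?X2 v z) \<le> A * B\<^sup>2 * 1" for v z
    unfolding real_norm_def by (rule abs_mult3_le) (use A B sq in auto)
  have bY2: "norm (?Y2 v z) \<le> A * 1 * D\<^sup>2" for v z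
    unfolding real_norm_def by (rule abs_mult3_le) (use A D sq in auto)
  have iX: "(\<integral>v. \<integral>z. ?X2 v z \<partial>k \<partial>cell_measure L) \<le> C * cell_norm1 L g * (cell_norm2 L f)\<^sup>2"
  proof -
    have "(\<integral>v. \<integral>z. ?X2 v z \<partial>k \<partial>cell_measure L) \<le> (\<integral>v. (C * cell_norm1 L g) * (f v)\<^sup>2 \<partial>cell_measure L)"
    proof (rule integral_mono')
      show "integrable (cell_measure L) (\<lambda>v. (C * cell_norm1 L g) * (f v)\<^sup>2)"
        by (intro integrable_cell_cont[OF L_pos] cont_periodic_mult cont_periodic_const cont_periodic_power2 f)
      show "(\<integral>z. ?X2 v z \<partial>k) \<le> (C * cell_norm1 L g) * (f v)\<^sup>2" for v
        using mult_right_mono[OF k_fst_abs[OF g, of v], of "(f v)\<^sup>2"] by simp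
      show "0 \<le> (C * cell_norm1 L g) * (f v)\<^sup>2" for v
        by (intro mult_nonneg_nonneg C_nonneg cell_norm1_nonneg) simp
    qed
    then show ?thesis by (simp add: cell_norm2_power2)
  qed
  have iY: "(\<integral>v. \<integral>z. ?Y2 v z \<partial>k \<partial>cell_measure L) \<le> C * cell_norm1 L g * (cell_norm2 L \<psi>)\<^sup>2"
  proof -
    let ?H = "\<lambda>v z. \<bar>g v\<bar> * (\<psi> (v + (1 / 2) *\<^sub>R (fst z + snd z)))\<^sup>2 * 1"
    have cH: "continuous_on UNIV (\<lambda>w. ?H (fst w) (snd w))"
      by (intro continuous_intros cg cf cpsi) auto
    have bH: "norm (?H v z) \<le> A * D\<^sup>2 * 1" for v z
      unfolding real_norm_def by (rule abs_mult3_le) (use A D sq in auto)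
    have "(\<integral>v. \<integral>z. ?Y2 v z \<partial>k \<partial>cell_measure L) = (\<integral>z. \<integral>v. ?Y2 v z \<partial>cell_measure L \<partial>k)"
      by (rule Fubini_cell_k(1)[OF cY2 bY2])
    also have "\<dots> = (\<integral>z. \<integral>v. ?H v z \<partial>cell_measure L \<partial>k)"
    proof (rule Bochner_Integration.integral_cong)
      fix z :: "(real^'n) \<times> (real^'n)"
      have "cp (\<lambda>v. ?Y2 v z)"
        by (intro cont_periodic_mult cont_periodic_shift'[where f = "\<lambda>v. \<bar>g v\<bar>"]
            cont_periodic_shift'[where f = "\<lambda>v. (\<psi> v)\<^sup>2"] cont_periodic_abs cont_periodic_power2
            cont_periodic_const g p)
      from integral_cell_shift_cont[OF L_pos this, of "fst z"]
      have "(\<integral>v. ?Y2 v z \<partial>cell_measure L) = (\<integral>v. ?Y2 (v + fst z) z \<partial>cell_measure L)" by simp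
      also have "\<dots> = (\<integral>v. ?H v z \<partial>cell_measure L)"
      proof (rule Bochner_Integration.integral_cong)
        fix v :: "real^'n"
        have "fst z = (1 / 2) *\<^sub>R fst z + (1 / 2) *\<^sub>R fst z" by (simp flip: scaleR_left_distrib)
        then have "v + fst z - (1 / 2) *\<^sub>R (fst z - snd z) = v + (1 / 2) *\<^sub>R (fst z + snd z)"
          by (simp add: scaleR_right_distrib scaleR_right_diff_distrib)
        then show "?Y2 (v + fst z) z = ?H v z" by (simp only: add_diff_cancel_right' mult_1_right)
      qed simp
      finally show "(\<integral>v. ?Y2 v z \<partial>cell_measure L) = (\<integral>v. ?H v z \<partial>cell_measure L)" .
    qed simp
    also have "\<dots> = (\<integral>v. \<integral>z. ?H v z \<partial>k \<partial>cell_measure L)"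
      by (rule Fubini_cell_k(1)[OF cH bH, symmetric])
    also have "\<dots> \<le> (\<integral>v. \<bar>g v\<bar> * (C * (cell_norm2 L \<psi>)\<^sup>2) \<partial>cell_measure L)"
    proof (rule integral_mono')
      show "integrable (cell_measure L) (\<lambda>v. \<bar>g v\<bar> * (C * (cell_norm2 L \<psi>)\<^sup>2))"
        by (intro integrable_cell_cont[OF L_pos] cont_periodic_mult cont_periodic_const cont_periodic_abs g)
      show "(\<integral>z. ?H v z \<partial>k) \<le> \<bar>g v\<bar> * (C * (cell_norm2 L \<psi>)\<^sup>2)" for v
        using mult_left_mono[OF k_mid[OF cont_periodic_power2[OF p], of v], of "\<bar>g v\<bar>"]
        by (simp add: cell_norm2_power2)
      show "0 \<le> \<bar>g v\<bar> * (C * (cell_norm2 L \<psi>)\<^sup>2)" for v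
        using C_nonneg by simp
    qed
    also have "\<dots> = C * cell_norm1 L g * (cell_norm2 L \<psi>)\<^sup>2" by (simp add: cell_norm1_def mult_ac)
    finally show ?thesis .
  qed
  have "(\<integral>v. gain g f v * \<psi> v \<partial>cell_measure L) = (\<integral>w. ?G (fst w) (snd w) \<partial>?P)"
    unfolding gain_weak[OF g f p] by (rule Fubini_cell_k(2)[OF cG bG])
  then have "(\<integral>v. gain g f v * \<psi> v \<partial>cell_measure L)\<^sup>2 = (\<integral>w. X (fst w) (snd w) * Y (fst w) (snd w) \<partial>?P)\<^sup>2"
    by (simp only: XY)
  also have "\<dots> \<le> (\<integral>w. (X (fst w) (snd w))\<^sup>2 \<partial>?P) * (\<integral>w. (Y (fst w) (snd w))\<^sup>2 \<partial>?P)"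
    by (rule integral_Cauchy_Schwarz; unfold XY X2 Y2)
       (rule integrable_cell_k[OF cX2 bX2], rule integrable_cell_k[OF cY2 bY2], rule integrable_cell_k[OF cG bG])
  also have "\<dots> = (\<integral>v. \<integral>z. ?X2 v z \<partial>k \<partial>cell_measure L) * (\<integral>v. \<integral>z. ?Y2 v z \<partial>k \<partial>cell_measure L)"
    unfolding X2 Y2 Fubini_cell_k(2)[OF cX2 bX2] Fubini_cell_k(2)[OF cY2 bY2] ..
  also have "\<dots> \<le> (C * cell_norm1 L g * (cell_norm2 L f)\<^sup>2) * (C * cell_norm1 L g * (cell_norm2 L \<psi>)\<^sup>2)"
    by (rule mult_mono[OF iX iY])
       (auto intro!: mult_nonneg_nonneg C_nonneg cell_norm1_nonneg Bochner_Integration.integral_nonneg)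
  also have "\<dots> = (C * cell_norm1 L g * cell_norm2 L f * cell_norm2 L \<psi>)\<^sup>2"
    by (simp add: power2_eq_square mult_ac)
  finally have *: "\<bar>\<integral>v. gain g f v * \<psi> v \<partial>cell_measure L\<bar>\<^sup>2
      \<le> (C * cell_norm1 L g * cell_norm2 L f * cell_norm2 L \<psi>)\<^sup>2"
    by (simp only: power2_abs)
  have "0 \<le> C * cell_norm1 L g * cell_norm2 L f * cell_norm2 L \<psi>"
    by (intro mult_nonneg_nonneg C_nonneg cell_norm1_nonneg cell_norm2_nonneg)
  with * show ?thesis by (rule power2_le_imp_le)
qed

lemma loss_eq: "loss g f v = (\<integral>z. g (v - fst z) \<partial>k) * f v" for g f :: "real^'n \<Rightarrow> real"
  by (simp add: loss_def)

lemma abs_integral_fst_le: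
  assumes "cp g" shows "\<bar>\<integral>z. g (v - fst z) \<partial>k\<bar> \<le> C * cell_norm1 L g"
  using integral_abs_bound[of k "\<lambda>z. g (v - fst z)"] k_fst_abs[OF assms, of v] by linarith

lemma cp_loss:
  fixes g f :: "real^'n \<Rightarrow> real"
  assumes g: "cp g" and f: "cp f" shows "cp (loss g f)"
proof -
  obtain A where A: "\<And>x. \<bar>g x\<bar> \<le> A" using cp_bound[OF g] by metis
  have "continuous_on UNIV (\<lambda>v. \<integral>z. g (v - fst z) \<partial>k)"
    by (rule continuous_integral_k[where B = A]) (use A in \<open>auto intro!: continuous_intros continuous_on_compose2[OF cp_cont[OF g]]\<close>)
  moreover have "periodic L (\<lambda>v. \<integral>z. g (v - fst z) \<partial>k)"
    unfolding periodic_def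
  proof (intro allI, rule Bochner_Integration.integral_cong)
    fix v :: "real^'n" and j and z :: "(real^'n) \<times> (real^'n)"
    have "v + (2 * L) *\<^sub>R axis j 1 - fst z = (v - fst z) + (2 * L) *\<^sub>R axis j 1" by simp
    then show "g (v + (2 * L) *\<^sub>R axis j 1 - fst z) = g (v - fst z)"
      using g unfolding cont_periodic_def periodic_def by metis
  qed simp
  ultimately have "cp (\<lambda>v. \<integral>z. g (v - fst z) \<partial>k)" by (simp add: cont_periodic_def)
  then show ?thesis unfolding loss_eq[abs_def] using f by (rule cont_periodic_mult)
qed

lemma cp_gain:
  fixes g f :: "real^'n \<Rightarrow> real"
  assumes g: "cp g" and f: "cp f" shows "cp (gain g f)"
proof -
  have "gain g f = (\<lambda>v. Q g f v + loss g f v)" using cp_Q_gain_loss[OF g f] by auto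
  then show ?thesis using cont_periodic_add[OF cont_periodic_Q[OF g f] cp_loss[OF g f]] by simp
qed

lemma loss_estimate:
  fixes g f \<psi> :: "real^'n \<Rightarrow> real"
  assumes g: "cp g" and f: "cp f" and p: "cp \<psi>"
  shows "\<bar>\<integral>v. loss g f v * \<psi> v \<partial>cell_measure L\<bar> \<le> C * cell_norm1 L g * cell_norm2 L f * cell_norm2 L \<psi>"
proof -
  have "\<bar>\<integral>v. loss g f v * \<psi> v \<partial>cell_measure L\<bar> \<le> (\<integral>v. \<bar>loss g f v * \<psi> v\<bar> \<partial>cell_measure L)"
    by (rule integral_abs_bound)
  also have "\<dots> \<le> (\<integral>v. C * cell_norm1 L g * (\<bar>f v\<bar> * \<bar>\<psi> v\<bar>) \<partial>cell_measure L)"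
  proof (rule integral_mono)
    show "integrable (cell_measure L) (\<lambda>v. \<bar>loss g f v * \<psi> v\<bar>)"
      "integrable (cell_measure L) (\<lambda>v. C * cell_norm1 L g * (\<bar>f v\<bar> * \<bar>\<psi> v\<bar>))"
      by (intro integrable_cell_cont[OF L_pos] cont_periodic_abs cont_periodic_mult cont_periodic_const cp_loss g f p)+
    show "\<bar>loss g f v * \<psi> v\<bar> \<le> C * cell_norm1 L g * (\<bar>f v\<bar> * \<bar>\<psi> v\<bar>)" for v
      using mult_right_mono[OF abs_integral_fst_le[OF g, of v], of "\<bar>f v\<bar> * \<bar>\<psi> v\<bar>"]
      by (simp add: loss_eq abs_mult mult_ac)
  qed
  also have "\<dots> = C * cell_norm1 L g * (\<integral>v. \<bar>f v\<bar> * \<bar>\<psi> v\<bar> \<partial>cell_measure L)" by simp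
  also have "(\<integral>v. \<bar>f v\<bar> * \<bar>\<psi> v\<bar> \<partial>cell_measure L) \<le> cell_norm2 L f * cell_norm2 L \<psi>"
    using cell_Cauchy_Schwarz[OF L_pos cont_periodic_abs[OF f] cont_periodic_abs[OF p]]
    by (simp add: cell_norm2_def)
  finally show ?thesis
    by (simp add: mult_left_mono C_nonneg cell_norm1_nonneg mult.assoc)
qed

lemma Q_estimate:
  fixes g f \<psi> :: "real^'n \<Rightarrow> real"
  assumes g: "cp g" and f: "cp f" and p: "cp \<psi>"
  shows "\<bar>\<integral>v. Q g f v * \<psi> v \<partial>cell_measure L\<bar> \<le> 2 * C * cell_norm1 L g * cell_norm2 L f * cell_norm2 L \<psi>"
proof -
  have "(\<integral>v. Q g f v * \<psi> v \<partial>cell_measure L)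
      = (\<integral>v. gain g f v * \<psi> v \<partial>cell_measure L) - (\<integral>v. loss g f v * \<psi> v \<partial>cell_measure L)"
    unfolding cp_Q_gain_loss[OF g f] left_diff_distrib
    by (intro Bochner_Integration.integral_diff integrable_cell_cont[OF L_pos] cont_periodic_mult cp_gain cp_loss g f p)
  then show ?thesis using gain_estimate[OF g f p] loss_estimate[OF g f p] by linarith
qed

text \<open>Conservation of mass: tested with the constant 1, the weak form of the gain is the
  loss.\<close>

lemma integral_Q_eq_0:
  fixes f :: "real^'n \<Rightarrow> real"
  assumes f: "cp f"
  shows "(\<integral>v. Q f f v \<partial>cell_measure L) = 0"
proof -
  have "(\<integral>v. gain f f v \<partial>cell_measure L) = (\<integral>v. loss f f v \<partial>cell_measure L)"
    using gain_weak[OF f f cont_periodic_const[of L 1]] by (simp add: loss_def)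
  then show ?thesis
    unfolding cp_Q_gain_loss[OF f f]
    by (subst Bochner_Integration.integral_diff) (auto intro!: integrable_cell_cont[OF L_pos] cp_gain cp_loss f)
qed

text \<open>For \<open>f = p - w\<close> with \<open>p = max f 0\<close> the gain terms of \<open>(p, p)\<close> and \<open>(w, w)\<close> have the good sign,
  so every remaining term is at least quadratic in \<open>w\<close>.\<close>
lemma neg_part_estimate:
  fixes f :: "real^'n \<Rightarrow> real"
  assumes f: "cp f"
  defines "w \<equiv> \<lambda>v. max (- f v) 0"
  shows "- (\<integral>v. Q f f v * w v \<partial>cell_measure L)
      \<le> 3 * C * sqrt ((2 * L) ^ CARD('n)) * cell_norm2 L f * (cell_norm2 L w)\<^sup>2"
proof -
  define p where "p v = max (f v) 0" for v
  define c where "c = sqrt ((2 * L) ^ CARD('n))"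
  have w: "cp w" unfolding w_def by (rule cont_periodic_compose[OF f]) (intro continuous_intros)
  have p: "cp p" unfolding p_def[abs_def] by (rule cont_periodic_compose[OF f]) (intro continuous_intros)
  have pf: "\<bar>p v\<bar> \<le> \<bar>f v\<bar>" for v by (auto simp: p_def)
  have n1: "cell_norm1 L p \<le> c * cell_norm2 L f" "cell_norm1 L f \<le> c * cell_norm2 L f"
    "cell_norm1 L w \<le> c * cell_norm2 L w"
    using cell_norm1_mono[OF L_pos p f pf] cell_norm1_le_norm2[OF L_pos f] cell_norm1_le_norm2[OF L_pos w]
    by (auto simp: c_def)
  have n2: "cell_norm2 L p \<le> cell_norm2 L f"
    by (rule cell_norm2_mono[OF L_pos p f pf])
  obtain B where B: "\<And>x. \<bar>f x\<bar> \<le> B" using cp_bound[OF f] by metis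
  have gain_ge: "- gain p w v - gain w p v \<le> gain f f v" for v
  proof -
    have ip: "integrable k (\<lambda>z. g (v - (1 / 2) *\<^sub>R (fst z + snd z)) * h (v - (1 / 2) *\<^sub>R (fst z - snd z)))"
      if gh: "cp g" "cp h" for g h :: "real^'n \<Rightarrow> real"
    proof -
      obtain B1 where 1: "\<And>x. norm (g x) \<le> B1" using cont_periodic_bounded[OF L_pos gh(1)] by metis
      obtain B2 where 2: "\<And>x. norm (h x) \<le> B2" using cont_periodic_bounded[OF L_pos gh(2)] by metis
      show ?thesis by (rule integrable_gain[OF cp_cont[OF gh(1)] 1 cp_cont[OF gh(2)] 2])
    qed
    have pt: "- (p x * w y) - w x * p y \<le> f x * f y" for x y
    proof -
      have "f x * f y = (p x - w x) * (p y - w y)" by (auto simp: p_def w_def max_def)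
      moreover have "0 \<le> p x * p y" "0 \<le> w x * w y" by (auto simp: p_def w_def)
      ultimately show ?thesis by (simp add: algebra_simps)
    qed
    have "- gain p w v - gain w p v = (\<integral>z. - (p (v - (1 / 2) *\<^sub>R (fst z + snd z)) * w (v - (1 / 2) *\<^sub>R (fst z - snd z)))
          - w (v - (1 / 2) *\<^sub>R (fst z + snd z)) * p (v - (1 / 2) *\<^sub>R (fst z - snd z)) \<partial>k)"
      unfolding gain_def
      by (subst Bochner_Integration.integral_diff) (auto intro!: ip p w Bochner_Integration.integrable_minus)
    also have "\<dots> \<le> gain f f v"
      unfolding gain_def
      by (rule integral_mono) (auto intro!: ip p w f Bochner_Integration.integrable_minus Bochner_Integration.integrable_diff pt)
    finally show ?thesis .
  qed
  have w0: "0 \<le> w v" for v by (simp add: w_def)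
  have "- (\<integral>v. Q f f v * w v \<partial>cell_measure L) = (\<integral>v. - (Q f f v * w v) \<partial>cell_measure L)" by simp
  also have "\<dots> \<le> (\<integral>v. gain p w v * w v + gain w p v * w v - loss f w v * w v \<partial>cell_measure L)"
  proof (rule integral_mono)
    show "integrable (cell_measure L) (\<lambda>v. - (Q f f v * w v))"
      "integrable (cell_measure L) (\<lambda>v. gain p w v * w v + gain w p v * w v - loss f w v * w v)"
      by (intro Bochner_Integration.integrable_minus Bochner_Integration.integrable_add Bochner_Integration.integrable_diff
          integrable_cell_cont[OF L_pos] cont_periodic_mult cont_periodic_Q cp_gain cp_loss f p w)+
    fix v
    \<comment> \<open>Only points with w positive count, and there f = - w; so the loss term is
      quadratic in w as well.\<close>
    have "f v * w v = - (w v * w v)" by (auto simp: w_def max_def)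
    then have l: "loss f f v * w v = - (loss f w v * w v)"
      by (simp add: loss_eq mult.assoc)
    have "(- gain p w v - gain w p v) * w v \<le> gain f f v * w v"
      by (rule mult_right_mono[OF gain_ge w0])
    then show "- (Q f f v * w v) \<le> gain p w v * w v + gain w p v * w v - loss f w v * w v"
      using l by (simp add: cp_Q_gain_loss[OF f f] algebra_simps)
  qed
  also have "\<dots> = (\<integral>v. gain p w v * w v \<partial>cell_measure L) + (\<integral>v. gain w p v * w v \<partial>cell_measure L)
      - (\<integral>v. loss f w v * w v \<partial>cell_measure L)"
  proof -
    have "integrable (cell_measure L) (\<lambda>v. gain p w v * w v)" "integrable (cell_measure L) (\<lambda>v. gain w p v * w v)"
      "integrable (cell_measure L) (\<lambda>v. loss f w v * w v)"
      by (intro integrable_cell_cont[OF L_pos] cont_periodic_mult cp_gain cp_loss f p w)+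
    then show ?thesis by simp
  qed
  also have "\<dots> \<le> C * cell_norm1 L p * cell_norm2 L w * cell_norm2 L w
      + C * cell_norm1 L w * cell_norm2 L p * cell_norm2 L w + C * cell_norm1 L f * cell_norm2 L w * cell_norm2 L w"
    using gain_estimate[OF p w w] gain_estimate[OF w p w] loss_estimate[OF f w w] by linarith
  \<comment> \<open>Each L^1 norm is traded for an L^2 norm at the price \<open>c\<close>; the three
    terms then have the same bound, hence the 3.\<close>
  also have "\<dots> \<le> C * (c * cell_norm2 L f) * cell_norm2 L w * cell_norm2 L w
      + C * (c * cell_norm2 L w) * cell_norm2 L f * cell_norm2 L w + C * (c * cell_norm2 L f) * cell_norm2 L w * cell_norm2 L w"
    using n1 n2 L_pos
    by (intro add_mono mult_mono mult_right_mono mult_left_mono mult_nonneg_nonneg C_nonneg cell_norm1_nonneg cell_norm2_nonneg)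
       (auto simp: c_def)
  also have "\<dots> = 3 * C * c * cell_norm2 L f * (cell_norm2 L w)\<^sup>2" by (simp add: power2_eq_square algebra_simps)
  finally show ?thesis by (simp add: c_def)
qed

end

section \<open>The cut-off kernel satisfies the abstract collision bounds\<close>

context cutoff_kernel
begin

definition est_const :: real where
  "est_const = enn2real (ennreal \<Phi>_sup * b_mass) + enn2real J_const"

lemma ennreal_integral_coll:
  assumes "F \<in> borel_measurable (borel \<Otimes>\<^sub>M borel)" "\<And>z. 0 \<le> F z" "\<And>z. F z \<le> B"
  shows "ennreal (\<integral>z. F z \<partial>coll) = (\<integral>\<^sup>+z. ennreal (F z) \<partial>coll)"
proof -
  have "integrable coll F"
    by (rule finite_measure.integrable_const_bound[OF finite_coll, of _ B])
       (use assms in auto)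
  then show ?thesis using assms(2) by (intro nn_integral_eq_integral[symmetric]) auto
qed

lemma integral_le_of_nn:
  assumes "ennreal x \<le> c * ennreal y" "c \<noteq> \<infinity>" "0 \<le> y"
  shows "x \<le> enn2real c * y"
proof -
  have "c = ennreal (enn2real c)" using assms(2) by (simp add: less_top)
  then have "ennreal x \<le> ennreal (enn2real c * y)"
    using assms(1,3) by (metis ennreal_mult' enn2real_nonneg)
  then show ?thesis using assms(3) by (simp add: ennreal_le_iff)
qed

lemma collision_coll: "collision L est_const coll"
proof (rule collision.intro)
  show "0 < L" by (rule L_pos)
  show "0 \<le> est_const" by (simp add: est_const_def)
  show "finite_measure coll" by (rule finite_coll)
  show "sets coll = sets (borel \<Otimes>\<^sub>M borel)" by simp
  show "distr coll coll (\<lambda>z. (snd z, fst z)) = coll" by (rule distr_coll_swap)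
next
  fix h :: "real^'n \<Rightarrow> real" and v :: "real^'n"
  assume h: "cont_periodic L h" and pos: "\<And>x. 0 \<le> h x"
  have [measurable]: "h \<in> borel_measurable borel" using h by (rule cont_periodic_measurable)
  obtain B where B: "\<And>x. norm (h x) \<le> B" using cont_periodic_bounded[OF L_pos h] by metis
  have hB: "h x \<le> B" for x using B[of x] by simp
  have I: "ennreal (\<integral>x. h x \<partial>cell_measure L) = (\<integral>\<^sup>+x. ennreal (h x) \<partial>cell_measure L)"
    using integrable_cell_cont[OF L_pos h] pos by (intro nn_integral_eq_integral[symmetric]) auto
  have I0: "0 \<le> (\<integral>x. h x \<partial>cell_measure L)" using pos by simp
  have fin1: "ennreal \<Phi>_sup * b_mass \<noteq> \<infinity>" and fin2: "J_const \<noteq> \<infinity>"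
    using b_mass_finite by (auto simp: J_const_def ennreal_mult_eq_top_iff)
  have "ennreal (\<integral>z. h (v - fst z) \<partial>coll) = (\<integral>\<^sup>+z. ennreal (h (v - fst z)) \<partial>coll)"
    by (rule ennreal_integral_coll) (use pos hB in measurable)
  also have "\<dots> \<le> ennreal \<Phi>_sup * b_mass * (\<integral>\<^sup>+q. ennreal (h (v - q)) * indicator (cball 0 R) q \<partial>lborel)"
    by (rule nn_integral_coll_fst_le) measurable
  also have "\<dots> \<le> ennreal \<Phi>_sup * b_mass * ennreal (\<integral>x. h x \<partial>cell_measure L)"
    unfolding I by (intro mult_left_mono nn_integral_ball_le_cell)
      (use L_pos RL h in \<open>auto simp: cont_periodic_def periodic_def\<close>)
  finally have "(\<integral>z. h (v - fst z) \<partial>coll) \<le> enn2real (ennreal \<Phi>_sup * b_mass) * (\<integral>x. h x \<partial>cell_measure L)"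
    by (rule integral_le_of_nn[OF _ fin1 I0])
  also have "\<dots> \<le> est_const * (\<integral>x. h x \<partial>cell_measure L)"
    by (rule mult_right_mono[OF _ I0]) (simp add: est_const_def)
  finally show "(\<integral>z. h (v - fst z) \<partial>coll) \<le> est_const * (\<integral>x. h x \<partial>cell_measure L)" .
  have "ennreal (\<integral>z. h (v + (1 / 2) *\<^sub>R (fst z + snd z)) \<partial>coll)
      = (\<integral>\<^sup>+z. ennreal (h (v + (1 / 2) *\<^sub>R (fst z + snd z))) \<partial>coll)"
    by (rule ennreal_integral_coll) (use pos hB in measurable)
  also have "\<dots> \<le> J_const * ennreal (\<integral>x. h x \<partial>cell_measure L)"
    unfolding I by (rule nn_integral_coll_mid_le[OF h pos])
  finally have "(\<integral>z. h (v + (1 / 2) *\<^sub>R (fst z + snd z)) \<partial>coll) \<le> enn2real J_const * (\<integral>x. h x \<partial>cell_measure L)"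
    by (rule integral_le_of_nn[OF _ fin2 I0])
  also have "\<dots> \<le> est_const * (\<integral>x. h x \<partial>cell_measure L)"
    by (rule mult_right_mono[OF _ I0]) (simp add: est_const_def)
  finally show "(\<integral>z. h (v + (1 / 2) *\<^sub>R (fst z + snd z)) \<partial>coll) \<le> est_const * (\<integral>x. h x \<partial>cell_measure L)" .
qed

sublocale collision L est_const coll by (rule collision_coll)

text \<open>\<open>Q\<close> integrates against the joint law \<open>coll\<close>, while
  \<open>QR\<close> is an iterated integral. Fubini needs integrability on the product, which the
  boundedness of g and f and the finiteness of \<open>coll\<close> supply.\<close>

lemma QR_eq_Q:
  fixes g f :: "real^'n \<Rightarrow> complex"
  assumes g: "continuous_on UNIV g" "\<And>x. norm (g x) \<le> B" and f: "continuous_on UNIV f" "\<And>x. norm (f x) \<le> B'"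
  shows "QR R \<Phi> b g f v = Q g f v"
proof -
  define E where "E z = g (v - (1 / 2) *\<^sub>R (fst z + snd z)) * f (v - (1 / 2) *\<^sub>R (fst z - snd z)) - g (v - fst z) * f v"
    for z :: "(real^'n) \<times> (real^'n)"
  let ?\<psi> = "\<lambda>z :: (real^'n) \<times> (real^'n). (fst z, norm (fst z) *\<^sub>R snd z)"
  have Ec: "continuous_on UNIV E"
    unfolding E_def[abs_def] by (intro continuous_on_diff continuous_gain_integrand continuous_loss_integrand g f)
  have Em[measurable]: "E \<in> borel_measurable (borel \<Otimes>\<^sub>M borel)"
    using borel_measurable_continuous_onI[OF Ec] by (simp add: borel_prod)
  have Ei: "integrable coll E"
    unfolding E_def[abs_def]
    by (intro Bochner_Integration.integrable_diff integrable_gain[OF g f] integrable_loss[OF g f])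
  have m: "?\<psi> \<in> measurable (density (lborel \<Otimes>\<^sub>M S) (\<lambda>z. ennreal (kernel_fun z))) (borel \<Otimes>\<^sub>M borel)"
    by measurable
  have km: "kernel_fun \<in> borel_measurable (lborel \<Otimes>\<^sub>M S)" by measurable
  have Epm: "(\<lambda>z. E (?\<psi> z)) \<in> borel_measurable (lborel \<Otimes>\<^sub>M S)" by measurable
  have int: "integrable (lborel \<Otimes>\<^sub>M S) (\<lambda>z. kernel_fun z *\<^sub>R E (?\<psi> z))"
  proof -
    have "integrable (density (lborel \<Otimes>\<^sub>M S) (\<lambda>z. ennreal (kernel_fun z))) (\<lambda>z. E (?\<psi> z))"
      using Ei unfolding coll_def by (subst (asm) integrable_distr_eq[OF m Em])
    then show ?thesis
      by (subst (asm) integrable_density[OF Epm km]) (auto simp: kernel_fun_nonneg)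
  qed
  have "Q g f v = (\<integral>z. E z \<partial>coll)" by (simp add: Q_def E_def)
  also have "\<dots> = (\<integral>z. E (?\<psi> z) \<partial>density (lborel \<Otimes>\<^sub>M S) (\<lambda>z. ennreal (kernel_fun z)))"
    unfolding coll_def by (rule integral_distr[OF m Em])
  also have "\<dots> = (\<integral>z. kernel_fun z *\<^sub>R E (?\<psi> z) \<partial>(lborel \<Otimes>\<^sub>M S))"
    by (rule integral_density[OF Epm km]) (auto simp: kernel_fun_nonneg)
  also have "\<dots> = (\<integral>q. \<integral>\<sigma>. kernel_fun (q, \<sigma>) *\<^sub>R E (?\<psi> (q, \<sigma>)) \<partial>S \<partial>lborel)"
    by (rule LS.integral_fst'[OF int, symmetric])
  also have "\<dots> = QR R \<Phi> b g f v"
  proof -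
    have "indicator {..R} (norm q) = (indicator {q. norm q \<le> R} q :: real)" for q :: "real^'n"
      by (simp add: indicator_def)
    then show ?thesis
      unfolding QR_def E_def kernel_fun_def fst_conv snd_conv scaleR_conv_of_real by simp
  qed
  finally show ?thesis by simp
qed

end

section \<open>Trigonometric polynomials under the collision operator\<close>

lemma PN_space_add: "f \<in> PN_space L N \<Longrightarrow> g \<in> PN_space L N \<Longrightarrow> (\<lambda>v. f v + g v) \<in> PN_space L N"
proof -
  assume "f \<in> PN_space L N" "g \<in> PN_space L N"
  then obtain c d where "f = trig_sum L (freqs N) c" "g = trig_sum L (freqs N) d"
    by (auto simp: PN_space_trig_sum)
  then have "(\<lambda>v. f v + g v) = trig_sum L (freqs N) (\<lambda>k. c k + d k)"
    by (simp add: trig_sum_def fun_eq_iff distrib_right sum.distrib)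
  then show ?thesis by (auto simp: PN_space_trig_sum)
qed

lemma PN_space_cmult: "f \<in> PN_space L N \<Longrightarrow> (\<lambda>v. a * f v) \<in> PN_space L N"
proof -
  assume "f \<in> PN_space L N"
  then obtain c where "f = trig_sum L (freqs N) c" by (auto simp: PN_space_trig_sum)
  then have "(\<lambda>v. a * f v) = trig_sum L (freqs N) (\<lambda>k. a * c k)"
    by (simp add: trig_sum_def fun_eq_iff sum_distrib_left mult.assoc)
  then show ?thesis by (auto simp: PN_space_trig_sum)
qed

lemma PN_space_fmode: "k \<in> freqs N \<Longrightarrow> fmode L k \<in> PN_space L N"
proof -
  assume "k \<in> freqs N"
  then have "fmode L k = trig_sum L (freqs N) (\<lambda>l. if l = k then 1 else 0)"
    by (intro ext) (simp add: trig_sum_def if_distrib[of "\<lambda>x. x * _"] cong: if_cong)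
  then show ?thesis by (auto simp: PN_space_trig_sum)
qed

lemma PN_space_sum:
  assumes "finite I" "\<And>i. i \<in> I \<Longrightarrow> f i \<in> PN_space L N"
  shows "(\<lambda>v. \<Sum>i\<in>I. f i v) \<in> PN_space L N"
  using assms
proof (induction I)
  case empty
  have "(\<lambda>v. 0) = trig_sum L (freqs N) (\<lambda>k. 0)" by (simp add: trig_sum_def fun_eq_iff)
  then show ?case by (auto simp: PN_space_trig_sum)
next
  case (insert i I)
  then show ?case by (simp add: PN_space_add)
qed

lemma freqs_add: "k \<in> freqs N \<Longrightarrow> l \<in> freqs N \<Longrightarrow> (\<lambda>j. k j + l j) \<in> freqs (2 * N)"
  unfolding freqs_def
proof (intro CollectI allI)
  fix j
  assume "k \<in> {k. \<forall>j. - (real N / 2) \<le> real_of_int (k j) \<and> real_of_int (k j) \<le> real N / 2}"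
    "l \<in> {k. \<forall>j. - (real N / 2) \<le> real_of_int (k j) \<and> real_of_int (k j) \<le> real N / 2}"
  then have "- (real N / 2) \<le> real_of_int (k j) \<and> real_of_int (k j) \<le> real N / 2"
    "- (real N / 2) \<le> real_of_int (l j) \<and> real_of_int (l j) \<le> real N / 2" by auto
  then show "- (real (2 * N) / 2) \<le> real_of_int (k j + l j) \<and> real_of_int (k j + l j) \<le> real (2 * N) / 2"
    by simp
qed

context collision
begin

lemma
  fixes g f h :: "real^'n \<Rightarrow> 'b::{real_normed_field, banach, second_countable_topology}"
  assumes g: "cp g" and f: "cp f" and h: "cp h"
  shows Q_add_left_cp: "Q (\<lambda>x. g x + h x) f v = Q g f v + Q h f v"
    and Q_add_right_cp: "Q f (\<lambda>x. g x + h x) v = Q f g v + Q f h v"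
proof -
  obtain B1 where 1: "\<And>x. norm (g x) \<le> B1" using cont_periodic_bounded[OF L_pos g] by metis
  obtain B2 where 2: "\<And>x. norm (f x) \<le> B2" using cont_periodic_bounded[OF L_pos f] by metis
  obtain B3 where 3: "\<And>x. norm (h x) \<le> B3" using cont_periodic_bounded[OF L_pos h] by metis
  have c: "continuous_on UNIV g" "continuous_on UNIV f" "continuous_on UNIV h"
    using g f h by (auto simp: cont_periodic_def)
  show "Q (\<lambda>x. g x + h x) f v = Q g f v + Q h f v" by (rule Q_add_left[OF c(1) 1 c(2) 2 c(3) 3])
  show "Q f (\<lambda>x. g x + h x) v = Q f g v + Q f h v" by (rule Q_add_right[OF c(1) 1 c(2) 2 c(3) 3])
qed

lemma
  fixes g :: "'i \<Rightarrow> real^'n \<Rightarrow> 'b::{real_normed_field, banach, second_countable_topology}"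
  assumes "finite I" and g: "\<And>i. i \<in> I \<Longrightarrow> cp (g i)" and f: "cp f"
  shows Q_sum_left: "Q (\<lambda>x. \<Sum>i\<in>I. g i x) f v = (\<Sum>i\<in>I. Q (g i) f v)"
    and Q_sum_right: "Q f (\<lambda>x. \<Sum>i\<in>I. g i x) v = (\<Sum>i\<in>I. Q f (g i) v)"
proof -
  have "Q (\<lambda>x. \<Sum>i\<in>I. g i x) f v = (\<Sum>i\<in>I. Q (g i) f v) \<and> Q f (\<lambda>x. \<Sum>i\<in>I. g i x) v = (\<Sum>i\<in>I. Q f (g i) v)"
    using assms(1) g
  proof (induction I)
    case empty
    then show ?case by (simp add: Q_def)
  next
    case (insert i I)
    then show ?case
      by (simp add: Q_add_left_cp Q_add_right_cp f cont_periodic_sum)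
  qed
  then show "Q (\<lambda>x. \<Sum>i\<in>I. g i x) f v = (\<Sum>i\<in>I. Q (g i) f v)"
    "Q f (\<lambda>x. \<Sum>i\<in>I. g i x) v = (\<Sum>i\<in>I. Q f (g i) v)" by auto
qed

text \<open>Translation covariance: moving v multiplies the gain product and the loss product by the
  same phase.\<close>

lemma Q_fmode: "Q (fmode L l) (fmode L m) v = Q (fmode L l) (fmode L m) 0 * fmode L (\<lambda>j. l j + m j) v"
proof -
  have s: "fmode L k (v - a) = fmode L k (0 - a) * fmode L k v" for k a
    using fmode_shift[of L k "0 - a" v] by simp
  have "Q (fmode L l) (fmode L m) v
      = (\<integral>z. (fmode L l (0 - (1 / 2) *\<^sub>R (fst z + snd z)) * fmode L m (0 - (1 / 2) *\<^sub>R (fst z - snd z))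
           - fmode L l (0 - fst z) * fmode L m 0) * (fmode L l v * fmode L m v) \<partial>k)"
    unfolding Q_def by (rule Bochner_Integration.integral_cong) (simp_all only: s[of l] s[of m], simp add: fmode_def algebra_simps)
  also have "\<dots> = Q (fmode L l) (fmode L m) 0 * (fmode L l v * fmode L m v)"
    unfolding Q_def by (rule integral_mult_left_zero)
  finally show ?thesis by (simp add: fmode_mult)
qed

text \<open>Frequencies at most double. Hence the modes discarded by the projection have frequencies
  at most N, the range in which a shift by L/N detects them.\<close>

lemma Q_PN_space:
  assumes g: "g \<in> PN_space L N" and f: "f \<in> PN_space L N"
  shows "Q g f \<in> PN_space L (2 * N)"
proof -
  obtain c d where c: "g = (\<lambda>v. \<Sum>k\<in>freqs N. c k * fmode L k v)" and d: "f = (\<lambda>v. \<Sum>k\<in>freqs N. d k * fmode L k v)"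
    using g f by (auto simp: PN_space_def)
  have cpf: "cp (\<lambda>v. a * fmode L k v)" for a k
    by (intro cont_periodic_mult cont_periodic_const cont_periodic_fmode[OF L_pos])
  have "Q g f v = (\<Sum>l\<in>freqs N. \<Sum>m\<in>freqs N. (c l * d m * Q (fmode L l) (fmode L m) 0) * fmode L (\<lambda>j. l j + m j) v)" for v
  proof -
    have "Q g f v = (\<Sum>l\<in>freqs N. Q (\<lambda>v. c l * fmode L l v) f v)"
      unfolding c by (rule Q_sum_left) (auto intro: cpf cont_periodic_PN_space[OF L_pos f])
    also have "\<dots> = (\<Sum>l\<in>freqs N. \<Sum>m\<in>freqs N. Q (\<lambda>v. c l * fmode L l v) (\<lambda>v. d m * fmode L m v) v)"
      unfolding d by (rule sum.cong[OF refl], rule Q_sum_right) (auto intro: cpf)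
    also have "\<dots> = (\<Sum>l\<in>freqs N. \<Sum>m\<in>freqs N. (c l * d m * Q (fmode L l) (fmode L m) 0) * fmode L (\<lambda>j. l j + m j) v)"
      by (intro sum.cong refl) (simp add: Q_cmult_left Q_cmult_right Q_fmode[of _ _ v])
    finally show ?thesis .
  qed
  then have "Q g f = (\<lambda>v. \<Sum>l\<in>freqs N. \<Sum>m\<in>freqs N. (c l * d m * Q (fmode L l) (fmode L m) 0) * fmode L (\<lambda>j. l j + m j) v)"
    by blast
  also have "\<dots> \<in> PN_space L (2 * N)"
    by (intro PN_space_sum PN_space_cmult PN_space_fmode freqs_add) auto
  finally show ?thesis .
qed

end

section \<open>Ordinary differential equations in Banach spaces\<close>

lemma gronwall:
  fixes u :: "real \<Rightarrow> real"
  assumes d: "\<And>t. t \<in> {0..T} \<Longrightarrow> (u has_real_derivative u' t) (at t within {0..T})"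
    and le: "\<And>t. t \<in> {0..T} \<Longrightarrow> u' t \<le> a * u t + b"
    and ab: "0 \<le> a" "0 \<le> b" and t: "t \<in> {0..T}"
  shows "u t \<le> exp (a * t) * (u 0 + b * t)"
proof (cases "t = 0")
  case False
  then have t0: "0 < t" using t by simp
  \<comment> \<open>The integrating factor absorbs \<open>a\<close>, and subtracting
    \<open>b * s\<close> absorbs the forcing, so that w does not increase.\<close>
  define w where "w s = exp (- a * s) * u s - b * s" for s
  define w' where "w' s = exp (- a * s) * (u' s - a * u s) - b" for s
  have dw: "(w has_derivative (\<lambda>h. w' s * h)) (at s within {0..t})" if s: "s \<in> {0..t}" for s
  proof -
    have "(u has_real_derivative u' s) (at s within {0..t})"
      using d[of s] s t by (auto intro: DERIV_subset)
    then have "(w has_real_derivative w' s) (at s within {0..t})"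
      unfolding w_def[abs_def] w'_def
      by (auto intro!: derivative_eq_intros simp: algebra_simps)
    then show ?thesis by (simp add: has_field_derivative_def)
  qed
  obtain s where s: "s \<in> {0<..<t}" "w t - w 0 = w' s * (t - 0)"
    using mvt_simple[OF t0 dw] by auto
  have "u' s - a * u s \<le> b" using le[of s] s t by auto
  then have "exp (- a * s) * (u' s - a * u s) \<le> exp (- a * s) * b" by (intro mult_left_mono) auto
  also have "\<dots> \<le> 1 * b" using s ab by (intro mult_right_mono) auto
  finally have "w' s \<le> 0" by (simp add: w'_def)
  then have "w' s * (t - 0) \<le> 0" using t0 by (intro mult_nonpos_nonneg) auto
  then have "w t \<le> w 0" using s by linarith
  then have "exp (- a * t) * u t \<le> u 0 + b * t" by (simp add: w_def)
  then have "exp (a * t) * (exp (- a * t) * u t) \<le> exp (a * t) * (u 0 + b * t)"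
    by (intro mult_left_mono) auto
  then show ?thesis by (simp add: mult.assoc[symmetric] exp_add[symmetric])
qed simp

text \<open>Picard iteration in the norm weighted by \<open>exp (- 2 K t)\<close>, in which the integral
  operator is a contraction on the whole interval.\<close>
lemma lipschitz_ode_exists:
  fixes X :: "'b::banach \<Rightarrow> 'b"
  assumes lip: "\<And>x y. norm (X x - X y) \<le> K * norm (x - y)" and T: "0 \<le> T"
  obtains x where "x 0 = x0" "\<And>t. t \<in> {0..T} \<Longrightarrow> (x has_vector_derivative X (x t)) (at t within {0..T})"
proof -
  \<comment> \<open>The rate makes |K| / l at most 1/2, the contraction factor, and is positive even
    for K = 0.\<close>
  define l where "l = 2 * \<bar>K\<bar> + 2"
  have l: "0 < l" by (simp add: l_def)
  have Xc: "continuous_on UNIV X"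
  proof (rule lipschitz_on_continuous_on)
    show "\<bar>K\<bar>-lipschitz_on UNIV X"
    proof (rule lipschitz_onI)
      fix x y :: 'b
      have "K * norm (x - y) \<le> \<bar>K\<bar> * norm (x - y)" by (intro mult_right_mono) auto
      then show "dist (X x) (X y) \<le> \<bar>K\<bar> * dist x y"
        using lip[of x y] by (simp add: dist_norm)
    qed simp
  qed
  \<comment> \<open>Clamping time to [0, T] turns curves on the interval into bounded continuous
    functions on the line, where the fixed point theorem is applied.\<close>
  define c where "c t = max 0 (min t T)" for t :: real
  have c: "c t \<in> {0..T}" "continuous_on UNIV c" for t
    using T by (auto simp: c_def[abs_def] intro!: continuous_intros)
  \<comment> \<open>The unknown is rescaled as x(s) = exp (l s) y(s), which replaces the weighted
    norm by the plain sup norm of y.\<close>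
  define F where "F y s = X (exp (l * s) *\<^sub>R apply_bcontfun y s)" for y :: "real \<Rightarrow>\<^sub>C 'b" and s
  have Fc: "continuous_on A (F y)" for y A
    unfolding F_def[abs_def] by (intro continuous_on_compose2[OF Xc] continuous_intros) auto
  have Fi: "F y integrable_on {0..\<tau>}" for y \<tau>
    by (rule integrable_continuous_interval[OF Fc])
  define h where "h y \<tau> = exp (- l * \<tau>) *\<^sub>R (x0 + integral {0..\<tau>} (F y))" for y \<tau>
  have hc: "continuous_on {0..T} (h y)" for y
    unfolding h_def[abs_def] by (intro continuous_intros indefinite_integral_continuous_1 Fi)
  define G where "G y = Bcontfun (\<lambda>t. h y (c t))" for y
  have G: "apply_bcontfun (G y) t = h y (c t)" for y t
  proof -
    have "continuous_on UNIV (\<lambda>t. h y (c t))"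
      by (rule continuous_on_compose2[OF hc c(2)]) (use c(1) in auto)
    moreover have "bounded (range (\<lambda>t. h y (c t)))"
    proof (rule bounded_subset)
      show "bounded (h y ` {0..T})"
        by (intro compact_imp_bounded compact_continuous_image hc) auto
    qed (use c(1) in auto)
    ultimately have "(\<lambda>t. h y (c t)) \<in> bcontfun" by (simp add: bcontfun_def)
    then show ?thesis by (simp add: G_def Bcontfun_inverse)
  qed
  have contr: "dist (G y) (G z) \<le> (1 / 2) * dist y z" for y z
  proof (rule dist_bound)
    fix t
    define \<tau> where "\<tau> = c t"
    have \<tau>: "0 \<le> \<tau>" using c(1)[of t] by (simp add: \<tau>_def)
    define D where "D = dist y z"
    have D: "0 \<le> D" by (simp add: D_def)
    have I: "((\<lambda>s. \<bar>K\<bar> * D * exp (l * s)) has_integral (\<bar>K\<bar> * D * exp (l * \<tau>) / l - \<bar>K\<bar> * D * exp (l * 0) / l)) {0..\<tau>}"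
      by (rule fundamental_theorem_of_calculus[OF \<tau>])
         (use l in \<open>auto intro!: derivative_eq_intros simp flip: has_real_derivative_iff_has_vector_derivative\<close>)
    have "norm (integral {0..\<tau>} (\<lambda>s. F y s - F z s)) \<le> integral {0..\<tau>} (\<lambda>s. \<bar>K\<bar> * D * exp (l * s))"
    proof (rule integral_norm_bound_integral)
      show "(\<lambda>s. F y s - F z s) integrable_on {0..\<tau>}" by (intro integrable_diff Fi)
      show "(\<lambda>s. \<bar>K\<bar> * D * exp (l * s)) integrable_on {0..\<tau>}" using I by blast
      fix s
      have "norm (F y s - F z s) \<le> K * norm (exp (l * s) *\<^sub>R (apply_bcontfun y s - apply_bcontfun z s))"
        using lip by (simp add: F_def scaleR_diff_right)
      also have "\<dots> = K * (exp (l * s) * dist (apply_bcontfun y s) (apply_bcontfun z s))" by (simp add: dist_norm)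
      also have "\<dots> \<le> \<bar>K\<bar> * (exp (l * s) * D)"
        unfolding D_def by (intro mult_mono dist_bounded) auto
      finally show "norm (F y s - F z s) \<le> \<bar>K\<bar> * D * exp (l * s)" by (simp add: mult_ac)
    qed
    also have "\<dots> \<le> \<bar>K\<bar> * D * exp (l * \<tau>) / l"
      unfolding integral_unique[OF I] using l D by simp
    finally have *: "norm (integral {0..\<tau>} (\<lambda>s. F y s - F z s)) \<le> \<bar>K\<bar> * D * exp (l * \<tau>) / l" .
    have "norm (h y \<tau> - h z \<tau>) \<le> exp (- l * \<tau>) * (\<bar>K\<bar> * D * exp (l * \<tau>) / l)"
    proof -
      have "h y \<tau> - h z \<tau> = exp (- l * \<tau>) *\<^sub>R integral {0..\<tau>} (\<lambda>s. F y s - F z s)"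
        using Fi by (simp add: h_def integral_diff flip: scaleR_diff_right)
      then have "norm (h y \<tau> - h z \<tau>) = exp (- l * \<tau>) * norm (integral {0..\<tau>} (\<lambda>s. F y s - F z s))"
        by (simp only: norm_scaleR abs_exp_cancel)
      also have "\<dots> \<le> exp (- l * \<tau>) * (\<bar>K\<bar> * D * exp (l * \<tau>) / l)"
        by (rule mult_left_mono[OF *]) simp
      finally show ?thesis .
    qed
    also have "\<dots> = \<bar>K\<bar> / l * D" by (simp add: exp_minus field_simps)
    also have "\<dots> \<le> (1 / 2) * D"
      using D l by (intro mult_right_mono) (simp_all add: l_def field_simps)
    finally show "dist (apply_bcontfun (G y) t) (apply_bcontfun (G z) t) \<le> (1 / 2) * dist y z"
      by (simp add: G \<tau>_def[symmetric] dist_norm D_def)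
  qed
  have "\<exists>!y. G y = y"
    by (rule banach_fix_type[of "1 / 2"]) (use contr in auto)
  then obtain y where y: "G y = y" by blast
  define x where "x t = exp (l * t) *\<^sub>R apply_bcontfun y t" for t
  have x: "x t = x0 + integral {0..t} (\<lambda>s. X (x s))" if "t \<in> {0..T}" for t
  proof -
    have "apply_bcontfun y t = h y t"
      using G[of y t] that by (simp add: y c_def)
    then show ?thesis
      by (simp add: x_def h_def F_def[abs_def] scaleR_scaleR exp_minus)
  qed
  have Xx: "continuous_on {0..T} (\<lambda>s. X (x s))"
    using Fc[of "{0..T}" y] by (simp add: F_def[abs_def] x_def)
  have "(x has_vector_derivative X (x t)) (at t within {0..T})" if t: "t \<in> {0..T}" for t
  proof (rule has_vector_derivative_transform[OF t])
    show "((\<lambda>t. x0 + integral {0..t} (\<lambda>s. X (x s))) has_vector_derivative X (x t)) (at t within {0..T})"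
      using has_vector_derivative_add[OF has_vector_derivative_const integral_has_vector_derivative[OF Xx t]] by simp
  qed (use x in simp)
  moreover have "x 0 = x0" using x[of 0] T by simp
  ultimately show ?thesis using that by blast
qed

section \<open>Energies of curves of bounded continuous functions\<close>

text \<open>Joint continuity in the function and the point is what differentiation under the
  integral over the cell asks for.\<close>

lemma continuous_eval_bcontfun:
  "continuous_on UNIV (\<lambda>p. apply_bcontfun (fst p :: 'a::metric_space \<Rightarrow>\<^sub>C 'b::metric_space) (snd p))"
  unfolding continuous_on_iff
proof (intro ballI allI impI)
  fix p :: "('a \<Rightarrow>\<^sub>C 'b) \<times> 'a" and e :: real assume e: "0 < e"
  have "isCont (apply_bcontfun (fst p)) (snd p)"
    using continuous_on_apply_bcontfun[of UNIV "fst p"] continuous_on_eq_continuous_at[OF open_UNIV] by blast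
  then obtain d where d: "0 < d" "\<And>v. dist v (snd p) < d \<Longrightarrow> dist (apply_bcontfun (fst p) v) (apply_bcontfun (fst p) (snd p)) < e / 2"
    using e unfolding continuous_at_eps_delta by (metis half_gt_zero)
  show "\<exists>d>0. \<forall>q\<in>UNIV. dist q p < d \<longrightarrow>
      dist (apply_bcontfun (fst q) (snd q)) (apply_bcontfun (fst p) (snd p)) < e"
  proof (intro exI[of _ "min d (e / 2)"] conjI ballI impI)
    fix q assume q: "dist q p < min d (e / 2)"
    have "dist (apply_bcontfun (fst q) (snd q)) (apply_bcontfun (fst p) (snd q)) < e / 2"
      using dist_bounded[of "fst q" "snd q" "fst p"] dist_fst_le[of q p] q by linarith
    moreover have "dist (apply_bcontfun (fst p) (snd q)) (apply_bcontfun (fst p) (snd p)) < e / 2"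
      using d(2)[of "snd q"] dist_snd_le[of q p] q by linarith
    ultimately show "dist (apply_bcontfun (fst q) (snd q)) (apply_bcontfun (fst p) (snd p)) < e"
      using dist_triangle[of "apply_bcontfun (fst q) (snd q)" "apply_bcontfun (fst p) (snd p)" "apply_bcontfun (fst p) (snd q)"]
      by linarith
  qed (use d e in auto)
qed

lemma bounded_linear_apply_bcontfun:
  "bounded_linear (\<lambda>f :: 'a::metric_space \<Rightarrow>\<^sub>C 'b::real_normed_vector. apply_bcontfun f v)"
  by (rule bounded_linear_intro[where K = 1]) (auto simp: norm_bounded)

text \<open>One rule for three energies: the square gives the L^2 norm, the identity the mass, and
  the squared negative part the control of positivity. Differentiability in the sup norm makes the
  integrand jointly continuous.\<close>

lemma has_derivative_cell_integral:
  fixes x :: "real \<Rightarrow> (real^'n) \<Rightarrow>\<^sub>C real"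
  assumes d: "\<And>t. t \<in> {0..T} \<Longrightarrow> (x has_vector_derivative x' t) (at t within {0..T})"
    and x': "continuous_on {0..T} x'"
    and \<phi>: "\<And>s. (\<phi> has_real_derivative \<phi>' s) (at s)" and \<phi>': "continuous_on UNIV \<phi>'"
    and t: "t \<in> {0..T}"
  shows "((\<lambda>t. \<integral>v. \<phi> (apply_bcontfun (x t) v) \<partial>cell_measure L) has_real_derivative
     (\<integral>v. \<phi>' (apply_bcontfun (x t) v) * apply_bcontfun (x' t) v \<partial>cell_measure L)) (at t within {0..T})"
proof -
  have xc: "continuous_on {0..T} x"
    using d by (meson continuous_on_eq_continuous_within has_vector_derivative_continuous)
  have \<phi>c: "continuous_on UNIV \<phi>"
    using \<phi> by (meson DERIV_isCont continuous_at_imp_continuous_on)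
  have ev: "continuous_on ({0..T} \<times> A) (\<lambda>p. apply_bcontfun (y (fst p)) (snd p))"
    if "continuous_on {0..T} y" for y :: "real \<Rightarrow> (real^'n) \<Rightarrow>\<^sub>C real" and A
    by (rule continuous_on_compose2[OF continuous_eval_bcontfun, where f = "\<lambda>p. (y (fst p), snd p)", simplified])
       (auto intro!: continuous_intros continuous_on_compose2[OF that])
  let ?a = "\<chi> j. - L :: real^'n" and ?b = "\<chi> j. L :: real^'n"
  have "((\<lambda>t. integral (cbox ?a ?b) (\<lambda>v. \<phi> (apply_bcontfun (x t) v))) has_real_derivative
     integral (cbox ?a ?b) (\<lambda>v. \<phi>' (apply_bcontfun (x t) v) * apply_bcontfun (x' t) v)) (at t within {0..T})"
  proof (rule leibniz_rule_field_derivative[where U = "{0..T}"])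
    fix s and v :: "real^'n" assume s: "s \<in> {0..T}"
    have "((\<lambda>t. apply_bcontfun (x t) v) has_real_derivative apply_bcontfun (x' s) v) (at s within {0..T})"
      using bounded_linear.has_vector_derivative[OF bounded_linear_apply_bcontfun d[OF s]]
      by (simp add: has_real_derivative_iff_has_vector_derivative)
    from DERIV_chain2[OF \<phi> this]
    show "((\<lambda>t. \<phi> (apply_bcontfun (x t) v)) has_real_derivative
        \<phi>' (apply_bcontfun (x s) v) * apply_bcontfun (x' s) v) (at s within {0..T})" .
  next
    fix s assume "s \<in> {0..T}"
    show "(\<lambda>v. \<phi> (apply_bcontfun (x s) v)) integrable_on cbox ?a ?b"
      by (intro integrable_continuous continuous_on_compose2[OF \<phi>c]) auto
  next
    show "continuous_on ({0..T} \<times> cbox ?a ?b) (\<lambda>(t, v). \<phi>' (apply_bcontfun (x t) v) * apply_bcontfun (x' t) v)"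
      unfolding case_prod_beta'
      by (intro continuous_intros continuous_on_compose2[OF \<phi>' ev[OF xc]] ev[OF x']) auto
  qed (use t in auto)
  moreover have "(\<integral>v. \<phi> (apply_bcontfun (x t) v) \<partial>cell_measure L) = integral (cbox ?a ?b) (\<lambda>v. \<phi> (apply_bcontfun (x t) v))" for t
    by (subst integral_cell_eq_HK) (auto intro!: continuous_on_compose2[OF \<phi>c] simp: cell_eq_cbox)
  moreover have "(\<integral>v. \<phi>' (apply_bcontfun (x t) v) * apply_bcontfun (x' t) v \<partial>cell_measure L)
      = integral (cbox ?a ?b) (\<lambda>v. \<phi>' (apply_bcontfun (x t) v) * apply_bcontfun (x' t) v)"
    by (subst integral_cell_eq_HK) (auto intro!: continuous_intros continuous_on_compose2[OF \<phi>'] simp: cell_eq_cbox)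
  ultimately show ?thesis by simp
qed

text \<open>Squaring removes the corner of the maximum at 0, where the difference quotient is
  bounded by |h|.\<close>

lemma has_derivative_pos_part_square:
  "((\<lambda>s::real. (max s 0)\<^sup>2) has_real_derivative 2 * max s 0) (at s)"
proof -
  consider "0 < s" | "s = 0" | "s < 0" by linarith
  then show ?thesis
  proof cases
    case 1
    have "((\<lambda>s::real. s\<^sup>2) has_real_derivative 2 * max s 0) (at s)"
      using 1 by (auto intro!: derivative_eq_intros)
    then show ?thesis
      by (rule has_field_derivative_transform_within_open[where S = "{0<..}"]) (use 1 in auto)
  next
    case 2
    have le: "\<bar>(max h 0)\<^sup>2 / h\<bar> \<le> \<bar>h\<bar>" for h :: real
      by (cases "h = 0") (auto simp: max_def power2_eq_square)
    have "((\<lambda>h::real. (max h 0)\<^sup>2 / h) \<longlongrightarrow> 0) (at 0)"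
      by (rule Lim_null_comparison[where g = "\<lambda>h. \<bar>h\<bar>"])
         (use le in \<open>auto intro!: always_eventually tendsto_rabs_zero tendsto_ident_at\<close>)
    then show ?thesis using 2 by (simp add: DERIV_def)
  next
    case 3
    have "((\<lambda>s::real. 0) has_real_derivative 2 * max s 0) (at s)"
      using 3 by (auto intro!: derivative_eq_intros)
    then show ?thesis
      by (rule has_field_derivative_transform_within_open[where S = "{..<0}"]) (use 3 in auto)
  qed
qed

lemma has_derivative_neg_part_square:
  "((\<lambda>s::real. (max (- s) 0)\<^sup>2) has_real_derivative - 2 * max (- s) 0) (at s)"
proof -
  have "((\<lambda>s::real. - s) has_real_derivative - 1) (at s)" by (auto intro!: derivative_eq_intros)
  from DERIV_chain2[OF has_derivative_pos_part_square this] show ?thesis by simp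
qed

section \<open>Weak derivatives\<close>

text \<open>\<open>ennreal\<close> sends negative numbers to 0, so \<open>P\<close> and
  \<open>N\<close> carry the positive and the negative part of w. They agree on boxes, an
  intersection-stable generator, hence as measures, and so their densities agree almost
  everywhere.\<close>

lemma box_AE_eq_0:
  fixes w :: "real^'n \<Rightarrow> real"
  assumes w: "integrable lborel w" and 0: "\<And>a b. (\<integral>v. indicator (box a b) v * w v \<partial>lborel) = 0"
  shows "AE v in lborel. w v = 0"
proof -
  have [measurable]: "w \<in> borel_measurable borel" using w by auto
  define P where "P = density lborel (\<lambda>v. ennreal (w v))"
  define N where "N = density lborel (\<lambda>v. ennreal (- w v))"
  have fin: "(\<integral>\<^sup>+v. ennreal (w v) * indicator A v \<partial>lborel) < \<infinity>"
    "(\<integral>\<^sup>+v. ennreal (- w v) * indicator A v \<partial>lborel) < \<infinity>" if "A \<in> sets borel" for A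
  proof -
    have "(\<integral>\<^sup>+v. ennreal (w v) * indicator A v \<partial>lborel) \<le> (\<integral>\<^sup>+v. ennreal (norm (w v)) \<partial>lborel)"
      "(\<integral>\<^sup>+v. ennreal (- w v) * indicator A v \<partial>lborel) \<le> (\<integral>\<^sup>+v. ennreal (norm (w v)) \<partial>lborel)"
      by (auto intro!: nn_integral_mono ennreal_leI split: split_indicator)
    moreover have "(\<integral>\<^sup>+v. ennreal (norm (w v)) \<partial>lborel) < \<infinity>"
      using w by (simp add: integrable_iff_bounded)
    ultimately show "(\<integral>\<^sup>+v. ennreal (w v) * indicator A v \<partial>lborel) < \<infinity>"
      "(\<integral>\<^sup>+v. ennreal (- w v) * indicator A v \<partial>lborel) < \<infinity>" by (auto intro: order_le_less_trans)
  qed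
  have box: "emeasure P (box a b) = emeasure N (box a b)" for a b
  proof -
    let ?B = "box a b"
    have i: "integrable lborel (\<lambda>v. indicator ?B v * w v)"
      using integrable_mult_indicator[OF _ w, of ?B] by simp
    define p where "p = (\<integral>\<^sup>+v. ennreal (indicator ?B v * w v) \<partial>lborel)"
    define m where "m = (\<integral>\<^sup>+v. ennreal (- (indicator ?B v * w v)) \<partial>lborel)"
    have e: "p = (\<integral>\<^sup>+v. ennreal (w v) * indicator ?B v \<partial>lborel)" "m = (\<integral>\<^sup>+v. ennreal (- w v) * indicator ?B v \<partial>lborel)"
      unfolding p_def m_def by (auto intro!: nn_integral_cong split: split_indicator)
    have pm: "p < \<infinity>" "m < \<infinity>" unfolding e by (rule fin; simp)+
    have "enn2real p - enn2real m = 0"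
      using real_lebesgue_integral_def[OF i] 0[of a b] by (simp add: p_def m_def)
    then have "ennreal (enn2real p) = ennreal (enn2real m)" by simp
    moreover have "ennreal (enn2real p) = p" "ennreal (enn2real m) = m" using pm by simp_all
    ultimately have "p = m" by simp
    then show ?thesis by (simp add: P_def N_def emeasure_density e)
  qed
  have "P = N"
  proof (rule measure_eqI_generator_eq[where E = "range (\<lambda>(a, b). box a b)" and \<Omega> = UNIV and A = "\<lambda>i. box (- (real i *\<^sub>R One)) (real i *\<^sub>R One)"])
    show "Int_stable (range (\<lambda>(a, b). box a b :: (real^'n) set))"
      by (auto simp: Int_stable_def box_Int_box)
    show "sets P = sigma_sets UNIV (range (\<lambda>(a, b). box a b))" "sets N = sigma_sets UNIV (range (\<lambda>(a, b). box a b))"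
      by (simp_all add: P_def N_def borel_eq_box)
    show "(\<Union>i. box (- (real i *\<^sub>R One)) (real i *\<^sub>R One)) = (UNIV :: (real^'n) set)"
      by (rule UN_box_eq_UNIV)
    show "emeasure P (box (- (real i *\<^sub>R One)) (real i *\<^sub>R One)) \<noteq> \<infinity>" for i
      using fin(1)[of "box (- (real i *\<^sub>R One)) (real i *\<^sub>R One)"] by (simp add: P_def emeasure_density)
  qed (use box in auto)
  then have "AE v in lborel. ennreal (w v) = ennreal (- w v)"
    unfolding P_def N_def by (intro sigma_finite_measure.density_unique[OF sigma_finite_lborel]) auto
  then show ?thesis
  proof eventually_elim
    fix v assume v: "ennreal (w v) = ennreal (- w v)"
    show "w v = 0"
    proof (cases "0 \<le> w v")
      case True
      then have "ennreal (w v) = 0" using v by (simp add: ennreal_neg)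
      then show ?thesis using True by (simp add: ennreal_eq_0_iff)
    next
      case False
      then have "ennreal (- w v) = 0" using v by (simp add: ennreal_neg)
      then show ?thesis using False by (simp add: ennreal_eq_0_iff)
    qed
  qed
qed

text \<open>\<open>C\<^sup>1\<close> functions that increase to the indicator of the open interval from \<open>a\<close> to \<open>b\<close> as \<open>n\<close> grows.\<close>
definition bump1 :: "real \<Rightarrow> real \<Rightarrow> real \<Rightarrow> real \<Rightarrow> real" where
  "bump1 n a b s = n * (max ((s - a) * (b - s)) 0)\<^sup>2 / (1 + n * (max ((s - a) * (b - s)) 0)\<^sup>2)"

definition bump1_deriv :: "real \<Rightarrow> real \<Rightarrow> real \<Rightarrow> real \<Rightarrow> real" where
  "bump1_deriv n a b s = n * (2 * max ((s - a) * (b - s)) 0 * (a + b - 2 * s)) / (1 + n * (max ((s - a) * (b - s)) 0)\<^sup>2)\<^sup>2"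

lemma bump1_has_derivative:
  assumes "0 \<le> n"
  shows "(bump1 n a b has_real_derivative bump1_deriv n a b s) (at s)"
proof -
  have pos: "1 + n * (max ((s - a) * (b - s)) 0)\<^sup>2 \<noteq> 0" for s
    using assms by (smt (verit) mult_nonneg_nonneg zero_le_power2)
  have "((\<lambda>s. (max ((s - a) * (b - s)) 0)\<^sup>2) has_real_derivative 2 * max ((s - a) * (b - s)) 0 * (a + b - 2 * s)) (at s)"
  proof -
    have "((\<lambda>s. (s - a) * (b - s)) has_real_derivative (a + b - 2 * s)) (at s)"
      by (auto intro!: derivative_eq_intros)
    from DERIV_chain2[OF has_derivative_pos_part_square this] show ?thesis .
  qed
  note Y = this
  have "((\<lambda>s. n * Y s / (1 + n * Y s)) has_real_derivative n * Y' / (1 + n * Y s)\<^sup>2) (at s)"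
    if "(Y has_real_derivative Y') (at s)" "1 + n * Y s \<noteq> 0" for Y Y'
    using that by (auto intro!: derivative_eq_intros simp: power2_eq_square field_simps)
  from this[OF Y pos[of s]] show ?thesis
    unfolding bump1_def[abs_def] bump1_deriv_def .
qed

lemma bump1_cont: "0 \<le> n \<Longrightarrow> continuous_on A (bump1 n a b)"
  by (meson bump1_has_derivative DERIV_isCont continuous_at_imp_continuous_on)

lemma bump1_deriv_cont:
  assumes "0 \<le> n" shows "continuous_on A (bump1_deriv n a b)"
proof -
  have pos: "1 + n * (max ((s - a) * (b - s)) 0)\<^sup>2 \<noteq> 0" for s
    using assms by (smt (verit) mult_nonneg_nonneg zero_le_power2)
  show ?thesis
    unfolding bump1_deriv_def[abs_def] by (intro continuous_intros) (use pos in auto)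
qed

lemma bump1_range: "0 \<le> n \<Longrightarrow> 0 \<le> bump1 n a b s \<and> bump1 n a b s \<le> 1"
  by (simp add: bump1_def divide_le_eq_1 add_pos_nonneg)

lemma bump1_zero: "a \<le> b \<Longrightarrow> \<not> (a < s \<and> s < b) \<Longrightarrow> bump1 n a b s = 0"
proof -
  assume "a \<le> b" "\<not> (a < s \<and> s < b)"
  then have "(s - a) * (b - s) \<le> 0" by (auto intro: mult_nonpos_nonneg mult_nonneg_nonpos)
  then show ?thesis by (simp add: bump1_def)
qed

lemma bump1_limit:
  assumes "a < s" "s < b"
  shows "(\<lambda>n. bump1 (real n) a b s) \<longlonglongrightarrow> 1"
proof -
  define y where "y = (max ((s - a) * (b - s)) 0)\<^sup>2"
  have y: "0 < y" using assms by (simp add: y_def)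
  have "(\<lambda>n. 1 - 1 / (1 + real n * y)) \<longlonglongrightarrow> 1 - 0"
  proof (intro tendsto_intros)
    have "filterlim (\<lambda>n. 1 + real n * y) at_top sequentially"
      by (intro filterlim_tendsto_add_at_top[OF tendsto_const]
          filterlim_at_top_mult_tendsto_pos[OF tendsto_const y] filterlim_real_sequentially)
    then show "(\<lambda>n. 1 / (1 + real n * y)) \<longlonglongrightarrow> 0"
      by (intro tendsto_divide_0[OF tendsto_const] filterlim_at_top_imp_at_infinity)
  qed
  moreover have "bump1 (real n) a b s = 1 - 1 / (1 + real n * y)" for n
  proof -
    have "0 < 1 + real n * y" using y by (simp add: add_pos_nonneg)
    then show ?thesis unfolding bump1_def y_def[symmetric] by (simp add: field_simps)
  qed
  ultimately show ?thesis by simp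
qed

definition bump :: "real \<Rightarrow> real^'n \<Rightarrow> real^'n \<Rightarrow> real^'n \<Rightarrow> real" where
  "bump n a b v = (\<Prod>i\<in>UNIV. bump1 n (a $ i) (b $ i) (v $ i))"

lemma bump_partial:
  assumes n: "0 \<le> n"
  shows "has_partial (bump n a b) j
    (\<lambda>v. bump1_deriv n (a $ j) (b $ j) (v $ j) * (\<Prod>i\<in>UNIV - {j}. bump1 n (a $ i) (b $ i) (v $ i)))"
  unfolding has_partial_def
proof
  fix v :: "real^'a"
  have e: "bump n a b (v + t *\<^sub>R axis j 1)
      = bump1 n (a $ j) (b $ j) (v $ j + t) * (\<Prod>i\<in>UNIV - {j}. bump1 n (a $ i) (b $ i) (v $ i))" for t
    unfolding bump_def by (subst prod.remove[of _ j]) (auto simp: axis_def intro!: prod.cong)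
  have "((\<lambda>t. bump1 n (a $ j) (b $ j) (v $ j + t)) has_real_derivative bump1_deriv n (a $ j) (b $ j) (v $ j)) (at 0)"
    using bump1_has_derivative[OF n, of "a $ j" "b $ j" "v $ j"] by (simp add: DERIV_at_within_shift add.commute flip: DERIV_shift[of _ _ 0 "v $ j"])
  then show "((\<lambda>t. bump n a b (v + t *\<^sub>R axis j 1)) has_real_derivative
      bump1_deriv n (a $ j) (b $ j) (v $ j) * (\<Prod>i\<in>UNIV - {j}. bump1 n (a $ i) (b $ i) (v $ i))) (at 0)"
    unfolding e by (rule DERIV_cmult_right)
qed

lemma bump_zero:
  assumes "\<And>i. a $ i \<le> b $ i" "v \<notin> box a b"
  shows "bump n a b v = 0"
proof -
  obtain i where "\<not> (a $ i < v $ i \<and> v $ i < b $ i)" using assms(2) by (auto simp: mem_box_cart)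
  then have "bump1 n (a $ i) (b $ i) (v $ i) = 0" using assms(1) bump1_zero by blast
  then show ?thesis unfolding bump_def by (intro prod_zero) auto
qed

lemma test_fn_bump:
  assumes n: "0 \<le> n" and ab: "\<And>i. a $ i \<le> b $ i"
  shows "test_fn (bump n a b)"
  unfolding test_fn_def
proof (intro conjI allI)
  have c1: "continuous_on UNIV (\<lambda>v::real^'a. bump1 n (a $ i) (b $ i) (v $ i))" for i
    by (rule continuous_on_compose2[OF bump1_cont[OF n, of UNIV]]) (auto intro!: continuous_intros)
  show "continuous_on UNIV (bump n a b)"
    unfolding bump_def[abs_def] by (intro continuous_on_prod c1)
  show "bounded {v. bump n a b v \<noteq> 0}"
    by (rule bounded_subset[OF bounded_box[of a b]]) (use bump_zero[OF ab] in blast)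
  fix j
  show "\<exists>\<psi>. continuous_on UNIV \<psi> \<and> has_partial (bump n a b) j \<psi>"
    by (rule exI, rule conjI[OF _ bump_partial[OF n]])
       (intro continuous_on_mult continuous_on_prod c1 continuous_on_compose2[OF bump1_deriv_cont[OF n, of UNIV]];
        auto intro!: continuous_intros)
qed

lemma bump_range: "0 \<le> n \<Longrightarrow> 0 \<le> bump n a b v \<and> bump n a b v \<le> 1"
  unfolding bump_def using bump1_range by (auto intro!: prod_nonneg prod_le_1)

lemma bump_limit:
  assumes "\<And>i. a $ i \<le> b $ i"
  shows "(\<lambda>n. bump (real n) a b v) \<longlonglongrightarrow> indicator (box a b) v"
proof (cases "v \<in> box a b")
  case True
  then have "(\<lambda>n. bump (real n) a b v) \<longlonglongrightarrow> (\<Prod>i\<in>(UNIV::'a set). 1)"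
    unfolding bump_def by (intro tendsto_prod bump1_limit) (auto simp: mem_box_cart)
  then show ?thesis using True by simp
next
  case False
  then show ?thesis using bump_zero[OF assms False] by simp
qed

text \<open>Bumps increasing to the indicator of the box are admissible test functions, and for each
  of them both pairings equal minus the pairing of f with the derivative of the bump.\<close>

lemma weak_partial_box:
  assumes g: "weak_partial f j g" and g': "weak_partial f j g'"
  shows "(\<integral>v. indicator (box a b) v *\<^sub>R g v \<partial>lborel) = (\<integral>v. indicator (box a b) v *\<^sub>R g' v \<partial>lborel)"
proof (cases "\<forall>i. a $ i \<le> b $ i")
  case True
  then have ab: "\<And>i. a $ i \<le> b $ i" by blast
  have lim: "(\<lambda>n. \<integral>v. complex_of_real (bump (real n) a b v) * h v \<partial>lborel) \<longlonglongrightarrow> (\<integral>v. indicator (box a b) v *\<^sub>R h v \<partial>lborel)"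
    if "set_integrable lborel (cbox a b) h" for h :: "real^'a \<Rightarrow> complex"
  proof -
    \<comment> \<open>Weak derivatives are integrable only on compact sets; the bumps vanish outside
      the box, so cutting off there changes nothing and provides the dominating function.\<close>
    define h0 where "h0 v = indicator (cbox a b) v *\<^sub>R h v" for v
    have h0: "integrable lborel h0" using that by (simp add: set_integrable_def h0_def[abs_def])
    have [measurable]: "h0 \<in> borel_measurable borel" using h0 by auto
    have bm: "(\<lambda>v. complex_of_real (bump (real n) a b v)) \<in> borel_measurable borel" for n
      using test_fn_bump[OF _ ab, of "real n"] by (auto intro!: borel_measurable_continuous_onI continuous_intros simp: test_fn_def)
    have e: "complex_of_real (bump (real n) a b v) * h v = complex_of_real (bump (real n) a b v) * h0 v" for n v
      using bump_zero[OF ab, of v n] box_subset_cbox[of a b] by (auto simp: h0_def split: split_indicator)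
    have e': "indicator (box a b) v *\<^sub>R h v = indicator (box a b) v *\<^sub>R h0 v" for v
      using box_subset_cbox[of a b] by (auto simp: h0_def split: split_indicator)
    show ?thesis
      unfolding e e'
    proof (rule integral_dominated_convergence[where w = "\<lambda>v. norm (h0 v)"])
      show "AE v in lborel. (\<lambda>n. complex_of_real (bump (real n) a b v) * h0 v) \<longlonglongrightarrow> indicator (box a b) v *\<^sub>R h0 v"
      proof (rule AE_I2)
        fix v :: "real^'a"
        show "(\<lambda>n. complex_of_real (bump (real n) a b v) * h0 v) \<longlonglongrightarrow> indicator (box a b) v *\<^sub>R h0 v"
          unfolding scaleR_conv_of_real
          by (rule tendsto_mult[OF tendsto_of_real[OF bump_limit[OF ab]] tendsto_const])
      qed
      show "AE v in lborel. norm (complex_of_real (bump (real n) a b v) * h0 v) \<le> norm (h0 v)" for n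
        using bump_range[of "real n" a b] by (intro AE_I2) (simp add: norm_mult mult_left_le_one_le)
    qed (use h0 bm in auto)
  qed
  have sg: "set_integrable lborel (cbox a b) g" "set_integrable lborel (cbox a b) g'"
    using g g' by (auto simp: weak_partial_def)
  have "(\<integral>v. complex_of_real (bump (real n) a b v) * g v \<partial>lborel) = (\<integral>v. complex_of_real (bump (real n) a b v) * g' v \<partial>lborel)" for n
  proof -
    have t: "test_fn (bump (real n) a b)" by (rule test_fn_bump[OF _ ab]) simp
    obtain \<psi> where p: "has_partial (bump (real n) a b) j \<psi>" using bump_partial[of "real n" a b j] by auto
    have "(\<integral>v. complex_of_real (\<psi> v) * f v \<partial>lborel) = - (\<integral>v. complex_of_real (bump (real n) a b v) * h v \<partial>lborel)"
      if "weak_partial f j h" for h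
      using that t p unfolding weak_partial_def by blast
    from this[OF g] this[OF g'] show ?thesis by simp
  qed
  then show ?thesis using LIMSEQ_unique[OF lim[OF sg(1)]] lim[OF sg(2)] by simp
next
  case False
  then obtain i where i: "\<not> a $ i \<le> b $ i" by blast
  have "v \<notin> box a b" for v
  proof
    assume "v \<in> box a b"
    then have "a $ i < v $ i \<and> v $ i < b $ i" by (simp add: mem_box_cart)
    with i show False by linarith
  qed
  then have "box a b = {}" by blast
  then show ?thesis by simp
qed

text \<open>Localised to a bounded box around the cell, because weak derivatives are only locally
  integrable; test boxes are intersected with it, and real and imaginary part are treated
  separately.\<close>

lemma weak_partial_unique:
  fixes f :: "real^'n \<Rightarrow> complex"
  assumes g: "weak_partial f j g" and g': "weak_partial f j g'"
  shows "AE v in lborel. v \<in> cell L \<longrightarrow> g v = g' v"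
proof -
  obtain a b :: "real^'n" where ab: "cell L \<subseteq> box a b"
    using bounded_subset_box_symmetric[OF compact_imp_bounded[OF compact_cell[of L]]] by metis
  have int: "integrable lborel (\<lambda>v. indicator (box a b) v *\<^sub>R h v)" if "weak_partial f j h" for h
  proof -
    have "set_integrable lborel (cbox a b) h" using that by (auto simp: weak_partial_def)
    then have "set_integrable lborel (box a b) h"
      by (rule set_integrable_subset) (auto simp: box_subset_cbox)
    then show ?thesis by (simp add: set_integrable_def)
  qed
  define w where "w v = indicator (box a b) v *\<^sub>R (g v - g' v)" for v
  have w: "integrable lborel w"
    using Bochner_Integration.integrable_diff[OF int[OF g] int[OF g']] by (simp add: w_def[abs_def] scaleR_diff_right)
  have z: "(\<integral>v. indicator (box c d) v *\<^sub>R w v \<partial>lborel) = 0" for c d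
  proof -
    obtain l u where lu: "box c d \<inter> box a b = box l u" by (simp add: box_Int_box)
    have "integrable lborel (\<lambda>v. indicator (box l u) v *\<^sub>R h v)" if "weak_partial f j h" for h
    proof -
      have "set_integrable lborel (cbox l u) h" using that by (auto simp: weak_partial_def)
      then have "set_integrable lborel (box l u) h"
        by (rule set_integrable_subset) (auto simp: box_subset_cbox)
      then show ?thesis by (simp add: set_integrable_def)
    qed
    note i = this[OF g] this[OF g']
    have "indicator (box c d) v *\<^sub>R w v = indicator (box l u) v *\<^sub>R g v - indicator (box l u) v *\<^sub>R g' v" for v
      using lu by (auto simp: w_def split: split_indicator)
    then show ?thesis
      using Bochner_Integration.integral_diff[OF i] weak_partial_box[OF g g', of l u] by simp
  qed
  have "AE v in lborel. Re (w v) = 0"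
  proof (rule box_AE_eq_0)
    fix c d
    have "integrable lborel (\<lambda>v. indicator (box c d) v *\<^sub>R w v)"
      by (rule integrable_mult_indicator[OF _ w]) simp
    from integral_Re[OF this] show "(\<integral>v. indicator (box c d) v * Re (w v) \<partial>lborel) = 0" by (simp add: z)
  qed (use w in auto)
  moreover have "AE v in lborel. Im (w v) = 0"
  proof (rule box_AE_eq_0)
    fix c d
    have "integrable lborel (\<lambda>v. indicator (box c d) v *\<^sub>R w v)"
      by (rule integrable_mult_indicator[OF _ w]) simp
    from integral_Im[OF this] show "(\<integral>v. indicator (box c d) v * Im (w v) \<partial>lborel) = 0" by (simp add: z)
  qed (use w in auto)
  ultimately show ?thesis
    by eventually_elim (use ab in \<open>auto simp: w_def complex_eq_iff subset_iff\<close>)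
qed

text \<open>\<open>H1norm\<close> picks its weak derivative by \<open>SOME\<close>; uniqueness
  almost everywhere makes the norm independent of the choice.\<close>

lemma L2norm_weak_partial:
  fixes f :: "real^'n \<Rightarrow> complex"
  assumes g: "weak_partial f j g" and g': "weak_partial f j g'"
  shows "L2norm L g = L2norm L g'"
proof -
  have m: "(\<lambda>v. indicator (cell L) v *\<^sub>R (cmod (h v))\<^sup>2) \<in> borel_measurable lborel" if "weak_partial f j h" for h
  proof -
    have "set_integrable lborel (cell L) h" using that compact_cell by (auto simp: weak_partial_def)
    then have "(\<lambda>v. indicator (cell L) v *\<^sub>R h v) \<in> borel_measurable lborel" by (auto simp: set_integrable_def)
    then have "(\<lambda>v. (cmod (indicator (cell L) v *\<^sub>R h v))\<^sup>2) \<in> borel_measurable lborel" by measurable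
    moreover have "(cmod (indicator (cell L) v *\<^sub>R h v))\<^sup>2 = indicator (cell L) v *\<^sub>R (cmod (h v))\<^sup>2" for v
      by (simp split: split_indicator)
    ultimately show ?thesis by simp
  qed
  have "AE v in lborel. indicator (cell L) v *\<^sub>R (cmod (g v))\<^sup>2 = indicator (cell L) v *\<^sub>R (cmod (g' v))\<^sup>2"
    using weak_partial_unique[OF g g', of L] by eventually_elim (auto split: split_indicator)
  then show ?thesis
    unfolding L2norm_def set_lebesgue_integral_def
    by (intro arg_cong[where f = sqrt] integral_cong_AE m[OF g] m[OF g'])
qed

text \<open>Dominated convergence works along sequences, so difference quotients are taken at the
  step lengths 1 / (n + 1).\<close>

lemma has_vector_derivative_sequence:
  fixes f :: "real \<Rightarrow> 'b::real_normed_vector"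
  assumes "(f has_vector_derivative D) (at 0)"
  shows "(\<lambda>n. real (Suc n) *\<^sub>R (f (1 / real (Suc n)) - f 0)) \<longlonglongrightarrow> D"
proof -
  have "((\<lambda>h. norm (f (0 + h) - f 0 - h *\<^sub>R D) / norm h) \<longlongrightarrow> 0) (at 0)"
    using assms by (simp add: has_vector_derivative_def has_derivative_at)
  moreover have "filterlim (\<lambda>n. 1 / real (Suc n)) (at 0) sequentially"
    using LIMSEQ_Suc[OF lim_const_over_n[of 1]] by (simp add: filterlim_at)
  ultimately have "(\<lambda>n. norm (f (0 + 1 / real (Suc n)) - f 0 - (1 / real (Suc n)) *\<^sub>R D) / norm (1 / real (Suc n))) \<longlonglongrightarrow> 0"
    by (rule filterlim_compose)
  moreover have "norm (f (0 + 1 / real (Suc n)) - f 0 - (1 / real (Suc n)) *\<^sub>R D) / norm (1 / real (Suc n))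
      = norm (real (Suc n) *\<^sub>R (f (1 / real (Suc n)) - f 0) - D)" for n
  proof -
    have "real (Suc n) *\<^sub>R (f (1 / real (Suc n)) - f 0) - D
        = real (Suc n) *\<^sub>R (f (1 / real (Suc n)) - f 0 - (1 / real (Suc n)) *\<^sub>R D)"
      by (simp add: scaleR_diff_right)
    then have "norm (real (Suc n) *\<^sub>R (f (1 / real (Suc n)) - f 0) - D)
        = real (Suc n) * norm (f (1 / real (Suc n)) - f 0 - (1 / real (Suc n)) *\<^sub>R D)"
      by (simp only: norm_scaleR abs_of_nat)
    then show ?thesis by (simp add: field_simps)
  qed
  ultimately have "(\<lambda>n. norm (real (Suc n) *\<^sub>R (f (1 / real (Suc n)) - f 0) - D)) \<longlonglongrightarrow> 0" by (simp only:)
  then show ?thesis using LIM_zero_iff tendsto_norm_zero_iff by blast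
qed

lemma integrable_lborel_compact_support:
  fixes h :: "'a::euclidean_space \<Rightarrow> 'b::{banach, second_countable_topology}"
  assumes "continuous_on UNIV h" "\<And>v. r < norm v \<Longrightarrow> h v = 0"
  shows "integrable lborel h"
proof -
  have "integrable lborel (\<lambda>v. indicator (cball 0 r) v *\<^sub>R h v)"
    by (rule borel_integrable_compact) (auto intro: continuous_on_subset[OF assms(1)])
  moreover have "indicator (cball 0 r) v *\<^sub>R h v = h v" for v
    using assms(2)[of v] by (auto simp: indicator_def)
  ultimately show ?thesis by simp
qed

text \<open>By translation invariance the integrals of the difference quotients along the axis vanish.\<close>
lemma integral_line_derivative_eq_0:
  fixes h \<rho> :: "real^'n \<Rightarrow> complex"
  assumes h: "continuous_on UNIV h" and c: "continuous_on UNIV \<rho>"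
    and sh: "\<And>v. r < norm v \<Longrightarrow> h v = 0" and sc: "\<And>v. r < norm v \<Longrightarrow> \<rho> v = 0"
    and d: "\<And>v t. ((\<lambda>t. h (v + t *\<^sub>R axis j 1)) has_vector_derivative \<rho> (v + t *\<^sub>R axis j 1)) (at t)"
  shows "(\<integral>v. \<rho> v \<partial>lborel) = 0"
proof -
  let ?e = "axis j 1 :: real^'n"
  define F where "F n v = real (Suc n) *\<^sub>R (h (v + (1 / real (Suc n)) *\<^sub>R ?e) - h v)" for n v
  have ih: "integrable lborel h" by (rule integrable_lborel_compact_support[OF h sh])
  have trans: "(\<integral>v. h (v + y) \<partial>lborel) = (\<integral>v. h v \<partial>lborel)" "integrable lborel (\<lambda>v. h (v + y))" for y
  proof -
    have [measurable]: "h \<in> borel_measurable borel" using h by (rule borel_measurable_continuous_onI)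
    have "(\<integral>v. h v \<partial>lborel) = (\<integral>v. h v \<partial>distr lborel borel ((+) y))" by (simp add: lborel_distr_plus)
    also have "\<dots> = (\<integral>v. h (y + v) \<partial>lborel)" by (rule integral_distr) auto
    finally show "(\<integral>v. h (v + y) \<partial>lborel) = (\<integral>v. h v \<partial>lborel)" by (simp add: add.commute)
    have "integrable (distr lborel borel ((+) y)) h" using ih by (simp add: lborel_distr_plus)
    then have "integrable lborel (\<lambda>v. h (y + v))" by (subst (asm) integrable_distr_eq) auto
    then show "integrable lborel (\<lambda>v. h (v + y))" by (simp add: add.commute)
  qed
  have F0: "(\<integral>v. F n v \<partial>lborel) = 0" for n
    unfolding F_def by (simp add: trans ih)
  have "compact (\<rho> ` cball 0 r)"
    by (intro compact_continuous_image continuous_on_subset[OF c]) auto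
  then obtain M0 where M0: "\<And>v. v \<in> cball 0 r \<Longrightarrow> norm (\<rho> v) \<le> M0"
    by (meson bounded_iff compact_imp_bounded image_eqI)
  define M where "M = max M0 0"
  have M: "norm (\<rho> v) \<le> M" "0 \<le> M" for v
    using M0[of v] sc[of v] by (cases "r < norm v"; auto simp: M_def)+
  \<comment> \<open>The step lengths are at most 1, so all quotients live in one ball and share the
    bound M of the derivative.\<close>
  have bound: "norm (F n v) \<le> M * indicator (cball 0 (\<bar>r\<bar> + 1)) v" for n v
  proof (cases "norm v \<le> \<bar>r\<bar> + 1")
    case True
    have "norm (h (v + (1 / real (Suc n)) *\<^sub>R ?e) - h (v + 0 *\<^sub>R ?e)) \<le> M * norm (1 / real (Suc n) - 0)"
    proof (rule differentiable_bound[where S = UNIV])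
      fix t :: real
      show "((\<lambda>t. h (v + t *\<^sub>R ?e)) has_derivative (\<lambda>x. x *\<^sub>R \<rho> (v + t *\<^sub>R ?e))) (at t within UNIV)"
        using d[of v t] by (simp add: has_vector_derivative_def)
      show "onorm (\<lambda>x. x *\<^sub>R \<rho> (v + t *\<^sub>R ?e)) \<le> M"
      proof (rule onorm_le)
        fix x :: real
        show "norm (x *\<^sub>R \<rho> (v + t *\<^sub>R ?e)) \<le> M * norm x"
          using mult_right_mono[OF M(1), of "norm x"] by (simp add: mult.commute)
      qed
    qed auto
    then have "real (Suc n) * norm (h (v + (1 / real (Suc n)) *\<^sub>R ?e) - h v) \<le> real (Suc n) * (M * (1 / real (Suc n)))"
      by (intro mult_left_mono) auto
    then have "norm (F n v) \<le> M" by (simp add: F_def)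
    then show ?thesis using True by simp
  next
    case False
    have e: "norm ((1 / real (Suc n)) *\<^sub>R ?e) \<le> 1" by simp
    have "norm v \<le> norm (v + (1 / real (Suc n)) *\<^sub>R ?e) + norm ((1 / real (Suc n)) *\<^sub>R ?e)"
      using norm_triangle_ineq4[of "v + (1 / real (Suc n)) *\<^sub>R ?e" "(1 / real (Suc n)) *\<^sub>R ?e"] by simp
    then have "r < norm (v + (1 / real (Suc n)) *\<^sub>R ?e)" "r < norm v" using False e by linarith+
    then have "F n v = 0" by (simp only: F_def sh) simp
    then show ?thesis using M by simp
  qed
  have "(\<lambda>n. \<integral>v. F n v \<partial>lborel) \<longlonglongrightarrow> (\<integral>v. \<rho> v \<partial>lborel)"
  proof (rule integral_dominated_convergence[where w = "\<lambda>v. M * indicator (cball 0 (\<bar>r\<bar> + 1)) v"])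
    show "\<rho> \<in> borel_measurable lborel" using borel_measurable_continuous_onI[OF c] by simp
    show "F n \<in> borel_measurable lborel" for n
    proof -
      have "continuous_on UNIV (F n)"
        unfolding F_def[abs_def] by (intro continuous_intros h continuous_on_compose2[OF h]) auto
      then show ?thesis using borel_measurable_continuous_onI by auto
    qed
    show "integrable lborel (\<lambda>v::real^'n. M * indicator (cball 0 (\<bar>r\<bar> + 1)) v)"
      using emeasure_bounded_finite[of "cball 0 (\<bar>r\<bar> + 1) :: (real^'n) set"] by (simp add: integrable_indicator_iff)
    show "AE v in lborel. (\<lambda>n. F n v) \<longlonglongrightarrow> \<rho> v"
      using has_vector_derivative_sequence[OF d[of _ 0, simplified]] by (simp add: F_def)
  qed (use bound in auto)
  then show ?thesis by (simp add: F0 LIMSEQ_const_iff)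
qed

section \<open>Classical and weak derivatives of trigonometric polynomials\<close>

lemma has_vector_derivative_fmode:
  "((\<lambda>t. fmode L k (v + t *\<^sub>R axis j 1)) has_vector_derivative
     \<i> * of_real (pi * of_int (k j) / L) * fmode L k (v + t *\<^sub>R axis j 1)) (at t)"
proof -
  define a where "a = pi * of_int (k j) / L"
  have e: "fmode L k (v + t *\<^sub>R axis j 1) = fmode L k v * exp (\<i> * of_real a * of_real t)" for t
    by (simp add: fmode_shift fmode_axis cis_conv_exp a_def mult_ac)
  have "((\<lambda>z. exp (\<i> * of_real a * z)) has_field_derivative exp (\<i> * of_real a * of_real t) * (\<i> * of_real a)) (at (of_real t))"
    by (auto intro!: derivative_eq_intros)
  from has_vector_derivative_real_field[OF this, of UNIV]
  have "((\<lambda>t. exp (\<i> * of_real a * of_real t)) has_vector_derivative exp (\<i> * of_real a * of_real t) * (\<i> * of_real a)) (at t)"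
    by simp
  from bounded_linear.has_vector_derivative[OF bounded_linear_mult_right this, of "fmode L k v"]
  show ?thesis unfolding e a_def[symmetric] by (simp add: mult_ac)
qed

lemma has_vector_derivative_trig_sum:
  "((\<lambda>t. trig_sum L K c (v + t *\<^sub>R axis j 1)) has_vector_derivative
     trig_sum L K (trig_partial L j c) (v + t *\<^sub>R axis j 1)) (at t)"
proof -
  have "((\<lambda>t. \<Sum>k\<in>K. c k * fmode L k (v + t *\<^sub>R axis j 1)) has_vector_derivative
     (\<Sum>k\<in>K. c k * (\<i> * of_real (pi * of_int (k j) / L) * fmode L k (v + t *\<^sub>R axis j 1)))) (at t)"
    by (intro has_vector_derivative_sum bounded_linear.has_vector_derivative[OF bounded_linear_mult_right has_vector_derivative_fmode])
  then show ?thesis by (simp add: trig_sum_def[abs_def] trig_partial_def mult_ac)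
qed

lemma has_partial_unique: "has_partial \<phi> j \<psi> \<Longrightarrow> has_partial \<phi> j \<psi>' \<Longrightarrow> \<psi> = \<psi>'"
  unfolding has_partial_def by (auto intro: DERIV_unique)

text \<open>Integration by parts without boundary terms: the product of the test function with the
  polynomial has compact support, so the integral of its derivative along the axis vanishes.\<close>

lemma weak_partial_trig_sum:
  fixes c :: "('n::finite \<Rightarrow> int) \<Rightarrow> complex"
  assumes L: "0 < L"
  shows "weak_partial (trig_sum L K c) j (trig_sum L K (trig_partial L j c))"
  unfolding weak_partial_def
proof (intro conjI allI impI)
  have cont: "continuous_on A (trig_sum L K c')" for c' :: "('n \<Rightarrow> int) \<Rightarrow> complex" and A
    using cont_periodic_trig_sum[OF L, of K c'] by (auto simp: cont_periodic_def intro: continuous_on_subset)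
  show "set_integrable lborel S (trig_sum L K c)" "set_integrable lborel S (trig_sum L K (trig_partial L j c))"
    if "compact S" for S
    unfolding set_integrable_def by (intro borel_integrable_compact that cont)+
  fix \<phi> \<psi> :: "real^'n \<Rightarrow> real" assume a: "test_fn \<phi> \<and> has_partial \<phi> j \<psi>"
  let ?f = "trig_sum L K c" and ?g = "trig_sum L K (trig_partial L j c)"
  have \<phi>c: "continuous_on UNIV \<phi>" using a by (simp add: test_fn_def)
  \<comment> \<open>The given \<psi> is a pointwise derivative with no stated continuity; it
    coincides with the continuous derivative that \<open>test_fn\<close> guarantees.\<close>
  obtain \<psi>' where "continuous_on UNIV \<psi>'" "has_partial \<phi> j \<psi>'" using a by (auto simp: test_fn_def)
  then have \<psi>c: "continuous_on UNIV \<psi>" using a has_partial_unique by blast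
  obtain r where "\<And>v. \<phi> v \<noteq> 0 \<Longrightarrow> norm v \<le> r"
    using a by (auto simp: test_fn_def bounded_iff)
  then have r: "\<And>v. r < norm v \<Longrightarrow> \<phi> v = 0" by force
  have line: "((\<lambda>t. \<phi> (v + t *\<^sub>R axis j 1)) has_real_derivative \<psi> (v + t *\<^sub>R axis j 1)) (at t)" for v t
  proof -
    have "((\<lambda>s. \<phi> ((v + t *\<^sub>R axis j 1) + s *\<^sub>R axis j 1)) has_real_derivative \<psi> (v + t *\<^sub>R axis j 1)) (at 0)"
      using a by (simp add: has_partial_def)
    moreover have "(v + t *\<^sub>R axis j 1) + s *\<^sub>R axis j 1 = v + (s + t) *\<^sub>R axis j 1" for s
      by (simp add: scaleR_left_distrib)
    ultimately have "((\<lambda>s. \<phi> (v + (s + t) *\<^sub>R axis j 1)) has_real_derivative \<psi> (v + t *\<^sub>R axis j 1)) (at 0)" by simp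
    then show ?thesis using DERIV_shift[of "\<lambda>t. \<phi> (v + t *\<^sub>R axis j 1)" _ 0 t] by simp
  qed
  \<comment> \<open>Beyond radius r the test function vanishes in a whole neighbourhood along the
    axis, hence so does its derivative.\<close>
  have r': "\<psi> v = 0" if "r < norm v" for v
  proof -
    have "isCont (\<lambda>t. norm (v + t *\<^sub>R axis j 1 :: real^'n)) 0" by (intro continuous_intros)
    then have "((\<lambda>t. norm (v + t *\<^sub>R axis j 1 :: real^'n)) \<longlongrightarrow> norm v) (at 0)" by (simp add: isCont_def)
    then have "eventually (\<lambda>t. r < norm (v + t *\<^sub>R axis j 1 :: real^'n)) (at 0)"
      using that by (rule order_tendstoD(1))
    then have "eventually (\<lambda>t. r < norm (v + t *\<^sub>R axis j 1 :: real^'n)) (nhds 0)"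
      using that by (auto simp: eventually_at_filter elim: eventually_mono)
    then have "eventually (\<lambda>t. 0 = \<phi> (v + t *\<^sub>R axis j 1)) (nhds 0)"
      by eventually_elim (use r in auto)
    then have "((\<lambda>t. 0) has_real_derivative \<psi> v) (at 0)"
      using line[of v 0] by (subst DERIV_cong_ev[OF refl _ refl]) auto
    then show ?thesis using DERIV_unique[OF _ DERIV_const] by blast
  qed
  have "(\<integral>v. of_real (\<phi> v) * ?g v + of_real (\<psi> v) * ?f v \<partial>lborel) = 0"
  proof (rule integral_line_derivative_eq_0[where h = "\<lambda>v. of_real (\<phi> v) * ?f v" and r = r and j = j])
    fix v t
    have "((\<lambda>t. complex_of_real (\<phi> (v + t *\<^sub>R axis j 1))) has_vector_derivative of_real (\<psi> (v + t *\<^sub>R axis j 1))) (at t)"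
      using line[of v t] by (intro has_vector_derivative_of_real) (simp add: has_real_derivative_iff_has_vector_derivative)
    from has_vector_derivative_mult[OF this has_vector_derivative_trig_sum]
    show "((\<lambda>t. of_real (\<phi> (v + t *\<^sub>R axis j 1)) * ?f (v + t *\<^sub>R axis j 1)) has_vector_derivative
        of_real (\<phi> (v + t *\<^sub>R axis j 1)) * ?g (v + t *\<^sub>R axis j 1) + of_real (\<psi> (v + t *\<^sub>R axis j 1)) * ?f (v + t *\<^sub>R axis j 1)) (at t)" .
  qed (auto intro!: continuous_intros \<phi>c \<psi>c cont simp: r r')
  moreover have "integrable lborel (\<lambda>v. of_real (\<phi> v) * ?g v)" "integrable lborel (\<lambda>v. of_real (\<psi> v) * ?f v)"
    by (rule integrable_lborel_compact_support[where r = r]; auto intro!: continuous_intros \<phi>c \<psi>c cont simp: r r')+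
  ultimately show "(\<integral>v. of_real (\<psi> v) * ?f v \<partial>lborel) = - (\<integral>v. of_real (\<phi> v) * ?g v \<partial>lborel)"
    by (simp add: add_eq_0_iff2)
qed

lemma L2norm_power2: "(L2norm L f)\<^sup>2 = (\<integral>v. (cmod (f v))\<^sup>2 \<partial>cell_measure L)"
  by (simp add: L2norm_def set_integral_cell)

lemma in_L1_cont: "0 < L \<Longrightarrow> cont_periodic L f \<Longrightarrow> in_L1 L f"
  by (simp add: in_L1_def set_integrable_cell integrable_cell_cont)

lemma in_L2_cont:
  assumes "0 < L" "cont_periodic L f" shows "in_L2 L f"
proof -
  have "cont_periodic L (\<lambda>v. (cmod (f v))\<^sup>2)"
    by (rule cont_periodic_compose[OF assms(2)]) (intro continuous_intros)
  then show ?thesis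
    using cont_periodic_measurable[OF assms(2)] assms(1) by (simp add: in_L2_def set_integrable_cell integrable_cell_cont)
qed

lemma in_H1_trig_sum: "0 < L \<Longrightarrow> in_H1 L (trig_sum L K c)"
  unfolding in_H1_def using weak_partial_trig_sum in_L2_cont cont_periodic_trig_sum by blast

lemma partial_le_H1norm:
  assumes L: "0 < L"
  shows "(\<integral>v. (cmod (trig_sum L K (trig_partial L j c) v))\<^sup>2 \<partial>cell_measure L) \<le> (H1norm L (trig_sum L K c))\<^sup>2"
proof -
  let ?f = "trig_sum L K c"
  have w: "weak_partial ?f j (trig_sum L K (trig_partial L j c))" by (rule weak_partial_trig_sum[OF L])
  then have "weak_partial ?f j (SOME g. weak_partial ?f j g)" by (rule someI[where P = "weak_partial ?f j"])
  then have "(\<integral>v. (cmod (trig_sum L K (trig_partial L j c) v))\<^sup>2 \<partial>cell_measure L) = (L2norm L (SOME g. weak_partial ?f j g))\<^sup>2"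
    using L2norm_weak_partial[OF w] L2norm_power2 by metis
  also have "\<dots> \<le> (\<Sum>j\<in>UNIV. (L2norm L (SOME g. weak_partial ?f j g))\<^sup>2)"
    by (rule member_le_sum) auto
  also have "\<dots> \<le> (H1norm L ?f)\<^sup>2"
    by (simp add: H1norm_def sum_nonneg)
  finally show ?thesis .
qed

section \<open>The Galerkin system\<close>

text \<open>Stated for bounded continuous functions without periodicity, since the truncated field
  acts on the space of all of these.\<close>

lemma PN_add:
  fixes g h :: "real^'n \<Rightarrow> complex"
  assumes g: "continuous_on UNIV g" "\<And>x. norm (g x) \<le> B" and h: "continuous_on UNIV h" "\<And>x. norm (h x) \<le> B'"
  shows "PN L N (\<lambda>v. g v + h v) v = PN L N g v + PN L N h v"
proof -
  have fm: "continuous_on UNIV (fmode L k :: real^'n \<Rightarrow> complex)" for k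
    unfolding fmode_def cis_conv_exp by (intro continuous_intros)
  have i: "integrable (cell_measure L) (\<lambda>v. f v * cnj (fmode L k v))"
    if "continuous_on UNIV f" "\<And>x. norm (f x) \<le> B" for f :: "real^'n \<Rightarrow> complex" and B k
    by (rule integrable_cell_bounded[of _ B])
       (use that fm in \<open>auto intro!: borel_measurable_continuous_onI continuous_intros simp: norm_mult\<close>)
  have "fcoef L (\<lambda>v. g v + h v) k = fcoef L g k + fcoef L h k" for k
    by (simp add: fcoef_eq distrib_right add_divide_distrib i[OF g] i[OF h])
  then show ?thesis by (simp add: PN_def distrib_right sum.distrib)
qed

text \<open>A curve starting in \<open>PN_space\<close> with velocities in \<open>PN_space\<close> stays there, since its distance
  to the interpolant through the nodes of the discrete Fourier transform has derivative zero.\<close>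
lemma PN_space_curve:
  fixes G H :: "real \<Rightarrow> real^'n \<Rightarrow> complex"
  assumes L: "0 < L" and T: "0 \<le> T" and G0: "G 0 \<in> PN_space L N"
    and H: "\<And>t. t \<in> {0..T} \<Longrightarrow> H t \<in> PN_space L N"
    and d: "\<And>t v. t \<in> {0..T} \<Longrightarrow> ((\<lambda>s. G s v) has_vector_derivative H t v) (at t within {0..T})"
  obtains c where "\<And>t. t \<in> {0..T} \<Longrightarrow> G t = trig_sum L (freqs N) (c t)"
    "\<And>t k. t \<in> {0..T} \<Longrightarrow> k \<in> freqs N \<Longrightarrow> ((\<lambda>s. c s k) has_vector_derivative fcoef L (H t) k) (at t within {0..T})"
proof -
  obtain S :: "('n \<Rightarrow> nat) set" and P :: "('n \<Rightarrow> nat) \<Rightarrow> real^'n" and W where S: "finite S" and W: "\<And>k l. k \<in> freqs N \<Longrightarrow> l \<in> freqs N \<Longrightarrow>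
      (\<Sum>s\<in>S. W k s * fmode L l (P s)) = (if k = l then 1 else (0::complex))"
    using interpolation_weights[OF L, where N = N and 'n = 'n] by metis
  have coef: "(\<Sum>s\<in>S. W k s * f (P s)) = fcoef L f k" if f: "f \<in> PN_space L N" and k: "k \<in> freqs N" for f k
  proof -
    obtain a where a: "f = trig_sum L (freqs N) a" using f by (auto simp: PN_space_trig_sum)
    have "(\<Sum>s\<in>S. W k s * f (P s)) = (\<Sum>s\<in>S. \<Sum>l\<in>freqs N. a l * (W k s * fmode L l (P s)))"
      by (simp add: a trig_sum_def sum_distrib_left mult_ac)
    also have "\<dots> = (\<Sum>l\<in>freqs N. a l * (\<Sum>s\<in>S. W k s * fmode L l (P s)))"
      by (subst sum.swap) (simp add: sum_distrib_left)
    also have "\<dots> = (\<Sum>l\<in>freqs N. a l * (if k = l then 1 else 0))"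
      by (intro sum.cong refl) (simp add: W[OF k])
    also have "\<dots> = a k" using k by (simp add: if_distrib cong: if_cong)
    finally show ?thesis using k by (simp add: a fcoef_trig_sum[OF L])
  qed
  define c where "c t k = (\<Sum>s\<in>S. W k s * G t (P s))" for t k
  have dc: "((\<lambda>s. c s k) has_vector_derivative fcoef L (H t) k) (at t within {0..T})"
    if t: "t \<in> {0..T}" and k: "k \<in> freqs N" for t k
    unfolding c_def coef[OF H[OF t] k, symmetric]
    by (intro has_vector_derivative_sum bounded_linear.has_vector_derivative[OF bounded_linear_mult_right d[OF t]])
  have "G t v = trig_sum L (freqs N) (c t) v" if t: "t \<in> {0..T}" for t v
  proof -
    define D where "D s = G s v - trig_sum L (freqs N) (c s) v" for s
    have "(D has_vector_derivative 0) (at s within {0..T})" if s: "s \<in> {0..T}" for s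
    proof -
      have "((\<lambda>s. trig_sum L (freqs N) (c s) v) has_vector_derivative trig_sum L (freqs N) (fcoef L (H s)) v) (at s within {0..T})"
        unfolding trig_sum_def
        by (intro has_vector_derivative_sum bounded_linear.has_vector_derivative[OF bounded_linear_mult_left dc[OF s]])
      moreover have "trig_sum L (freqs N) (fcoef L (H s)) v = H s v"
        using PN_idem[OF L H[OF s]] by (simp add: PN_trig_sum)
      ultimately have "((\<lambda>s. trig_sum L (freqs N) (c s) v) has_vector_derivative H s v) (at s within {0..T})" by simp
      from has_vector_derivative_diff[OF d[OF s, of v] this] show ?thesis by (simp add: D_def[abs_def])
    qed
    then obtain a where a: "\<And>s. s \<in> {0..T} \<Longrightarrow> D s = a"
      using has_vector_derivative_zero_constant[of "{0..T}" D] by auto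
    have "trig_sum L (freqs N) (c 0) = G 0"
    proof
      fix w
      have "trig_sum L (freqs N) (c 0) w = trig_sum L (freqs N) (fcoef L (G 0)) w"
        unfolding trig_sum_def by (intro sum.cong refl) (simp add: c_def coef[OF G0])
      also have "\<dots> = G 0 w" using PN_idem[OF L G0] by (simp add: PN_trig_sum)
      finally show "trig_sum L (freqs N) (c 0) w = G 0 w" .
    qed
    then have "D 0 = 0" by (simp add: D_def)
    with a[of 0] a[OF t] T show ?thesis by (simp add: D_def)
  qed
  then have "G t = trig_sum L (freqs N) (c t)" if "t \<in> {0..T}" for t
    using that by blast
  then show ?thesis using dc that by blast
qed

lemma has_derivative_cmod_square:
  fixes \<delta> :: "real \<Rightarrow> complex"
  assumes "(\<delta> has_vector_derivative d) (at t within S)"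
  shows "((\<lambda>s. (cmod (\<delta> s))\<^sup>2) has_real_derivative 2 * Re (cnj (\<delta> t) * d)) (at t within S)"
proof -
  have r: "((\<lambda>s. Re (\<delta> s)) has_real_derivative Re d) (at t within S)"
    and i: "((\<lambda>s. Im (\<delta> s)) has_real_derivative Im d) (at t within S)"
    using bounded_linear.has_vector_derivative[OF bounded_linear_Re assms]
      bounded_linear.has_vector_derivative[OF bounded_linear_Im assms]
    by (auto simp: has_real_derivative_iff_has_vector_derivative)
  show ?thesis
    unfolding cmod_power2 using DERIV_add[OF DERIV_mult[OF r r] DERIV_mult[OF i i]]
    by (simp add: power2_eq_square algebra_simps)
qed

section \<open>Uniqueness of Galerkin solutions\<close>

context cutoff_kernel
begin

lemma PN_space_bound:
  "cmod (trig_sum L K c v) \<le> (\<Sum>k\<in>K. cmod (c k))"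
  unfolding trig_sum_def by (rule sum_norm_le) (simp add: norm_mult)

text \<open>Polarisation: Q(G,G) - Q(F,F) = Q(G - F, G) + Q(F, G - F), each term contributing half
  of the constant 4.\<close>

lemma Q_diff_bound:
  fixes F G :: "real^'n \<Rightarrow> complex"
  assumes F: "cp F" "\<And>x. cmod (F x) \<le> B" and G: "cp G" "\<And>x. cmod (G x) \<le> B" and D: "\<And>x. cmod (G x - F x) \<le> D"
  shows "cmod (Q G G v - Q F F v) \<le> 4 * measure coll UNIV * B * D"
proof -
  let ?E = "\<lambda>x. G x - F x"
  have E: "cp ?E" by (intro cont_periodic_diff F G)
  have "Q G G v = Q (\<lambda>x. ?E x + F x) G v" by simp
  also have "\<dots> = Q ?E G v + Q F G v" by (rule Q_add_left_cp[OF E G(1) F(1)])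
  also have "Q F G v = Q F (\<lambda>x. ?E x + F x) v" by simp
  also have "\<dots> = Q F ?E v + Q F F v" by (rule Q_add_right_cp[OF E F(1) F(1)])
  finally have "Q G G v - Q F F v = Q ?E G v + Q F ?E v" by simp
  moreover have "cmod (Q ?E G v) \<le> 2 * measure coll UNIV * D * B"
    by (rule norm_Q_le) (use E G D in \<open>auto simp: cont_periodic_def\<close>)
  moreover have "cmod (Q F ?E v) \<le> 2 * measure coll UNIV * B * D"
    by (rule norm_Q_le) (use E F D in \<open>auto simp: cont_periodic_def\<close>)
  ultimately show ?thesis using norm_triangle_ineq[of "Q ?E G v" "Q F ?E v"] by (simp add: mult_ac)
qed

text \<open>Supplies what the pointwise notion of solution lacks: differentiable coefficients and,
  from their continuity, a bound uniform in time and space. It also replaces \<open>QR\<close> by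
  \<open>Q\<close>.\<close>

lemma galerkin_sol_curve:
  fixes F :: "real \<Rightarrow> real^'n \<Rightarrow> complex"
  assumes T: "0 < T" and f0: "f0 \<in> PN_space L N" and sol: "galerkin_sol R L \<Phi> b N T f0 F"
  obtains c B where "\<And>t. t \<in> {0..T} \<Longrightarrow> F t = trig_sum L (freqs N) (c t)"
    "\<And>t k. t \<in> {0..T} \<Longrightarrow> k \<in> freqs N \<Longrightarrow> ((\<lambda>s. c s k) has_vector_derivative fcoef L (Q (F t) (F t)) k) (at t within {0..T})"
    "\<And>t v. t \<in> {0..T} \<Longrightarrow> cmod (F t v) \<le> B"
proof -
  have F0: "F 0 = f0" and dF: "\<And>t v. t \<in> {0..T} \<Longrightarrow> ((\<lambda>s. F s v) has_vector_derivative PN L N (QR R \<Phi> b (F t) (F t)) v) (at t within {0..T})"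
    using sol by (auto simp: galerkin_sol_def)
  obtain c where c: "\<And>t. t \<in> {0..T} \<Longrightarrow> F t = trig_sum L (freqs N) (c t)"
    and dc: "\<And>t k. t \<in> {0..T} \<Longrightarrow> k \<in> freqs N \<Longrightarrow>
      ((\<lambda>s. c s k) has_vector_derivative fcoef L (PN L N (QR R \<Phi> b (F t) (F t))) k) (at t within {0..T})"
    using PN_space_curve[OF L_pos less_imp_le[OF T], of F N "\<lambda>t. PN L N (QR R \<Phi> b (F t) (F t))"] F0 f0 dF PN_in_PN_space
    by metis
  have QQ: "QR R \<Phi> b (F t) (F t) = Q (F t) (F t)" if "t \<in> {0..T}" for t
  proof -
    have cpF: "cp (F t)" using c[OF that] cont_periodic_trig_sum[OF L_pos] by simp
    obtain B where B: "\<And>x. norm (F t x) \<le> B" using cont_periodic_bounded[OF L_pos cpF] by metis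
    have cF: "continuous_on UNIV (F t)" using cpF by (simp add: cont_periodic_def)
    show ?thesis using QR_eq_Q[OF cF B cF B] by blast
  qed
  have coef: "fcoef L (PN L N h) k = fcoef L h k" if "k \<in> freqs N" for h :: "real^'n \<Rightarrow> complex" and k
    using that by (simp add: PN_trig_sum fcoef_trig_sum[OF L_pos])
  have cc: "continuous_on {0..T} (\<lambda>t. c t k)" if "k \<in> freqs N" for k
    using dc[OF _ that] by (meson continuous_on_eq_continuous_within has_vector_derivative_continuous)
  have "compact ((\<lambda>t. \<Sum>k\<in>freqs N. cmod (c t k)) ` {0..T})"
    by (intro compact_continuous_image continuous_on_sum continuous_on_norm cc) auto
  then obtain B where B: "\<And>t. t \<in> {0..T} \<Longrightarrow> norm (\<Sum>k\<in>freqs N. cmod (c t k)) \<le> B"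
    by (meson bounded_iff compact_imp_bounded image_eqI)
  have "cmod (F t v) \<le> B" if t: "t \<in> {0..T}" for t v
  proof -
    have "cmod (F t v) \<le> (\<Sum>k\<in>freqs N. cmod (c t k))" unfolding c[OF t] by (rule PN_space_bound)
    also have "\<dots> \<le> B" using B[OF t] by simp
    finally show ?thesis .
  qed
  then show ?thesis
    using that[of c B] c dc QQ coef by simp
qed

text \<open>Gronwall for the squared distance of the coefficient vectors, the Lipschitz constant
  coming from the common bound of the two solutions. Complex-valued competitors are covered.\<close>

lemma galerkin_unique:
  fixes F G :: "real \<Rightarrow> real^'n \<Rightarrow> complex"
  assumes T: "0 < T" and f0: "f0 \<in> PN_space L N"
    and F: "galerkin_sol R L \<Phi> b N T f0 F" and G: "galerkin_sol R L \<Phi> b N T f0 G" and t: "t \<in> {0..T}"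
  shows "G t = F t"
proof -
  let ?K = "freqs N :: ('n \<Rightarrow> int) set"
  obtain c B where c: "\<And>t. t \<in> {0..T} \<Longrightarrow> F t = trig_sum L ?K (c t)"
    and dc: "\<And>t k. t \<in> {0..T} \<Longrightarrow> k \<in> ?K \<Longrightarrow> ((\<lambda>s. c s k) has_vector_derivative fcoef L (Q (F t) (F t)) k) (at t within {0..T})"
    and B: "\<And>t v. t \<in> {0..T} \<Longrightarrow> cmod (F t v) \<le> B"
    using galerkin_sol_curve[OF T f0 F] by metis
  obtain d B' where d: "\<And>t. t \<in> {0..T} \<Longrightarrow> G t = trig_sum L ?K (d t)"
    and dd: "\<And>t k. t \<in> {0..T} \<Longrightarrow> k \<in> ?K \<Longrightarrow> ((\<lambda>s. d s k) has_vector_derivative fcoef L (Q (G t) (G t)) k) (at t within {0..T})"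
    and B': "\<And>t v. t \<in> {0..T} \<Longrightarrow> cmod (G t v) \<le> B'"
    using galerkin_sol_curve[OF T f0 G] by metis
  define A where "A = max B B'"
  have A: "cmod (F t v) \<le> A" "cmod (G t v) \<le> A" if "t \<in> {0..T}" for t v
    using B[OF that, of v] B'[OF that, of v] by (auto simp: A_def)
  have A0: "0 \<le> A" using order_trans[OF norm_ge_zero A(1)[OF t]] by blast
  define \<delta> where "\<delta> s k = d s k - c s k" for s k
  define e where "e s = (\<Sum>k\<in>?K. (cmod (\<delta> s k))\<^sup>2)" for s
  define q where "q s k = fcoef L (Q (G s) (G s)) k - fcoef L (Q (F s) (F s)) k" for s k
  define M where "M = 4 * measure coll UNIV * A"
  have M0: "0 \<le> M" using A0 by (simp add: M_def)
  have de: "(e has_real_derivative (\<Sum>k\<in>?K. 2 * Re (cnj (\<delta> s k) * q s k))) (at s within {0..T})" if "s \<in> {0..T}" for s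
    unfolding e_def[abs_def]
  proof (intro DERIV_sum has_derivative_cmod_square)
    fix k assume "k \<in> ?K"
    from has_vector_derivative_diff[OF dd[OF that this] dc[OF that this]]
    show "((\<lambda>s. \<delta> s k) has_vector_derivative q s k) (at s within {0..T})" by (simp add: \<delta>_def q_def)
  qed
  have qb: "cmod (q s k) \<le> M * (\<Sum>k\<in>?K. cmod (\<delta> s k))" if s: "s \<in> {0..T}" for s k
  proof -
    have cpF: "cp (F s)" "cp (G s)" using c[OF s] d[OF s] cont_periodic_trig_sum[OF L_pos] by auto
    have dif: "cmod (G s x - F s x) \<le> (\<Sum>k\<in>?K. cmod (\<delta> s k))" for x
    proof -
      have "G s x - F s x = trig_sum L ?K (\<delta> s) x"
        by (simp add: c[OF s] d[OF s] trig_sum_def \<delta>_def left_diff_distrib sum_subtractf)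
      then show ?thesis using PN_space_bound by metis
    qed
    have "q s k = fcoef L (\<lambda>v. Q (G s) (G s) v - Q (F s) (F s) v) k"
    proof -
      have "integrable (cell_measure L) (\<lambda>w. h w * cnj (fmode L k w))" if "cp h" for h :: "real^'n \<Rightarrow> complex"
        by (intro integrable_cell_cont[OF L_pos] cont_periodic_mult that cont_periodic_cnj cont_periodic_fmode[OF L_pos])
      then show ?thesis
        using cont_periodic_Q[OF cpF(1) cpF(1)] cont_periodic_Q[OF cpF(2) cpF(2)]
        by (simp add: q_def fcoef_eq left_diff_distrib diff_divide_distrib)
    qed
    also have "cmod \<dots> \<le> M * (\<Sum>k\<in>?K. cmod (\<delta> s k))"
      unfolding M_def
      by (rule norm_fcoef_le[OF L_pos], rule Q_diff_bound[OF cpF(1) A(1)[OF s] cpF(2) A(2)[OF s] dif])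
    finally show ?thesis .
  qed
  have le: "(\<Sum>k\<in>?K. 2 * Re (cnj (\<delta> s k) * q s k)) \<le> (2 * M * card ?K) * e s + 0" if s: "s \<in> {0..T}" for s
  proof -
    let ?S = "\<Sum>k\<in>?K. cmod (\<delta> s k)"
    have "(\<Sum>k\<in>?K. 2 * Re (cnj (\<delta> s k) * q s k)) \<le> (\<Sum>k\<in>?K. 2 * (cmod (\<delta> s k) * (M * ?S)))"
    proof (intro sum_mono mult_left_mono)
      fix k
      have "Re (cnj (\<delta> s k) * q s k) \<le> cmod (\<delta> s k) * cmod (q s k)"
        using complex_Re_le_cmod[of "cnj (\<delta> s k) * q s k"] by (simp add: norm_mult)
      also have "\<dots> \<le> cmod (\<delta> s k) * (M * ?S)" by (intro mult_left_mono qb[OF s]) auto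
      finally show "Re (cnj (\<delta> s k) * q s k) \<le> cmod (\<delta> s k) * (M * ?S)" .
    qed auto
    also have "\<dots> = 2 * M * ?S\<^sup>2"
      by (simp add: power2_eq_square sum_distrib_right sum_distrib_left mult_ac)
    also have "\<dots> \<le> 2 * M * (card ?K * e s)"
      using sum_squared_le_sum_of_squares[of "\<lambda>k. cmod (\<delta> s k)" ?K] M0
      by (intro mult_left_mono) (auto simp: e_def mult.commute)
    finally show ?thesis by (simp add: mult_ac)
  qed
  have "e t \<le> exp ((2 * M * card ?K) * t) * (e 0 + 0 * t)"
    by (rule gronwall[OF de le _ _ t]) (use M0 in auto)
  moreover have "e 0 = 0"
  proof -
    have "trig_sum L ?K (d 0) = trig_sum L ?K (c 0)"
      using c[of 0] d[of 0] F G T by (simp add: galerkin_sol_def)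
    then have "d 0 k = c 0 k" if "k \<in> ?K" for k
      using that fcoef_trig_sum[OF L_pos finite_freqs, of N "d 0" k] fcoef_trig_sum[OF L_pos finite_freqs, of N "c 0" k] by simp
    then show ?thesis by (simp add: e_def \<delta>_def)
  qed
  ultimately have "e t \<le> 0" by simp
  moreover have "0 \<le> e t" unfolding e_def by (intro sum_nonneg) auto
  ultimately have "e t = 0" by (rule antisym)
  then have "\<And>k. k \<in> ?K \<Longrightarrow> d t k = c t k"
    by (simp add: e_def \<delta>_def sum_nonneg_eq_0_iff)
  then show ?thesis using c[OF t] d[OF t] by (simp add: trig_sum_def fun_eq_iff)
qed

end

section \<open>A truncated Galerkin field\<close>

text \<open>Completeness in the sup norm, so that the Picard argument applies to curves of bounded
  continuous functions.\<close>

instance bcontfun :: (metric_space, banach) banach ..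

text \<open>A quadratic field is Lipschitz only on balls; a Lipschitz factor vanishing outside
  radius M makes it globally so. The first part of the constant stems from varying the factor, the
  second from the bilinear map. By symmetry one argument may be assumed inside the ball, unless both
  terms vanish.\<close>

lemma lipschitz_cutoff:
  fixes B :: "'b::real_normed_vector \<Rightarrow> 'b \<Rightarrow> 'c::real_normed_vector" and cut :: "'b \<Rightarrow> real"
  assumes add1: "\<And>f g h. B (f + g) h = B f h + B g h" and add2: "\<And>f g h. B h (f + g) = B h f + B h g"
    and bd: "\<And>f g. norm (B f g) \<le> C * norm f * norm g" and C: "0 \<le> C" and M: "0 \<le> M"
    and cut: "\<And>f g. \<bar>cut f - cut g\<bar> \<le> K * norm (f - g)" "\<And>f. \<bar>cut f\<bar> \<le> 1" "\<And>f. M < norm f \<Longrightarrow> cut f = 0"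
  shows "norm (cut f *\<^sub>R B f f - cut g *\<^sub>R B g g) \<le> (K * C * M\<^sup>2 + 2 * C * M) * norm (f - g)"
proof -
  have K: "0 \<le> K * norm (f - g)" for f g :: 'b using order_trans[OF abs_ge_zero cut(1)] .
  have main: "norm (cut f *\<^sub>R B f f - cut g *\<^sub>R B g g) \<le> (K * C * M\<^sup>2 + 2 * C * M) * norm (f - g)"
    if f: "norm f \<le> M" for f g
  proof -
    have "cut f *\<^sub>R B f f - cut g *\<^sub>R B g g = (cut f - cut g) *\<^sub>R B f f + cut g *\<^sub>R (B f f - B g g)"
      by (simp add: algebra_simps)
    also have "norm \<dots> \<le> \<bar>cut f - cut g\<bar> * norm (B f f) + \<bar>cut g\<bar> * norm (B f f - B g g)"
      by (metis norm_scaleR norm_triangle_ineq)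
    also have "\<dots> \<le> K * norm (f - g) * (C * M\<^sup>2) + 2 * C * M * norm (f - g)"
    proof (rule add_mono)
      have "norm (B f f) \<le> C * M\<^sup>2"
        using order_trans[OF bd[of f f] mult_mono[OF mult_left_mono[OF f C] f]] C M
        by (simp add: power2_eq_square mult.assoc)
      then show "\<bar>cut f - cut g\<bar> * norm (B f f) \<le> K * norm (f - g) * (C * M\<^sup>2)"
        using cut(1)[of f g] K[of f g] by (intro mult_mono) auto
      show "\<bar>cut g\<bar> * norm (B f f - B g g) \<le> 2 * C * M * norm (f - g)"
      proof (cases "M < norm g")
        case True
        then show ?thesis using cut(3)[OF True] C M by simp
      next
        case False
        have "B f f - B g g = B (f - g) f + B g (f - g)"
          using add1[of "f - g" g f] add2[of g "f - g" g] by simp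
        then have "norm (B f f - B g g) \<le> norm (B (f - g) f) + norm (B g (f - g))"
          by (simp add: norm_triangle_ineq)
        also have "\<dots> \<le> C * norm (f - g) * norm f + C * norm g * norm (f - g)" by (intro add_mono bd)
        also have "\<dots> \<le> C * norm (f - g) * M + C * M * norm (f - g)"
          using f False C by (intro add_mono mult_left_mono mult_right_mono) auto
        finally have "norm (B f f - B g g) \<le> 2 * C * M * norm (f - g)" by (simp add: mult_ac)
        moreover have "\<bar>cut g\<bar> * norm (B f f - B g g) \<le> 1 * norm (B f f - B g g)"
          by (intro mult_right_mono cut(2)) auto
        ultimately show ?thesis by linarith
      qed
    qed
    finally show ?thesis by (simp add: algebra_simps)
  qed
  show ?thesis
  proof (cases "norm f \<le> M")
    case True
    then show ?thesis by (rule main)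
  next
    case f: False
    show ?thesis
    proof (cases "norm g \<le> M")
      case True
      from main[OF this, of f] show ?thesis by (simp add: norm_minus_commute)
    next
      case False
      then have "cut f = 0" "cut g = 0" using f cut(3) by auto
      moreover have "(K * C * M\<^sup>2 + 2 * C * M) * norm (f - g) = K * norm (f - g) * (C * M\<^sup>2) + 2 * C * M * norm (f - g)"
        by (simp add: algebra_simps)
      moreover have "0 \<le> K * norm (f - g) * (C * M\<^sup>2) + 2 * C * M * norm (f - g)"
        using K[of f g] C M by (intro add_nonneg_nonneg mult_nonneg_nonneg[OF K] mult_nonneg_nonneg[of "2 * C * M"]) auto
      ultimately show ?thesis by simp
    qed
  qed
qed

definition cutoff :: "real \<Rightarrow> real" where "cutoff y = max 0 (min 1 (2 - y))"

lemma cutoff: "0 \<le> cutoff y" "cutoff y \<le> 1" "y \<le> 1 \<Longrightarrow> cutoff y = 1" "2 \<le> y \<Longrightarrow> cutoff y = 0"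
  "\<bar>cutoff y - cutoff z\<bar> \<le> \<bar>y - z\<bar>"
  by (auto simp: cutoff_def)

lemma cell_norm1_diff_le:
  fixes f g :: "real^'n \<Rightarrow> real"
  assumes L: "0 < L" and f: "continuous_on UNIV f" "\<And>x. \<bar>f x\<bar> \<le> A" and g: "continuous_on UNIV g" "\<And>x. \<bar>g x\<bar> \<le> B"
    and D: "\<And>x. \<bar>f x - g x\<bar> \<le> D"
  shows "\<bar>cell_norm1 L f - cell_norm1 L g\<bar> \<le> (2 * L) ^ CARD('n) * D"
proof -
  have i: "integrable (cell_measure L) f" "integrable (cell_measure L) g"
    using f g by (auto intro!: integrable_cell_bounded borel_measurable_continuous_onI)
  have "cell_norm1 L f - cell_norm1 L g = (\<integral>v. \<bar>f v\<bar> - \<bar>g v\<bar> \<partial>cell_measure L)"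
    unfolding cell_norm1_def using i by simp
  also have "\<bar>\<dots>\<bar> \<le> (\<integral>v. \<bar>\<bar>f v\<bar> - \<bar>g v\<bar>\<bar> \<partial>cell_measure L)" by (rule integral_abs_bound)
  also have "\<dots> \<le> (\<integral>v. D \<partial>(cell_measure L :: (real^'n) measure))"
  proof (rule integral_mono)
    show "\<bar>\<bar>f v\<bar> - \<bar>g v\<bar>\<bar> \<le> D" for v using D[of v] by linarith
  qed (use i finite_measure.integrable_const[OF finite_cell_measure] in auto)
  also have "\<dots> = (2 * L) ^ CARD('n) * D" using measure_cell_measure[of L, where 'n = 'n] L by simp
  finally show ?thesis .
qed

section \<open>The projected collision field on bounded continuous functions\<close>

context cutoff_kernel
begin

text \<open>Real parts make this a field on a real Banach space; for real arguments the projection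
  is real already.\<close>

definition PQ :: "nat \<Rightarrow> ((real^'n) \<Rightarrow>\<^sub>C real) \<Rightarrow> ((real^'n) \<Rightarrow>\<^sub>C real) \<Rightarrow> (real^'n) \<Rightarrow>\<^sub>C real" where
  "PQ N f g = Bcontfun (\<lambda>v. Re (PN L N (\<lambda>w. complex_of_real (Q (apply_bcontfun f) (apply_bcontfun g) w)) v))"

lemma cont_periodic_Re: "cp f \<Longrightarrow> cp (\<lambda>v. Re (f v))"
  by (erule cont_periodic_compose) (intro continuous_intros)

lemma cont_periodic_of_real: "cp f \<Longrightarrow> cp (\<lambda>v. complex_of_real (f v))"
  by (erule cont_periodic_compose) (intro continuous_intros)

lemma cp_PN: "cp (PN L N h)"
  by (simp add: PN_trig_sum cont_periodic_trig_sum L_pos)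

lemma cp_bcontfun:
  assumes "cp (f :: real^'n \<Rightarrow> real)" shows "f \<in> bcontfun"
proof -
  obtain B where "\<And>x. norm (f x) \<le> B" using cont_periodic_bounded[OF L_pos assms] by metis
  then show ?thesis using assms by (intro bcontfun_normI) (auto simp: cont_periodic_def)
qed

lemma apply_PQ: "apply_bcontfun (PQ N f g) v = Re (PN L N (\<lambda>w. complex_of_real (Q (apply_bcontfun f) (apply_bcontfun g) w)) v)"
  unfolding PQ_def by (subst Bcontfun_inverse) (auto intro!: cp_bcontfun cont_periodic_Re cp_PN)

lemma bcont: "continuous_on UNIV (apply_bcontfun f)" "norm (apply_bcontfun f x) \<le> norm f"
  for f :: "(real^'n) \<Rightarrow>\<^sub>C real"
  by (auto simp del: real_norm_def intro: norm_bounded)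

lemma norm_Q_bcont: "\<bar>Q (apply_bcontfun f) (apply_bcontfun g) v\<bar> \<le> 2 * measure coll UNIV * norm f * norm g"
  using norm_Q_le[OF bcont bcont] by simp

lemma PQ_add: "PQ N (f + g) h = PQ N f h + PQ N g h" "PQ N h (f + g) = PQ N h f + PQ N h g"
proof -
  have qc: "continuous_on UNIV (\<lambda>w. complex_of_real (Q (apply_bcontfun f) (apply_bcontfun g) w))"
    "\<And>w. norm (complex_of_real (Q (apply_bcontfun f) (apply_bcontfun g) w)) \<le> 2 * measure coll UNIV * norm f * norm g"
    for f g :: "(real^'n) \<Rightarrow>\<^sub>C real"
    using continuous_Q[OF bcont bcont] norm_Q_bcont by (auto intro!: continuous_intros)
  have 1: "apply_bcontfun (f + g) = (\<lambda>x. apply_bcontfun f x + apply_bcontfun g x)" by auto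
  show "PQ N (f + g) h = PQ N f h + PQ N g h"
    by (rule bcontfun_eqI) (simp add: apply_PQ 1 Q_add_left[OF bcont bcont bcont] PN_add[OF qc qc])
  show "PQ N h (f + g) = PQ N h f + PQ N h g"
    by (rule bcontfun_eqI) (simp add: apply_PQ 1 Q_add_right[OF bcont bcont bcont] PN_add[OF qc qc])
qed

lemma PQ_norm:
  "norm (PQ N f g) \<le> real (card (freqs N :: ('n \<Rightarrow> int) set)) * (2 * measure coll UNIV) * norm f * norm g"
proof (rule norm_bound)
  fix v
  let ?h = "\<lambda>w. complex_of_real (Q (apply_bcontfun f) (apply_bcontfun g) w)"
  have "norm (apply_bcontfun (PQ N f g) v) \<le> cmod (PN L N ?h v)"
    by (simp add: apply_PQ abs_Re_le_cmod)
  also have "\<dots> \<le> (\<Sum>k\<in>freqs N. cmod (fcoef L ?h k))"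
    unfolding PN_trig_sum by (rule PN_space_bound)
  also have "\<dots> \<le> (\<Sum>k\<in>(freqs N :: ('n \<Rightarrow> int) set). 2 * measure coll UNIV * norm f * norm g)"
    by (intro sum_mono norm_fcoef_le[OF L_pos]) (simp add: norm_Q_bcont)
  finally show "norm (apply_bcontfun (PQ N f g) v) \<le> real (card (freqs N :: ('n \<Rightarrow> int) set)) * (2 * measure coll UNIV) * norm f * norm g"
    by (simp add: mult.assoc)
qed

text \<open>The cut-off is inactive while the sup norm is at most M and the L^1 norm at most m, and
  the field is switched off once either reaches twice its level.\<close>

definition cut_size :: "real \<Rightarrow> real \<Rightarrow> ((real^'n) \<Rightarrow>\<^sub>C real) \<Rightarrow> real" where
  "cut_size M m f = max (norm f / M) (cell_norm1 L (apply_bcontfun f) / m)"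

lemma cut_size_diff:
  assumes M: "0 < M" and m: "0 < m"
  shows "\<bar>cut_size M m f - cut_size M m g\<bar> \<le> (1 / M + (2 * L) ^ CARD('n) / m) * norm (f - g)"
proof -
  have "\<bar>norm f / M - norm g / M\<bar> = \<bar>norm f - norm g\<bar> / M"
    using M by (simp flip: diff_divide_distrib)
  also have "\<dots> \<le> norm (f - g) / M"
    using M norm_triangle_ineq3[of f g] by (intro divide_right_mono) auto
  finally have 1: "\<bar>norm f / M - norm g / M\<bar> \<le> norm (f - g) / M" .
  have "\<bar>cell_norm1 L (apply_bcontfun f) - cell_norm1 L (apply_bcontfun g)\<bar> \<le> (2 * L) ^ CARD('n) * norm (f - g)"
  proof (rule cell_norm1_diff_le[OF L_pos bcont(1) _ bcont(1)])
    show "\<bar>apply_bcontfun f x\<bar> \<le> norm f" for x using bcont(2)[of f x] by simp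
    show "\<bar>apply_bcontfun g x\<bar> \<le> norm g" for x using bcont(2)[of g x] by simp
    show "\<bar>apply_bcontfun f x - apply_bcontfun g x\<bar> \<le> norm (f - g)" for x
      using bcont(2)[of "f - g" x] by simp
  qed
  then have "\<bar>cell_norm1 L (apply_bcontfun f) - cell_norm1 L (apply_bcontfun g)\<bar> / m \<le> (2 * L) ^ CARD('n) * norm (f - g) / m"
    using m by (intro divide_right_mono) auto
  then have 2: "\<bar>cell_norm1 L (apply_bcontfun f) / m - cell_norm1 L (apply_bcontfun g) / m\<bar> \<le> (2 * L) ^ CARD('n) * norm (f - g) / m"
    using m by (simp flip: diff_divide_distrib)
  have "0 \<le> norm (f - g) / M" "0 \<le> (2 * L) ^ CARD('n) * norm (f - g) / m" using M m L_pos by auto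
  moreover have "\<bar>max a b - max c d\<bar> \<le> \<bar>a - c\<bar> + \<bar>b - d\<bar>" for a b c d :: real by linarith
  ultimately show ?thesis
    unfolding cut_size_def using 1 2 by (simp add: distrib_right)
qed

text \<open>The cut-off makes the Galerkin field globally Lipschitz and bounds the mass norm seen by it;
  the energy estimates below show that the cut-off is never active.\<close>
lemma truncated_solution:
  assumes T: "0 \<le> T" and M: "0 < M" and m: "0 < m"
  obtains x where "x 0 = x0"
    "\<And>t. t \<in> {0..T} \<Longrightarrow> (x has_vector_derivative cutoff (cut_size M m (x t)) *\<^sub>R PQ N (x t) (x t)) (at t within {0..T})"
    "continuous_on {0..T} (\<lambda>t. cutoff (cut_size M m (x t)) *\<^sub>R PQ N (x t) (x t))"
proof -
  define X where "X = (\<lambda>f. cutoff (cut_size M m f) *\<^sub>R PQ N f f)"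
  define C' where "C' = real (card (freqs N :: ('n \<Rightarrow> int) set)) * (2 * measure coll UNIV)"
  \<comment> \<open>The cut-off vanishes beyond sup norm 2 M, so \<open>lipschitz_cutoff\<close> is
    applied with the radius \<open>2 * M\<close>.\<close>
  define K where "K = (1 / M + (2 * L) ^ CARD('n) / m) * C' * (2 * M)\<^sup>2 + 2 * C' * (2 * M)"
  have lip: "norm (X f - X g) \<le> K * norm (f - g)" for f g :: "(real^'n) \<Rightarrow>\<^sub>C real"
    unfolding X_def K_def
  proof (rule lipschitz_cutoff[where B = "PQ N" and cut = "\<lambda>f. cutoff (cut_size M m f)"])
    show "norm (PQ N f g) \<le> C' * norm f * norm g" for f g unfolding C'_def by (rule PQ_norm)
    show "\<bar>cutoff (cut_size M m f) - cutoff (cut_size M m g)\<bar> \<le> (1 / M + (2 * L) ^ CARD('n) / m) * norm (f - g)" for f g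
      by (rule order_trans[OF cutoff(5)]) (rule cut_size_diff[OF M m])
    show "\<bar>cutoff (cut_size M m f)\<bar> \<le> 1" for f using cutoff(1,2) by simp
    fix f :: "(real^'n) \<Rightarrow>\<^sub>C real" assume "2 * M < norm f"
    then have "2 \<le> norm f / M" using M by (simp add: field_simps)
    then show "cutoff (cut_size M m f) = 0" by (intro cutoff(4)) (simp add: cut_size_def)
  qed (use M in \<open>auto simp: PQ_add C'_def\<close>)
  have K: "0 \<le> K" using M m L_pos by (simp add: K_def C'_def)
  obtain x where x: "x 0 = x0" "\<And>t. t \<in> {0..T} \<Longrightarrow> (x has_vector_derivative X (x t)) (at t within {0..T})"
    by (rule lipschitz_ode_exists[of X K T x0]) (rule lip, rule T, blast)
  have l: "K-lipschitz_on UNIV X"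
    by (rule lipschitz_onI) (use lip K in \<open>auto simp: dist_norm\<close>)
  have xc: "continuous_on {0..T} x"
    unfolding continuous_on_eq_continuous_within using x(2) by (blast intro: has_vector_derivative_continuous)
  have c: "continuous_on {0..T} (\<lambda>t. X (x t))"
    by (rule continuous_on_compose2[OF lipschitz_on_continuous_on[OF l] xc subset_UNIV])
  show ?thesis
  proof (rule that[of x])
    show "x 0 = x0" by (rule x(1))
    show "(x has_vector_derivative cutoff (cut_size M m (x t)) *\<^sub>R PQ N (x t) (x t)) (at t within {0..T})"
      if "t \<in> {0..T}" for t
      using x(2)[OF that] by (simp only: X_def)
    show "continuous_on {0..T} (\<lambda>t. cutoff (cut_size M m (x t)) *\<^sub>R PQ N (x t) (x t))"
      using c by (simp only: X_def)
  qed
qed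

end

section \<open>Energy estimates for the truncated flow\<close>

lemma PN_space_shift: "p \<in> PN_space L N \<Longrightarrow> (\<lambda>v. p (v + y)) \<in> PN_space L N"
proof -
  assume "p \<in> PN_space L N"
  then obtain c where "p = trig_sum L (freqs N) c" by (auto simp: PN_space_trig_sum)
  then have "(\<lambda>v. p (v + y)) = trig_sum L (freqs N) (\<lambda>k. c k * fmode L k y)"
    by (simp add: trig_sum_def fun_eq_iff fmode_shift mult_ac)
  then show ?thesis by (auto simp: PN_space_trig_sum)
qed

lemma PN_space_diff: "f \<in> PN_space L N \<Longrightarrow> g \<in> PN_space L N \<Longrightarrow> (\<lambda>v. f v - g v) \<in> PN_space L N"
  using PN_space_add[of f L N "\<lambda>v. (-1) * g v"] PN_space_cmult[of g L N "-1"] by simp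

lemma PN_space_one: "(\<lambda>v::real^'n. 1) \<in> PN_space L N"
proof -
  have "(\<lambda>j::'n. 0) \<in> freqs N" by (simp add: freqs_def)
  moreover have "fmode L (\<lambda>j::'n. 0) = (\<lambda>v. 1)" by (rule ext) (rule fmode_0)
  ultimately show ?thesis using PN_space_fmode by metis
qed

text \<open>Translation as a bounded linear map on the space of the flow, so that a shifted solution
  curve is differentiable with the shifted velocity.\<close>

definition shift_bcontfun :: "real^'n \<Rightarrow> ((real^'n) \<Rightarrow>\<^sub>C real) \<Rightarrow> (real^'n) \<Rightarrow>\<^sub>C real" where
  "shift_bcontfun y f = Bcontfun (\<lambda>v. apply_bcontfun f (v + y))"

lemma apply_shift_bcontfun [simp]: "apply_bcontfun (shift_bcontfun y f) v = apply_bcontfun f (v + y)"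
proof -
  have "(\<lambda>v. apply_bcontfun f (v + y)) \<in> bcontfun"
    by (rule bcontfun_normI[where b = "norm f"])
       (auto simp del: real_norm_def intro!: continuous_on_compose2[OF continuous_on_apply_bcontfun] continuous_intros norm_bounded)
  then show ?thesis by (simp add: shift_bcontfun_def Bcontfun_inverse)
qed

lemma bounded_linear_shift_bcontfun: "bounded_linear (shift_bcontfun y)"
proof (rule bounded_linear_intro[where K = 1])
  fix f g :: "(real^'a) \<Rightarrow>\<^sub>C real" and r :: real
  show "shift_bcontfun y (f + g) = shift_bcontfun y f + shift_bcontfun y g" by (rule bcontfun_eqI) simp
  show "shift_bcontfun y (r *\<^sub>R f) = r *\<^sub>R shift_bcontfun y f" by (rule bcontfun_eqI) simp
  show "norm (shift_bcontfun y f) \<le> norm f * 1" by (rule norm_bound) (simp del: real_norm_def add: norm_bounded)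
qed

text \<open>A solution of the truncated equation with its two levels, M for the sup norm and m for
  the L^1 norm. Only the initial value is assumed to be a trigonometric polynomial; periodicity at
  later times is derived.\<close>

locale galerkin_flow = cutoff_kernel R L \<Phi> b dim
  for R L \<Phi> b and dim :: "'n::finite itself" +
  fixes x :: "real \<Rightarrow> (real^'n) \<Rightarrow>\<^sub>C real" and T M m :: real and N :: nat
  assumes T: "0 < T" and M: "0 < M" and m: "0 < m"
    and x_deriv: "\<And>t. t \<in> {0..T} \<Longrightarrow>
      (x has_vector_derivative cutoff (cut_size M m (x t)) *\<^sub>R PQ N (x t) (x t)) (at t within {0..T})"
    and x_cont: "continuous_on {0..T} (\<lambda>t. cutoff (cut_size M m (x t)) *\<^sub>R PQ N (x t) (x t))"
    and x_init: "(\<lambda>v. complex_of_real (apply_bcontfun (x 0) v)) \<in> PN_space L N"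
begin

abbreviation "f t \<equiv> apply_bcontfun (x t)"
definition "lam t = cutoff (cut_size M m (x t))"
definition "x' t = lam t *\<^sub>R PQ N (x t) (x t)"
definition "q t = Q (f t) (f t)"

lemma x': "t \<in> {0..T} \<Longrightarrow> (x has_vector_derivative x' t) (at t within {0..T})" "continuous_on {0..T} x'"
  using x_deriv x_cont by (auto simp: x'_def lam_def)

text \<open>The last bound needs no a priori estimate: once the L^1 norm reaches 2 m, the factor is
  0.\<close>

lemma lam: "0 \<le> lam t" "lam t \<le> 1" "lam t * cell_norm1 L (f t) \<le> 2 * m"
proof -
  show l: "0 \<le> lam t" "lam t \<le> 1" by (auto simp: lam_def cutoff)
  show "lam t * cell_norm1 L (f t) \<le> 2 * m"
  proof (cases "2 \<le> cell_norm1 L (f t) / m")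
    case True
    then have "lam t = 0" unfolding lam_def by (intro cutoff(4)) (simp add: cut_size_def)
    then show ?thesis using m by simp
  next
    case False
    then have "cell_norm1 L (f t) \<le> 2 * m" using m by (simp add: field_simps)
    then show ?thesis using l cell_norm1_nonneg[of L "f t"] mult_mono[of "lam t" 1 "cell_norm1 L (f t)" "2 * m"] by simp
  qed
qed

lemma x'_eq: "complex_of_real (apply_bcontfun (x' t) v) = of_real (lam t) * PN L N (\<lambda>w. of_real (q t w)) v"
proof -
  have "Im (PN L N (\<lambda>w. complex_of_real (q t w)) v) = 0" by (rule PN_real[OF L_pos]) simp
  then show ?thesis
    by (simp add: x'_def apply_PQ q_def complex_eq_iff)
qed

lemma f_PN: assumes t: "t \<in> {0..T}" shows "(\<lambda>v. complex_of_real (f t v)) \<in> PN_space L N"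
proof -
  have "((\<lambda>s. complex_of_real (f s v)) has_vector_derivative complex_of_real (apply_bcontfun (x' s) v)) (at s within {0..T})"
    if "s \<in> {0..T}" for s v
    by (rule bounded_linear.has_vector_derivative[OF bounded_linear_of_real
        bounded_linear.has_vector_derivative[OF bounded_linear_apply_bcontfun x'(1)[OF that]]])
  moreover have "(\<lambda>v. complex_of_real (apply_bcontfun (x' s) v)) \<in> PN_space L N" for s
    unfolding x'_eq by (rule PN_space_cmult[OF PN_in_PN_space])
  ultimately obtain c where "\<And>t. t \<in> {0..T} \<Longrightarrow> (\<lambda>v. complex_of_real (f t v)) = trig_sum L (freqs N) (c t)"
    using PN_space_curve[OF L_pos less_imp_le[OF T], of "\<lambda>s v. complex_of_real (f s v)" N "\<lambda>s v. complex_of_real (apply_bcontfun (x' s) v)"] x_init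
    by metis
  then show ?thesis using t by (auto simp: PN_space_trig_sum)
qed

lemma cp_of_PN: "(\<lambda>v. complex_of_real (g v)) \<in> PN_space L N \<Longrightarrow> cp g"
  using cont_periodic_Re[OF cont_periodic_PN_space[OF L_pos]] by fastforce

lemma cp_f: "t \<in> {0..T} \<Longrightarrow> cp (f t)"
  using cp_of_PN[OF f_PN] .

lemma cp_q: "t \<in> {0..T} \<Longrightarrow> cp (q t)"
  unfolding q_def by (intro cont_periodic_Q cp_f)

lemma cp_x': "cp (apply_bcontfun (x' t))"
proof -
  have "(\<lambda>v. complex_of_real (apply_bcontfun (x' t) v)) \<in> PN_space L N"
    unfolding x'_eq by (rule PN_space_cmult[OF PN_in_PN_space])
  then show ?thesis by (rule cp_of_PN)
qed

text \<open>Self-adjointness of the projection in the form used by the energy estimates: tested with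
  a trigonometric polynomial, the velocity acts like the unprojected collision term.\<close>

lemma integral_x':
  assumes t: "t \<in> {0..T}" and g: "(\<lambda>v. complex_of_real (g v)) \<in> PN_space L N"
  shows "(\<integral>v. g v * apply_bcontfun (x' t) v \<partial>cell_measure L) = lam t * (\<integral>v. g v * q t v \<partial>cell_measure L)"
proof -
  let ?q = "\<lambda>w. complex_of_real (q t w)"
  have im: "cnj (PN L N ?q v) = PN L N ?q v" for v
    using PN_real[OF L_pos, of ?q N v] by (simp add: complex_eq_iff)
  have "complex_of_real (\<integral>v. g v * apply_bcontfun (x' t) v \<partial>cell_measure L)
      = (\<integral>v. complex_of_real (lam t) * (of_real (g v) * cnj (PN L N ?q v)) \<partial>cell_measure L)"
    by (simp add: x'_eq im mult_ac flip: integral_complex_of_real)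
  also have "\<dots> = of_real (lam t) * (\<integral>v. of_real (g v) * cnj (?q v) \<partial>cell_measure L)"
    using integral_PN_cnj[OF L_pos cont_periodic_of_real[OF cp_q[OF t]] g] by simp
  also have "\<dots> = complex_of_real (lam t * (\<integral>v. g v * q t v \<partial>cell_measure L))"
    by (simp flip: integral_complex_of_real)
  finally show ?thesis by (simp only: of_real_eq_iff)
qed

text \<open>\<open>f t\<close> is itself an admissible test function, so the projection drops out.
  The square grows at rate 2 * (2 C) * (2 m) = 8 C m, as the cut-off bounds the L^1 norm by 2 m; the
  square root halves the rate.\<close>

lemma norm2_bound:
  assumes t: "t \<in> {0..T}"
  shows "cell_norm2 L (f t) \<le> exp (4 * est_const * m * t) * cell_norm2 L (f 0)"
proof -
  let ?a = "8 * est_const * m"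
  have "(cell_norm2 L (f t))\<^sup>2 \<le> exp (?a * t) * ((cell_norm2 L (f 0))\<^sup>2 + 0 * t)"
    unfolding cell_norm2_power2
  proof (rule gronwall[OF _ _ _ _ t])
    fix s assume s: "s \<in> {0..T}"
    have "((\<lambda>s::real. s\<^sup>2) has_real_derivative 2 * r) (at r)" for r by (auto intro!: derivative_eq_intros)
    from has_derivative_cell_integral[OF x' this _ s, of L]
    show "((\<lambda>s. \<integral>v. (f s v)\<^sup>2 \<partial>cell_measure L) has_real_derivative
        (\<integral>v. 2 * f s v * apply_bcontfun (x' s) v \<partial>cell_measure L)) (at s within {0..T})"
      by (auto intro!: continuous_intros)
    have "(\<integral>v. 2 * f s v * apply_bcontfun (x' s) v \<partial>cell_measure L) = 2 * (lam s * (\<integral>v. q s v * f s v \<partial>cell_measure L))"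
      using integral_x'[OF s f_PN[OF s]] by (simp add: mult.assoc mult.commute[of "q s _"])
    also have "\<dots> \<le> 2 * (lam s * (2 * est_const * cell_norm1 L (f s) * cell_norm2 L (f s) * cell_norm2 L (f s)))"
      using Q_estimate[OF cp_f[OF s] cp_f[OF s] cp_f[OF s]] lam(1)[of s]
      by (intro mult_left_mono) (auto simp: q_def)
    also have "\<dots> = 4 * est_const * (cell_norm2 L (f s))\<^sup>2 * (lam s * cell_norm1 L (f s))"
      by (simp add: power2_eq_square mult_ac)
    also have "\<dots> \<le> 4 * est_const * (cell_norm2 L (f s))\<^sup>2 * (2 * m)"
      using lam(3)[of s] C_nonneg by (intro mult_left_mono) auto
    finally show "(\<integral>v. 2 * f s v * apply_bcontfun (x' s) v \<partial>cell_measure L) \<le> ?a * (\<integral>v. (f s v)\<^sup>2 \<partial>cell_measure L) + 0"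
      by (simp add: cell_norm2_power2 mult_ac)
  qed (use C_nonneg m in auto)
  also have "\<dots> = (exp (4 * est_const * m * t) * cell_norm2 L (f 0))\<^sup>2"
    by (simp add: power_mult_distrib power2_eq_square[of "exp _"] flip: exp_add)
  finally show ?thesis by (rule power2_le_imp_le) (simp add: cell_norm2_nonneg)
qed

text \<open>The constant 1 lies in \<open>PN_space\<close>, so neither the projection nor the
  cut-off affects the mass.\<close>

lemma mass_conserved:
  assumes t: "t \<in> {0..T}"
  shows "(\<integral>v. f t v \<partial>cell_measure L) = (\<integral>v. f 0 v \<partial>cell_measure L)"
proof -
  have "((\<lambda>s. \<integral>v. f s v \<partial>cell_measure L) has_vector_derivative 0) (at s within {0..T})" if s: "s \<in> {0..T}" for s
  proof -
    have "(\<integral>v. 1 * apply_bcontfun (x' s) v \<partial>cell_measure L) = lam s * (\<integral>v. 1 * q s v \<partial>cell_measure L)"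
      by (rule integral_x'[OF s]) (simp add: PN_space_one)
    also have "\<dots> = 0" using integral_Q_eq_0[OF cp_f[OF s]] by (simp add: q_def)
    finally have "(\<integral>v. 1 * apply_bcontfun (x' s) v \<partial>cell_measure L) = 0" .
    then show ?thesis
      using has_derivative_cell_integral[OF x' DERIV_ident _ s, of L]
      by (simp add: has_real_derivative_iff_has_vector_derivative)
  qed
  then obtain a where "\<And>s. s \<in> {0..T} \<Longrightarrow> (\<integral>v. f s v \<partial>cell_measure L) = a"
    using has_vector_derivative_zero_constant[of "{0..T}" "\<lambda>s. \<integral>v. f s v \<partial>cell_measure L"] by auto
  then show ?thesis using t T by simp
qed

definition "z y t v = f t (v + y) - f t v"

text \<open>\<open>w t\<close> is in general no trigonometric polynomial, so the projection cannot
  be moved off when testing with it; \<open>err\<close> is the price.\<close>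

definition "err t v = q t v - Re (PN L N (\<lambda>w. complex_of_real (q t w)) v)"

definition "w t v = max (- f t v) 0"

section \<open>Regularity, projection error and negative part under an L^2 bound\<close>

context
  fixes K :: real
  assumes K: "\<And>t. t \<in> {0..T} \<Longrightarrow> cell_norm2 L (f t) \<le> K"
begin

lemma K_nonneg: "0 \<le> K"
  using K[of 0] T cell_norm2_nonneg[of L "f 0"] by simp

lemma z_PN: "t \<in> {0..T} \<Longrightarrow> (\<lambda>v. complex_of_real (z y t v)) \<in> PN_space L N"
  unfolding z_def of_real_diff by (intro PN_space_diff PN_space_shift[OF f_PN] f_PN)

lemma cp_z: "t \<in> {0..T} \<Longrightarrow> cp (z y t)"
  by (rule cp_of_PN[OF z_PN])

lemma q_shift_diff:
  assumes t: "t \<in> {0..T}"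
  shows "q t (v + y) - q t v = Q (z y t) (\<lambda>v. f t (v + y)) v + Q (f t) (z y t) v"
proof -
  let ?s = "\<lambda>v. f t (v + y)"
  have cs: "cp ?s" by (rule cont_periodic_shift[OF cp_f[OF t]])
  have sz: "?s = (\<lambda>v. z y t v + f t v)" by (simp add: z_def)
  have "q t (v + y) = Q ?s ?s v" by (simp add: q_def Q_shift)
  also have "\<dots> = Q (\<lambda>v. z y t v + f t v) ?s v" by (simp only: sz[symmetric])
  also have "\<dots> = Q (z y t) ?s v + Q (f t) ?s v" by (rule Q_add_left_cp[OF cp_z[OF t] cs cp_f[OF t]])
  also have "Q (f t) ?s v = Q (f t) (\<lambda>v. z y t v + f t v) v" by (simp only: sz[symmetric])
  also have "\<dots> = Q (f t) (z y t) v + Q (f t) (f t) v" by (rule Q_add_right_cp[OF cp_z[OF t] cp_f[OF t] cp_f[OF t]])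
  finally show ?thesis by (simp add: q_def)
qed

lemma norm1_f: "t \<in> {0..T} \<Longrightarrow> cell_norm1 L (f t) \<le> sqrt ((2 * L) ^ CARD('n)) * K"
  using cell_norm1_le_norm2[OF L_pos cp_f, of t] K[of t] L_pos
  by (meson mult_left_mono order_trans real_sqrt_ge_zero zero_le_power less_imp_le mult_nonneg_nonneg zero_le_numeral)

text \<open>Bilinearity puts the difference into one argument at a time. After trading L^1 for L^2
  norms both terms have the same constant with factor 2, hence the 4.\<close>

lemma q_shift_weak:
  assumes t: "t \<in> {0..T}" and g: "cp g"
  shows "\<bar>\<integral>v. g v * (q t (v + y) - q t v) \<partial>cell_measure L\<bar>
    \<le> 4 * est_const * sqrt ((2 * L) ^ CARD('n)) * K * cell_norm2 L (z y t) * cell_norm2 L g"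
proof -
  let ?s = "\<lambda>v. f t (v + y)" and ?Z = "cell_norm2 L (z y t)" and ?g = "cell_norm2 L g"
  have cs: "cp ?s" by (rule cont_periodic_shift[OF cp_f[OF t]])
  have i: "integrable (cell_measure L) (\<lambda>v. Q (z y t) ?s v * g v)" "integrable (cell_measure L) (\<lambda>v. Q (f t) (z y t) v * g v)"
    by (intro integrable_cell_cont[OF L_pos] cont_periodic_mult cont_periodic_Q cp_z cp_f cs g t)+
  have "(\<integral>v. g v * (q t (v + y) - q t v) \<partial>cell_measure L)
      = (\<integral>v. Q (z y t) ?s v * g v \<partial>cell_measure L) + (\<integral>v. Q (f t) (z y t) v * g v \<partial>cell_measure L)"
    using i by (simp add: q_shift_diff[OF t] distrib_left mult.commute[of "g _"])
  moreover have "\<bar>\<integral>v. Q (z y t) ?s v * g v \<partial>cell_measure L\<bar> \<le> 2 * est_const * sqrt ((2 * L) ^ CARD('n)) * K * ?Z * ?g"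
  proof -
    have "\<bar>\<integral>v. Q (z y t) ?s v * g v \<partial>cell_measure L\<bar> \<le> 2 * est_const * cell_norm1 L (z y t) * cell_norm2 L ?s * ?g"
      by (rule Q_estimate[OF cp_z[OF t] cs g])
    also have "\<dots> \<le> 2 * est_const * (sqrt ((2 * L) ^ CARD('n)) * ?Z) * K * ?g"
      using cell_norm1_le_norm2[OF L_pos cp_z[OF t]] cell_norm2_shift[OF L_pos cp_f[OF t]] K[OF t] C_nonneg L_pos
      by (intro mult_mono mult_right_mono mult_left_mono mult_nonneg_nonneg cell_norm1_nonneg cell_norm2_nonneg) auto
    finally show ?thesis by (simp add: mult_ac)
  qed
  moreover have "\<bar>\<integral>v. Q (f t) (z y t) v * g v \<partial>cell_measure L\<bar> \<le> 2 * est_const * sqrt ((2 * L) ^ CARD('n)) * K * ?Z * ?g"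
  proof -
    have "\<bar>\<integral>v. Q (f t) (z y t) v * g v \<partial>cell_measure L\<bar> \<le> 2 * est_const * cell_norm1 L (f t) * ?Z * ?g"
      by (rule Q_estimate[OF cp_f[OF t] cp_z[OF t] g])
    also have "\<dots> \<le> 2 * est_const * (sqrt ((2 * L) ^ CARD('n)) * K) * ?Z * ?g"
      using norm1_f[OF t] C_nonneg
      by (intro mult_right_mono mult_left_mono mult_nonneg_nonneg cell_norm1_nonneg cell_norm2_nonneg) auto
    finally show ?thesis by (simp add: mult_ac)
  qed
  ultimately show ?thesis by linarith
qed

text \<open>Regularity propagates because the difference is again a trigonometric polynomial, so the
  energy method applies to it as to the solution itself.\<close>

lemma shift_bound:
  assumes t: "t \<in> {0..T}"
  shows "(cell_norm2 L (z y t))\<^sup>2 \<le> exp (8 * est_const * sqrt ((2 * L) ^ CARD('n)) * K * t) * (cell_norm2 L (z y 0))\<^sup>2"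
proof -
  let ?a = "8 * est_const * sqrt ((2 * L) ^ CARD('n)) * K"
  let ?Z = "\<lambda>t. shift_bcontfun y (x t) - x t" and ?Z' = "\<lambda>t. shift_bcontfun y (x' t) - x' t"
  have Z: "apply_bcontfun (?Z t) v = z y t v" for t v by (simp add: z_def)
  have dZ: "(?Z has_vector_derivative ?Z' s) (at s within {0..T})" if "s \<in> {0..T}" for s
    by (intro has_vector_derivative_diff bounded_linear.has_vector_derivative[OF bounded_linear_shift_bcontfun] x' that)
  have cZ': "continuous_on {0..T} ?Z'"
    by (intro continuous_intros x'(2) bounded_linear.continuous_on[OF bounded_linear_shift_bcontfun])
  have "(cell_norm2 L (z y t))\<^sup>2 \<le> exp (?a * t) * ((cell_norm2 L (z y 0))\<^sup>2 + 0 * t)"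
    unfolding cell_norm2_power2
  proof (rule gronwall[OF _ _ _ _ t])
    fix s assume s: "s \<in> {0..T}"
    have "((\<lambda>s::real. s\<^sup>2) has_real_derivative 2 * r) (at r)" for r by (auto intro!: derivative_eq_intros)
    from has_derivative_cell_integral[OF dZ cZ' this _ s, of L]
    show "((\<lambda>s. \<integral>v. (z y s v)\<^sup>2 \<partial>cell_measure L) has_real_derivative
        (\<integral>v. 2 * z y s v * (apply_bcontfun (x' s) (v + y) - apply_bcontfun (x' s) v) \<partial>cell_measure L)) (at s within {0..T})"
      unfolding Z by (auto intro!: continuous_intros)
    \<comment> \<open>The shift of the velocity is moved onto the test function, which stays in
      \<open>PN_space\<close>; only then can the projection be removed.\<close>
    let ?w = "\<lambda>v. z y s (v - y)"
    have wPN: "(\<lambda>v. complex_of_real (?w v)) \<in> PN_space L N"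
      using PN_space_shift[OF z_PN[OF s, of y], of "- y"] by simp
    have cw: "cp ?w" by (rule cp_of_PN[OF wPN])
    have i: "integrable (cell_measure L) (\<lambda>v. z y s v * apply_bcontfun (x' s) (v + y))"
      "integrable (cell_measure L) (\<lambda>v. z y s v * apply_bcontfun (x' s) v)"
      "integrable (cell_measure L) (\<lambda>v. z y s v * q s (v + y))" "integrable (cell_measure L) (\<lambda>v. z y s v * q s v)"
      by (intro integrable_cell_cont[OF L_pos] cont_periodic_mult cp_z s cp_x' cp_q cont_periodic_shift)+
    have sh: "(\<integral>v. z y s v * h (v + y) \<partial>cell_measure L) = (\<integral>v. ?w v * h v \<partial>cell_measure L)" if "cp h" for h
      using integral_cell_shift_cont[OF L_pos cont_periodic_mult[OF cw that], of y] by simp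
    have "(\<integral>v. 2 * z y s v * (apply_bcontfun (x' s) (v + y) - apply_bcontfun (x' s) v) \<partial>cell_measure L)
        = 2 * ((\<integral>v. z y s v * apply_bcontfun (x' s) (v + y) \<partial>cell_measure L) - (\<integral>v. z y s v * apply_bcontfun (x' s) v \<partial>cell_measure L))"
      using i by (simp add: right_diff_distrib mult.assoc)
    also have "\<dots> = 2 * (lam s * (\<integral>v. z y s v * q s (v + y) \<partial>cell_measure L) - lam s * (\<integral>v. z y s v * q s v \<partial>cell_measure L))"
      unfolding sh[OF cp_x'] sh[OF cp_q[OF s]] integral_x'[OF s wPN] integral_x'[OF s z_PN[OF s]] ..
    also have "\<dots> = 2 * (lam s * (\<integral>v. z y s v * (q s (v + y) - q s v) \<partial>cell_measure L))"
      using i by (simp add: right_diff_distrib)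
    also have "\<dots> \<le> 2 * (1 * \<bar>\<integral>v. z y s v * (q s (v + y) - q s v) \<partial>cell_measure L\<bar>)"
    proof (intro mult_left_mono)
      let ?I = "\<integral>v. z y s v * (q s (v + y) - q s v) \<partial>cell_measure L"
      have "lam s * ?I \<le> lam s * \<bar>?I\<bar>" using lam(1) by (intro mult_left_mono) auto
      also have "\<dots> \<le> 1 * \<bar>?I\<bar>" using lam(2) by (intro mult_right_mono) auto
      finally show "lam s * ?I \<le> 1 * \<bar>?I\<bar>" .
    qed simp
    also have "\<dots> \<le> 2 * (4 * est_const * sqrt ((2 * L) ^ CARD('n)) * K * cell_norm2 L (z y s) * cell_norm2 L (z y s))"
      using q_shift_weak[OF s cp_z[OF s], of y y] by (simp add: mult_ac)
    finally show "(\<integral>v. 2 * z y s v * (apply_bcontfun (x' s) (v + y) - apply_bcontfun (x' s) v) \<partial>cell_measure L)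
        \<le> ?a * (\<integral>v. (z y s v)\<^sup>2 \<partial>cell_measure L) + 0"
      unfolding cell_norm2_power2[symmetric] power2_eq_square[of "cell_norm2 L (z y s)"] by (simp only: mult_ac add_0_right)
  qed (use C_nonneg K_nonneg L_pos in auto)
  then show ?thesis by simp
qed

text \<open>Duality: the weak bound is tested with the difference itself, and one factor of its norm
  cancels.\<close>

lemma q_shift_norm:
  assumes t: "t \<in> {0..T}"
  shows "(\<integral>v. (q t (v + y) - q t v)\<^sup>2 \<partial>cell_measure L) \<le> (4 * est_const * sqrt ((2 * L) ^ CARD('n)) * K)\<^sup>2 * (cell_norm2 L (z y t))\<^sup>2"
proof -
  let ?d = "\<lambda>v. q t (v + y) - q t v" and ?A = "4 * est_const * sqrt ((2 * L) ^ CARD('n)) * K * cell_norm2 L (z y t)"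
  have cd: "cp ?d" by (intro cont_periodic_diff cont_periodic_shift cp_q t)
  have A: "0 \<le> ?A" using C_nonneg K_nonneg L_pos by (intro mult_nonneg_nonneg cell_norm2_nonneg) auto
  have "cell_norm2 L ?d * cell_norm2 L ?d \<le> ?A * cell_norm2 L ?d"
    using q_shift_weak[OF t cd, of y] by (simp add: power2_eq_square[symmetric] cell_norm2_power2)
  then have "cell_norm2 L ?d \<le> ?A"
    using cell_norm2_nonneg[of L ?d] A by (cases "cell_norm2 L ?d = 0") auto
  then have "(cell_norm2 L ?d)\<^sup>2 \<le> ?A\<^sup>2" using cell_norm2_nonneg by (rule power_mono)
  then show ?thesis by (simp add: cell_norm2_power2 power_mult_distrib)
qed

lemma cp_err: "t \<in> {0..T} \<Longrightarrow> cp (err t)"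
  unfolding err_def[abs_def] by (intro cont_periodic_diff cp_q cont_periodic_Re cp_PN)

text \<open>The frequencies of \<open>q t\<close> lie in \<open>freqs (2 * N)\<close>, so its
  projection error is controlled by its differences at step L/N, these by the differences of
  \<open>f t\<close>, and those by the differences at time 0.\<close>

lemma err_bound:
  assumes t: "t \<in> {0..T}" and N: "0 < N" and H: "\<And>j. (cell_norm2 L (z ((L / N) *\<^sub>R axis j 1) 0))\<^sup>2 \<le> H"
  shows "(cell_norm2 L (err t))\<^sup>2
    \<le> real CARD('n) * ((4 * est_const * sqrt ((2 * L) ^ CARD('n)) * K)\<^sup>2 * (exp (8 * est_const * sqrt ((2 * L) ^ CARD('n)) * K * T) * H)) / 2"
proof -
  let ?q = "\<lambda>v. complex_of_real (q t v)"
  have cpq: "?q = Q (\<lambda>v. complex_of_real (f t v)) (\<lambda>v. complex_of_real (f t v))"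
    unfolding q_def by (rule ext) (simp only: Q_of_real)
  have qPN: "?q \<in> PN_space L (2 * N)" unfolding cpq by (rule Q_PN_space[OF f_PN[OF t] f_PN[OF t]])
  have "(cell_norm2 L (err t))\<^sup>2 = (\<integral>v. (cmod (?q v - PN L N ?q v))\<^sup>2 \<partial>cell_measure L)"
    unfolding cell_norm2_power2
  proof (rule Bochner_Integration.integral_cong[OF refl])
    fix v
    have "Im (PN L N ?q v) = 0" by (rule PN_real[OF L_pos]) simp
    then show "(err t v)\<^sup>2 = (cmod (?q v - PN L N ?q v))\<^sup>2" by (simp add: err_def cmod_power2)
  qed
  also have "\<dots> \<le> real CARD('n) * ((4 * est_const * sqrt ((2 * L) ^ CARD('n)) * K)\<^sup>2 * (exp (8 * est_const * sqrt ((2 * L) ^ CARD('n)) * K * T) * H)) / 2"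
  proof (rule PN_error_le_shift[OF L_pos N qPN])
    fix j :: 'n
    let ?y = "(L / N) *\<^sub>R axis j 1 :: real^'n"
    have "(\<integral>v. (cmod (?q (v + ?y) - ?q v))\<^sup>2 \<partial>cell_measure L) = (\<integral>v. (q t (v + ?y) - q t v)\<^sup>2 \<partial>cell_measure L)"
      by (simp flip: of_real_diff)
    also have "\<dots> \<le> (4 * est_const * sqrt ((2 * L) ^ CARD('n)) * K)\<^sup>2 * (cell_norm2 L (z ?y t))\<^sup>2" by (rule q_shift_norm[OF t])
    also have "\<dots> \<le> (4 * est_const * sqrt ((2 * L) ^ CARD('n)) * K)\<^sup>2 * (exp (8 * est_const * sqrt ((2 * L) ^ CARD('n)) * K * T) * H)"
    proof (rule mult_left_mono)
      have "(cell_norm2 L (z ?y t))\<^sup>2 \<le> exp (8 * est_const * sqrt ((2 * L) ^ CARD('n)) * K * t) * (cell_norm2 L (z ?y 0))\<^sup>2"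
        by (rule shift_bound[OF t])
      also have "\<dots> \<le> exp (8 * est_const * sqrt ((2 * L) ^ CARD('n)) * K * T) * H"
        using t C_nonneg K_nonneg L_pos H[of j] by (intro mult_mono) (auto intro!: mult_left_mono)
      finally show "(cell_norm2 L (z ?y t))\<^sup>2 \<le> exp (8 * est_const * sqrt ((2 * L) ^ CARD('n)) * K * T) * H" .
    qed simp
    finally show "(\<integral>v. (cmod (?q (v + ?y) - ?q v))\<^sup>2 \<partial>cell_measure L)
        \<le> (4 * est_const * sqrt ((2 * L) ^ CARD('n)) * K)\<^sup>2 * (exp (8 * est_const * sqrt ((2 * L) ^ CARD('n)) * K * T) * H)" .
  qed
  finally show ?thesis .
qed

lemma cp_w: "t \<in> {0..T} \<Longrightarrow> cp (w t)"
  unfolding w_def[abs_def] by (rule cont_periodic_compose[OF cp_f]) (auto intro!: continuous_intros)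

text \<open>The projection error enters linearly in w; Young's inequality separates it into the
  forcing \<open>E\<close> and the summand 1 in the exponent.\<close>

lemma neg_part_bound:
  assumes t: "t \<in> {0..T}" and E: "\<And>t. t \<in> {0..T} \<Longrightarrow> (cell_norm2 L (err t))\<^sup>2 \<le> E"
  shows "(cell_norm2 L (w t))\<^sup>2 \<le> exp ((6 * est_const * sqrt ((2 * L) ^ CARD('n)) * K + 1) * t) * ((cell_norm2 L (w 0))\<^sup>2 + E * t)"
  unfolding cell_norm2_power2
proof (rule gronwall[OF _ _ _ _ t])
  fix s assume s: "s \<in> {0..T}"
  have "continuous_on UNIV (\<lambda>r::real. - 2 * max (- r) 0)" by (intro continuous_intros)
  from has_derivative_cell_integral[OF x' has_derivative_neg_part_square this s, of L]
  show "((\<lambda>s. \<integral>v. (w s v)\<^sup>2 \<partial>cell_measure L) has_real_derivative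
      (\<integral>v. - 2 * w s v * apply_bcontfun (x' s) v \<partial>cell_measure L)) (at s within {0..T})"
    unfolding w_def .
  have i: "integrable (cell_measure L) (\<lambda>v. q s v * w s v)" "integrable (cell_measure L) (\<lambda>v. w s v * err s v)"
    by (intro integrable_cell_cont[OF L_pos] cont_periodic_mult cp_q cp_w cp_err s)+
  let ?I = "\<integral>v. q s v * w s v \<partial>cell_measure L" and ?J = "\<integral>v. w s v * err s v \<partial>cell_measure L"
  \<comment> \<open>The projected collision term is written as \<open>q\<close> minus
    \<open>err\<close>, since w does not allow the projection to be moved onto it.\<close>
  have "- 2 * w s v * apply_bcontfun (x' s) v = 2 * lam s * (- (q s v * w s v) + w s v * err s v)" for v
    by (simp add: x'_def apply_PQ err_def q_def) (simp add: algebra_simps)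
  then have "(\<integral>v. - 2 * w s v * apply_bcontfun (x' s) v \<partial>cell_measure L)
      = (\<integral>v. 2 * lam s * (- (q s v * w s v) + w s v * err s v) \<partial>cell_measure L)"
    by presburger
  also have "\<dots> = 2 * lam s * (- ?I + ?J)" using i by simp
  also have "\<dots> \<le> 2 * lam s * (3 * est_const * sqrt ((2 * L) ^ CARD('n)) * cell_norm2 L (f s) * (cell_norm2 L (w s))\<^sup>2
      + cell_norm2 L (w s) * cell_norm2 L (err s))"
    using neg_part_estimate[OF cp_f[OF s]] cell_Cauchy_Schwarz[OF L_pos cp_w[OF s] cp_err[OF s]] lam(1)[of s]
    by (intro mult_left_mono add_mono) (auto simp: q_def w_def[abs_def])
  also have "\<dots> \<le> 2 * 1 * (3 * est_const * sqrt ((2 * L) ^ CARD('n)) * K * (cell_norm2 L (w s))\<^sup>2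
      + ((cell_norm2 L (w s))\<^sup>2 + E) / 2)"
  proof (intro mult_mono add_mono mult_nonneg_nonneg add_nonneg_nonneg)
    show "cell_norm2 L (w s) * cell_norm2 L (err s) \<le> ((cell_norm2 L (w s))\<^sup>2 + E) / 2"
      using sum_squares_bound[of "cell_norm2 L (w s)" "cell_norm2 L (err s)"] E[OF s] by simp
  qed (use lam C_nonneg K[OF s] L_pos K_nonneg cell_norm2_nonneg in auto)
  finally show "(\<integral>v. - 2 * w s v * apply_bcontfun (x' s) v \<partial>cell_measure L)
      \<le> (6 * est_const * sqrt ((2 * L) ^ CARD('n)) * K + 1) * (\<integral>v. (w s v)\<^sup>2 \<partial>cell_measure L) + E"
    unfolding cell_norm2_power2[symmetric] by (simp add: field_simps)
next
  show "0 \<le> 6 * est_const * sqrt ((2 * L) ^ CARD('n)) * K + 1" using C_nonneg K_nonneg L_pos by simp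
  show "0 \<le> E" using E[OF t] zero_le_power2 order_trans by blast
qed

lemma norm1_eq:
  assumes t: "t \<in> {0..T}"
  shows "cell_norm1 L (f t) \<le> (\<integral>v. f 0 v \<partial>cell_measure L) + 2 * (sqrt ((2 * L) ^ CARD('n)) * cell_norm2 L (w t))"
proof -
  have i: "integrable (cell_measure L) (f t)" "integrable (cell_measure L) (w t)"
    by (intro integrable_cell_cont[OF L_pos] cp_f cp_w t)+
  have "\<bar>f t v\<bar> = f t v + 2 * w t v" for v by (auto simp: w_def)
  then have "cell_norm1 L (f t) = (\<integral>v. f t v \<partial>cell_measure L) + 2 * (\<integral>v. w t v \<partial>cell_measure L)"
    using i by (simp add: cell_norm1_def)
  also have "(\<integral>v. w t v \<partial>cell_measure L) = cell_norm1 L (w t)"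
    by (simp add: cell_norm1_def w_def)
  also have "\<dots> \<le> sqrt ((2 * L) ^ CARD('n)) * cell_norm2 L (w t)" by (rule cell_norm1_le_norm2[OF L_pos cp_w[OF t]])
  finally show ?thesis by (simp add: mass_conserved[OF t])
qed

end

end

section \<open>Existence and uniqueness of the Galerkin solution\<close>

lemma L2norm_of_real: "L2norm L (\<lambda>v. complex_of_real (g v)) = cell_norm2 L g"
  by (simp add: L2norm_def set_integral_cell cell_norm2_def)

lemma L1norm_of_real: "L1norm L (\<lambda>v. complex_of_real (g v)) = cell_norm1 L g"
  by (simp add: L1norm_def set_integral_cell cell_norm1_def)

lemma shift_le_H1norm:
  fixes p :: "real^'n \<Rightarrow> complex"
  assumes L: "0 < L" and p: "p \<in> PN_space L N"
  shows "(\<integral>v. (cmod (p (v + s *\<^sub>R axis j 1) - p v))\<^sup>2 \<partial>cell_measure L) \<le> s\<^sup>2 * (H1norm L p)\<^sup>2"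
proof -
  obtain c where c: "p = trig_sum L (freqs N) c" using p by (auto simp: PN_space_trig_sum)
  have "(\<integral>v. (cmod (p (v + s *\<^sub>R axis j 1) - p v))\<^sup>2 \<partial>cell_measure L)
      \<le> s\<^sup>2 * (\<integral>v. (cmod (trig_sum L (freqs N) (trig_partial L j c) v))\<^sup>2 \<partial>cell_measure L)"
    unfolding c by (rule shift_le_partial[OF L finite_freqs])
  also have "\<dots> \<le> s\<^sup>2 * (H1norm L p)\<^sup>2"
    unfolding c by (intro mult_left_mono partial_le_H1norm[OF L]) simp
  finally show ?thesis .
qed

lemma (in galerkin_flow) galerkin_sol_flow:
  assumes lam1: "\<And>t. t \<in> {0..T} \<Longrightarrow> lam t = 1"
  shows "galerkin_sol R L \<Phi> b N T (\<lambda>v. complex_of_real (f 0 v)) (\<lambda>t v. complex_of_real (f t v))"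
  unfolding galerkin_sol_def
proof (intro conjI ballI allI refl)
  fix t assume t: "t \<in> {0..T}"
  let ?F = "\<lambda>v. complex_of_real (f t v)"
  have c: "cp ?F" by (rule cont_periodic_PN_space[OF L_pos f_PN[OF t]])
  then show "periodic_fn L ?F" by (simp add: cont_periodic_def periodic_def periodic_fn_def)
  show "in_L1 L ?F" by (rule in_L1_cont[OF L_pos c])
  show "in_H1 L ?F" using f_PN[OF t] in_H1_trig_sum[OF L_pos] by (auto simp: PN_space_trig_sum)
  fix v
  have "QR R \<Phi> b ?F ?F w = complex_of_real (q t w)" for w
  proof -
    have Fc: "continuous_on UNIV ?F" by (intro continuous_intros bcont(1))
    have Fb: "norm (?F u) \<le> norm (x t)" for u using bcont(2)[of "x t" u] by simp
    have "QR R \<Phi> b ?F ?F w = Q ?F ?F w" by (rule QR_eq_Q[OF Fc Fb Fc Fb])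
    also have "\<dots> = complex_of_real (q t w)" unfolding q_def by (rule Q_of_real)
    finally show ?thesis .
  qed
  then have "QR R \<Phi> b ?F ?F = (\<lambda>w. complex_of_real (q t w))" by (rule ext)
  then have "PN L N (QR R \<Phi> b ?F ?F) v = complex_of_real (apply_bcontfun (x' t) v)"
    by (simp add: x'_eq lam1[OF t])
  moreover have "((\<lambda>s. complex_of_real (f s v)) has_vector_derivative complex_of_real (apply_bcontfun (x' t) v)) (at t within {0..T})"
    by (rule bounded_linear.has_vector_derivative[OF bounded_linear_of_real
        bounded_linear.has_vector_derivative[OF bounded_linear_apply_bcontfun x'(1)[OF t]]])
  ultimately show "((\<lambda>s. complex_of_real (f s v)) has_vector_derivative PN L N (QR R \<Phi> b ?F ?F) v) (at t within {0..T})"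
    by simp
qed

section \<open>Closing the circle of estimates for small data and large N\<close>

context cutoff_kernel
begin

text \<open>The bound of \<open>err_bound\<close> for squared initial differences (L/N)^2 H^2, with
  1/N^2 taken out, so that it does not depend on N.\<close>

definition err_const :: "real \<Rightarrow> real \<Rightarrow> real \<Rightarrow> real" where
  "err_const T K H = real CARD('n) * ((4 * est_const * sqrt ((2 * L) ^ CARD('n)) * K)\<^sup>2 *
     (exp (8 * est_const * sqrt ((2 * L) ^ CARD('n)) * K * T) * (L\<^sup>2 * H\<^sup>2))) / 2"

text \<open>\<open>m\<close> is twice the conserved mass. Smallness keeps the L^1 norm of the
  negative part below m/4, so the L^1 norm is at most m/2 + 2 (m/4) = m, which is the level below
  which the cut-off is inactive.\<close>

lemma galerkin_exists:
  fixes p :: "real^'n \<Rightarrow> complex"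
  assumes T: "0 < T" and N: "0 < N" and m: "0 < m" and p: "p \<in> PN_space L N" "\<And>v. Im (p v) = 0"
    and mass: "(\<integral>v. Re (p v) \<partial>cell_measure L) = m / 2"
    and K: "exp (4 * est_const * m * T) * L2norm L p \<le> K" and H: "H1norm L p \<le> H"
    and small: "exp ((6 * est_const * sqrt ((2 * L) ^ CARD('n)) * K + 1) * T)
      * ((L2norm L (neg_part p))\<^sup>2 + err_const T K H / (real N)\<^sup>2 * T) \<le> (m / (4 * sqrt ((2 * L) ^ CARD('n))))\<^sup>2"
  shows "\<exists>F. galerkin_sol R L \<Phi> b N T p F \<and> (\<forall>t\<in>{0..T}. L1norm L (F t) \<le> m \<and> L2norm L (F t) \<le> K)"
proof -
  let ?V = "sqrt ((2 * L) ^ CARD('n))"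
  have V: "0 < ?V" using L_pos by simp
  define x0 where "x0 = Bcontfun (\<lambda>v. Re (p v))"
  have x0: "apply_bcontfun x0 = (\<lambda>v. Re (p v))"
    unfolding x0_def by (rule Bcontfun_inverse[OF cp_bcontfun[OF cont_periodic_Re[OF cont_periodic_PN_space[OF L_pos p(1)]]]])
  have p_eq: "p = (\<lambda>v. complex_of_real (apply_bcontfun x0 v))" using p(2) by (simp add: x0 fun_eq_iff complex_eq_iff)
  \<comment> \<open>The sup norm is bounded through the L^2 bound K by finite dimension; the added 1
    keeps M positive.\<close>
  define M where "M = real (card (freqs N :: ('n \<Rightarrow> int) set)) * sqrt (K\<^sup>2 / (2 * L) ^ CARD('n)) + 1"
  have M: "0 < M" unfolding M_def using L_pos by (intro add_nonneg_pos mult_nonneg_nonneg) auto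
  obtain x where xs: "x 0 = x0"
    "\<And>t. t \<in> {0..T} \<Longrightarrow> (x has_vector_derivative cutoff (cut_size M m (x t)) *\<^sub>R PQ N (x t) (x t)) (at t within {0..T})"
    "continuous_on {0..T} (\<lambda>t. cutoff (cut_size M m (x t)) *\<^sub>R PQ N (x t) (x t))"
    using truncated_solution[OF less_imp_le[OF T] M m] by blast
  interpret G: galerkin_flow R L \<Phi> b dim x T M m N
    by unfold_locales (use T M m xs p(1) in \<open>auto simp: p_eq[symmetric]\<close>)
  have n2p: "L2norm L p = cell_norm2 L (G.f 0)" by (simp add: p_eq L2norm_of_real xs(1))
  have n2: "cell_norm2 L (G.f t) \<le> K" if t: "t \<in> {0..T}" for t
  proof -
    have "cell_norm2 L (G.f t) \<le> exp (4 * est_const * m * t) * cell_norm2 L (G.f 0)" by (rule G.norm2_bound[OF t])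
    also have "\<dots> \<le> exp (4 * est_const * m * T) * cell_norm2 L (G.f 0)"
      using t m C_nonneg by (intro mult_right_mono cell_norm2_nonneg) (simp add: mult_left_mono)
    finally show ?thesis using K by (simp add: n2p)
  qed
  have z: "(cell_norm2 L (G.z ((L / N) *\<^sub>R axis j 1) 0))\<^sup>2 \<le> (L / N)\<^sup>2 * H\<^sup>2" for j
  proof -
    have "(cell_norm2 L (G.z ((L / N) *\<^sub>R axis j 1) 0))\<^sup>2
        = (\<integral>v. (cmod (p (v + (L / N) *\<^sub>R axis j 1) - p v))\<^sup>2 \<partial>cell_measure L)"
      by (simp add: cell_norm2_power2 G.z_def p_eq xs(1) flip: of_real_diff)
    also have "\<dots> \<le> (L / N)\<^sup>2 * (H1norm L p)\<^sup>2" by (rule shift_le_H1norm[OF L_pos p(1)])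
    also have "\<dots> \<le> (L / N)\<^sup>2 * H\<^sup>2"
      using H by (intro mult_left_mono power_mono) (auto simp: H1norm_def sum_nonneg)
    finally show ?thesis .
  qed
  have err: "(cell_norm2 L (G.err t))\<^sup>2 \<le> err_const T K H / (real N)\<^sup>2" if t: "t \<in> {0..T}" for t
    using G.err_bound[OF n2 t N z] by (simp add: err_const_def power_divide)
  have w: "cell_norm2 L (G.w t) \<le> m / (4 * ?V)" if t: "t \<in> {0..T}" for t
  proof (rule power2_le_imp_le)
    let ?A = "6 * est_const * ?V * K + 1" and ?E = "err_const T K H / (real N)\<^sup>2"
    have A: "0 \<le> ?A" using C_nonneg G.K_nonneg[OF n2] V by (intro add_nonneg_nonneg mult_nonneg_nonneg) auto
    have E: "0 \<le> ?E" using order_trans[OF zero_le_power2 err[OF t]] .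
    have w0: "L2norm L (neg_part p) = cell_norm2 L (G.w 0)"
      unfolding neg_part_def L2norm_of_real by (simp add: G.w_def[abs_def] xs(1) x0)
    have "(cell_norm2 L (G.w t))\<^sup>2 \<le> exp (?A * t) * ((cell_norm2 L (G.w 0))\<^sup>2 + ?E * t)"
      by (rule G.neg_part_bound[OF n2 t err])
    also have "\<dots> \<le> exp (?A * T) * ((cell_norm2 L (G.w 0))\<^sup>2 + ?E * T)"
    proof (rule mult_mono)
      show "exp (?A * t) \<le> exp (?A * T)" using t A by (simp add: mult_left_mono)
      show "(cell_norm2 L (G.w 0))\<^sup>2 + ?E * t \<le> (cell_norm2 L (G.w 0))\<^sup>2 + ?E * T"
        using t E by (intro add_left_mono mult_left_mono) auto
      show "0 \<le> (cell_norm2 L (G.w 0))\<^sup>2 + ?E * t"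
        using t E by (intro add_nonneg_nonneg mult_nonneg_nonneg) auto
    qed simp
    also have "\<dots> \<le> (m / (4 * ?V))\<^sup>2" using small by (simp only: w0)
    finally show "(cell_norm2 L (G.w t))\<^sup>2 \<le> (m / (4 * ?V))\<^sup>2" .
    show "0 \<le> m / (4 * ?V)" using m V by simp
  qed
  have r: "2 * (r * (m / (4 * r))) = m / 2" if "0 < r" for r :: real using that by (simp add: field_simps)
  have n1: "cell_norm1 L (G.f t) \<le> m" if t: "t \<in> {0..T}" for t
  proof -
    have "cell_norm1 L (G.f t) \<le> (\<integral>v. G.f 0 v \<partial>cell_measure L) + 2 * (?V * cell_norm2 L (G.w t))"
      by (rule G.norm1_eq[OF n2 t])
    also have "(\<integral>v. G.f 0 v \<partial>cell_measure L) = m / 2" using mass by (simp add: xs(1) x0)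
    also have "2 * (?V * cell_norm2 L (G.w t)) \<le> 2 * (?V * (m / (4 * ?V)))"
      using w[OF t] V by (intro mult_left_mono) auto
    also have "\<dots> = m / 2" by (rule r[OF V])
    finally show ?thesis by simp
  qed
  have lam: "G.lam t = 1" if t: "t \<in> {0..T}" for t
  proof -
    have "norm (x t) \<le> M"
    proof (rule norm_bound)
      fix v
      have "cmod (complex_of_real (G.f t v)) \<le> real (card (freqs N :: ('n \<Rightarrow> int) set)) *
          sqrt ((\<integral>v. (cmod (complex_of_real (G.f t v)))\<^sup>2 \<partial>cell_measure L) / (2 * L) ^ CARD('n))"
        by (rule sup_le_L2_PN_space[OF L_pos G.f_PN[OF t]])
      also have "\<dots> \<le> real (card (freqs N :: ('n \<Rightarrow> int) set)) * sqrt (K\<^sup>2 / (2 * L) ^ CARD('n))"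
        using power_mono[OF n2[OF t] cell_norm2_nonneg, of 2] L_pos
        by (intro mult_left_mono real_sqrt_le_mono divide_right_mono) (auto simp: cell_norm2_power2)
      finally show "norm (G.f t v) \<le> M" by (simp add: M_def)
    qed
    then have "cut_size M m (x t) \<le> 1" using n1[OF t] M m by (simp add: cut_size_def)
    then show ?thesis unfolding G.lam_def by (rule cutoff(3))
  qed
  have "galerkin_sol R L \<Phi> b N T p (\<lambda>t v. complex_of_real (G.f t v))"
    using G.galerkin_sol_flow[OF lam] by (simp add: p_eq xs(1))
  then show ?thesis using n1 n2 by (intro exI[of _ "\<lambda>t v. complex_of_real (G.f t v)"]) (auto simp: L1norm_of_real L2norm_of_real)
qed

text \<open>A continuous function with zero norm vanishes at every point, not only almost
  everywhere; this serves the degenerate case of vanishing mass.\<close>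

lemma L2norm_eq_0_imp_PN_zero:
  assumes p: "p \<in> PN_space L N" "\<And>v. Im (p v) = 0" and 0: "L2norm L p \<le> 0"
  shows "p = (\<lambda>v. 0)"
proof
  fix v
  have p_eq: "p = (\<lambda>v. complex_of_real (Re (p v)))" using p(2) by (simp add: fun_eq_iff complex_eq_iff)
  have "cell_norm2 L (\<lambda>v. Re (p v)) = 0"
    using 0 p_eq L2norm_of_real[of L "\<lambda>v. Re (p v)"] cell_norm2_nonneg[of L "\<lambda>v. Re (p v)"] by simp
  then have "(\<integral>v. (Re (p v))\<^sup>2 \<partial>cell_measure L) = 0" by (simp flip: cell_norm2_power2)
  then have "Re (p v) = 0"
    by (rule integral_power2_eq_0_cell[OF L_pos cont_periodic_Re[OF cont_periodic_PN_space[OF L_pos p(1)]]])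
  then show "p v = 0" using p(2) by (simp add: complex_eq_iff)
qed

lemma galerkin_sol_zero: "galerkin_sol R L \<Phi> b N T (\<lambda>v::real^'n. 0) (\<lambda>t v. 0)"
proof -
  have QR: "QR R \<Phi> b (\<lambda>v. 0) (\<lambda>v. 0) = (\<lambda>v::real^'n. 0)" by (rule ext) (simp add: QR_def)
  have PN: "PN L N (\<lambda>v. 0) = (\<lambda>v::real^'n. 0)" by (simp add: PN_def fcoef_def)
  have "trig_sum L {} (\<lambda>k. 0) = (\<lambda>v::real^'n. 0)" by (simp add: trig_sum_def fun_eq_iff)
  then have "in_H1 L (\<lambda>v::real^'n. 0)" using in_H1_trig_sum[OF L_pos] by metis
  moreover have "set_integrable lborel (cell L) (\<lambda>v::real^'n. 0::complex)" by (simp add: set_integrable_cell)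
  ultimately show ?thesis by (simp add: galerkin_sol_def periodic_fn_def in_L1_def QR PN)
qed

end

theorem theorem4p4:
  fixes R L :: real and \<Phi> b :: "real \<Rightarrow> real"
  assumes dim: "CARD('n::finite) \<ge> 2"
    and RL: "0 < R" "R \<le> L"
    and Phi_meas: "\<Phi> \<in> borel_measurable borel"
    and Phi_nonneg: "\<forall>r\<ge>0. 0 \<le> \<Phi> r"
    and Phi_bdd: "bdd_above (\<Phi> ` {0..R})"
    and b_meas: "b \<in> borel_measurable borel"
    and b_nonneg: "\<forall>s. 0 \<le> b s"
    and b_neg: "\<forall>s<0. b s = 0"
    and b_int: "\<forall>e::real^'n. norm e = 1 \<longrightarrow>
                   (\<integral>\<^sup>+ \<sigma>. ennreal (b (\<sigma> \<bullet> e)) \<partial>sphere_measure) < \<infinity>"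
  shows "\<exists>D0>0. \<forall>(T::real) (f0 :: real^'n \<Rightarrow> complex) (fN0 :: nat \<Rightarrow> real^'n \<Rightarrow> complex).
     0 < T \<longrightarrow>
     periodic_fn L f0 \<longrightarrow> (\<forall>v. Im (f0 v) = 0 \<and> 0 \<le> Re (f0 v)) \<longrightarrow>
     in_L1 L f0 \<longrightarrow> in_H1 L f0 \<longrightarrow> (\<exists>v. f0 v \<noteq> 0) \<longrightarrow>
     (\<forall>N. fN0 N \<in> PN_space L N \<and> (\<forall>v. Im (fN0 N v) = 0)) \<longrightarrow>
     (\<forall>N. (LINT v:cell L|lborel. fN0 N v) = (LINT v:cell L|lborel. f0 v)) \<longrightarrow>
     (\<forall>N. L2norm L (fN0 N) \<le> L2norm L f0 \<and> H1norm L (fN0 N) \<le> H1norm L f0) \<longrightarrow>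
     (\<exists>N1. \<forall>N>N1. L1norm L (fN0 N) \<le> 2 * L1norm L f0) \<longrightarrow>
     (\<forall>\<epsilon>>0. \<exists>N2. \<forall>N>N2. L2norm L (neg_part (fN0 N)) < \<epsilon>) \<longrightarrow>
     (\<exists>N0::nat. \<forall>N>N0.
        \<exists>F. galerkin_sol R L \<Phi> b N T (fN0 N) F \<and>
            (\<forall>G. galerkin_sol R L \<Phi> b N T (fN0 N) G \<longrightarrow> (\<forall>t\<in>{0..T}. G t = F t)) \<and>
            (\<forall>t\<in>{0..T}. L1norm L (F t) \<le> 2 * L1norm L f0 \<and>
               L2norm L (F t) \<le> exp (2 * D0 * L1norm L f0 * T) * L2norm L f0))"
proof -
  interpret cutoff_kernel R L \<Phi> b "TYPE('n)"
    by unfold_locales (use assms in auto)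
  let ?V = "sqrt ((2 * L) ^ CARD('n))"
  have V: "0 < ?V" using L_pos by simp
  show ?thesis
  \<comment> \<open>The L^2 rate is 4 C m with m = 2 M1, that is 2 (4 C) M1; the added 1 makes the
    constant positive when C = 0.\<close>
  proof (intro exI[of _ "4 * est_const + 1"] conjI allI impI)
    show "0 < 4 * est_const + 1" using C_nonneg by simp
    fix T :: real and f0 :: "real^'n \<Rightarrow> complex" and fN0 :: "nat \<Rightarrow> real^'n \<Rightarrow> complex"
    assume T: "0 < T" and f0: "\<forall>v. Im (f0 v) = 0 \<and> 0 \<le> Re (f0 v)" and f0L1: "in_L1 L f0"
      and fN0: "\<forall>N. fN0 N \<in> PN_space L N \<and> (\<forall>v. Im (fN0 N v) = 0)"
      and mass: "\<forall>N. (LINT v:cell L|lborel. fN0 N v) = (LINT v:cell L|lborel. f0 v)"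
      and norms: "\<forall>N. L2norm L (fN0 N) \<le> L2norm L f0 \<and> H1norm L (fN0 N) \<le> H1norm L f0"
      and neg: "\<forall>\<epsilon>>0. \<exists>N2. \<forall>N>N2. L2norm L (neg_part (fN0 N)) < \<epsilon>"
    define M1 M2 where "M1 = L1norm L f0" and "M2 = L2norm L f0"
    let ?B = "\<lambda>F. \<forall>t\<in>{0..T}. L1norm L (F t) \<le> 2 * M1 \<and> L2norm L (F t) \<le> exp (2 * (4 * est_const + 1) * M1 * T) * M2"
    have pN: "fN0 N \<in> PN_space L N" "Im (fN0 N v) = 0" for N v using fN0 by auto
    have f0i: "integrable (cell_measure L) f0" using f0L1 by (simp add: in_L1_def set_integrable_cell)
    have cf0: "cmod (f0 v) = Re (f0 v)" for v using f0 by (simp add: cmod_def)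
    have M1_eq: "M1 = (\<integral>v. Re (f0 v) \<partial>cell_measure L)" by (simp add: M1_def L1norm_def set_integral_cell cf0)
    have M1_0: "0 \<le> M1" unfolding M1_eq using f0 by (intro integral_nonneg_AE) auto
    have M2_0: "0 \<le> M2" by (simp add: M2_def L2norm_def set_integral_cell)
    have "\<exists>N0. \<forall>N>N0. \<exists>F. galerkin_sol R L \<Phi> b N T (fN0 N) F \<and> ?B F"
    proof (cases "M1 = 0")
      \<comment> \<open>\<open>f0\<close> may be nonzero at some points and still vanish almost
        everywhere. Then every \<open>fN0 N\<close> has zero L^2 norm, hence is 0, and the zero
        curve is the solution.\<close>
      case True
      have "AE v in cell_measure L. Re (f0 v) = 0"
        using True M1_eq f0 integral_nonneg_eq_0_iff_AE[of "cell_measure L" "\<lambda>v. Re (f0 v)"] f0i by auto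
      then have "(\<integral>v. (cmod (f0 v))\<^sup>2 \<partial>cell_measure L) = (\<integral>v. 0 \<partial>(cell_measure L :: (real^'n) measure))"
        using f0i by (intro integral_cong_AE) (auto simp: cf0)
      then have "L2norm L f0 = 0" by (simp add: L2norm_def set_integral_cell)
      then have "fN0 N = (\<lambda>v. 0)" for N
        using L2norm_eq_0_imp_PN_zero[OF pN] norms by metis
      then have "galerkin_sol R L \<Phi> b N T (fN0 N) (\<lambda>t v. 0)" for N using galerkin_sol_zero by metis
      moreover have "?B (\<lambda>t v. 0)" using M1_0 M2_0 by (simp add: L1norm_def L2norm_def)
      ultimately show ?thesis by blast
    next
      case False
      then have m: "0 < 2 * M1" using M1_0 by simp
      define K where "K = exp (4 * est_const * (2 * M1) * T) * M2"
      define A where "A = exp ((6 * est_const * ?V * K + 1) * T)"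
      define \<kappa> where "\<kappa> = err_const T K (H1norm L f0)"
      \<comment> \<open>The admissible size is shared equally by the initial negative part and the
        projection error accumulated up to T, hence the 2 in the denominator.\<close>
      define \<delta> where "\<delta> = (2 * M1 / (4 * ?V))\<^sup>2 / (2 * A)"
      have A: "0 < A" by (simp add: A_def)
      have d: "0 < \<delta>" unfolding \<delta>_def using m V A by (intro divide_pos_pos zero_less_power mult_pos_pos) auto
      obtain N2 where N2: "\<And>N. N2 < N \<Longrightarrow> L2norm L (neg_part (fN0 N)) < sqrt \<delta>"
        using neg d by (meson real_sqrt_gt_zero)
      \<comment> \<open>The error decays like 1/N^2, and N is at most N^2, so a threshold linear in
        N suffices.\<close>
      obtain N3 :: nat where N3: "\<kappa> * T / \<delta> < N3" using reals_Archimedean2 by blast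
      have "\<exists>F. galerkin_sol R L \<Phi> b N T (fN0 N) F \<and> ?B F" if N: "max N2 N3 < N" for N
      proof -
        have "N3 * \<delta> \<le> (real N)\<^sup>2 * \<delta>"
        proof (intro mult_right_mono)
          have "real N3 \<le> real N" using N by simp
          also have "\<dots> \<le> (real N)\<^sup>2" using N self_le_power[of "real N" 2] by simp
          finally show "real N3 \<le> (real N)\<^sup>2" .
        qed (use d in simp)
        moreover have "\<kappa> * T \<le> N3 * \<delta>" using N3 d by (simp add: pos_divide_less_eq)
        ultimately have "\<kappa> * T / (real N)\<^sup>2 \<le> \<delta>" using N by (simp add: pos_divide_le_eq mult.commute)
        then have "\<kappa> / (real N)\<^sup>2 * T \<le> \<delta>" by simp
        moreover have "(L2norm L (neg_part (fN0 N)))\<^sup>2 \<le> \<delta>"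
        proof -
          have "L2norm L (neg_part (fN0 N)) \<le> sqrt \<delta>" using N2[of N] N by simp
          moreover have "0 \<le> L2norm L (neg_part (fN0 N))" by (simp add: L2norm_def set_integral_cell)
          ultimately have "(L2norm L (neg_part (fN0 N)))\<^sup>2 \<le> (sqrt \<delta>)\<^sup>2" by (intro power_mono)
          then show ?thesis using d by simp
        qed
        ultimately have "A * ((L2norm L (neg_part (fN0 N)))\<^sup>2 + \<kappa> / (real N)\<^sup>2 * T) \<le> A * (2 * \<delta>)"
          using A by (intro mult_left_mono) auto
        also have "\<dots> = (2 * M1 / (4 * ?V))\<^sup>2" using A by (simp add: \<delta>_def)
        finally have small: "A * ((L2norm L (neg_part (fN0 N)))\<^sup>2 + \<kappa> / (real N)\<^sup>2 * T) \<le> (2 * M1 / (4 * ?V))\<^sup>2" .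
        have "(\<integral>v. Re (fN0 N v) \<partial>cell_measure L) = Re (\<integral>v. fN0 N v \<partial>cell_measure L)"
          using integrable_cell_cont[OF L_pos cont_periodic_PN_space[OF L_pos pN(1)]] by simp
        also have "(\<integral>v. fN0 N v \<partial>cell_measure L) = (\<integral>v. f0 v \<partial>cell_measure L)"
          using mass by (simp add: set_integral_cell)
        also have "Re \<dots> = 2 * M1 / 2" using f0i by (simp add: M1_eq)
        finally have mass': "(\<integral>v. Re (fN0 N v) \<partial>cell_measure L) = 2 * M1 / 2" .
        have K: "exp (4 * est_const * (2 * M1) * T) * L2norm L (fN0 N) \<le> K"
          unfolding K_def M2_def using norms by (intro mult_left_mono) auto
        have "0 < N" using N by simp
        from galerkin_exists[OF T this m pN mass' K _ small[unfolded A_def \<kappa>_def]] norms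
        obtain F where F: "galerkin_sol R L \<Phi> b N T (fN0 N) F"
            "\<And>t. t \<in> {0..T} \<Longrightarrow> L1norm L (F t) \<le> 2 * M1 \<and> L2norm L (F t) \<le> K" by blast
        have "K \<le> exp (2 * (4 * est_const + 1) * M1 * T) * M2"
          unfolding K_def using M1_0 M2_0 T by (intro mult_right_mono) (auto simp: algebra_simps)
        then show ?thesis using F by (meson order_trans)
      qed
      then show ?thesis by blast
    qed
    then obtain N0 where N0: "\<And>N. N0 < N \<Longrightarrow> \<exists>F. galerkin_sol R L \<Phi> b N T (fN0 N) F \<and> ?B F" by blast
    have "\<exists>F. galerkin_sol R L \<Phi> b N T (fN0 N) F \<and>
        (\<forall>G. galerkin_sol R L \<Phi> b N T (fN0 N) G \<longrightarrow> (\<forall>t\<in>{0..T}. G t = F t)) \<and> ?B F" if N: "N0 < N" for N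
    proof -
      obtain F where F: "galerkin_sol R L \<Phi> b N T (fN0 N) F" "?B F" using N0[OF N] by blast
      show ?thesis
        by (rule exI[of _ F], intro conjI allI impI ballI)
           (use F galerkin_unique[OF T pN(1) F(1)] in blast)+
    qed
    then show "\<exists>N0::nat. \<forall>N>N0.
        \<exists>F. galerkin_sol R L \<Phi> b N T (fN0 N) F \<and>
            (\<forall>G. galerkin_sol R L \<Phi> b N T (fN0 N) G \<longrightarrow> (\<forall>t\<in>{0..T}. G t = F t)) \<and>
            (\<forall>t\<in>{0..T}. L1norm L (F t) \<le> 2 * L1norm L f0 \<and>
               L2norm L (F t) \<le> exp (2 * (4 * est_const + 1) * L1norm L f0 * T) * L2norm L f0)"
      unfolding M1_def M2_def by blast
  qed
qed

end
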